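(* Let $\mathcal{E}=(E,\sigma,a)$ with $s\neq 0$ and $a\neq 0$, and let $m(s)$, $E'$, $e_i$, $\sigma'$, $\phi_0$, $E''$ be as defined in the context. 1. The algebra $$\mathcal{E}'=(E'=Ee_0,\sigma',ae_0):=E'[X;\sigma']/\big(X^{\frac{n}{m(s)}}-ae_0\big)=\bigoplus_{k=0}^{\frac{n}{m(s)}-1}E'X^k$$ is a cyclic $F$-algebra with $\mathrm{Deg}(\mathcal{E}')=\frac{n}{m(s)}$ and $0\neq ae_0\in F^\times e_0$. In particular, the centre of $\mathcal{E}'$ is $F$ and the field $E'$ is a strictly maximal subfield of $\mathcal{E}'$ (i.e. $[E':F]=\frac{n}{m(s)}$). 2. The algebra $\mathcal{E}'$ is isomorphic to the matrix algebra $M_{\frac{n}{m(s)}}(F)$ if and only if $a=N_{E'/F}(b)$ for some $b\in (E')^\times$. 3. The monomorphism $\phi_0:Ee_0\to E\subseteq\mathcal{E}$ can be extended to a monomorphism $\phi_0:\mathcal{E}'\to\mathcal{E}$ by the rule $X\mapsto x^{m(s)}$, and $$\phi_0(\mathcal{E}')=E''[x^{m(s)};\sigma']/(x^n-a)=\bigoplus_{k=0}^{\frac{n}{m(s)}-1}E''x^{km(s)}.$$ Identifying $\mathcal{E}'$ with its image in $\mathcal{E}$, we have $\mathcal{E}\simeq M_{m(s)}(\mathcal{E}')$ and $C_{\mathcal{E}}(\mathcal{E}')\simeq M_{m(s)}(F)$. 4. $\mathcal{E}=\bigoplus_{i=0}^{m(s)-1}\Big(\prod_{j=0}^{m(s)-1}\mathcal{E}'e_j\Big)x^i$,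 where the algebras $\mathcal{E}'e_j=Ee_j[x^{m(s)};\sigma']/(x^n-ae_j)$, $j=0,\ldots,m(s)-1$, are isomorphic to the cyclic algebra $\mathcal{E}'$, and the inner automorphism $\omega_x$ of $\mathcal{E}$, $\omega_x(u)=xux^{-1}$, cyclically permutes them: $\omega_x(\mathcal{E}'e_j)=\mathcal{E}'e_{j-1}$ (indices modulo $m(s)$).
   Context: $F$ is a field containing a primitive $n$'th root of unity $q$ ($n\ge 2$), $s,a\in F$, $E=E(s)=F[h]/(h^n-s)$, $\sigma$ is the $F$-automorphism of $E$ with $\sigma(h)=qh$, and $\mathcal{E}=(E,\sigma,a)=E[x;\sigma]/(x^n-a)$ is the $F$-algebra generated by $h,x$ with $xh=qhx$, $h^n=s$, $x^n=a$. $m(s)=\max\{m\ge1\mid m\mid n,\ s\in F^{[m]}\}$, where $F^{[m]}=\{u^m\mid u\in F\}$; $s^{1/m(s)}\in F$ is a fixed $m(s)$'th root of $s$ in $F$. Put $\zeta=q^{n/m(s)}$, a primitive $m(s)$'th root of unity. For $i=0,\ldots,m(s)-1$ the elements $$e_i=\prod_{j\neq i}\frac{h^{n/m(s)}-\zeta^{j}s^{1/m(s)}}{\zeta^{i}s^{1/m(s)}-\zeta^{j}s^{1/m(s)}}\in E$$ are orthogonal nonzero idempotents of $E$ with $1=e_0+\cdots+e_{m(s)-1}$, $\sigma(e_i)=e_{i-1}$ (indices modulo $m(s)$), and $Ee_i\simeq F[h]/(h^{n/m(s)}-\zeta^i s^{1/m(s)})$ is a field. $E'=F[h]/(h^{n/m(s)}-s^{1/m(s)})$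 is identified with $Ee_0$ (via $h\leftrightarrow he_0$, and $F$ with $Fe_0$). $\sigma'$ denotes the automorphism induced by $\sigma^{m(s)}$ (on $E'$: $\sigma'(h)=q^{m(s)}h$; likewise its restrictions to $Ee_j$ and $E''$). $\phi_0:Ee_0\to E$ is the $F$-algebra monomorphism $\lambda\mapsto\sum_{i=0}^{m(s)-1}\sigma^{-i}(\lambda)$, and $E''=\phi_0(Ee_0)$. A central simple finite dimensional $F$-algebra of dimension $d^2$ has degree $\mathrm{Deg}=d$; a subfield containing $F$ is strictly maximal if its degree over $F$ equals the degree of the algebra; the algebra is cyclic if it has a strictly maximal subfield which is a Galois extension of $F$ with cyclic Galois group. $C_{\mathcal E}(\cdot)$ is the centralizer in $\mathcal{E}$. $\mathcal{E}'e_j$ means $\phi_0(\mathcal{E}')e_j$. $N_{E'/F}$ is the norm of the field extension $E'/F$. *)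

theory Defs
  imports "HOL-Algebra.Algebra" "HOL-Algebra.UnivPoly"
begin

section \<open>Associative algebras over a field\<close>

text \<open>
  An \<open>F\<close>-algebra is a record of type \<^typ>\<open>('f, 'a) module\<close>.  The locale \<^locale>\<open>algebra\<close> of
  HOL-Algebra insists on commutativity; the following is its non-commutative counterpart.
  A subalgebra on a subset \<open>S\<close> is \<open>A\<lparr>carrier := S\<rparr>\<close>; a corner with an idempotent \<open>e\<close> as
  identity is \<open>A\<lparr>carrier := S, one := e\<rparr>\<close>.
\<close>

locale assoc_algebra = module R M + ring M for R (structure) and M (structure) +
  assumes smult_mult_left:
      "\<lbrakk> c \<in> carrier R; x \<in> carrier M; y \<in> carrier M \<rbrakk> \<Longrightarrow>
        (c \<odot>\<^bsub>M\<^esub> x) \<otimes>\<^bsub>M\<^esub> y = c \<odot>\<^bsub>M\<^esub> (x \<otimes>\<^bsub>M\<^esub> y)"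
    and smult_mult_right:
      "\<lbrakk> c \<in> carrier R; x \<in> carrier M; y \<in> carrier M \<rbrakk> \<Longrightarrow>
        x \<otimes>\<^bsub>M\<^esub> (c \<odot>\<^bsub>M\<^esub> y) = c \<odot>\<^bsub>M\<^esub> (x \<otimes>\<^bsub>M\<^esub> y)"

text \<open>The copy \<open>F \<cdot> 1\<close> of the base field inside an algebra.\<close>

definition scalars :: "('f, 'z) ring_scheme \<Rightarrow> ('f, 'a, 'm) module_scheme \<Rightarrow> 'a set" where
  "scalars F A = (\<lambda>c. c \<odot>\<^bsub>A\<^esub> \<one>\<^bsub>A\<^esub>) ` carrier F"

definition self_algebra :: "('f, 'z) ring_scheme \<Rightarrow> ('f, 'f) module" where
  "self_algebra F = ring.extend (ring.truncate F) (module.fields (monoid.mult F))"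

definition alg_hom ::
  "('f, 'z) ring_scheme \<Rightarrow> ('f, 'a, 'm) module_scheme \<Rightarrow> ('f, 'b, 'k) module_scheme \<Rightarrow> ('a \<Rightarrow> 'b) set"
  where "alg_hom F A B =
    {h \<in> ring_hom A B. \<forall>c\<in>carrier F. \<forall>x\<in>carrier A. h (c \<odot>\<^bsub>A\<^esub> x) = c \<odot>\<^bsub>B\<^esub> h x}"

definition alg_mono ::
  "('f, 'z) ring_scheme \<Rightarrow> ('f, 'a, 'm) module_scheme \<Rightarrow> ('f, 'b, 'k) module_scheme \<Rightarrow> ('a \<Rightarrow> 'b) set"
  where "alg_mono F A B = {h \<in> alg_hom F A B. inj_on h (carrier A)}"

definition alg_iso ::
  "('f, 'z) ring_scheme \<Rightarrow> ('f, 'a, 'm) module_scheme \<Rightarrow> ('f, 'b, 'k) module_scheme \<Rightarrow> ('a \<Rightarrow> 'b) set"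
  where "alg_iso F A B = {h \<in> alg_hom F A B. bij_betw h (carrier A) (carrier B)}"

definition alg_isomorphic ::
  "('f, 'z) ring_scheme \<Rightarrow> ('f, 'a, 'm) module_scheme \<Rightarrow> ('f, 'b, 'k) module_scheme \<Rightarrow> bool"
  where "alg_isomorphic F A B \<longleftrightarrow> alg_iso F A B \<noteq> {}"

definition quot_algebra :: "('f, 'a, 'm) module_scheme \<Rightarrow> 'a set \<Rightarrow> ('f, 'a set) module" where
  "quot_algebra A I =
    ring.extend (A Quot I) (module.fields (\<lambda>c C. \<Union>x\<in>C. I +>\<^bsub>A\<^esub> (c \<odot>\<^bsub>A\<^esub> x)))"

definition mat_algebra :: "nat \<Rightarrow> ('f, 'a, 'm) module_scheme \<Rightarrow> ('f, nat \<times> nat \<Rightarrow> 'a) module" where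
  "mat_algebra d A = \<lparr>
     carrier = {..<d} \<times> {..<d} \<rightarrow>\<^sub>E carrier A,
     monoid.mult = (\<lambda>M N. \<lambda>(i, j)\<in>{..<d} \<times> {..<d}. \<Oplus>\<^bsub>A\<^esub>k\<in>{..<d}. M (i, k) \<otimes>\<^bsub>A\<^esub> N (k, j)),
     monoid.one = (\<lambda>(i, j)\<in>{..<d} \<times> {..<d}. if i = j then \<one>\<^bsub>A\<^esub> else \<zero>\<^bsub>A\<^esub>),
     ring.zero = (\<lambda>(i, j)\<in>{..<d} \<times> {..<d}. \<zero>\<^bsub>A\<^esub>),
     ring.add = (\<lambda>M N. \<lambda>(i, j)\<in>{..<d} \<times> {..<d}. M (i, j) \<oplus>\<^bsub>A\<^esub> N (i, j)),
     module.smult = (\<lambda>c M. \<lambda>(i, j)\<in>{..<d} \<times> {..<d}. c \<odot>\<^bsub>A\<^esub> M (i, j))\<rparr>"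

definition centralizer :: "('a, 'm) ring_scheme \<Rightarrow> 'a set \<Rightarrow> 'a set" where
  "centralizer A S = {y \<in> carrier A. \<forall>z\<in>S. y \<otimes>\<^bsub>A\<^esub> z = z \<otimes>\<^bsub>A\<^esub> y}"

definition internal_direct_sum :: "('a, 'm) ring_scheme \<Rightarrow> 'i set \<Rightarrow> ('i \<Rightarrow> 'a set) \<Rightarrow> 'a set \<Rightarrow> bool"
  where "internal_direct_sum A I S T \<longleftrightarrow>
    (\<forall>i\<in>I. additive_subgroup (S i) A) \<and>
    T = {\<Oplus>\<^bsub>A\<^esub>i\<in>I. u i | u. u \<in> Pi I S} \<and>
    (\<forall>u\<in>Pi I S. \<forall>v\<in>Pi I S. (\<Oplus>\<^bsub>A\<^esub>i\<in>I. u i) = (\<Oplus>\<^bsub>A\<^esub>i\<in>I. v i) \<longrightarrow> (\<forall>i\<in>I. u i = v i))"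

text \<open>
  \<open>T\<close> is the product of the algebras \<open>S i\<close>, each of which sits in \<open>A\<close> with its own identity:
  the sum is direct and multiplication is componentwise.
\<close>

definition internal_direct_product :: "('a, 'm) ring_scheme \<Rightarrow> 'i set \<Rightarrow> ('i \<Rightarrow> 'a set) \<Rightarrow> 'a set \<Rightarrow> bool"
  where "internal_direct_product A I S T \<longleftrightarrow>
    internal_direct_sum A I S T \<and>
    (\<forall>i\<in>I. \<forall>y\<in>S i. \<forall>z\<in>S i. y \<otimes>\<^bsub>A\<^esub> z \<in> S i) \<and>
    (\<forall>i\<in>I. \<forall>j\<in>I. i \<noteq> j \<longrightarrow> (\<forall>y\<in>S i. \<forall>z\<in>S j. y \<otimes>\<^bsub>A\<^esub> z = \<zero>\<^bsub>A\<^esub>))"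


section \<open>Central simple and cyclic algebras, norms\<close>

definition simple_ring :: "('a, 'm) ring_scheme \<Rightarrow> bool" where
  "simple_ring A \<longleftrightarrow> ring A \<and> carrier A \<noteq> {\<zero>\<^bsub>A\<^esub>} \<and>
    (\<forall>I. ideal I A \<longrightarrow> I = {\<zero>\<^bsub>A\<^esub>} \<or> I = carrier A)"

definition central_simple :: "('f, 'z) ring_scheme \<Rightarrow> ('f, 'a, 'm) module_scheme \<Rightarrow> bool" where
  "central_simple F A \<longleftrightarrow> assoc_algebra F A \<and> simple_ring A \<and>
    centralizer A (carrier A) = scalars F A \<and>
    ring.finite_dimension A (scalars F A) (carrier A)"

definition has_degree :: "('f, 'z) ring_scheme \<Rightarrow> ('f, 'a, 'm) module_scheme \<Rightarrow> nat \<Rightarrow> bool" where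
  "has_degree F A d \<longleftrightarrow> central_simple F A \<and> ring.dimension A (d\<^sup>2) (scalars F A) (carrier A)"

definition strictly_maximal_subfield ::
  "('f, 'z) ring_scheme \<Rightarrow> ('f, 'a, 'm) module_scheme \<Rightarrow> 'a set \<Rightarrow> bool" where
  "strictly_maximal_subfield F A K \<longleftrightarrow> subfield K A \<and> scalars F A \<subseteq> K \<and>
    (\<exists>d. has_degree F A d \<and> ring.dimension A d (scalars F A) K)"

definition galois_group ::
  "('f, 'z) ring_scheme \<Rightarrow> ('f, 'a, 'm) module_scheme \<Rightarrow> ('a \<Rightarrow> 'a) monoid" where
  "galois_group F K = BijGroup (carrier K) \<lparr>carrier := alg_hom F K K \<inter> Bij (carrier K)\<rparr>"

text \<open>A finite extension is Galois if \<open>F\<close> is the fixed field of its automorphism group.\<close>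

definition galois_extension :: "('f, 'z) ring_scheme \<Rightarrow> ('f, 'a, 'm) module_scheme \<Rightarrow> bool" where
  "galois_extension F K \<longleftrightarrow> assoc_algebra F K \<and> field K \<and>
    ring.finite_dimension K (scalars F K) (carrier K) \<and>
    {x \<in> carrier K. \<forall>\<tau>\<in>carrier (galois_group F K). \<tau> x = x} = scalars F K"

definition cyclic_algebra :: "('f, 'z) ring_scheme \<Rightarrow> ('f, 'a, 'm) module_scheme \<Rightarrow> bool" where
  "cyclic_algebra F A \<longleftrightarrow> central_simple F A \<and>
    (\<exists>K. strictly_maximal_subfield F A K \<and>
      galois_extension F (A\<lparr>carrier := K\<rparr>) \<and>
      cyclic_group (galois_group F (A\<lparr>carrier := K\<rparr>)))"

text \<open>The determinant of a \<open>d \<times> d\<close> matrix over a commutative ring (Leibniz formula).\<close>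

definition ring_det :: "('f, 'z) ring_scheme \<Rightarrow> nat \<Rightarrow> (nat \<Rightarrow> nat \<Rightarrow> 'f) \<Rightarrow> 'f" where
  "ring_det F d M = (\<Oplus>\<^bsub>F\<^esub>p\<in>{p. p permutes {..<d}}.
     (if evenperm p then \<one>\<^bsub>F\<^esub> else \<ominus>\<^bsub>F\<^esub> \<one>\<^bsub>F\<^esub>) \<otimes>\<^bsub>F\<^esub> (\<Otimes>\<^bsub>F\<^esub>i\<in>{..<d}. M i (p i)))"

text \<open>
  The norm of \<open>b\<close> is the determinant of multiplication by \<open>b\<close>, written in an arbitrarily chosen
  \<open>F\<close>-basis \<open>us\<close> of \<open>K\<close>.  Only the matrix entries with indices below \<open>length us\<close> matter, and these
  are unique.
\<close>

definition is_basis :: "('f, 'z) ring_scheme \<Rightarrow> ('f, 'a, 'm) module_scheme \<Rightarrow> 'a list \<Rightarrow> bool" where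
  "is_basis F K us \<longleftrightarrow> set us \<subseteq> carrier K \<and> ring.independent K (scalars F K) us \<and>
    ring.Span K (scalars F K) us = carrier K"

definition mult_matrix ::
  "('f, 'z) ring_scheme \<Rightarrow> ('f, 'a, 'm) module_scheme \<Rightarrow> 'a list \<Rightarrow> 'a \<Rightarrow> nat \<Rightarrow> nat \<Rightarrow> 'f" where
  "mult_matrix F K us b = (SOME M. \<forall>j<length us.
     (\<forall>i<length us. M i j \<in> carrier F) \<and>
     b \<otimes>\<^bsub>K\<^esub> us ! j = (\<Oplus>\<^bsub>K\<^esub>i\<in>{..<length us}. M i j \<odot>\<^bsub>K\<^esub> us ! i))"

definition field_norm :: "('f, 'z) ring_scheme \<Rightarrow> ('f, 'a, 'm) module_scheme \<Rightarrow> 'a \<Rightarrow> 'f" where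
  "field_norm F K b = (let us = (SOME us. is_basis F K us)
     in ring_det F (length us) (mult_matrix F K us b))"


section \<open>Skew polynomial rings and the algebras \<open>(D, \<sigma>, a)\<close>\<close>

text \<open>
  \<open>D[x; \<sigma>]\<close> with \<open>x u = \<sigma>(u) x\<close>; as for \<^const>\<open>UP\<close>, the polynomial \<open>\<Sum> u\<^sub>i x\<^sup>i\<close> is its
  coefficient function.
\<close>

definition skew_UP :: "('f, 'a, 'm) module_scheme \<Rightarrow> ('a \<Rightarrow> 'a) \<Rightarrow> ('f, nat \<Rightarrow> 'a) module" where
  "skew_UP D \<sigma> = \<lparr>
     carrier = up D,
     monoid.mult = (\<lambda>p q k. \<Oplus>\<^bsub>D\<^esub>i\<in>{..k}. p i \<otimes>\<^bsub>D\<^esub> (\<sigma> ^^ i) (q (k - i))),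
     monoid.one = (\<lambda>i. if i = 0 then \<one>\<^bsub>D\<^esub> else \<zero>\<^bsub>D\<^esub>),
     ring.zero = (\<lambda>i. \<zero>\<^bsub>D\<^esub>),
     ring.add = (\<lambda>p q i. p i \<oplus>\<^bsub>D\<^esub> q i),
     module.smult = (\<lambda>c p i. c \<odot>\<^bsub>D\<^esub> p i)\<rparr>"

definition skew_monom :: "('f, 'a, 'm) module_scheme \<Rightarrow> 'a \<Rightarrow> nat \<Rightarrow> nat \<Rightarrow> 'a" where
  "skew_monom D u k = (\<lambda>i. if i = k then u else \<zero>\<^bsub>D\<^esub>)"

text \<open>The two-sided ideal \<open>(x\<^sup>d - a)\<close> and the quotient \<open>(D, \<sigma>, a) = D[x; \<sigma>]/(x\<^sup>d - a)\<close>.\<close>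

definition skew_ideal :: "('f, 'a, 'm) module_scheme \<Rightarrow> ('a \<Rightarrow> 'a) \<Rightarrow> nat \<Rightarrow> 'a \<Rightarrow> (nat \<Rightarrow> 'a) set" where
  "skew_ideal D \<sigma> d a = Idl\<^bsub>skew_UP D \<sigma>\<^esub>
     {skew_monom D \<one>\<^bsub>D\<^esub> d \<ominus>\<^bsub>skew_UP D \<sigma>\<^esub> skew_monom D a 0}"

definition skew_quot ::
  "('f, 'a, 'm) module_scheme \<Rightarrow> ('a \<Rightarrow> 'a) \<Rightarrow> nat \<Rightarrow> 'a \<Rightarrow> ('f, (nat \<Rightarrow> 'a) set) module" where
  "skew_quot D \<sigma> d a = quot_algebra (skew_UP D \<sigma>) (skew_ideal D \<sigma> d a)"

definition skew_const ::
  "('f, 'a, 'm) module_scheme \<Rightarrow> ('a \<Rightarrow> 'a) \<Rightarrow> nat \<Rightarrow> 'a \<Rightarrow> 'a \<Rightarrow> (nat \<Rightarrow> 'a) set" where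
  "skew_const D \<sigma> d a u = skew_ideal D \<sigma> d a +>\<^bsub>skew_UP D \<sigma>\<^esub> skew_monom D u 0"

definition skew_gen ::
  "('f, 'a, 'm) module_scheme \<Rightarrow> ('a \<Rightarrow> 'a) \<Rightarrow> nat \<Rightarrow> 'a \<Rightarrow> (nat \<Rightarrow> 'a) set" where
  "skew_gen D \<sigma> d a = skew_ideal D \<sigma> d a +>\<^bsub>skew_UP D \<sigma>\<^esub> skew_monom D \<one>\<^bsub>D\<^esub> 1"

text \<open>
  Images in \<open>(D, \<sigma>, a)\<close> of a constant \<open>u\<close> (\<open>skew_const\<close>) and of \<open>x\<close> (\<open>skew_gen\<close>) are cosets of
  the corresponding monomials.  The equality \<open>A = D[y; \<sigma>]/(y\<^sup>d - a)\<close> for an algebra \<open>A\<close> containing \<open>D\<close> through the map \<open>f\<close> and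
  containing the element \<open>y\<close>: the canonical map from the quotient to \<open>A\<close> is an isomorphism.
\<close>

definition is_skew_quot ::
  "('f, 'z) ring_scheme \<Rightarrow> ('f, 'b, 'k) module_scheme \<Rightarrow> ('f, 'a, 'm) module_scheme \<Rightarrow>
    ('a \<Rightarrow> 'b) \<Rightarrow> 'b \<Rightarrow> ('a \<Rightarrow> 'a) \<Rightarrow> nat \<Rightarrow> 'a \<Rightarrow> bool" where
  "is_skew_quot F A D f y \<sigma> d a \<longleftrightarrow> (\<exists>\<psi> \<in> alg_iso F (skew_quot D \<sigma> d a) A.
     (\<forall>u\<in>carrier D. \<psi> (skew_const D \<sigma> d a u) = f u) \<and> \<psi> (skew_gen D \<sigma> d a) = y)"


section \<open>The algebra \<open>E = F[h]/(h\<^sup>n - s)\<close>\<close>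

definition primitive_root_of_unity :: "('f, 'z) ring_scheme \<Rightarrow> nat \<Rightarrow> 'f \<Rightarrow> bool" where
  "primitive_root_of_unity F n q \<longleftrightarrow> q \<in> carrier F \<and> q [^]\<^bsub>F\<^esub> n = \<one>\<^bsub>F\<^esub> \<and>
    (\<forall>k. 0 < k \<and> k < n \<longrightarrow> q [^]\<^bsub>F\<^esub> k \<noteq> \<one>\<^bsub>F\<^esub>)"

definition root_index :: "('f, 'z) ring_scheme \<Rightarrow> nat \<Rightarrow> 'f \<Rightarrow> nat" where
  "root_index F n s = Max {m. 1 \<le> m \<and> m dvd n \<and> (\<exists>u\<in>carrier F. s = u [^]\<^bsub>F\<^esub> m)}"

definition kummer_ideal :: "('f, 'z) ring_scheme \<Rightarrow> nat \<Rightarrow> 'f \<Rightarrow> (nat \<Rightarrow> 'f) set" where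
  "kummer_ideal F n s =
    PIdl\<^bsub>UP F\<^esub> (up_ring.monom (UP F) \<one>\<^bsub>F\<^esub> n \<ominus>\<^bsub>UP F\<^esub> up_ring.monom (UP F) s 0)"

definition kummer_algebra :: "('f, 'z) ring_scheme \<Rightarrow> nat \<Rightarrow> 'f \<Rightarrow> ('f, (nat \<Rightarrow> 'f) set) module" where
  "kummer_algebra F n s = quot_algebra (UP F) (kummer_ideal F n s)"

definition kummer_gen :: "('f, 'z) ring_scheme \<Rightarrow> nat \<Rightarrow> 'f \<Rightarrow> (nat \<Rightarrow> 'f) set" where
  "kummer_gen F n s = kummer_ideal F n s +>\<^bsub>UP F\<^esub> up_ring.monom (UP F) \<one>\<^bsub>F\<^esub> 1"

text \<open>
  The element \<open>e\<^sub>i = \<Prod>\<^sub>j\<^sub>\<noteq>\<^sub>i (g - \<zeta>\<^sup>j r) / (\<zeta>\<^sup>i r - \<zeta>\<^sup>j r)\<close> of \<open>E\<close>, with \<open>j\<close> running below \<open>m\<close>;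
  here \<open>g = h\<^bsup>n/m\<^esup>\<close>, \<open>r = s\<^bsup>1/m\<^esup>\<close> and \<open>m = m(s)\<close>.
\<close>

definition kummer_idem ::
  "('f, 'z) ring_scheme \<Rightarrow> ('f, 'a, 'k) module_scheme \<Rightarrow> nat \<Rightarrow> 'f \<Rightarrow> 'f \<Rightarrow> 'a \<Rightarrow> nat \<Rightarrow> 'a" where
  "kummer_idem F E m \<zeta> r g i = (\<Otimes>\<^bsub>E\<^esub>j\<in>{..<m} - {i}.
     inv\<^bsub>F\<^esub> (\<zeta> [^]\<^bsub>F\<^esub> i \<otimes>\<^bsub>F\<^esub> r \<ominus>\<^bsub>F\<^esub> \<zeta> [^]\<^bsub>F\<^esub> j \<otimes>\<^bsub>F\<^esub> r) \<odot>\<^bsub>E\<^esub>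
       (g \<ominus>\<^bsub>E\<^esub> (\<zeta> [^]\<^bsub>F\<^esub> j \<otimes>\<^bsub>F\<^esub> r) \<odot>\<^bsub>E\<^esub> \<one>\<^bsub>E\<^esub>))"

text \<open>The algebra \<open>Ee\<close> with identity \<open>e\<close>, for an idempotent \<open>e\<close>.\<close>

definition corner :: "('f, 'a) module \<Rightarrow> 'a \<Rightarrow> ('f, 'a) module" where
  "corner E e = E\<lparr>carrier := (\<lambda>y. y \<otimes>\<^bsub>E\<^esub> e) ` carrier E, one := e\<rparr>"

text \<open>\<open>\<phi>\<^sub>0(\<lambda>) = \<Sum>\<^sub>i\<^sub><\<^sub>m \<sigma>\<^sup>-\<^sup>i(\<lambda>)\<close>.\<close>

definition orbit_sum :: "('f, 'a) module \<Rightarrow> ('a \<Rightarrow> 'a) \<Rightarrow> nat \<Rightarrow> 'a \<Rightarrow> 'a" where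
  "orbit_sum E \<sigma> m l = (\<Oplus>\<^bsub>E\<^esub>i\<in>{..<m}. (inv_into (carrier E) \<sigma> ^^ i) l)"

end

(* The algebra E splits along the eigenspaces of g = h^d / r, where d = n/m: since g^m = 1, they are
   cut out by the idempotents e_j, which sigma permutes cyclically. Every algebra (D, sigma, a) is
   handled through the presentation of its elements as unique sums of u_k x^k with k < d.
   Simplicity and the centre of E' = (E e_0, sigma^m, a) come from conjugation by h, which acts on
   the component u_k x^k through the k-th power of a root of unity; E e_0 is a field because a
   proper ideal has a dimension k < d, and the determinant of h on it would give a root of r or s of
   too high an index. A splitting of E' is read off a minimal left ideal, on which x acts as some b
   in E e_0; conversely b^-1 x and h generate the matrix algebra.
   Finally x permutes the e_j cyclically, so that the elements x^-i e_0 x^j are matrix units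
   commuting with phi(E'). *)
theory Submission
  imports Defs
begin

section \<open>Associative algebras and their homomorphisms\<close>

text \<open>The statement is about polynomial quotients and about norms taken in an arbitrary basis,
  whereas the computations need coordinates. Presentations mediate: an algebra is free over its base
  on \<open>1, x, .., x^(d-1)\<close>, with \<open>x u = sigma(u) x\<close> and
  \<open>x^d = a\<close>; algebras with the same presentation are isomorphic, and
  \<open>F[h]/(h^n - s)\<close> is the case of the trivial twist over F. No polynomial is ever
  factored. One elimination argument, \<open>power_sums_zero\<close>, shows that m is invertible in
  F, which makes the idempotents available, and that an ideal contains the components of its
  elements. The maximality of m(s) enters once: r has no k-th root in F for a divisor k > 1 of d,
  since such a root would be a km-th root of s. A k-dimensional subspace invariant under h makes
  \<open>r^k\<close> a d-th power; for 0 < k < d Bezout and the roots of unity in F turn this into a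
  forbidden root of r. The determinant defining the norm becomes a product of conjugates because the
  matrix of conjugates of a basis intertwines multiplication by b with a diagonal matrix.\<close>

lemma additive_finsum:
  assumes "abelian_monoid A" "abelian_monoid B" "h \<in> carrier A \<rightarrow> carrier B" "h \<zero>\<^bsub>A\<^esub> = \<zero>\<^bsub>B\<^esub>"
    and "\<And>x y. x \<in> carrier A ==> y \<in> carrier A ==> h (x \<oplus>\<^bsub>A\<^esub> y) = h x \<oplus>\<^bsub>B\<^esub> h y"
    and "f \<in> I \<rightarrow> carrier A"
  shows "h (\<Oplus>\<^bsub>A\<^esub>i\<in>I. f i) = (\<Oplus>\<^bsub>B\<^esub>i\<in>I. h (f i))"
proof -
  interpret A: abelian_monoid A by fact
  interpret B: abelian_monoid B by fact
  show ?thesis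
    using assms(6)
  proof (induction I rule: infinite_finite_induct)
    \<comment> \<open>A sum over an infinite index set is zero by convention, so this case only uses
      that \<open>h\<close> preserves zero.\<close>
    case (infinite I) then show ?case by (simp add: assms)
  next
    case empty then show ?case by (simp add: assms)
  next
    case (insert i I)
    have "f \<in> I \<rightarrow> carrier A" "f i \<in> carrier A" using insert by auto
    then have "(\<lambda>i. h (f i)) \<in> I \<rightarrow> carrier B" "h (f i) \<in> carrier B" "(\<Oplus>\<^bsub>A\<^esub>i\<in>I. f i) \<in> carrier A"
      using assms(3) by auto
    with insert show ?case by (simp add: assms(5))
  qed
qed

lemma multiplicative_pow:
  assumes "monoid A" "\<And>x y. x \<in> carrier A ==> y \<in> carrier A ==> h (x \<otimes>\<^bsub>A\<^esub> y) = h x \<otimes>\<^bsub>B\<^esub> h y"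
    "h \<one>\<^bsub>A\<^esub> = \<one>\<^bsub>B\<^esub>" "x \<in> carrier A"
  shows "h (x [^]\<^bsub>A\<^esub> (k::nat)) = h x [^]\<^bsub>B\<^esub> k"
proof -
  interpret monoid A by fact
  show ?thesis
    by (induction k) (simp_all add: assms)
qed

section \<open>Calculation rules in an associative algebra\<close>

context assoc_algebra begin

lemma one_smult_mult:
  "c \<in> carrier R ==> x \<in> carrier M ==> (c \<odot>\<^bsub>M\<^esub> \<one>\<^bsub>M\<^esub>) \<otimes>\<^bsub>M\<^esub> x = c \<odot>\<^bsub>M\<^esub> x"
  by (simp add: smult_mult_left)

lemma mult_one_smult:
  "c \<in> carrier R ==> x \<in> carrier M ==> x \<otimes>\<^bsub>M\<^esub> (c \<odot>\<^bsub>M\<^esub> \<one>\<^bsub>M\<^esub>) = c \<odot>\<^bsub>M\<^esub> x"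
  by (simp add: smult_mult_right)

lemma smult_minus_one: "x \<in> carrier M ==> (\<ominus> \<one>) \<odot>\<^bsub>M\<^esub> x = \<ominus>\<^bsub>M\<^esub> x"
  by (simp add: smult_l_minus)

lemma smult_finsum:
  "c \<in> carrier R ==> f \<in> I \<rightarrow> carrier M ==>
    c \<odot>\<^bsub>M\<^esub> (\<Oplus>\<^bsub>M\<^esub>i\<in>I. f i) = (\<Oplus>\<^bsub>M\<^esub>i\<in>I. c \<odot>\<^bsub>M\<^esub> f i)"
  by (rule additive_finsum) (auto simp: smult_r_distr abelian_monoid_axioms M.abelian_monoid_axioms)

lemma finsum_smult:
  "x \<in> carrier M ==> f \<in> I \<rightarrow> carrier R ==>
    (\<Oplus>\<^bsub>R\<^esub>i\<in>I. f i) \<odot>\<^bsub>M\<^esub> x = (\<Oplus>\<^bsub>M\<^esub>i\<in>I. f i \<odot>\<^bsub>M\<^esub> x)"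
  by (rule additive_finsum) (auto simp: smult_l_distr abelian_monoid_axioms M.abelian_monoid_axioms R.abelian_monoid_axioms)

lemma mult_finsum:
  "x \<in> carrier M ==> f \<in> I \<rightarrow> carrier M ==>
    x \<otimes>\<^bsub>M\<^esub> (\<Oplus>\<^bsub>M\<^esub>i\<in>I. f i) = (\<Oplus>\<^bsub>M\<^esub>i\<in>I. x \<otimes>\<^bsub>M\<^esub> f i)"
  by (rule additive_finsum) (auto simp: r_distr abelian_monoid_axioms M.abelian_monoid_axioms)

lemma finsum_mult:
  "x \<in> carrier M ==> f \<in> I \<rightarrow> carrier M ==>
    (\<Oplus>\<^bsub>M\<^esub>i\<in>I. f i) \<otimes>\<^bsub>M\<^esub> x = (\<Oplus>\<^bsub>M\<^esub>i\<in>I. f i \<otimes>\<^bsub>M\<^esub> x)"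
  by (rule additive_finsum[where h = "\<lambda>z. z \<otimes>\<^bsub>M\<^esub> x"])
    (auto simp: l_distr abelian_monoid_axioms M.abelian_monoid_axioms)

lemma smult_pow:
  "c \<in> carrier R ==> x \<in> carrier M ==> (c \<odot>\<^bsub>M\<^esub> x) [^]\<^bsub>M\<^esub> (k::nat) = (c [^]\<^bsub>R\<^esub> k) \<odot>\<^bsub>M\<^esub> (x [^]\<^bsub>M\<^esub> k)"
  by (induction k) (simp_all add: smult_mult_left smult_mult_right smult_assoc1 R.m_comm R.nat_pow_closed)

lemma finsum_delta:
  "finite I ==> i \<in> I ==> x \<in> carrier M ==> (\<Oplus>\<^bsub>M\<^esub>j\<in>I. if j = i then x else \<zero>\<^bsub>M\<^esub>) = x"
  using M.finsum_singleton[of i I "\<lambda>_. x"] by (simp add: eq_commute[of i])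

end

lemma assoc_algebraI:
  assumes "cring F" "ring A"
    and "\<And>c x. c \<in> carrier F ==> x \<in> carrier A ==> c \<odot>\<^bsub>A\<^esub> x \<in> carrier A"
    and "\<And>b c x. b \<in> carrier F ==> c \<in> carrier F ==> x \<in> carrier A ==> (b \<oplus>\<^bsub>F\<^esub> c) \<odot>\<^bsub>A\<^esub> x = b \<odot>\<^bsub>A\<^esub> x \<oplus>\<^bsub>A\<^esub> c \<odot>\<^bsub>A\<^esub> x"
    and "\<And>c x y. c \<in> carrier F ==> x \<in> carrier A ==> y \<in> carrier A ==> c \<odot>\<^bsub>A\<^esub> (x \<oplus>\<^bsub>A\<^esub> y) = c \<odot>\<^bsub>A\<^esub> x \<oplus>\<^bsub>A\<^esub> c \<odot>\<^bsub>A\<^esub> y"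
    and "\<And>b c x. b \<in> carrier F ==> c \<in> carrier F ==> x \<in> carrier A ==> (b \<otimes>\<^bsub>F\<^esub> c) \<odot>\<^bsub>A\<^esub> x = b \<odot>\<^bsub>A\<^esub> (c \<odot>\<^bsub>A\<^esub> x)"
    and "\<And>x. x \<in> carrier A ==> \<one>\<^bsub>F\<^esub> \<odot>\<^bsub>A\<^esub> x = x"
    and "\<And>c x y. c \<in> carrier F ==> x \<in> carrier A ==> y \<in> carrier A ==> (c \<odot>\<^bsub>A\<^esub> x) \<otimes>\<^bsub>A\<^esub> y = c \<odot>\<^bsub>A\<^esub> (x \<otimes>\<^bsub>A\<^esub> y)"
    and "\<And>c x y. c \<in> carrier F ==> x \<in> carrier A ==> y \<in> carrier A ==> x \<otimes>\<^bsub>A\<^esub> (c \<odot>\<^bsub>A\<^esub> y) = c \<odot>\<^bsub>A\<^esub> (x \<otimes>\<^bsub>A\<^esub> y)"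
  shows "assoc_algebra F A"
proof -
  interpret ring A by fact
  have "module F A" by (rule moduleI) (use assms abelian_group_axioms in auto)
  then show ?thesis
    by (intro assoc_algebra.intro assoc_algebra_axioms.intro) (use assms in auto)
qed

text \<open>An algebra structure may be transported along a map that is injective or surjective;
  the surjective case covers quotients and the injective one subalgebras.\<close>

lemma assoc_algebra_image:
  assumes "assoc_algebra F A" "h ` carrier A = carrier B"
    and add: "\<And>x y. x \<in> carrier A ==> y \<in> carrier A ==> h (x \<oplus>\<^bsub>A\<^esub> y) = h x \<oplus>\<^bsub>B\<^esub> h y"
    and mult: "\<And>x y. x \<in> carrier A ==> y \<in> carrier A ==> h (x \<otimes>\<^bsub>A\<^esub> y) = h x \<otimes>\<^bsub>B\<^esub> h y"
    and smult: "\<And>c x. c \<in> carrier F ==> x \<in> carrier A ==> h (c \<odot>\<^bsub>A\<^esub> x) = c \<odot>\<^bsub>B\<^esub> h x"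
    and one: "h \<one>\<^bsub>A\<^esub> = \<one>\<^bsub>B\<^esub>" and zero: "h \<zero>\<^bsub>A\<^esub> = \<zero>\<^bsub>B\<^esub>"
  shows "assoc_algebra F B"
proof -
  interpret A: assoc_algebra F A by fact
  have ex: "\<exists>y\<in>carrier A. x = h y" if "x \<in> carrier B" for x
    using assms(2) that by auto
  have cl: "h x \<in> carrier B" if "x \<in> carrier A" for x using assms(2) that by auto
  have "abelian_group B"
  proof (rule abelian_groupI)
    fix x assume "x \<in> carrier B"
    then obtain x' where x': "x' \<in> carrier A" "x = h x'" using ex by auto
    then have "h (\<ominus>\<^bsub>A\<^esub> x') \<oplus>\<^bsub>B\<^esub> x = \<zero>\<^bsub>B\<^esub>"
      using add[of "\<ominus>\<^bsub>A\<^esub> x'" x'] by (simp add: A.M.l_neg zero)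
    then show "\<exists>y\<in>carrier B. y \<oplus>\<^bsub>B\<^esub> x = \<zero>\<^bsub>B\<^esub>" using x' cl by blast
  next
    show "\<zero>\<^bsub>B\<^esub> \<in> carrier B" using cl[of "\<zero>\<^bsub>A\<^esub>"] zero by simp
  qed (auto dest!: ex simp flip: add zero intro!: cl arg_cong[where f = h] simp: A.M.a_ac)
  moreover have "Group.monoid B"
  proof (rule monoidI)
    show "\<one>\<^bsub>B\<^esub> \<in> carrier B" using cl[of "\<one>\<^bsub>A\<^esub>"] one by simp
  qed (auto dest!: ex simp flip: mult one intro!: cl arg_cong[where f = h] simp: A.m_assoc)
  ultimately have "ring B"
    by (rule ringI) (auto dest!: ex simp flip: add mult intro!: arg_cong[where f = h] simp: A.l_distr A.r_distr)
  then show ?thesis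
    by (rule assoc_algebraI[OF A.R.is_cring])
      (auto dest!: ex simp flip: add mult smult intro!: cl arg_cong[where f = h]
        simp: A.smult_l_distr A.smult_r_distr A.smult_assoc1 A.smult_mult_left A.smult_mult_right)
qed

text \<open>The identity \<open>e\<close> may differ from the identity of \<open>A\<close>; this is
  the form needed for corners cut out by an idempotent. Closure under negation and the presence of
  zero follow from closure under the scalars -1 and 0.\<close>

lemma assoc_algebra_sub:
  fixes A :: "('f, 'a, 'm) module_scheme"
  assumes "assoc_algebra F A" and sub: "S \<subseteq> carrier A" and e: "e \<in> S"
    and add: "\<And>x y. x \<in> S ==> y \<in> S ==> x \<oplus>\<^bsub>A\<^esub> y \<in> S"
    and mult: "\<And>x y. x \<in> S ==> y \<in> S ==> x \<otimes>\<^bsub>A\<^esub> y \<in> S"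
    and smult: "\<And>c x. c \<in> carrier F ==> x \<in> S ==> c \<odot>\<^bsub>A\<^esub> x \<in> S"
    and one: "\<And>x. x \<in> S ==> e \<otimes>\<^bsub>A\<^esub> x = x" "\<And>x. x \<in> S ==> x \<otimes>\<^bsub>A\<^esub> e = x"
  shows "assoc_algebra F (A\<lparr>carrier := S, one := e\<rparr>)" (is "assoc_algebra F ?B")
proof -
  interpret A: assoc_algebra F A by fact
  have cl: "x \<in> carrier A" if "x \<in> S" for x using sub that by auto
  have neg: "\<ominus>\<^bsub>A\<^esub> x \<in> S" if "x \<in> S" for x
    using smult[of "\<ominus>\<^bsub>F\<^esub> \<one>\<^bsub>F\<^esub>" x] that cl by (simp add: A.smult_minus_one)
  have zero: "\<zero>\<^bsub>A\<^esub> \<in> S"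
    using smult[of "\<zero>\<^bsub>F\<^esub>" e] e cl by simp
  have "abelian_group ?B"
  proof (rule abelian_groupI)
    fix x assume "x \<in> carrier ?B"
    then show "\<exists>y\<in>carrier ?B. y \<oplus>\<^bsub>?B\<^esub> x = \<zero>\<^bsub>?B\<^esub>"
      by (intro bexI[of _ "\<ominus>\<^bsub>A\<^esub> x"]) (auto simp: neg cl A.M.l_neg)
  qed (auto simp: add zero cl A.M.a_ac)
  moreover have "Group.monoid ?B"
    by (rule monoidI) (auto simp: mult e one cl A.m_assoc)
  ultimately have "ring ?B"
    by (rule ringI) (auto simp: cl A.l_distr A.r_distr)
  then show ?thesis
    by (rule assoc_algebraI[OF A.R.is_cring])
      (auto simp: smult cl A.smult_l_distr A.smult_r_distr A.smult_assoc1 A.smult_mult_left A.smult_mult_right)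
qed

lemma assoc_algebra_subalg:
  fixes A :: "('f, 'a, 'm) module_scheme"
  assumes "assoc_algebra F A" and "S \<subseteq> carrier A" and "\<one>\<^bsub>A\<^esub> \<in> S"
    and "\<And>x y. x \<in> S ==> y \<in> S ==> x \<oplus>\<^bsub>A\<^esub> y \<in> S"
    and "\<And>x y. x \<in> S ==> y \<in> S ==> x \<otimes>\<^bsub>A\<^esub> y \<in> S"
    and "\<And>c x. c \<in> carrier F ==> x \<in> S ==> c \<odot>\<^bsub>A\<^esub> x \<in> S"
  shows "assoc_algebra F (A\<lparr>carrier := S\<rparr>)"
proof -
  interpret A: assoc_algebra F A by fact
  have "A\<lparr>carrier := S\<rparr> = A\<lparr>carrier := S, one := \<one>\<^bsub>A\<^esub>\<rparr>" by simp
  then show ?thesis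
    using assoc_algebra_sub[OF assms(1,2,3)] assms by (simp add: subset_eq)
qed

lemma self_algebra_simps [simp]:
  "carrier (self_algebra F) = carrier F" "\<one>\<^bsub>self_algebra F\<^esub> = \<one>\<^bsub>F\<^esub>" "\<zero>\<^bsub>self_algebra F\<^esub> = \<zero>\<^bsub>F\<^esub>"
  "x \<otimes>\<^bsub>self_algebra F\<^esub> y = x \<otimes>\<^bsub>F\<^esub> y" "x \<oplus>\<^bsub>self_algebra F\<^esub> y = x \<oplus>\<^bsub>F\<^esub> y" "x \<odot>\<^bsub>self_algebra F\<^esub> y = x \<otimes>\<^bsub>F\<^esub> y"
  by (simp_all add: self_algebra_def ring.defs module.defs)

lemma assoc_algebra_self:
  assumes "cring F"
  shows "assoc_algebra F (self_algebra F)"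
proof -
  interpret cring F by fact
  have "abelian_group (self_algebra F)"
    by (rule abelian_groupI) (auto simp: a_ac intro!: bexI[of _ "\<ominus>\<^bsub>F\<^esub> _"] l_neg)
  moreover have "Group.monoid (self_algebra F)"
    by (rule monoidI) (auto simp: m_assoc)
  ultimately have "ring (self_algebra F)"
    by (rule ringI) (auto simp: l_distr r_distr)
  then show ?thesis
    by (rule assoc_algebraI[OF is_cring]) (auto simp: m_assoc l_distr r_distr m_lcomm)
qed

section \<open>Homomorphisms, isomorphisms and their inverses\<close>

lemma alg_homI:
  assumes "\<And>x. x \<in> carrier A ==> h x \<in> carrier B"
    "\<And>x y. x \<in> carrier A ==> y \<in> carrier A ==> h (x \<otimes>\<^bsub>A\<^esub> y) = h x \<otimes>\<^bsub>B\<^esub> h y"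
    "\<And>x y. x \<in> carrier A ==> y \<in> carrier A ==> h (x \<oplus>\<^bsub>A\<^esub> y) = h x \<oplus>\<^bsub>B\<^esub> h y"
    "h \<one>\<^bsub>A\<^esub> = \<one>\<^bsub>B\<^esub>"
    "\<And>c x. c \<in> carrier F ==> x \<in> carrier A ==> h (c \<odot>\<^bsub>A\<^esub> x) = c \<odot>\<^bsub>B\<^esub> h x"
  shows "h \<in> alg_hom F A B"
  unfolding alg_hom_def using assms by (auto intro!: ring_hom_memI)

lemma alg_homD:
  assumes "h \<in> alg_hom F A B"
  shows "\<And>x. x \<in> carrier A ==> h x \<in> carrier B"
    "\<And>x y. x \<in> carrier A ==> y \<in> carrier A ==> h (x \<otimes>\<^bsub>A\<^esub> y) = h x \<otimes>\<^bsub>B\<^esub> h y"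
    "\<And>x y. x \<in> carrier A ==> y \<in> carrier A ==> h (x \<oplus>\<^bsub>A\<^esub> y) = h x \<oplus>\<^bsub>B\<^esub> h y"
    "h \<one>\<^bsub>A\<^esub> = \<one>\<^bsub>B\<^esub>"
    "\<And>c x. c \<in> carrier F ==> x \<in> carrier A ==> h (c \<odot>\<^bsub>A\<^esub> x) = c \<odot>\<^bsub>B\<^esub> h x"
  using assms unfolding alg_hom_def by (auto dest: ring_hom_memE)

locale alg_homomorphism =
  A: assoc_algebra F A + B: assoc_algebra F B
  for F :: "('f, 'z) ring_scheme" and A :: "('f, 'a, 'm) module_scheme"
    and B :: "('f, 'b, 'k) module_scheme" +
  fixes h
  assumes hom: "h \<in> alg_hom F A B"
begin

lemmas hom_simps [simp] = alg_homD[OF hom]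

lemma zero [simp]: "h \<zero>\<^bsub>A\<^esub> = \<zero>\<^bsub>B\<^esub>"
proof -
  have "h (\<zero>\<^bsub>F\<^esub> \<odot>\<^bsub>A\<^esub> \<one>\<^bsub>A\<^esub>) = \<zero>\<^bsub>F\<^esub> \<odot>\<^bsub>B\<^esub> \<one>\<^bsub>B\<^esub>" by (simp del: A.smult_l_null B.smult_l_null)
  then show ?thesis by simp
qed

lemma neg [simp]: "x \<in> carrier A ==> h (\<ominus>\<^bsub>A\<^esub> x) = \<ominus>\<^bsub>B\<^esub> h x"
  using alg_homD(5)[OF hom, of "\<ominus>\<^bsub>F\<^esub> \<one>\<^bsub>F\<^esub>" x] by (simp add: A.smult_minus_one B.smult_minus_one del: alg_homD(5)[OF hom])

lemma minus [simp]: "x \<in> carrier A ==> y \<in> carrier A ==> h (x \<ominus>\<^bsub>A\<^esub> y) = h x \<ominus>\<^bsub>B\<^esub> h y"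
  by (simp add: a_minus_def)

lemma finsum [simp]: "f \<in> I \<rightarrow> carrier A ==> h (\<Oplus>\<^bsub>A\<^esub>i\<in>I. f i) = (\<Oplus>\<^bsub>B\<^esub>i\<in>I. h (f i))"
  by (rule additive_finsum) (auto simp: A.M.abelian_monoid_axioms B.M.abelian_monoid_axioms)

lemma pow [simp]: "x \<in> carrier A ==> h (x [^]\<^bsub>A\<^esub> (k::nat)) = h x [^]\<^bsub>B\<^esub> k"
  by (rule multiplicative_pow) (auto simp: A.monoid_axioms)

lemma inj_onI:
  assumes "\<And>x. x \<in> carrier A ==> h x = \<zero>\<^bsub>B\<^esub> ==> x = \<zero>\<^bsub>A\<^esub>"
  shows "inj_on h (carrier A)"
proof (rule Fun.inj_onI)
  fix x y assume xy: "x \<in> carrier A" "y \<in> carrier A" "h x = h y"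
  then have "h (x \<ominus>\<^bsub>A\<^esub> y) = \<zero>\<^bsub>B\<^esub>" by (simp add: B.M.r_neg a_minus_def)
  then have "x \<ominus>\<^bsub>A\<^esub> y = \<zero>\<^bsub>A\<^esub>" using assms xy by auto
  then show "x = y" using xy by simp
qed

lemma image_algebra: "assoc_algebra F (B\<lparr>carrier := h ` carrier A\<rparr>)"
  by (rule assoc_algebra_subalg[OF B.assoc_algebra_axioms])
    (auto simp flip: alg_homD(2,3,4,5)[OF hom])

end

lemma alg_hom_comp:
  "f \<in> alg_hom F A B ==> g \<in> alg_hom F B C ==> (\<lambda>x. g (f x)) \<in> alg_hom F A C"
  by (rule alg_homI) (simp_all add: alg_homD)

lemma alg_hom_funpow: "f \<in> alg_hom F A A ==> f ^^ k \<in> alg_hom F A A"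
proof (induction k)
  case 0 then show ?case by (auto intro!: alg_homI)
next
  case (Suc k) then show ?case using alg_hom_comp[of "f ^^ k" F A A f A] by (simp add: comp_def)
qed

lemma alg_isoI: "h \<in> alg_hom F A B ==> inj_on h (carrier A) ==> carrier B \<subseteq> h ` carrier A ==> h \<in> alg_iso F A B"
  by (auto simp: alg_iso_def bij_betw_def alg_homD)

lemma alg_isoD:
  "h \<in> alg_iso F A B ==> h \<in> alg_hom F A B"
  "h \<in> alg_iso F A B ==> bij_betw h (carrier A) (carrier B)"
  by (auto simp: alg_iso_def)

lemma alg_iso_inv:
  assumes "assoc_algebra F A" "h \<in> alg_iso F A B"
  shows "inv_into (carrier A) h \<in> alg_iso F B A"
proof -
  interpret A: assoc_algebra F A by fact
  let ?g = "inv_into (carrier A) h"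
  note h = alg_homD[OF alg_isoD(1)[OF assms(2)]]
  note bij = alg_isoD(2)[OF assms(2)]
  have g: "?g y \<in> carrier A" "h (?g y) = y" if "y \<in> carrier B" for y
    using bij that by (auto simp: bij_betw_def inv_into_into f_inv_into_f)
  have gh: "?g (h x) = x" if "x \<in> carrier A" for x
    using bij that by (auto simp: bij_betw_def)
  have "?g \<in> alg_hom F B A"
  proof (rule alg_homI)
    fix x y assume xy: "x \<in> carrier B" "y \<in> carrier B"
    show "?g (x \<otimes>\<^bsub>B\<^esub> y) = ?g x \<otimes>\<^bsub>A\<^esub> ?g y"
      using gh[of "?g x \<otimes>\<^bsub>A\<^esub> ?g y"] xy by (simp add: g h)
    show "?g (x \<oplus>\<^bsub>B\<^esub> y) = ?g x \<oplus>\<^bsub>A\<^esub> ?g y"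
      using gh[of "?g x \<oplus>\<^bsub>A\<^esub> ?g y"] xy by (simp add: g h)
  next
    fix c x assume cx: "c \<in> carrier F" "x \<in> carrier B"
    show "?g (c \<odot>\<^bsub>B\<^esub> x) = c \<odot>\<^bsub>A\<^esub> ?g x"
      using gh[of "c \<odot>\<^bsub>A\<^esub> ?g x"] cx by (simp add: g h)
  qed (use g gh[of "\<one>\<^bsub>A\<^esub>"] h in auto)
  then show ?thesis using bij by (simp add: alg_iso_def bij_betw_inv_into)
qed

lemma alg_isomorphic_sym:
  "assoc_algebra F A ==> alg_isomorphic F A B ==> alg_isomorphic F B A"
  unfolding alg_isomorphic_def using alg_iso_inv by blast

section \<open>Presentations with one skew generator\<close>

text \<open>Only the relations of \<open>D[x; \<sigma>]/(x^d - a)\<close> are recorded: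
  \<open>A\<close> may be larger than the subalgebra generated by \<open>D\<close> and
  \<open>y\<close>, and the powers of \<open>y\<close> may be dependent. This is exactly what the
  target of a homomorphism out of the quotient has to satisfy.\<close>

locale skew_rel =
  D: assoc_algebra F D + A: assoc_algebra F A
  for F :: "('f, 'z) ring_scheme" and D :: "('f, 'a, 'm) module_scheme"
    and A :: "('f, 'b, 'k) module_scheme" +
  fixes f :: "'a => 'b" and y :: 'b and \<sigma> :: "'a => 'a" and d :: nat and a :: 'a
  assumes sigma: "\<sigma> \<in> alg_hom F D D" and f: "f \<in> alg_hom F D A"
    and y [simp]: "y \<in> carrier A" and a [simp]: "a \<in> carrier D" and d: "0 < d"
    and rel: "\<And>u. u \<in> carrier D ==> y \<otimes>\<^bsub>A\<^esub> f u = f (\<sigma> u) \<otimes>\<^bsub>A\<^esub> y"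
    and pow: "y [^]\<^bsub>A\<^esub> d = f a"
begin

sublocale f: alg_homomorphism F D A f
  by unfold_locales (rule f)

sublocale sigma: alg_homomorphism F D D \<sigma>
  by unfold_locales (rule sigma)

definition expand :: "(nat => 'a) => 'b" where
  "expand u = (\<Oplus>\<^bsub>A\<^esub>k\<in>{..<d}. f (u k) \<otimes>\<^bsub>A\<^esub> y [^]\<^bsub>A\<^esub> k)"

lemma sigma_pow_hom: "alg_homomorphism F D D (\<sigma> ^^ k)"
  by unfold_locales (rule alg_hom_funpow[OF sigma])

lemma sigma_pow_closed [simp]: "u \<in> carrier D ==> (\<sigma> ^^ k) u \<in> carrier D"
  by (induction k) auto

lemma pow_rel: "u \<in> carrier D ==> y [^]\<^bsub>A\<^esub> k \<otimes>\<^bsub>A\<^esub> f u = f ((\<sigma> ^^ k) u) \<otimes>\<^bsub>A\<^esub> y [^]\<^bsub>A\<^esub> k"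
proof (induction k arbitrary: u)
  case (Suc k)
  have "y [^]\<^bsub>A\<^esub> Suc k \<otimes>\<^bsub>A\<^esub> f u = y [^]\<^bsub>A\<^esub> k \<otimes>\<^bsub>A\<^esub> (f (\<sigma> u) \<otimes>\<^bsub>A\<^esub> y)"
    using Suc.prems by (simp add: A.m_assoc rel)
  also have "\<dots> = f ((\<sigma> ^^ k) (\<sigma> u)) \<otimes>\<^bsub>A\<^esub> y [^]\<^bsub>A\<^esub> k \<otimes>\<^bsub>A\<^esub> y"
    using Suc.prems by (simp add: Suc.IH flip: A.m_assoc)
  finally show ?case using Suc.prems by (simp add: A.m_assoc funpow_swap1)
qed simp

lemma mono_closed [simp]: "u \<in> carrier D ==> f u \<otimes>\<^bsub>A\<^esub> y [^]\<^bsub>A\<^esub> (k::nat) \<in> carrier A"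
  by simp

lemma mono_mult:
  assumes "u \<in> carrier D" "v \<in> carrier D"
  shows "(f u \<otimes>\<^bsub>A\<^esub> y [^]\<^bsub>A\<^esub> k) \<otimes>\<^bsub>A\<^esub> (f v \<otimes>\<^bsub>A\<^esub> y [^]\<^bsub>A\<^esub> l) = f (u \<otimes>\<^bsub>D\<^esub> (\<sigma> ^^ k) v) \<otimes>\<^bsub>A\<^esub> y [^]\<^bsub>A\<^esub> (k + l)"
proof -
  have "(f u \<otimes>\<^bsub>A\<^esub> y [^]\<^bsub>A\<^esub> k) \<otimes>\<^bsub>A\<^esub> (f v \<otimes>\<^bsub>A\<^esub> y [^]\<^bsub>A\<^esub> l) = f u \<otimes>\<^bsub>A\<^esub> (y [^]\<^bsub>A\<^esub> k \<otimes>\<^bsub>A\<^esub> f v) \<otimes>\<^bsub>A\<^esub> y [^]\<^bsub>A\<^esub> l"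
    using assms by (simp add: A.m_assoc)
  also have "\<dots> = f (u \<otimes>\<^bsub>D\<^esub> (\<sigma> ^^ k) v) \<otimes>\<^bsub>A\<^esub> (y [^]\<^bsub>A\<^esub> k \<otimes>\<^bsub>A\<^esub> y [^]\<^bsub>A\<^esub> l)"
    using assms by (simp add: A.m_assoc pow_rel)
  finally show ?thesis by (simp add: A.nat_pow_mult)
qed

text \<open>Splitting off \<open>y^d\<close> on the left of the remaining power puts
  \<open>f a\<close> directly next to \<open>f u\<close>, so nothing has to be commuted.\<close>

lemma mono_reduce:
  assumes "u \<in> carrier D" "d \<le> k"
  shows "f u \<otimes>\<^bsub>A\<^esub> y [^]\<^bsub>A\<^esub> k = f (u \<otimes>\<^bsub>D\<^esub> a) \<otimes>\<^bsub>A\<^esub> y [^]\<^bsub>A\<^esub> (k - d)"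
proof -
  have "y [^]\<^bsub>A\<^esub> k = f a \<otimes>\<^bsub>A\<^esub> y [^]\<^bsub>A\<^esub> (k - d)"
    using assms(2) A.nat_pow_mult[of y d "k - d"] by (simp add: pow)
  then show ?thesis using assms by (simp add: A.m_assoc)
qed

lemma expand_closed [simp]: "u \<in> {..<d} \<rightarrow> carrier D ==> expand u \<in> carrier A"
  unfolding expand_def by (intro A.M.finsum_closed) (auto simp: Pi_iff)

lemma expand_cong: "(\<And>k. k < d ==> u k = v k) ==> u \<in> {..<d} \<rightarrow> carrier D ==> expand u = expand v"
  unfolding expand_def by (rule A.M.finsum_cong') (auto simp: Pi_iff)

lemma expand_add:
  assumes "u \<in> {..<d} \<rightarrow> carrier D" "v \<in> {..<d} \<rightarrow> carrier D"
  shows "expand (\<lambda>k. u k \<oplus>\<^bsub>D\<^esub> v k) = expand u \<oplus>\<^bsub>A\<^esub> expand v"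
proof -
  have "expand (\<lambda>k. u k \<oplus>\<^bsub>D\<^esub> v k) = (\<Oplus>\<^bsub>A\<^esub>k\<in>{..<d}. f (u k) \<otimes>\<^bsub>A\<^esub> y [^]\<^bsub>A\<^esub> k \<oplus>\<^bsub>A\<^esub> f (v k) \<otimes>\<^bsub>A\<^esub> y [^]\<^bsub>A\<^esub> k)"
    unfolding expand_def by (rule A.M.finsum_cong') (use assms in \<open>auto simp: Pi_iff A.l_distr\<close>)
  also have "\<dots> = expand u \<oplus>\<^bsub>A\<^esub> expand v"
    unfolding expand_def by (rule A.M.finsum_addf) (use assms in \<open>auto simp: Pi_iff\<close>)
  finally show ?thesis .
qed

lemma expand_left_mult:
  assumes "u \<in> {..<d} \<rightarrow> carrier D" "v \<in> carrier D"
  shows "expand (\<lambda>k. v \<otimes>\<^bsub>D\<^esub> u k) = f v \<otimes>\<^bsub>A\<^esub> expand u"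
  unfolding expand_def using assms
  by (subst A.mult_finsum) (auto simp: Pi_iff A.m_assoc intro!: A.M.finsum_cong')

lemma expand_smult:
  assumes "u \<in> {..<d} \<rightarrow> carrier D" "c \<in> carrier F"
  shows "expand (\<lambda>k. c \<odot>\<^bsub>D\<^esub> u k) = c \<odot>\<^bsub>A\<^esub> expand u"
  unfolding expand_def using assms
  by (subst A.smult_finsum) (auto simp: Pi_iff A.smult_mult_left intro!: A.M.finsum_cong')

lemma expand_single:
  assumes "u \<in> carrier D" "k < d"
  shows "expand (\<lambda>i. if i = k then u else \<zero>\<^bsub>D\<^esub>) = f u \<otimes>\<^bsub>A\<^esub> y [^]\<^bsub>A\<^esub> k"
proof -
  have "expand (\<lambda>i. if i = k then u else \<zero>\<^bsub>D\<^esub>) = (\<Oplus>\<^bsub>A\<^esub>i\<in>{..<d}. if i = k then f u \<otimes>\<^bsub>A\<^esub> y [^]\<^bsub>A\<^esub> k else \<zero>\<^bsub>A\<^esub>)"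
    unfolding expand_def by (rule A.M.finsum_cong') (use assms in \<open>auto simp: Pi_iff\<close>)
  then show ?thesis using assms by (simp add: A.finsum_delta)
qed

lemma expand_induct:
  assumes u: "u \<in> {..<d} \<rightarrow> carrier D"
    and "\<And>v k. v \<in> carrier D ==> k < d ==> P (f v \<otimes>\<^bsub>A\<^esub> y [^]\<^bsub>A\<^esub> k)" "P \<zero>\<^bsub>A\<^esub>"
    and "\<And>z w. z \<in> carrier A ==> w \<in> carrier A ==> P z ==> P w ==> P (z \<oplus>\<^bsub>A\<^esub> w)"
  shows "P (expand u)"
proof -
  have "P (\<Oplus>\<^bsub>A\<^esub>k\<in>I. f (u k) \<otimes>\<^bsub>A\<^esub> y [^]\<^bsub>A\<^esub> k)" if "finite I" "I \<subseteq> {..<d}" for I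
    using that
  proof (induction I)
    case (insert k I)
    then have "u \<in> I \<rightarrow> carrier D" "u k \<in> carrier D" using u by auto
    then show ?case using insert assms(2,4) by (simp add: Pi_iff)
  qed (simp add: assms)
  then show ?thesis by (simp add: expand_def)
qed

end

text \<open>Expansions exist and are unique, so \<open>A\<close> is the algebra
  \<open>(D, \<sigma>, a)\<close> up to isomorphism (\<open>skew_pres_iso\<close>). The algebra E
  over F with trivial twist, the algebra EE over E, and EE' over \<open>E e_0\<close> are all
  handled as instances.\<close>

locale skew_pres = skew_rel F D A f y \<sigma> d a
  for F :: "('f, 'z) ring_scheme" and D :: "('f, 'a, 'm) module_scheme"
    and A :: "('f, 'b, 'k) module_scheme" and f y \<sigma> d a +
  assumes span: "\<And>z. z \<in> carrier A ==> \<exists>u\<in>{..<d} \<rightarrow> carrier D. z = expand u"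
    and indep: "\<And>u k. u \<in> {..<d} \<rightarrow> carrier D ==> expand u = \<zero>\<^bsub>A\<^esub> ==> k < d ==> u k = \<zero>\<^bsub>D\<^esub>"
begin

lemma expand_inj:
  assumes "u \<in> {..<d} \<rightarrow> carrier D" "v \<in> {..<d} \<rightarrow> carrier D" "expand u = expand v" "k < d"
  shows "u k = v k"
proof -
  let ?w = "\<lambda>k. u k \<ominus>\<^bsub>D\<^esub> v k"
  have w: "?w \<in> {..<d} \<rightarrow> carrier D" using assms by (auto simp: Pi_iff)
  have "expand ?w \<oplus>\<^bsub>A\<^esub> expand v = expand (\<lambda>k. ?w k \<oplus>\<^bsub>D\<^esub> v k)"
    using w assms by (simp add: expand_add)
  also have "\<dots> = expand u"
    by (rule expand_cong) (use assms in \<open>auto simp: Pi_iff D.M.a_assoc D.M.l_neg a_minus_def\<close>)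
  finally have "expand ?w \<oplus>\<^bsub>A\<^esub> expand v = expand v" using assms by simp
  then have "expand ?w = \<zero>\<^bsub>A\<^esub>" using w assms by simp
  then have "?w k = \<zero>\<^bsub>D\<^esub>" using indep w assms by blast
  then show ?thesis using assms by (auto simp: Pi_iff)
qed

lemma induct [consumes 1, case_names mono zero add]:
  assumes "z \<in> carrier A"
    and "\<And>v k. v \<in> carrier D ==> k < d ==> P (f v \<otimes>\<^bsub>A\<^esub> y [^]\<^bsub>A\<^esub> k)" "P \<zero>\<^bsub>A\<^esub>"
    and "\<And>z w. z \<in> carrier A ==> w \<in> carrier A ==> P z ==> P w ==> P (z \<oplus>\<^bsub>A\<^esub> w)"
  shows "P z"
  using span[OF assms(1)] expand_induct[of _ P] assms(2-4) by blast

text \<open>Only the values below \<open>d\<close> are determined; beyond that the choice is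
  arbitrary.\<close>

definition coef :: "'b => nat => 'a" where
  "coef z = (SOME u. u \<in> {..<d} \<rightarrow> carrier D \<and> z = expand u)"

lemma coef: "z \<in> carrier A ==> coef z \<in> {..<d} \<rightarrow> carrier D" "z \<in> carrier A ==> expand (coef z) = z"
proof -
  assume "z \<in> carrier A"
  then have "\<exists>u. u \<in> {..<d} \<rightarrow> carrier D \<and> z = expand u" using span by blast
  then have "coef z \<in> {..<d} \<rightarrow> carrier D \<and> z = expand (coef z)"
    unfolding coef_def by (rule someI_ex)
  then show "coef z \<in> {..<d} \<rightarrow> carrier D" "expand (coef z) = z" by auto
qed

lemma coef_expand: "u \<in> {..<d} \<rightarrow> carrier D ==> k < d ==> coef (expand u) k = u k"
  using expand_inj[of "coef (expand u)" u k] by (simp add: coef)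

lemma f_inj: "inj_on f (carrier D)"
proof (rule f.inj_onI)
  fix u assume u: "u \<in> carrier D" "f u = \<zero>\<^bsub>A\<^esub>"
  then have "expand (\<lambda>i. if i = 0 then u else \<zero>\<^bsub>D\<^esub>) = \<zero>\<^bsub>A\<^esub>" using d by (simp add: expand_single)
  from indep[OF _ this, of 0] show "u = \<zero>\<^bsub>D\<^esub>" using u d by auto
qed

end

section \<open>The universal property of a presentation\<close>

locale skew_lift = A: skew_pres F D A f y \<sigma> d a + B: skew_rel F D B g w \<sigma> d a
  for F :: "('f, 'z) ring_scheme" and D :: "('f, 'a, 'm) module_scheme"
    and A :: "('f, 'b, 'k) module_scheme" and f y \<sigma> d a
    and B :: "('f, 'c, 'l) module_scheme" and g w
begin

definition lift :: "'b => 'c" where "lift z = B.expand (A.coef z)"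

lemma lift_expand: "u \<in> {..<d} \<rightarrow> carrier D ==> lift (A.expand u) = B.expand u"
  unfolding lift_def by (rule B.expand_cong) (auto simp: A.coef_expand A.coef)

lemma lift_closed [simp]: "z \<in> carrier A ==> lift z \<in> carrier B"
  by (simp add: lift_def A.coef)

lemma lift_add: 
  assumes "z \<in> carrier A" "z' \<in> carrier A" 
  shows "lift (z \<oplus>\<^bsub>A\<^esub> z') = lift z \<oplus>\<^bsub>B\<^esub> lift z'"
proof -
  note c = A.coef(1)[OF assms(1)] A.coef(1)[OF assms(2)]
  have "z \<oplus>\<^bsub>A\<^esub> z' = A.expand (\<lambda>k. A.coef z k \<oplus>\<^bsub>D\<^esub> A.coef z' k)"
    using assms by (simp add: A.expand_add[OF c] A.coef)
  then have "lift (z \<oplus>\<^bsub>A\<^esub> z') = B.expand (\<lambda>k. A.coef z k \<oplus>\<^bsub>D\<^esub> A.coef z' k)"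
    using c by (simp add: lift_expand Pi_iff)
  then show ?thesis by (simp add: B.expand_add[OF c] lift_def)
qed

text \<open>Below \<open>d\<close> this is the definition of \<open>lift\<close>. For larger
  exponents the relation for the d-th power shortens both sides in the same way, and strong
  induction on the exponent applies.\<close>

lemma lift_mono: "u \<in> carrier D ==> lift (f u \<otimes>\<^bsub>A\<^esub> y [^]\<^bsub>A\<^esub> (k::nat)) = g u \<otimes>\<^bsub>B\<^esub> w [^]\<^bsub>B\<^esub> k"
proof (induction k arbitrary: u rule: less_induct)
  case (less k)
  show ?case
  proof (cases "k < d")
    case True
    then have "lift (f u \<otimes>\<^bsub>A\<^esub> y [^]\<^bsub>A\<^esub> k) = lift (A.expand (\<lambda>i. if i = k then u else \<zero>\<^bsub>D\<^esub>))"
      using less.prems by (simp add: A.expand_single)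
    also have "\<dots> = B.expand (\<lambda>i. if i = k then u else \<zero>\<^bsub>D\<^esub>)"
      by (rule lift_expand) (use less.prems in auto)
    finally show ?thesis using less.prems True by (simp add: B.expand_single)
  next
    case False
    then show ?thesis
      using less.prems less.IH[of "k - d" "u \<otimes>\<^bsub>D\<^esub> a"] A.d
      by (simp add: A.mono_reduce B.mono_reduce del: A.f.hom_simps(2) B.f.hom_simps(2))
  qed
qed

lemma lift_zero: "lift \<zero>\<^bsub>A\<^esub> = \<zero>\<^bsub>B\<^esub>"
  using lift_mono[of "\<zero>\<^bsub>D\<^esub>" 0] by simp

text \<open>Both sides are additive in each factor, so monomials suffice. The product of two
  monomials is again one, possibly with exponent at least \<open>d\<close>, and
  \<open>lift_mono\<close> covers all exponents.\<close>

lemma lift_mult: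
  assumes "z \<in> carrier A" "z' \<in> carrier A"
  shows "lift (z \<otimes>\<^bsub>A\<^esub> z') = lift z \<otimes>\<^bsub>B\<^esub> lift z'"
  using assms
proof (induction z rule: A.induct)
  case (mono u k)
  from \<open>z' \<in> carrier A\<close> show ?case
  proof (induction z' rule: A.induct)
    case (mono v l)
    then show ?case using \<open>u \<in> carrier D\<close>
      by (simp add: A.mono_mult lift_mono B.mono_mult del: A.f.hom_simps(2) B.f.hom_simps(2))
  qed (use mono in \<open>auto simp: A.A.r_distr B.A.r_distr lift_add lift_zero\<close>)
qed (auto simp: A.A.l_distr B.A.l_distr lift_add lift_zero)

lemma lift_const: "u \<in> carrier D ==> lift (f u) = g u"
  using lift_mono[of u 0] by simp

lemma lift_gen: "lift y = w"
  using lift_mono[of "\<one>\<^bsub>D\<^esub>" 1] by simp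

lemma lift_hom: "lift \<in> alg_hom F A B"
proof (rule alg_homI)
  show "lift \<one>\<^bsub>A\<^esub> = \<one>\<^bsub>B\<^esub>" using lift_const[of "\<one>\<^bsub>D\<^esub>"] by simp
  fix c z assume cz: "c \<in> carrier F" "z \<in> carrier A"
  have "lift (c \<odot>\<^bsub>A\<^esub> z) = lift (f (c \<odot>\<^bsub>D\<^esub> \<one>\<^bsub>D\<^esub>) \<otimes>\<^bsub>A\<^esub> z)"
    using cz by (simp add: A.A.one_smult_mult)
  also have "\<dots> = g (c \<odot>\<^bsub>D\<^esub> \<one>\<^bsub>D\<^esub>) \<otimes>\<^bsub>B\<^esub> lift z"
    using cz lift_mult[of "f (c \<odot>\<^bsub>D\<^esub> \<one>\<^bsub>D\<^esub>)" z] lift_const[of "c \<odot>\<^bsub>D\<^esub> \<one>\<^bsub>D\<^esub>"]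
    by (simp del: A.f.hom_simps(5) B.f.hom_simps(5))
  also have "\<dots> = c \<odot>\<^bsub>B\<^esub> lift z" using cz by (simp add: B.A.one_smult_mult)
  finally show "lift (c \<odot>\<^bsub>A\<^esub> z) = c \<odot>\<^bsub>B\<^esub> lift z" .
qed (auto simp: lift_add lift_mult)

end

text \<open>Independence in \<open>B\<close> makes the lift injective and spanning of
  \<open>B\<close> makes it surjective, so the lift in the other direction never has to be
  built.\<close>

lemma skew_pres_iso:
  assumes "skew_pres F D A f y \<sigma> d a" "skew_pres F D B g w \<sigma> d a"
  shows "\<exists>\<psi>\<in>alg_iso F A B. (\<forall>u\<in>carrier D. \<psi> (f u) = g u) \<and> \<psi> y = w"
proof -
  interpret B: skew_pres F D B g w \<sigma> d a by fact
  interpret skew_lift F D A f y \<sigma> d a B g w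
    using assms by (simp add: skew_lift_def B.skew_rel_axioms)
  interpret lift: alg_homomorphism F A B lift
    by unfold_locales (rule lift_hom)
  have "inj_on lift (carrier A)"
  proof (rule lift.inj_onI)
    fix z assume z: "z \<in> carrier A" "lift z = \<zero>\<^bsub>B\<^esub>"
    then have "A.coef z k = \<zero>\<^bsub>D\<^esub>" if "k < d" for k
      using B.indep[OF A.coef(1)[OF z(1)] _ that] by (simp add: lift_def)
    then have "A.expand (A.coef z) = A.expand (\<lambda>k. \<zero>\<^bsub>D\<^esub>)"
      by (intro A.expand_cong) (auto simp: A.coef z)
    also have "\<dots> = \<zero>\<^bsub>A\<^esub>" by (simp add: A.expand_def)
    finally show "z = \<zero>\<^bsub>A\<^esub>" using z by (simp add: A.coef)
  qed
  moreover have "carrier B \<subseteq> lift ` carrier A"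
  proof
    fix z assume "z \<in> carrier B"
    then obtain u where u: "u \<in> {..<d} \<rightarrow> carrier D" "z = B.expand u" using B.span by blast
    then have "z = lift (A.expand u)" by (simp add: lift_expand)
    then show "z \<in> lift ` carrier A" using u by auto
  qed
  ultimately show ?thesis
    using alg_isoI[OF lift_hom] lift_const lift_gen by blast
qed

section \<open>Skew polynomial rings and their quotients\<close>

text \<open>Both sides sum over the triangle of pairs with i + j at most k, once along diagonals and
  once along rows; the induction step adds one diagonal. This is the reindexing behind associativity
  of the skew product.\<close>

lemma (in abelian_monoid) finsum_triangle:
  fixes k :: nat
  assumes "\<And>i j. f i j \<in> carrier G"
  shows "(\<Oplus>i\<in>{..k}. \<Oplus>j\<in>{..i}. f j (i - j)) = (\<Oplus>i\<in>{..k}. \<Oplus>j\<in>{..k - i}. f i j)"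
proof (induction k)
  case 0 then show ?case by (simp add: assms)
next
  case (Suc k)
  have "(\<Oplus>i\<in>{..k}. \<Oplus>j\<in>{..Suc k - i}. f i j) = (\<Oplus>i\<in>{..k}. f i (Suc k - i) \<oplus> (\<Oplus>j\<in>{..k - i}. f i j))"
    by (rule finsum_cong') (auto simp: Suc_diff_le assms)
  also have "\<dots> = (\<Oplus>i\<in>{..k}. f i (Suc k - i)) \<oplus> (\<Oplus>i\<in>{..k}. \<Oplus>j\<in>{..k - i}. f i j)"
    by (rule finsum_addf) (auto simp: assms)
  finally show ?case
    by (simp add: Suc assms a_assoc)
qed

text \<open>The following locale covers both \<open>skew_UP D \<sigma>\<close> and the commutative \<open>UP F\<close>, whose operations
  agree with those of \<open>skew_UP\<close> only on the carrier.\<close>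

locale skew_poly = D: assoc_algebra F D
  for F :: "('f, 'z) ring_scheme" and D :: "('f, 'a, 'm) module_scheme" and \<sigma>
    and P :: "('f, nat => 'a, 'k) module_scheme" +
  assumes sigma: "\<sigma> \<in> alg_hom F D D"
    and carrier_P: "carrier P = up D"
    and mult_P: "\<And>p q. p \<in> up D ==> q \<in> up D ==>
      p \<otimes>\<^bsub>P\<^esub> q = (\<lambda>k. \<Oplus>\<^bsub>D\<^esub>i\<in>{..k}. p i \<otimes>\<^bsub>D\<^esub> (\<sigma> ^^ i) (q (k - i)))"
    and one_P: "\<one>\<^bsub>P\<^esub> = (\<lambda>i. if i = 0 then \<one>\<^bsub>D\<^esub> else \<zero>\<^bsub>D\<^esub>)"
    and zero_P: "\<zero>\<^bsub>P\<^esub> = (\<lambda>i. \<zero>\<^bsub>D\<^esub>)"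
    and add_P: "\<And>p q. p \<in> up D ==> q \<in> up D ==> p \<oplus>\<^bsub>P\<^esub> q = (\<lambda>i. p i \<oplus>\<^bsub>D\<^esub> q i)"
    and smult_P: "\<And>c p. c \<in> carrier F ==> p \<in> up D ==> c \<odot>\<^bsub>P\<^esub> p = (\<lambda>i. c \<odot>\<^bsub>D\<^esub> p i)"
begin

lemma pow_hom: "alg_homomorphism F D D (\<sigma> ^^ k)"
  by unfold_locales (rule alg_hom_funpow[OF sigma])

lemma sp_closed [simp]: "u \<in> carrier D ==> (\<sigma> ^^ k) u \<in> carrier D"
  and sp_mult [simp]: "u \<in> carrier D ==> v \<in> carrier D ==> (\<sigma> ^^ k) (u \<otimes>\<^bsub>D\<^esub> v) = (\<sigma> ^^ k) u \<otimes>\<^bsub>D\<^esub> (\<sigma> ^^ k) v"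
  and sp_add [simp]: "u \<in> carrier D ==> v \<in> carrier D ==> (\<sigma> ^^ k) (u \<oplus>\<^bsub>D\<^esub> v) = (\<sigma> ^^ k) u \<oplus>\<^bsub>D\<^esub> (\<sigma> ^^ k) v"
  and sp_smult [simp]: "c \<in> carrier F ==> u \<in> carrier D ==> (\<sigma> ^^ k) (c \<odot>\<^bsub>D\<^esub> u) = c \<odot>\<^bsub>D\<^esub> (\<sigma> ^^ k) u"
  and sp_one [simp]: "(\<sigma> ^^ k) \<one>\<^bsub>D\<^esub> = \<one>\<^bsub>D\<^esub>"
  and sp_zero [simp]: "(\<sigma> ^^ k) \<zero>\<^bsub>D\<^esub> = \<zero>\<^bsub>D\<^esub>"
  and sp_neg [simp]: "u \<in> carrier D ==> (\<sigma> ^^ k) (\<ominus>\<^bsub>D\<^esub> u) = \<ominus>\<^bsub>D\<^esub> (\<sigma> ^^ k) u"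
  and sp_finsum: "g \<in> I \<rightarrow> carrier D ==> (\<sigma> ^^ k) (\<Oplus>\<^bsub>D\<^esub>i\<in>I. g i) = (\<Oplus>\<^bsub>D\<^esub>i\<in>I. (\<sigma> ^^ k) (g i))"
  using alg_homD[OF alg_hom_funpow[OF sigma, of k]] alg_homomorphism.zero[OF pow_hom[of k]]
    alg_homomorphism.neg[OF pow_hom[of k]] alg_homomorphism.finsum[OF pow_hom[of k]] by auto

lemma upD [simp]: "p \<in> up D ==> p i \<in> carrier D" by auto

lemma upI: "(\<And>i. p i \<in> carrier D) ==> (\<And>i. N < i ==> p i = \<zero>\<^bsub>D\<^esub>) ==> p \<in> up D"
  by (rule mem_upI) (auto intro!: exI[of _ N] simp: bound_def)

lemma upE:
  assumes "p \<in> up D"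
  obtains N where "\<And>i. N < i ==> p i = \<zero>\<^bsub>D\<^esub>"
  using D.bound_upD[OF assms] bound.bound by metis

lemma mult_closed: 
  assumes "p \<in> up D" "q \<in> up D" 
  shows "(\<lambda>k. \<Oplus>\<^bsub>D\<^esub>i\<in>{..k}. p i \<otimes>\<^bsub>D\<^esub> (\<sigma> ^^ i) (q (k - i))) \<in> up D"
proof -
  obtain M N where M: "\<And>i. M < i ==> p i = \<zero>\<^bsub>D\<^esub>" and N: "\<And>i. N < i ==> q i = \<zero>\<^bsub>D\<^esub>"
    using upE assms by metis
  show ?thesis
  proof (rule upI[where N = "M + N"])
    fix k assume k: "M + N < k"
    have "p i \<otimes>\<^bsub>D\<^esub> (\<sigma> ^^ i) (q (k - i)) = \<zero>\<^bsub>D\<^esub>" if "i \<le> k" for i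
      using k that assms M[of i] N[of "k - i"] by (cases "M < i") auto
    then have "(\<Oplus>\<^bsub>D\<^esub>i\<in>{..k}. p i \<otimes>\<^bsub>D\<^esub> (\<sigma> ^^ i) (q (k - i))) = (\<Oplus>\<^bsub>D\<^esub>i\<in>{..k}. \<zero>\<^bsub>D\<^esub>)"
      by (intro D.M.finsum_cong') auto
    then show "(\<Oplus>\<^bsub>D\<^esub>i\<in>{..k}. p i \<otimes>\<^bsub>D\<^esub> (\<sigma> ^^ i) (q (k - i))) = \<zero>\<^bsub>D\<^esub>" by simp
  qed (use assms in auto)
qed

lemma closed [simp]:
  "p \<in> up D ==> q \<in> up D ==> p \<oplus>\<^bsub>P\<^esub> q \<in> up D"
  "p \<in> up D ==> q \<in> up D ==> p \<otimes>\<^bsub>P\<^esub> q \<in> up D"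
  "c \<in> carrier F ==> p \<in> up D ==> c \<odot>\<^bsub>P\<^esub> p \<in> up D"
  "\<zero>\<^bsub>P\<^esub> \<in> up D" "\<one>\<^bsub>P\<^esub> \<in> up D"
proof -
  show "p \<oplus>\<^bsub>P\<^esub> q \<in> up D" if "p \<in> up D" "q \<in> up D"
    using that by (simp add: add_P D.up_add_closed)
  show "p \<otimes>\<^bsub>P\<^esub> q \<in> up D" if "p \<in> up D" "q \<in> up D"
    using that by (simp add: mult_P mult_closed)
  show "c \<odot>\<^bsub>P\<^esub> p \<in> up D" if c: "c \<in> carrier F" and p: "p \<in> up D"
  proof -
    obtain N where "\<And>i. N < i ==> p i = \<zero>\<^bsub>D\<^esub>" using upE[OF p] by metis
    then show ?thesis using c p by (intro upI[where N = N]) (auto simp: smult_P)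
  qed
  show "\<zero>\<^bsub>P\<^esub> \<in> up D" by (rule upI[where N = 0]) (auto simp: zero_P)
  show "\<one>\<^bsub>P\<^esub> \<in> up D" by (rule upI[where N = 0]) (auto simp: one_P)
qed

lemma zero_up: "(\<lambda>i. \<zero>\<^bsub>D\<^esub>) \<in> up D"
  using closed(4) by (simp add: zero_P)

lemma algebra_P: "assoc_algebra F P"
proof -
  have "abelian_group P"
  proof (rule abelian_groupI)
    fix p assume "p \<in> carrier P"
    then have p: "p \<in> up D" by (simp add: carrier_P)
    then have n: "(\<lambda>i. \<ominus>\<^bsub>D\<^esub> p i) \<in> up D" by (simp add: D.up_a_inv_closed)
    have "(\<lambda>i. \<ominus>\<^bsub>D\<^esub> p i) \<oplus>\<^bsub>P\<^esub> p = \<zero>\<^bsub>P\<^esub>"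
      unfolding add_P[OF n p] zero_P using p by (auto simp: D.M.l_neg)
    then show "\<exists>q\<in>carrier P. q \<oplus>\<^bsub>P\<^esub> p = \<zero>\<^bsub>P\<^esub>"
      using n unfolding carrier_P by blast
  next
    fix p assume "p \<in> carrier P"
    then have p: "p \<in> up D" by (simp add: carrier_P)
    then show "\<zero>\<^bsub>P\<^esub> \<oplus>\<^bsub>P\<^esub> p = p"
      unfolding zero_P add_P[OF zero_up p] by auto
  next
    fix p q r assume "p \<in> carrier P" "q \<in> carrier P" "r \<in> carrier P"
    then have pqr: "p \<in> up D" "q \<in> up D" "r \<in> up D" by (simp_all add: carrier_P)
    show "p \<oplus>\<^bsub>P\<^esub> q \<oplus>\<^bsub>P\<^esub> r = p \<oplus>\<^bsub>P\<^esub> (q \<oplus>\<^bsub>P\<^esub> r)"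
      unfolding add_P[OF pqr(1,2)] add_P[OF pqr(2,3)]
        add_P[OF D.up_add_closed[OF pqr(1,2)] pqr(3)] add_P[OF pqr(1) D.up_add_closed[OF pqr(2,3)]]
      using pqr by (simp add: D.M.a_assoc)
  next
    fix p q assume "p \<in> carrier P" "q \<in> carrier P"
    then have pq: "p \<in> up D" "q \<in> up D" by (simp_all add: carrier_P)
    show "p \<oplus>\<^bsub>P\<^esub> q = q \<oplus>\<^bsub>P\<^esub> p"
      unfolding add_P[OF pq] add_P[OF pq(2,1)] using pq by (simp add: D.M.a_comm)
  qed (simp_all add: carrier_P)
  moreover have "Group.monoid P"
  proof (rule monoidI)
    fix p q r assume "p \<in> carrier P" "q \<in> carrier P" "r \<in> carrier P"
    then have pqr: "p \<in> up D" "q \<in> up D" "r \<in> up D" by (simp_all add: carrier_P)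
    show "p \<otimes>\<^bsub>P\<^esub> q \<otimes>\<^bsub>P\<^esub> r = p \<otimes>\<^bsub>P\<^esub> (q \<otimes>\<^bsub>P\<^esub> r)"
    proof
      fix k
      \<comment> \<open>The common value of a triple product in degrees \<open>j\<close>,
        \<open>l\<close> and \<open>k - (j + l)\<close>. One bracketing yields it summed along
        diagonals, the other along rows after \<open>\<sigma>^i\<close> has been distributed over
        the inner sum.\<close>
      define f where "f j l = p j \<otimes>\<^bsub>D\<^esub> (\<sigma> ^^ j) (q l) \<otimes>\<^bsub>D\<^esub> (\<sigma> ^^ (j + l)) (r (k - (j + l)))" for j l
      have f: "f j l \<in> carrier D" for j l using pqr by (simp add: f_def)
      have "(p \<otimes>\<^bsub>P\<^esub> q \<otimes>\<^bsub>P\<^esub> r) k =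
          (\<Oplus>\<^bsub>D\<^esub>i\<in>{..k}. (\<Oplus>\<^bsub>D\<^esub>j\<in>{..i}. p j \<otimes>\<^bsub>D\<^esub> (\<sigma> ^^ j) (q (i - j))) \<otimes>\<^bsub>D\<^esub> (\<sigma> ^^ i) (r (k - i)))"
        using pqr closed(2)[OF pqr(1,2)] by (simp add: mult_P)
      also have "\<dots> = (\<Oplus>\<^bsub>D\<^esub>i\<in>{..k}. \<Oplus>\<^bsub>D\<^esub>j\<in>{..i}. f j (i - j))"
        using pqr by (intro D.M.finsum_cong')
          (auto simp: D.finsum_mult Pi_iff f_def simp del: funpow_add intro!: D.M.finsum_cong')
      also have "\<dots> = (\<Oplus>\<^bsub>D\<^esub>i\<in>{..k}. \<Oplus>\<^bsub>D\<^esub>j\<in>{..k - i}. f i j)"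
        using f by (rule D.M.finsum_triangle)
      also have "\<dots> = (\<Oplus>\<^bsub>D\<^esub>i\<in>{..k}. p i \<otimes>\<^bsub>D\<^esub> (\<sigma> ^^ i) (\<Oplus>\<^bsub>D\<^esub>j\<in>{..k - i}. q j \<otimes>\<^bsub>D\<^esub> (\<sigma> ^^ j) (r (k - i - j))))"
        using pqr by (intro D.M.finsum_cong')
          (auto simp: D.mult_finsum sp_finsum Pi_iff f_def D.m_assoc funpow_add intro!: D.M.finsum_cong')
      also have "\<dots> = (p \<otimes>\<^bsub>P\<^esub> (q \<otimes>\<^bsub>P\<^esub> r)) k"
        using pqr closed(2)[OF pqr(2,3)] by (simp add: mult_P)
      finally show "(p \<otimes>\<^bsub>P\<^esub> q \<otimes>\<^bsub>P\<^esub> r) k = (p \<otimes>\<^bsub>P\<^esub> (q \<otimes>\<^bsub>P\<^esub> r)) k" .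
    qed
  next
    fix p assume "p \<in> carrier P"
    then have p: "p \<in> up D" by (simp add: carrier_P)
    have "(\<one>\<^bsub>P\<^esub> \<otimes>\<^bsub>P\<^esub> p) k = p k" for k
    proof -
      have "(\<one>\<^bsub>P\<^esub> \<otimes>\<^bsub>P\<^esub> p) k = (\<Oplus>\<^bsub>D\<^esub>i\<in>{..k}. if i = 0 then p k else \<zero>\<^bsub>D\<^esub>)"
        using p mult_P[OF closed(5) p] by (auto simp: one_P intro!: D.M.finsum_cong')
      then show ?thesis using p by (simp add: D.finsum_delta)
    qed
    then show "\<one>\<^bsub>P\<^esub> \<otimes>\<^bsub>P\<^esub> p = p" by auto
    have "(p \<otimes>\<^bsub>P\<^esub> \<one>\<^bsub>P\<^esub>) k = p k" for k
    proof -
      have "(p \<otimes>\<^bsub>P\<^esub> \<one>\<^bsub>P\<^esub>) k = (\<Oplus>\<^bsub>D\<^esub>i\<in>{..k}. if i = k then p k else \<zero>\<^bsub>D\<^esub>)"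
        using p mult_P[OF p closed(5)] by (auto simp: one_P intro!: D.M.finsum_cong')
      then show ?thesis using p by (simp add: D.finsum_delta)
    qed
    then show "p \<otimes>\<^bsub>P\<^esub> \<one>\<^bsub>P\<^esub> = p" by auto
  qed (auto simp: carrier_P)
  ultimately have "ring P"
  proof (rule ringI)
    fix p q r assume "p \<in> carrier P" "q \<in> carrier P" "r \<in> carrier P"
    then have pqr: "p \<in> up D" "q \<in> up D" "r \<in> up D" by (simp_all add: carrier_P)
    show "(p \<oplus>\<^bsub>P\<^esub> q) \<otimes>\<^bsub>P\<^esub> r = p \<otimes>\<^bsub>P\<^esub> r \<oplus>\<^bsub>P\<^esub> q \<otimes>\<^bsub>P\<^esub> r"
      using pqr D.up_add_closed[OF pqr(1,2)]
      by (simp add: add_P mult_P mult_closed D.l_distr D.M.finsum_addf Pi_iff)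
    show "r \<otimes>\<^bsub>P\<^esub> (p \<oplus>\<^bsub>P\<^esub> q) = r \<otimes>\<^bsub>P\<^esub> p \<oplus>\<^bsub>P\<^esub> r \<otimes>\<^bsub>P\<^esub> q"
      using pqr D.up_add_closed[OF pqr(1,2)]
      by (simp add: add_P mult_P mult_closed D.r_distr D.M.finsum_addf Pi_iff)
  qed
  then show ?thesis
  proof (rule assoc_algebraI[OF D.R.is_cring])
    fix c p q assume "c \<in> carrier F" "p \<in> carrier P" "q \<in> carrier P"
    then have cpq: "c \<in> carrier F" "p \<in> up D" "q \<in> up D" by (simp_all add: carrier_P)
    note cl = cpq closed(3)[OF cpq(1,2)] closed(3)[OF cpq(1,3)] closed(2)[OF cpq(2,3)]
    show "(c \<odot>\<^bsub>P\<^esub> p) \<otimes>\<^bsub>P\<^esub> q = c \<odot>\<^bsub>P\<^esub> (p \<otimes>\<^bsub>P\<^esub> q)"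
      using cl by (simp add: mult_P, simp add: smult_P D.smult_mult_left D.smult_finsum Pi_iff mult_closed)
    show "p \<otimes>\<^bsub>P\<^esub> (c \<odot>\<^bsub>P\<^esub> q) = c \<odot>\<^bsub>P\<^esub> (p \<otimes>\<^bsub>P\<^esub> q)"
      using cl by (simp add: mult_P, simp add: smult_P D.smult_mult_right D.smult_finsum Pi_iff mult_closed)
    show "c \<odot>\<^bsub>P\<^esub> (p \<oplus>\<^bsub>P\<^esub> q) = c \<odot>\<^bsub>P\<^esub> p \<oplus>\<^bsub>P\<^esub> c \<odot>\<^bsub>P\<^esub> q"
      using cl closed(1)[OF cpq(2,3)] by (simp add: add_P, simp add: smult_P D.smult_r_distr D.up_add_closed)
  next
    fix b c p assume "b \<in> carrier F" "c \<in> carrier F" "p \<in> carrier P"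
    then have bcp: "b \<in> carrier F" "c \<in> carrier F" "p \<in> up D" by (simp_all add: carrier_P)
    note cl = bcp closed(3)[OF bcp(1,3)] closed(3)[OF bcp(2,3)]
    show "(b \<oplus>\<^bsub>F\<^esub> c) \<odot>\<^bsub>P\<^esub> p = b \<odot>\<^bsub>P\<^esub> p \<oplus>\<^bsub>P\<^esub> c \<odot>\<^bsub>P\<^esub> p"
      using cl by (simp add: add_P, simp add: smult_P D.smult_l_distr)
    show "(b \<otimes>\<^bsub>F\<^esub> c) \<odot>\<^bsub>P\<^esub> p = b \<odot>\<^bsub>P\<^esub> (c \<odot>\<^bsub>P\<^esub> p)"
      using cl by (simp add: smult_P[of b], simp add: smult_P D.smult_assoc1)
  next
    fix p assume "p \<in> carrier P"
    then show "\<one>\<^bsub>F\<^esub> \<odot>\<^bsub>P\<^esub> p = p" by (simp add: carrier_P smult_P)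
  qed (auto simp: carrier_P)
qed

sublocale P: assoc_algebra F P by (rule algebra_P)

abbreviation monom where "monom \<equiv> skew_monom D"

lemma monom_closed [simp]: "u \<in> carrier D ==> monom u k \<in> up D"
  by (rule upI[where N = k]) (auto simp: skew_monom_def)

lemma monom_up [simp]: "u \<in> carrier D ==> (\<lambda>i. if i = k then u else \<zero>\<^bsub>D\<^esub>) \<in> up D"
  using monom_closed[of u k] by (simp add: skew_monom_def)

lemma mult_monom:
  assumes "p \<in> up D" "v \<in> carrier D"
  shows "p \<otimes>\<^bsub>P\<^esub> monom v l = (\<lambda>k. if l \<le> k then p (k - l) \<otimes>\<^bsub>D\<^esub> (\<sigma> ^^ (k - l)) v else \<zero>\<^bsub>D\<^esub>)"
proof
  fix k
  have "(p \<otimes>\<^bsub>P\<^esub> monom v l) k = (\<Oplus>\<^bsub>D\<^esub>i\<in>{..k}. if i = k - l \<and> l \<le> k then p (k - l) \<otimes>\<^bsub>D\<^esub> (\<sigma> ^^ (k - l)) v else \<zero>\<^bsub>D\<^esub>)"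
    using assms mult_P[OF assms(1) monom_closed[OF assms(2)]]
    by (auto simp: skew_monom_def intro!: D.M.finsum_cong')
  then show "(p \<otimes>\<^bsub>P\<^esub> monom v l) k = (if l \<le> k then p (k - l) \<otimes>\<^bsub>D\<^esub> (\<sigma> ^^ (k - l)) v else \<zero>\<^bsub>D\<^esub>)"
    using assms by (simp add: D.finsum_delta)
qed

lemma monom_mult:
  assumes "p \<in> up D" "v \<in> carrier D"
  shows "monom v l \<otimes>\<^bsub>P\<^esub> p = (\<lambda>k. if l \<le> k then v \<otimes>\<^bsub>D\<^esub> (\<sigma> ^^ l) (p (k - l)) else \<zero>\<^bsub>D\<^esub>)"
proof
  fix k
  have "(monom v l \<otimes>\<^bsub>P\<^esub> p) k = (\<Oplus>\<^bsub>D\<^esub>i\<in>{..k}. if i = l then v \<otimes>\<^bsub>D\<^esub> (\<sigma> ^^ l) (p (k - l)) else \<zero>\<^bsub>D\<^esub>)"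
    using assms mult_P[OF monom_closed[OF assms(2)] assms(1)]
    by (auto simp: skew_monom_def intro!: D.M.finsum_cong')
  show "(monom v l \<otimes>\<^bsub>P\<^esub> p) k = (if l \<le> k then v \<otimes>\<^bsub>D\<^esub> (\<sigma> ^^ l) (p (k - l)) else \<zero>\<^bsub>D\<^esub>)"
  proof (cases "l \<le> k")
    case False
    have "(\<Oplus>\<^bsub>D\<^esub>i\<in>{..k}. if i = l then v \<otimes>\<^bsub>D\<^esub> (\<sigma> ^^ l) (p (k - l)) else \<zero>\<^bsub>D\<^esub>) = (\<Oplus>\<^bsub>D\<^esub>i\<in>{..k}. \<zero>\<^bsub>D\<^esub>)"
      by (rule D.M.finsum_cong') (use False in auto)
    then show ?thesis using False \<open>(monom v l \<otimes>\<^bsub>P\<^esub> p) k = _\<close> by simp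
  qed (use assms \<open>(monom v l \<otimes>\<^bsub>P\<^esub> p) k = _\<close> in \<open>simp add: D.finsum_delta\<close>)
qed

lemma monom_monom:
  "u \<in> carrier D ==> v \<in> carrier D ==> monom u k \<otimes>\<^bsub>P\<^esub> monom v l = monom (u \<otimes>\<^bsub>D\<^esub> (\<sigma> ^^ k) v) (k + l)"
  by (subst mult_monom) (auto simp: skew_monom_def fun_eq_iff)

lemma monom_pow: "monom \<one>\<^bsub>D\<^esub> (Suc 0) [^]\<^bsub>P\<^esub> k = monom \<one>\<^bsub>D\<^esub> k"
  by (induction k) (simp_all add: monom_monom one_P, simp add: skew_monom_def)

lemma monom_hom: "(\<lambda>u. monom u 0) \<in> alg_hom F D P"
proof (rule alg_homI)
  fix u v assume "u \<in> carrier D" "v \<in> carrier D"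
  then show "monom (u \<oplus>\<^bsub>D\<^esub> v) 0 = monom u 0 \<oplus>\<^bsub>P\<^esub> monom v 0"
    by (subst add_P) (auto simp: skew_monom_def fun_eq_iff)
next
  fix c u assume "c \<in> carrier F" "u \<in> carrier D"
  then show "monom (c \<odot>\<^bsub>D\<^esub> u) 0 = c \<odot>\<^bsub>P\<^esub> monom u 0"
    by (subst smult_P) (auto simp: skew_monom_def fun_eq_iff)
qed (auto simp: monom_monom carrier_P, simp add: skew_monom_def one_P)

lemma finsum_monom:
  assumes "u \<in> {..<n} \<rightarrow> carrier D"
  shows "(\<Oplus>\<^bsub>P\<^esub>k\<in>{..<n}. monom (u k) k) = (\<lambda>k. if k < n then u k else \<zero>\<^bsub>D\<^esub>)"
  using assms
proof (induction n)
  case 0 then show ?case by (simp add: zero_P)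
next
  case (Suc n)
  then have "(\<Oplus>\<^bsub>P\<^esub>k\<in>{..<Suc n}. monom (u k) k) = monom (u n) n \<oplus>\<^bsub>P\<^esub> (\<lambda>k. if k < n then u k else \<zero>\<^bsub>D\<^esub>)"
    by (auto simp: lessThan_Suc Pi_iff carrier_P)
  moreover have "(\<lambda>k. if k < n then u k else \<zero>\<^bsub>D\<^esub>) \<in> up D"
    using Suc.prems by (intro upI[where N = n]) auto
  ultimately show ?case
    using Suc.prems by (subst (asm) add_P) (auto simp: skew_monom_def fun_eq_iff less_Suc_eq Pi_iff)
qed

lemma up_induct [consumes 1, case_names monom add]:
  assumes "p \<in> up D" and m: "\<And>u k. u \<in> carrier D ==> Q (monom u k)"
    and a: "\<And>p q. p \<in> up D ==> q \<in> up D ==> Q p ==> Q q ==> Q (p \<oplus>\<^bsub>P\<^esub> q)"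
  shows "Q p"
proof -
  obtain N where N: "\<And>i. N < i ==> p i = \<zero>\<^bsub>D\<^esub>" using upE[OF assms(1)] by metis
  have "Q (\<Oplus>\<^bsub>P\<^esub>k\<in>{..<n}. monom (p k) k)" for n
  proof (induction n)
    case 0
    have "\<zero>\<^bsub>P\<^esub> = monom \<zero>\<^bsub>D\<^esub> 0" by (auto simp: zero_P skew_monom_def)
    then show ?case using m[of "\<zero>\<^bsub>D\<^esub>" 0] by simp
  next
    case (Suc n)
    have "(\<Oplus>\<^bsub>P\<^esub>k\<in>{..<n}. monom (p k) k) \<in> carrier P"
      by (rule P.M.finsum_closed) (use assms in \<open>auto simp: carrier_P\<close>)
    then show ?case
      using assms(1) Suc m[of "p n" n] by (auto simp: lessThan_Suc Pi_iff carrier_P intro!: a)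
  qed
  moreover have "(\<Oplus>\<^bsub>P\<^esub>k\<in>{..<Suc N}. monom (p k) k) = p"
    using N assms(1) by (subst finsum_monom) (auto simp: fun_eq_iff)
  ultimately show ?thesis by metis
qed

end

section \<open>Quotients of algebras and of skew polynomial rings\<close>

lemma quot_algebra_simps:
  "carrier (quot_algebra A I) = A_RCOSETS A I"
  "V \<otimes>\<^bsub>quot_algebra A I\<^esub> W = rcoset_mult A I V W"
  "V \<oplus>\<^bsub>quot_algebra A I\<^esub> W = set_add A V W"
  "\<one>\<^bsub>quot_algebra A I\<^esub> = a_r_coset A I \<one>\<^bsub>A\<^esub>" "\<zero>\<^bsub>quot_algebra A I\<^esub> = I"
  "c \<odot>\<^bsub>quot_algebra A I\<^esub> V = (\<Union>x\<in>V. a_r_coset A I (c \<odot>\<^bsub>A\<^esub> x))"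
  by (simp_all add: quot_algebra_def FactRing_def ring.defs module.defs)

lemma quot_algebra:
  assumes "assoc_algebra F A" "ideal I A"
  shows "assoc_algebra F (quot_algebra A I)"
    and "(\<lambda>z. I +>\<^bsub>A\<^esub> z) \<in> alg_hom F A (quot_algebra A I)"
    and "(\<lambda>z. I +>\<^bsub>A\<^esub> z) ` carrier A = carrier (quot_algebra A I)"
    and "z \<in> carrier A ==> I +>\<^bsub>A\<^esub> z = \<zero>\<^bsub>quot_algebra A I\<^esub> \<longleftrightarrow> z \<in> I"
proof -
  interpret A: assoc_algebra F A by fact
  interpret I: ideal I A by fact
  have sm: "I +>\<^bsub>A\<^esub> (c \<odot>\<^bsub>A\<^esub> z) = c \<odot>\<^bsub>quot_algebra A I\<^esub> (I +>\<^bsub>A\<^esub> z)" if cz: "c \<in> carrier F" "z \<in> carrier A" for c z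
  proof -
    \<comment> \<open>The scalar multiple of a coset is a union over all representatives. They all
      give the same coset because \<open>c x - c z = (c 1) (x - z)\<close> lies in the
      ideal.\<close>
    have "I +>\<^bsub>A\<^esub> (c \<odot>\<^bsub>A\<^esub> x) = I +>\<^bsub>A\<^esub> (c \<odot>\<^bsub>A\<^esub> z)" if "x \<in> I +>\<^bsub>A\<^esub> z" for x
    proof -
      have x: "x \<in> carrier A" using that cz by (meson I.a_subset A.M.a_r_coset_subset_G subsetD)
      have "I +>\<^bsub>A\<^esub> x = I +>\<^bsub>A\<^esub> z" using that cz A.M.a_repr_independence[OF _ _ I.a_subgroup] by metis
      then have "x \<ominus>\<^bsub>A\<^esub> z \<in> I" using x cz A.quotient_eq_iff_same_a_r_cos assms(2) by blast
      then have "(c \<odot>\<^bsub>A\<^esub> \<one>\<^bsub>A\<^esub>) \<otimes>\<^bsub>A\<^esub> (x \<ominus>\<^bsub>A\<^esub> z) \<in> I" using cz by (intro I.I_l_closed) auto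
      then have "c \<odot>\<^bsub>A\<^esub> x \<ominus>\<^bsub>A\<^esub> c \<odot>\<^bsub>A\<^esub> z \<in> I"
        using x cz by (simp add: A.one_smult_mult a_minus_def A.smult_r_distr A.smult_r_minus)
      then show ?thesis using x cz A.quotient_eq_iff_same_a_r_cos assms(2) by blast
    qed
    moreover have "z \<in> I +>\<^bsub>A\<^esub> z" using cz by (simp add: I.a_rcos_self)
    ultimately show ?thesis unfolding quot_algebra_simps by blast
  qed
  have add: "I +>\<^bsub>A\<^esub> (x \<oplus>\<^bsub>A\<^esub> y) = (I +>\<^bsub>A\<^esub> x) \<oplus>\<^bsub>quot_algebra A I\<^esub> (I +>\<^bsub>A\<^esub> y)"
    if "x \<in> carrier A" "y \<in> carrier A" for x y using that by (simp add: quot_algebra_simps I.a_rcos_sum)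
  have mult: "I +>\<^bsub>A\<^esub> (x \<otimes>\<^bsub>A\<^esub> y) = (I +>\<^bsub>A\<^esub> x) \<otimes>\<^bsub>quot_algebra A I\<^esub> (I +>\<^bsub>A\<^esub> y)"
    if "x \<in> carrier A" "y \<in> carrier A" for x y using that by (simp add: quot_algebra_simps I.rcoset_mult_add)
  show im: "(\<lambda>z. I +>\<^bsub>A\<^esub> z) ` carrier A = carrier (quot_algebra A I)"
    by (auto simp: quot_algebra_simps A_RCOSETS_def')
  show 0: "I +>\<^bsub>A\<^esub> z = \<zero>\<^bsub>quot_algebra A I\<^esub> \<longleftrightarrow> z \<in> I" if "z \<in> carrier A" for z
    using that I.a_rcos_self[of z] A.M.a_coset_join2[of z I] I.a_subgroup
    by (auto simp: quot_algebra_simps I.a_rcos_const)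
  show "assoc_algebra F (quot_algebra A I)"
    by (rule assoc_algebra_image[OF assms(1) im add mult sm])
      (use 0[of "\<zero>\<^bsub>A\<^esub>"] I.zero_closed in \<open>simp_all add: quot_algebra_simps(4)\<close>)
  show "(\<lambda>z. I +>\<^bsub>A\<^esub> z) \<in> alg_hom F A (quot_algebra A I)"
  proof (rule alg_homI)
    show "I +>\<^bsub>A\<^esub> z \<in> carrier (quot_algebra A I)" if "z \<in> carrier A" for z
      using that unfolding im[symmetric] by (rule imageI)
    show "I +>\<^bsub>A\<^esub> \<one>\<^bsub>A\<^esub> = \<one>\<^bsub>quot_algebra A I\<^esub>" by (rule quot_algebra_simps(4)[symmetric])
  qed (fact add mult sm)+
qed

text \<open>The conditions on \<open>a\<close> and \<open>\<sigma>\<close> say that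
  \<open>x^d - a\<close> is central in \<open>D[x; \<sigma>]\<close>. The ideal \<open>I\<close> is
  left abstract: it contains this element and consists of left multiples of it. That fits both the
  generated two-sided ideal of a skew polynomial ring and the principal ideal of
  \<open>UP F\<close>.\<close>

locale skew_quotient = skew_poly F D \<sigma> P
  for F :: "('f, 'z) ring_scheme" and D :: "('f, 'a, 'm) module_scheme" and \<sigma>
    and P :: "('f, nat => 'a, 'k) module_scheme" +
  fixes d :: nat and a :: 'a and I
  assumes d: "0 < d" and a: "a \<in> carrier D"
    and a_fixed: "\<sigma> a = a" and a_comm: "\<And>u. u \<in> carrier D ==> a \<otimes>\<^bsub>D\<^esub> u = u \<otimes>\<^bsub>D\<^esub> a"
    and order: "\<And>u. u \<in> carrier D ==> (\<sigma> ^^ d) u = u"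
    and ideal: "ideal I P"
    and gen: "skew_monom D \<one>\<^bsub>D\<^esub> d \<ominus>\<^bsub>P\<^esub> skew_monom D a 0 \<in> I"
    and cyclic: "\<And>p. p \<in> I ==> \<exists>q\<in>carrier P. p = q \<otimes>\<^bsub>P\<^esub> (skew_monom D \<one>\<^bsub>D\<^esub> d \<ominus>\<^bsub>P\<^esub> skew_monom D a 0)"
begin

abbreviation "Q \<equiv> quot_algebra P I"
abbreviation proj where "proj p \<equiv> I +>\<^bsub>P\<^esub> p"

sublocale Q: assoc_algebra F Q by (rule quot_algebra(1)[OF algebra_P ideal])
sublocale proj: alg_homomorphism F P Q proj
  by unfold_locales (rule quot_algebra(2)[OF algebra_P ideal])

lemma pow_a [simp]: "(\<sigma> ^^ k) a = a" by (induction k) (simp_all add: a_fixed)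

lemma proj_eq: "p \<in> up D ==> q \<in> up D ==> p \<ominus>\<^bsub>P\<^esub> q \<in> I ==> proj p = proj q"
  using P.quotient_eq_iff_same_a_r_cos[OF ideal] carrier_P by blast

lemma proj_rel: "skew_rel F D Q (\<lambda>u. proj (monom u 0)) (proj (monom \<one>\<^bsub>D\<^esub> (Suc 0))) \<sigma> d a"
proof (intro skew_rel.intro skew_rel_axioms.intro)
  show "(\<lambda>u. proj (monom u 0)) \<in> alg_hom F D Q"
    using alg_hom_comp[OF monom_hom proj.hom] .
  show "proj (monom \<one>\<^bsub>D\<^esub> (Suc 0)) \<in> carrier Q" by (simp add: carrier_P)
  show "proj (monom \<one>\<^bsub>D\<^esub> (Suc 0)) \<otimes>\<^bsub>Q\<^esub> proj (monom u 0) = proj (monom (\<sigma> u) 0) \<otimes>\<^bsub>Q\<^esub> proj (monom \<one>\<^bsub>D\<^esub> (Suc 0))"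
    if u: "u \<in> carrier D" for u
    using u sp_closed[of u 1] by (simp add: monom_monom carrier_P del: proj.hom_simps(2) sp_closed add: proj.hom_simps(2)[symmetric])
  have "proj (monom \<one>\<^bsub>D\<^esub> d) = proj (monom a 0)"
    by (rule proj_eq) (simp_all add: gen a)
  then show "proj (monom \<one>\<^bsub>D\<^esub> (Suc 0)) [^]\<^bsub>Q\<^esub> d = proj (monom a 0)"
    using proj.pow[of "monom \<one>\<^bsub>D\<^esub> (Suc 0)" d] by (simp add: carrier_P monom_pow del: proj.pow)
qed (use sigma d a D.assoc_algebra_axioms Q.assoc_algebra_axioms in auto)

sublocale R: skew_rel F D Q "\<lambda>u. proj (monom u 0)" "proj (monom \<one>\<^bsub>D\<^esub> (Suc 0))" \<sigma> d a
  by (rule proj_rel)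

lemma proj_mono: "u \<in> carrier D ==> proj (monom u 0) \<otimes>\<^bsub>Q\<^esub> proj (monom \<one>\<^bsub>D\<^esub> (Suc 0)) [^]\<^bsub>Q\<^esub> k = proj (monom u k)"
  using proj.hom_simps(2)[of "monom u 0" "monom \<one>\<^bsub>D\<^esub> k"] proj.pow[of "monom \<one>\<^bsub>D\<^esub> (Suc 0)" k]
  by (simp add: carrier_P monom_pow monom_monom del: proj.hom_simps proj.pow)

lemma proj_monom_expand: "u \<in> carrier D ==> \<exists>v\<in>{..<d} \<rightarrow> carrier D. proj (monom u k) = R.expand v"
proof (induction k arbitrary: u rule: less_induct)
  case (less k)
  show ?case
  proof (cases "k < d")
    case True
    then show ?thesis
      using less.prems R.expand_single[of u k] proj_mono[of u k]
      by (intro bexI[of _ "\<lambda>i. if i = k then u else \<zero>\<^bsub>D\<^esub>"]) auto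
  next
    case False
    then have "proj (monom u 0) \<otimes>\<^bsub>Q\<^esub> proj (monom \<one>\<^bsub>D\<^esub> (Suc 0)) [^]\<^bsub>Q\<^esub> k =
        proj (monom (u \<otimes>\<^bsub>D\<^esub> a) 0) \<otimes>\<^bsub>Q\<^esub> proj (monom \<one>\<^bsub>D\<^esub> (Suc 0)) [^]\<^bsub>Q\<^esub> (k - d)"
      using less.prems by (intro R.mono_reduce) auto
    then have "proj (monom u k) = proj (monom (u \<otimes>\<^bsub>D\<^esub> a) (k - d))"
      by (simp only: proj_mono less.prems a D.m_closed)
    then show ?thesis using less False d a by simp
  qed
qed

lemma proj_expand: "p \<in> up D ==> \<exists>v\<in>{..<d} \<rightarrow> carrier D. proj p = R.expand v"
proof (induction p rule: up_induct)
  case (monom u k)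
  then show ?case by (rule proj_monom_expand)
next
  case (add p q)
  then obtain u v where uv: "u \<in> {..<d} \<rightarrow> carrier D" "v \<in> {..<d} \<rightarrow> carrier D"
    and "proj p = R.expand u" "proj q = R.expand v" by blast
  then have "proj (p \<oplus>\<^bsub>P\<^esub> q) = R.expand (\<lambda>k. u k \<oplus>\<^bsub>D\<^esub> v k)"
    using add by (subst R.expand_add) (simp_all add: carrier_P)
  moreover have "(\<lambda>k. u k \<oplus>\<^bsub>D\<^esub> v k) \<in> {..<d} \<rightarrow> carrier D" using uv by (auto simp: Pi_iff)
  ultimately show ?case by blast
qed

lemma mult_gen:
  assumes "q \<in> up D"
  shows "(q \<otimes>\<^bsub>P\<^esub> (monom \<one>\<^bsub>D\<^esub> d \<ominus>\<^bsub>P\<^esub> monom a 0)) k = (if d \<le> k then q (k - d) else \<zero>\<^bsub>D\<^esub>) \<oplus>\<^bsub>D\<^esub> q k \<otimes>\<^bsub>D\<^esub> (\<ominus>\<^bsub>D\<^esub> a)"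
proof -
  have "\<ominus>\<^bsub>P\<^esub> monom a 0 = monom (\<ominus>\<^bsub>D\<^esub> a) 0"
    using alg_homomorphism.neg[of F D P "\<lambda>u. monom u 0" a] monom_hom a
    by (simp add: alg_homomorphism_def alg_homomorphism_axioms_def D.assoc_algebra_axioms algebra_P)
  then have "q \<otimes>\<^bsub>P\<^esub> (monom \<one>\<^bsub>D\<^esub> d \<ominus>\<^bsub>P\<^esub> monom a 0) = q \<otimes>\<^bsub>P\<^esub> monom \<one>\<^bsub>D\<^esub> d \<oplus>\<^bsub>P\<^esub> q \<otimes>\<^bsub>P\<^esub> monom (\<ominus>\<^bsub>D\<^esub> a) 0"
    using assms a by (simp add: a_minus_def P.r_distr carrier_P)
  also have "\<dots> = (\<lambda>i. (q \<otimes>\<^bsub>P\<^esub> monom \<one>\<^bsub>D\<^esub> d) i \<oplus>\<^bsub>D\<^esub> (q \<otimes>\<^bsub>P\<^esub> monom (\<ominus>\<^bsub>D\<^esub> a) 0) i)"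
    using assms a by (intro add_P) auto
  finally show ?thesis using assms a by (simp add: mult_monom)
qed

text \<open>A nonzero multiple of \<open>x^d - a\<close> has degree at least d: the coefficient of
  \<open>x^(i+d)\<close> in the product is \<open>q_i - q_(i+d) a\<close>, so vanishing of all of
  them propagates from the top of \<open>q\<close> downwards. This takes the place of division with
  remainder and gives independence of the first d powers in the quotient.\<close>

lemma gen_multiple_zero:
  assumes q: "q \<in> up D" and z: "\<And>k. d \<le> k ==> (q \<otimes>\<^bsub>P\<^esub> (monom \<one>\<^bsub>D\<^esub> d \<ominus>\<^bsub>P\<^esub> monom a 0)) k = \<zero>\<^bsub>D\<^esub>"
  shows "q = \<zero>\<^bsub>P\<^esub>"
proof -
  obtain N where N: "\<And>i. N < i ==> q i = \<zero>\<^bsub>D\<^esub>" using upE[OF q] by metis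
  have *: "q i = \<zero>\<^bsub>D\<^esub>" if "Suc N - n \<le> i" for n i
    using that
  proof (induction n arbitrary: i)
    case 0 then show ?case using N by simp
  next
    case (Suc n)
    have "q (i + d) = \<zero>\<^bsub>D\<^esub>" using Suc d by (intro Suc.IH) auto
    moreover have "(if d \<le> i + d then q (i + d - d) else \<zero>\<^bsub>D\<^esub>) \<oplus>\<^bsub>D\<^esub> q (i + d) \<otimes>\<^bsub>D\<^esub> (\<ominus>\<^bsub>D\<^esub> a) = \<zero>\<^bsub>D\<^esub>"
      using z[of "i + d"] unfolding mult_gen[OF q] by simp
    ultimately show ?case using q a by simp
  qed
  have "q i = \<zero>\<^bsub>D\<^esub>" for i using *[of "Suc N" i] by simp
  then show ?thesis by (auto simp: zero_P)
qed

lemma skew_pres: "skew_pres F D Q (\<lambda>u. proj (monom u 0)) (proj (monom \<one>\<^bsub>D\<^esub> (Suc 0))) \<sigma> d a"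
proof (intro skew_pres.intro skew_pres_axioms.intro proj_rel)
  fix z assume "z \<in> carrier Q"
  then have "z \<in> proj ` up D"
    using quot_algebra(3)[OF algebra_P ideal] by (simp add: carrier_P)
  then obtain p where "p \<in> up D" "z = proj p" by blast
  then show "\<exists>u\<in>{..<d} \<rightarrow> carrier D. z = R.expand u" using proj_expand by auto
next
  fix u k assume u: "u \<in> {..<d} \<rightarrow> carrier D" and 0: "R.expand u = \<zero>\<^bsub>Q\<^esub>" and k: "k < d"
  define p where "p = (\<lambda>k. if k < d then u k else \<zero>\<^bsub>D\<^esub>)"
  have p: "p \<in> up D" using u by (intro upI[where N = d]) (auto simp: p_def)
  have "R.expand u = (\<Oplus>\<^bsub>Q\<^esub>k\<in>{..<d}. proj (monom (u k) k))"
    unfolding R.expand_def using u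
    by (intro Q.M.finsum_cong') (auto simp: proj_mono Pi_iff carrier_P)
  also have "\<dots> = proj (\<Oplus>\<^bsub>P\<^esub>k\<in>{..<d}. monom (u k) k)"
    using u by (subst proj.finsum) (auto simp: carrier_P Pi_iff)
  also have "\<dots> = proj p" using u by (simp add: finsum_monom p_def)
  finally have "p \<in> I" using quot_algebra(4)[OF algebra_P ideal, of p] 0 p carrier_P by simp
  then obtain q where q: "q \<in> up D" "p = q \<otimes>\<^bsub>P\<^esub> (monom \<one>\<^bsub>D\<^esub> d \<ominus>\<^bsub>P\<^esub> monom a 0)"
    using cyclic carrier_P by auto
  then have "q = \<zero>\<^bsub>P\<^esub>" by (intro gen_multiple_zero) (auto simp flip: q(2) simp: p_def)
  then have "p k = \<zero>\<^bsub>D\<^esub>" using q a mult_gen[of q k] by (simp add: zero_P zero_up)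
  then show "u k = \<zero>\<^bsub>D\<^esub>" using k by (simp add: p_def)
qed

end

text \<open>Centrality of \<open>w\<close> turns \<open>(q w) p\<close> into \<open>(q p) w\<close>,
  so left multiples absorb factors on either side.\<close>

lemma (in ring) central_multiples_ideal:
  assumes w: "w \<in> carrier R" and comm: "\<And>p. p \<in> carrier R ==> w \<otimes> p = p \<otimes> w"
  shows "ideal {q \<otimes> w |q. q \<in> carrier R} R" (is "ideal ?J _")
proof (rule idealI)
  show "subgroup ?J (add_monoid R)"
  proof (rule add.subgroupI)
    show "?J \<noteq> {}" by blast
    fix z assume "z \<in> ?J"
    then obtain q where q: "q \<in> carrier R" "z = q \<otimes> w" by blast
    then have "\<ominus> z = (\<ominus> q) \<otimes> w" using w by (simp add: l_minus)
    then show "\<ominus> z \<in> ?J" using q by blast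
    fix z' assume "z' \<in> ?J"
    then obtain q' where q': "q' \<in> carrier R" "z' = q' \<otimes> w" by blast
    then have "z \<oplus> z' = (q \<oplus> q') \<otimes> w" using w q by (simp add: l_distr)
    then show "z \<oplus> z' \<in> ?J" using q q' by blast
  qed (use w in auto)
  fix z p assume z: "z \<in> ?J" and p: "p \<in> carrier R"
  then obtain q where q: "q \<in> carrier R" "z = q \<otimes> w" by auto
  have "p \<otimes> z = (p \<otimes> q) \<otimes> w" "z \<otimes> p = (q \<otimes> p) \<otimes> w"
    using p q w comm[OF p] by (simp_all add: m_assoc)
  then show "p \<otimes> z \<in> ?J" "z \<otimes> p \<in> ?J" using p q by blast+
qed (rule ring_axioms)

text \<open>Since \<open>x^d - a\<close> is central, the two-sided ideal that it generates is
  contained in its set of left multiples; this is the bridge from \<open>genideal\<close> to the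
  hypotheses of \<open>skew_quotient\<close>.\<close>

lemma skew_quot_pres:
  fixes D :: "('f, 'a, 'm) module_scheme"
  assumes "assoc_algebra F D" "\<sigma> \<in> alg_hom F D D" "0 < d" "a \<in> carrier D" "\<sigma> a = a"
    and a_comm: "\<And>u. u \<in> carrier D ==> a \<otimes>\<^bsub>D\<^esub> u = u \<otimes>\<^bsub>D\<^esub> a"
    and order: "\<And>u. u \<in> carrier D ==> (\<sigma> ^^ d) u = u"
  shows "skew_pres F D (skew_quot D \<sigma> d a) (skew_const D \<sigma> d a) (skew_gen D \<sigma> d a) \<sigma> d a"
proof -
  interpret D: assoc_algebra F D by fact
  interpret P: skew_poly F D \<sigma> "skew_UP D \<sigma>"
    by (unfold_locales) (use assms in \<open>auto simp: skew_UP_def\<close>)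
  let ?P = "skew_UP D \<sigma>"
  let ?w = "skew_monom D \<one>\<^bsub>D\<^esub> d \<ominus>\<^bsub>?P\<^esub> skew_monom D a 0"
  have w: "?w \<in> carrier ?P" using assms by (intro P.P.minus_closed) (auto simp: P.carrier_P)
  have pow_a: "(\<sigma> ^^ k) a = a" for k by (induction k) (simp_all add: assms)
  have comm: "?w \<otimes>\<^bsub>?P\<^esub> p = p \<otimes>\<^bsub>?P\<^esub> ?w" if p: "p \<in> carrier ?P" for p
  proof -
    have "P.monom \<one>\<^bsub>D\<^esub> d \<otimes>\<^bsub>?P\<^esub> p = p \<otimes>\<^bsub>?P\<^esub> P.monom \<one>\<^bsub>D\<^esub> d" "P.monom a 0 \<otimes>\<^bsub>?P\<^esub> p = p \<otimes>\<^bsub>?P\<^esub> P.monom a 0"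
      using p assms pow_a by (auto simp: P.carrier_P P.mult_monom P.monom_mult fun_eq_iff)
    moreover have "P.monom \<one>\<^bsub>D\<^esub> d \<in> carrier ?P" "P.monom a 0 \<in> carrier ?P"
      using assms by (simp_all add: P.carrier_P)
    ultimately show ?thesis
      using p by (simp add: a_minus_def P.P.l_distr P.P.r_distr P.P.l_minus P.P.r_minus)
  qed
  note multiples = P.P.central_multiples_ideal[OF w comm]
  have "?w = \<one>\<^bsub>?P\<^esub> \<otimes>\<^bsub>?P\<^esub> ?w" using w by (rule P.P.l_one[symmetric])
  then have "Idl\<^bsub>?P\<^esub> {?w} \<subseteq> {q \<otimes>\<^bsub>?P\<^esub> ?w |q. q \<in> carrier ?P}"
    by (intro P.P.genideal_minimal[OF multiples]) blast+
  then have sub: "skew_ideal D \<sigma> d a \<subseteq> {q \<otimes>\<^bsub>?P\<^esub> ?w |q. q \<in> carrier ?P}" unfolding skew_ideal_def .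
  interpret skew_quotient F D \<sigma> ?P d a "skew_ideal D \<sigma> d a"
  proof (intro skew_quotient.intro skew_quotient_axioms.intro P.skew_poly_axioms)
    show "ideal (skew_ideal D \<sigma> d a) ?P"
      unfolding skew_ideal_def by (rule P.P.genideal_ideal) (use w in simp)
    show "?w \<in> skew_ideal D \<sigma> d a"
      unfolding skew_ideal_def by (rule P.P.genideal_self'[OF w])
    show "\<exists>q\<in>carrier ?P. p = q \<otimes>\<^bsub>?P\<^esub> ?w" if "p \<in> skew_ideal D \<sigma> d a" for p
      using that sub by blast
  qed (fact assms)+
  show ?thesis
    using skew_pres by (simp add: skew_quot_def skew_const_def[abs_def] skew_gen_def One_nat_def)
qed

section \<open>Commutative polynomials as skew polynomials with trivial twist\<close>

lemma finsum_self_algebra: "finsum (self_algebra F) = finsum F"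
  by (simp add: finsum_def finprod_def self_algebra_def ring.defs module.defs fun_eq_iff)

lemma up_self_algebra: "up (self_algebra F) = up F"
  by (simp add: up_def bound_def)

lemma funpow_ident: "((\<lambda>x. x) ^^ i) x = x"
  by (induction i) auto

text \<open>Allows the coset of a constant polynomial to be replaced by the corresponding multiple
  of the identity, the form in which scalars are written everywhere else.\<close>

lemma skew_pres_cong:
  assumes "skew_pres F D A f y \<sigma> d a" and fg: "\<And>u. u \<in> carrier D ==> f u = g u"
  shows "skew_pres F D A g y \<sigma> d a"
proof -
  interpret skew_pres F D A f y \<sigma> d a by fact
  have "skew_rel F D A g y \<sigma> d a"
  proof (intro skew_rel.intro skew_rel_axioms.intro D.assoc_algebra_axioms A.assoc_algebra_axioms sigma y a d)
    show "g \<in> alg_hom F D A" by (rule alg_homI) (simp_all flip: fg)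
    show "y \<otimes>\<^bsub>A\<^esub> g u = g (\<sigma> u) \<otimes>\<^bsub>A\<^esub> y" if "u \<in> carrier D" for u using rel[OF that] that by (simp flip: fg)
    show "y [^]\<^bsub>A\<^esub> d = g a" using pow by (simp flip: fg)
  qed
  then interpret B: skew_rel F D A g y \<sigma> d a .
  have eq: "B.expand u = expand u" if "u \<in> {..<d} \<rightarrow> carrier D" for u
    unfolding B.expand_def expand_def using that by (intro A.M.finsum_cong') (auto simp: Pi_iff fg[symmetric])
  show ?thesis
  proof (intro skew_pres.intro skew_pres_axioms.intro B.skew_rel_axioms)
    show "\<exists>u\<in>{..<d} \<rightarrow> carrier D. z = B.expand u" if "z \<in> carrier A" for z
      using span[OF that] eq by auto
    show "u k = \<zero>\<^bsub>D\<^esub>" if "u \<in> {..<d} \<rightarrow> carrier D" "B.expand u = \<zero>\<^bsub>A\<^esub>" "k < d" for u k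
      using indep[of u k] that eq by simp
  qed
qed

lemma UP_skew_poly:
  fixes F :: "('f, 'z) ring_scheme"
  assumes "cring F"
  shows "skew_poly F (self_algebra F) (\<lambda>x. x) (UP F)"
proof (intro skew_poly.intro skew_poly_axioms.intro assoc_algebra_self assms)
  show "(\<lambda>x. x) \<in> alg_hom F (self_algebra F) (self_algebra F)" by (rule alg_homI) auto
  show "carrier (UP F) = up (self_algebra F)" by (simp add: up_self_algebra UP_def)
  show "\<one>\<^bsub>UP F\<^esub> = (\<lambda>i. if i = 0 then \<one>\<^bsub>self_algebra F\<^esub> else \<zero>\<^bsub>self_algebra F\<^esub>)"
    "\<zero>\<^bsub>UP F\<^esub> = (\<lambda>i. \<zero>\<^bsub>self_algebra F\<^esub>)" unfolding self_algebra_simps by (simp_all add: UP_def)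
next
  fix p q assume "p \<in> up (self_algebra F)" "q \<in> up (self_algebra F)"
  then have pq: "p \<in> up F" "q \<in> up F" by (simp_all add: up_self_algebra)
  show "p \<otimes>\<^bsub>UP F\<^esub> q = (\<lambda>k. \<Oplus>\<^bsub>self_algebra F\<^esub>i\<in>{..k}. p i \<otimes>\<^bsub>self_algebra F\<^esub> ((\<lambda>x. x) ^^ i) (q (k - i)))"
    unfolding finsum_self_algebra self_algebra_simps funpow_ident using pq by (simp add: UP_def)
  show "p \<oplus>\<^bsub>UP F\<^esub> q = (\<lambda>i. p i \<oplus>\<^bsub>self_algebra F\<^esub> q i)"
    unfolding self_algebra_simps using pq by (simp add: UP_def)
next
  fix c p assume "c \<in> carrier F" "p \<in> up (self_algebra F)"
  then show "c \<odot>\<^bsub>UP F\<^esub> p = (\<lambda>i. c \<odot>\<^bsub>self_algebra F\<^esub> p i)"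
    unfolding self_algebra_simps up_self_algebra by (simp add: UP_def)
qed

lemma UP_monom_eq: "u \<in> carrier F ==> up_ring.monom (UP F) u k = skew_monom (self_algebra F) u k"
  unfolding skew_monom_def self_algebra_simps by (simp add: UP_def)

text \<open>The case \<open>D = F\<close> with identity twist. The presentation comes from
  \<open>skew_quotient\<close>; commutativity is inherited from \<open>UP F\<close> through
  representatives.\<close>

lemma kummer_pres:
  fixes F :: "('f, 'z) ring_scheme"
  assumes "cring F" "0 < n" "s \<in> carrier F"
  shows "cring (kummer_algebra F n s)"
    and "skew_pres F (self_algebra F) (kummer_algebra F n s)
      (\<lambda>u. u \<odot>\<^bsub>kummer_algebra F n s\<^esub> \<one>\<^bsub>kummer_algebra F n s\<^esub>) (kummer_gen F n s) (\<lambda>x. x) n s"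
proof -
  interpret F: cring F by fact
  interpret D: assoc_algebra F "self_algebra F" by (rule assoc_algebra_self) fact
  interpret UP: UP_cring F "UP F" by unfold_locales simp
  interpret P: skew_poly F "self_algebra F" "\<lambda>x. x" "UP F"
    by (rule UP_skew_poly[OF assms(1)])
  note mon = UP_monom_eq[of _ F]
  let ?w = "skew_monom (self_algebra F) \<one>\<^bsub>F\<^esub> n \<ominus>\<^bsub>UP F\<^esub> skew_monom (self_algebra F) s 0"
  have w: "?w \<in> carrier (UP F)"
    using assms by (intro UP.P.minus_closed) (auto simp: P.carrier_P)
  have I: "kummer_ideal F n s = PIdl\<^bsub>UP F\<^esub> ?w" using assms by (simp add: kummer_ideal_def mon)
  have ideal: "ideal (kummer_ideal F n s) (UP F)"
    unfolding I by (rule UP.P.cgenideal_ideal[OF w])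
  interpret Q: skew_quotient F "self_algebra F" "\<lambda>x. x" "UP F" n s "kummer_ideal F n s"
  proof (intro skew_quotient.intro skew_quotient_axioms.intro P.skew_poly_axioms ideal)
    show "skew_monom (self_algebra F) \<one>\<^bsub>self_algebra F\<^esub> n \<ominus>\<^bsub>UP F\<^esub> skew_monom (self_algebra F) s 0 \<in> kummer_ideal F n s"
      unfolding I self_algebra_simps by (rule UP.P.cgenideal_self[OF w])
    fix p assume "p \<in> kummer_ideal F n s"
    then show "\<exists>q\<in>carrier (UP F). p = q \<otimes>\<^bsub>UP F\<^esub> (skew_monom (self_algebra F) \<one>\<^bsub>self_algebra F\<^esub> n \<ominus>\<^bsub>UP F\<^esub> skew_monom (self_algebra F) s 0)"
      unfolding I cgenideal_def self_algebra_simps by blast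
  next
    show "s \<otimes>\<^bsub>self_algebra F\<^esub> u = u \<otimes>\<^bsub>self_algebra F\<^esub> s" if "u \<in> carrier (self_algebra F)" for u
      using that assms(3) unfolding self_algebra_simps by (rule F.m_comm[rotated])
  qed (use assms in \<open>simp_all add: funpow_ident\<close>)
  show "cring (kummer_algebra F n s)"
  proof -
    have "V \<otimes>\<^bsub>Q.Q\<^esub> W = W \<otimes>\<^bsub>Q.Q\<^esub> V" if VW: "V \<in> carrier Q.Q" "W \<in> carrier Q.Q" for V W
    proof -
      obtain v w where "v \<in> carrier (UP F)" "w \<in> carrier (UP F)" "V = Q.proj v" "W = Q.proj w"
        using VW unfolding quot_algebra(3)[OF P.algebra_P ideal, symmetric] by blast
      then show ?thesis using Q.proj.hom_simps(2) UP.P.m_comm by metis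
    qed
    then show ?thesis unfolding kummer_algebra_def
      by (intro cring.intro Q.Q.ring_axioms comm_monoid.intro comm_monoid_axioms.intro Q.Q.monoid_axioms)
  qed
  have hom: "(\<lambda>u. Q.proj (P.monom u 0)) \<in> alg_hom F (self_algebra F) Q.Q"
    by (rule Q.R.f)
  have "skew_pres F (self_algebra F) Q.Q (\<lambda>u. u \<odot>\<^bsub>Q.Q\<^esub> \<one>\<^bsub>Q.Q\<^esub>) (Q.proj (P.monom \<one>\<^bsub>self_algebra F\<^esub> (Suc 0))) (\<lambda>x. x) n s"
  proof (rule skew_pres_cong[OF Q.skew_pres])
    fix u assume "u \<in> carrier (self_algebra F)"
    then show "Q.proj (P.monom u 0) = u \<odot>\<^bsub>Q.Q\<^esub> \<one>\<^bsub>Q.Q\<^esub>"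
      using alg_homD(5)[OF hom, of u "\<one>\<^bsub>F\<^esub>"] alg_homD(4)[OF hom] by simp
  qed
  then show "skew_pres F (self_algebra F) (kummer_algebra F n s)
      (\<lambda>u. u \<odot>\<^bsub>kummer_algebra F n s\<^esub> \<one>\<^bsub>kummer_algebra F n s\<^esub>) (kummer_gen F n s) (\<lambda>x. x) n s"
    unfolding kummer_algebra_def kummer_gen_def mon[OF F.one_closed] One_nat_def self_algebra_simps .
qed

section \<open>Roots of unity and idempotents\<close>

lemma (in abelian_monoid) finsum_swap:
  assumes "finite I" "finite J" "\<And>i j. i \<in> I ==> j \<in> J ==> f i j \<in> carrier G"
  shows "(\<Oplus>i\<in>I. \<Oplus>j\<in>J. f i j) = (\<Oplus>j\<in>J. \<Oplus>i\<in>I. f i j)"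
  using assms(1,3)
proof (induction I)
  case empty then show ?case by simp
next
  case (insert i I)
  have "(\<Oplus>j\<in>J. \<Oplus>i\<in>insert i I. f i j) = (\<Oplus>j\<in>J. f i j \<oplus> (\<Oplus>i\<in>I. f i j))"
    by (rule finsum_cong') (use insert in \<open>auto simp: Pi_iff\<close>)
  also have "\<dots> = (\<Oplus>j\<in>J. f i j) \<oplus> (\<Oplus>j\<in>J. \<Oplus>i\<in>I. f i j)"
    by (rule finsum_addf) (use insert in \<open>auto simp: Pi_iff\<close>)
  finally show ?case using insert by (simp add: Pi_iff)
qed

lemma (in abelian_monoid) finsum_lessThan_Suc:
  fixes n :: nat
  assumes "\<And>i. i \<le> n ==> f i \<in> carrier G"
  shows "(\<Oplus>i\<in>{..<Suc n}. f i) = (\<Oplus>i\<in>{..<n}. f i) \<oplus> f n"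
  using assms by (simp add: lessThan_Suc Pi_iff a_comm)

lemma (in abelian_monoid) finsum_lessThan_shift:
  fixes n :: nat
  assumes "\<And>i. i \<le> n ==> f i \<in> carrier G"
  shows "(\<Oplus>i\<in>{..<Suc n}. f i) = f 0 \<oplus> (\<Oplus>i\<in>{..<n}. f (Suc i))"
  using assms
proof (induction n)
  case (Suc n)
  have "(\<Oplus>i\<in>{..<Suc (Suc n)}. f i) = f 0 \<oplus> (\<Oplus>i\<in>{..<n}. f (Suc i)) \<oplus> f (Suc n)"
    using Suc by (subst finsum_lessThan_Suc) auto
  also have "\<dots> = f 0 \<oplus> (\<Oplus>i\<in>{..<Suc n}. f (Suc i))"
    using Suc.prems by (simp add: finsum_lessThan_Suc a_assoc Pi_iff)
  finally show ?case .
qed (simp add: lessThan_Suc)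

text \<open>Adding \<open>f 0 = f m\<close> to either side gives the sum of \<open>f\<close> over
  \<open>0..m\<close>, and this term then cancels. It makes sums over powers of a root of unity
  invariant under multiplication by the root.\<close>

lemma (in abelian_group) finsum_cyclic_shift:
  fixes m :: nat
  assumes "\<And>i. f i \<in> carrier G" "f m = f 0"
  shows "(\<Oplus>i\<in>{..<m}. f (Suc i)) = (\<Oplus>i\<in>{..<m}. f i)"
proof -
  have "f 0 \<oplus> (\<Oplus>i\<in>{..<m}. f (Suc i)) = f 0 \<oplus> (\<Oplus>i\<in>{..<m}. f i)"
    using finsum_lessThan_shift[of m f] finsum_lessThan_Suc[of m f] assms by (simp add: a_comm)
  then show ?thesis using assms(1) by (simp add: Pi_iff)
qed

lemma (in field) inv_nonzero [simp]: "x \<in> carrier R ==> x \<noteq> \<zero> ==> inv x \<in> carrier R"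
  by (simp add: field_Units)

lemma (in field) inv_mult [simp]:
  "x \<in> carrier R ==> x \<noteq> \<zero> ==> x \<otimes> inv x = \<one>" "x \<in> carrier R ==> x \<noteq> \<zero> ==> inv x \<otimes> x = \<one>"
  by (simp_all add: field_Units)

lemma (in field) inv_neq_zero [simp]: "x \<in> carrier R ==> x \<noteq> \<zero> ==> inv x \<noteq> \<zero>"
  using inv_mult(1)[of x] by force

lemma (in field) pow_neq_zero [simp]: "x \<in> carrier R ==> x \<noteq> \<zero> ==> x [^] (k::nat) \<noteq> \<zero>"
  by (induction k) (auto simp: integral_iff)

lemma (in field) inv_pow_mult [simp]:
  assumes "x \<in> carrier R" "x \<noteq> \<zero>"
  shows "inv x [^] (k::nat) \<otimes> x [^] k = \<one>" "x [^] k \<otimes> inv x [^] k = \<one>"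
proof -
  show "inv x [^] k \<otimes> x [^] k = \<one>"
    using pow_mult_distrib[of "inv x" x k] assms by simp
  then show "x [^] k \<otimes> inv x [^] k = \<one>" using assms by (simp add: m_comm)
qed

text \<open>Powers of pairwise distinct scalars are linearly independent: subtracting \<open>l i\<^sub>0\<close> times the
  \<open>j\<close>-th relation from the next one removes the term with index \<open>i\<^sub>0\<close>.\<close>

lemma power_sums_zero:
  assumes "field F" "assoc_algebra F A" "finite I" "inj_on l I" "l \<in> I \<rightarrow> carrier F" "c \<in> I \<rightarrow> carrier A"
    and "\<And>j::nat. (\<Oplus>\<^bsub>A\<^esub>i\<in>I. (l i [^]\<^bsub>F\<^esub> j) \<odot>\<^bsub>A\<^esub> c i) = \<zero>\<^bsub>A\<^esub>"
  shows "\<forall>i\<in>I. c i = \<zero>\<^bsub>A\<^esub>"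
  using assms(3-)
proof (induction I arbitrary: c)
  case (insert k I)
  interpret F: field F by fact
  interpret A: assoc_algebra F A by fact
  define b where "b i = (l i \<ominus>\<^bsub>F\<^esub> l k) \<odot>\<^bsub>A\<^esub> c i" for i
  have l: "l k \<in> carrier F" "\<And>i. i \<in> I ==> l i \<in> carrier F"
    and c: "c k \<in> carrier A" "\<And>i. i \<in> I ==> c i \<in> carrier A"
    using insert.prems by auto
  have "\<forall>i\<in>I. b i = \<zero>\<^bsub>A\<^esub>"
  proof (rule insert.IH)
    fix j :: nat
    let ?T = "\<lambda>j i. (l i [^]\<^bsub>F\<^esub> j) \<odot>\<^bsub>A\<^esub> c i"
    have "\<zero>\<^bsub>A\<^esub> = (\<Oplus>\<^bsub>A\<^esub>i\<in>insert k I. ?T (Suc j) i) \<ominus>\<^bsub>A\<^esub> l k \<odot>\<^bsub>A\<^esub> (\<Oplus>\<^bsub>A\<^esub>i\<in>insert k I. ?T j i)"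
      unfolding insert.prems(4) using l by (simp add: a_minus_def)
    also have "l k \<odot>\<^bsub>A\<^esub> (\<Oplus>\<^bsub>A\<^esub>i\<in>insert k I. ?T j i) = (\<Oplus>\<^bsub>A\<^esub>i\<in>insert k I. l k \<odot>\<^bsub>A\<^esub> ?T j i)"
      using l c by (subst A.smult_finsum) (auto simp: Pi_iff)
    also have "(\<Oplus>\<^bsub>A\<^esub>i\<in>insert k I. ?T (Suc j) i) \<ominus>\<^bsub>A\<^esub> \<dots> = 
      (\<Oplus>\<^bsub>A\<^esub>i\<in>insert k I. ?T (Suc j) i) \<oplus>\<^bsub>A\<^esub> (\<ominus>\<^bsub>F\<^esub> \<one>\<^bsub>F\<^esub>) \<odot>\<^bsub>A\<^esub> (\<Oplus>\<^bsub>A\<^esub>i\<in>insert k I. l k \<odot>\<^bsub>A\<^esub> ?T j i)"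
      using l c by (simp add: A.smult_minus_one a_minus_def Pi_iff)
    also have "\<dots> = (\<Oplus>\<^bsub>A\<^esub>i\<in>insert k I. ?T (Suc j) i \<oplus>\<^bsub>A\<^esub> (\<ominus>\<^bsub>F\<^esub> \<one>\<^bsub>F\<^esub>) \<odot>\<^bsub>A\<^esub> (l k \<odot>\<^bsub>A\<^esub> ?T j i))"
      using l c insert.hyps by (subst A.smult_finsum) (auto simp: Pi_iff A.M.finsum_addf simp del: A.M.add.finprod_insert)
    also have "\<dots> = (\<Oplus>\<^bsub>A\<^esub>i\<in>insert k I. (l i [^]\<^bsub>F\<^esub> j) \<odot>\<^bsub>A\<^esub> b i)"
    proof (rule A.M.finsum_cong'[OF refl])
      fix i assume "i \<in> insert k I"
      then have i: "l i \<in> carrier F" "c i \<in> carrier A" using l c by auto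
      have "?T (Suc j) i \<oplus>\<^bsub>A\<^esub> (\<ominus>\<^bsub>F\<^esub> \<one>\<^bsub>F\<^esub>) \<odot>\<^bsub>A\<^esub> (l k \<odot>\<^bsub>A\<^esub> ?T j i) =
          (l i [^]\<^bsub>F\<^esub> Suc j \<oplus>\<^bsub>F\<^esub> (\<ominus>\<^bsub>F\<^esub> \<one>\<^bsub>F\<^esub>) \<otimes>\<^bsub>F\<^esub> (l k \<otimes>\<^bsub>F\<^esub> l i [^]\<^bsub>F\<^esub> j)) \<odot>\<^bsub>A\<^esub> c i"
        using i l by (simp add: A.smult_l_distr A.smult_assoc1 del: nat_pow_Suc)
      also have "l i [^]\<^bsub>F\<^esub> Suc j \<oplus>\<^bsub>F\<^esub> (\<ominus>\<^bsub>F\<^esub> \<one>\<^bsub>F\<^esub>) \<otimes>\<^bsub>F\<^esub> (l k \<otimes>\<^bsub>F\<^esub> l i [^]\<^bsub>F\<^esub> j) =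
          l i [^]\<^bsub>F\<^esub> j \<otimes>\<^bsub>F\<^esub> (l i \<ominus>\<^bsub>F\<^esub> l k)"
        using i l by (simp add: a_minus_def F.r_distr F.l_minus F.r_minus F.m_comm)
      finally show "?T (Suc j) i \<oplus>\<^bsub>A\<^esub> (\<ominus>\<^bsub>F\<^esub> \<one>\<^bsub>F\<^esub>) \<odot>\<^bsub>A\<^esub> (l k \<odot>\<^bsub>A\<^esub> ?T j i) = (l i [^]\<^bsub>F\<^esub> j) \<odot>\<^bsub>A\<^esub> b i"
        using i l by (simp add: b_def A.smult_assoc1)
    qed (use l c b_def in auto)
    also have "\<dots> = (\<Oplus>\<^bsub>A\<^esub>i\<in>I. (l i [^]\<^bsub>F\<^esub> j) \<odot>\<^bsub>A\<^esub> b i)"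
      using insert.hyps l c by (simp add: Pi_iff b_def a_minus_def F.r_neg)
    finally show "(\<Oplus>\<^bsub>A\<^esub>i\<in>I. (l i [^]\<^bsub>F\<^esub> j) \<odot>\<^bsub>A\<^esub> b i) = \<zero>\<^bsub>A\<^esub>" by simp
  qed (use insert.prems l c in \<open>auto simp: b_def inj_on_insert\<close>)
  have 0: "c i = \<zero>\<^bsub>A\<^esub>" if i: "i \<in> I" for i
  proof -
    have ne: "l i \<ominus>\<^bsub>F\<^esub> l k \<noteq> \<zero>\<^bsub>F\<^esub>"
      using insert.prems(1) insert.hyps i l by (metis F.r_right_minus_eq image_eqI inj_on_insert insert_Diff_single insert_absorb Diff_insert_absorb)
    have "c i = (inv\<^bsub>F\<^esub> (l i \<ominus>\<^bsub>F\<^esub> l k) \<otimes>\<^bsub>F\<^esub> (l i \<ominus>\<^bsub>F\<^esub> l k)) \<odot>\<^bsub>A\<^esub> c i"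
      using ne i l c by simp
    also have "\<dots> = inv\<^bsub>F\<^esub> (l i \<ominus>\<^bsub>F\<^esub> l k) \<odot>\<^bsub>A\<^esub> b i"
      unfolding b_def by (rule A.smult_assoc1) (use ne i l c in auto)
    also have "\<dots> = \<zero>\<^bsub>A\<^esub>" using \<open>\<forall>i\<in>I. b i = \<zero>\<^bsub>A\<^esub>\<close> i ne l by simp
    finally show ?thesis .
  qed
  \<comment> \<open>The relation with exponent 0 is the plain sum of the \<open>c i\<close>; once
    the other terms are gone it isolates \<open>c k\<close>.\<close>
  have "(\<Oplus>\<^bsub>A\<^esub>i\<in>insert k I. c i) = \<zero>\<^bsub>A\<^esub>"
  proof -
    have "(\<Oplus>\<^bsub>A\<^esub>i\<in>insert k I. c i) = (\<Oplus>\<^bsub>A\<^esub>i\<in>insert k I. (l i [^]\<^bsub>F\<^esub> (0::nat)) \<odot>\<^bsub>A\<^esub> c i)"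
      by (rule A.M.finsum_cong') (use c in auto)
    then show ?thesis using insert.prems(4)[of 0] by simp
  qed
  moreover have "(\<Oplus>\<^bsub>A\<^esub>i\<in>insert k I. c i) = c k \<oplus>\<^bsub>A\<^esub> (\<Oplus>\<^bsub>A\<^esub>i\<in>I. c i)"
    using insert.hyps c by (subst A.M.finsum_insert) auto
  moreover have "(\<Oplus>\<^bsub>A\<^esub>i\<in>I. c i) = \<zero>\<^bsub>A\<^esub>"
    using A.M.finsum_cong'[of I I "\<lambda>_. \<zero>\<^bsub>A\<^esub>" c] 0 by simp
  ultimately show ?case using 0 c by simp
qed simp

locale root_of_unity = field F for F :: "('f, 'z) ring_scheme" (structure) +
  fixes m :: nat and \<zeta> :: 'f
  assumes prim: "primitive_root_of_unity F m \<zeta>" and m: "0 < m"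
begin

lemma root [simp]: "\<zeta> \<in> carrier F" "\<zeta> [^] m = \<one>"
  using prim by (simp_all add: primitive_root_of_unity_def)

lemma root_nz [simp]: "\<zeta> \<noteq> \<zero>"
  using root m nat_pow_zero[of m] by (metis neq0_conv one_not_zero)

lemma root_pow_mod: "\<zeta> [^] k = \<zeta> [^] (k mod m)"
proof -
  have "\<zeta> [^] k = \<zeta> [^] (m * (k div m) + k mod m)" by simp
  also have "\<dots> = (\<zeta> [^] m) [^] (k div m) \<otimes> \<zeta> [^] (k mod m)"
    by (simp only: nat_pow_mult[symmetric] nat_pow_pow[symmetric] root(1) nat_pow_closed)
  finally show ?thesis by simp
qed

lemma root_pow_eq_one: "\<zeta> [^] k = \<one> \<longleftrightarrow> m dvd k"
proof
  assume "\<zeta> [^] k = \<one>"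
  then have "\<zeta> [^] (k mod m) = \<one>" using root_pow_mod by simp
  then show "m dvd k" using prim m unfolding primitive_root_of_unity_def
    by (metis dvd_eq_mod_eq_0 mod_less_divisor neq0_conv)
next
  assume "m dvd k"
  then show "\<zeta> [^] k = \<one>" using root_pow_mod[of k] by simp
qed

lemma root_pow_inj:
  assumes "i < m" "j < m" "\<zeta> [^] i = \<zeta> [^] j"
  shows "i = j"
proof -
  have *: "i = j" if "i \<le> j" "i < m" "j < m" "\<zeta> [^] i = \<zeta> [^] j" for i j
  proof -
    have "\<zeta> [^] i \<otimes> \<zeta> [^] (j - i) = \<zeta> [^] i \<otimes> \<one>"
      using that nat_pow_mult[of \<zeta> i "j - i"] by simp
    then have "\<zeta> [^] (j - i) = \<one>" by (subst (asm) m_lcancel) auto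
    then have "m dvd j - i" by (simp add: root_pow_eq_one)
    then show ?thesis using that by (auto dest: dvd_imp_le)
  qed
  show ?thesis using *[of i j] *[of j i] assms by (cases "i \<le> j") auto
qed

text \<open>Multiplication by \<open>z\<close> permutes the terms cyclically, hence
  \<open>(z - 1) S = 0\<close> for the sum \<open>S\<close>.\<close>

lemma geometric_sum_zero:
  assumes "z \<in> carrier F" "z [^] m = \<one>" "z \<noteq> \<one>"
  shows "(\<Oplus>k\<in>{..<m}. z [^] k) = \<zero>"
proof -
  let ?S = "\<Oplus>k\<in>{..<m}. z [^] k"
  have S: "?S \<in> carrier F" using assms(1) by (intro finsum_closed) auto
  have "z \<otimes> ?S = (\<Oplus>k\<in>{..<m}. z [^] Suc k)"
    using assms(1) by (subst finsum_rdistr) (auto intro!: finsum_cong' simp: m_comm)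
  also have "\<dots> = ?S"
    using assms by (intro finsum_cyclic_shift) auto
  finally have "(z \<ominus> \<one>) \<otimes> ?S = \<zero>" using assms(1) S by (simp add: a_minus_def l_distr l_minus r_neg)
  moreover have "z \<ominus> \<one> \<noteq> \<zero>" using assms by simp
  ultimately show ?thesis using assms(1) S integral by blast
qed

text \<open>The integer \<open>m\<close> as an element of F; its inverse normalises the idempotents
  below.\<close>

definition num where "num = (\<Oplus>k\<in>{..<m}. \<one>)"

lemma num_closed [simp]: "num \<in> carrier F" by (simp add: num_def)

text \<open>If \<open>m\<close> vanished in F, all power sums of the m distinct powers of
  \<open>\<zeta>\<close> would vanish: the j-th one is a geometric sum, zero when
  \<open>\<zeta>^j\<close> differs from 1 and equal to \<open>m\<close> otherwise. Then
  \<open>power_sums_zero\<close>, with all coefficients 1, would give 1 = 0. So a primitive m-th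
  root keeps the characteristic away from the divisors of m.\<close>

lemma num_nz [simp]: "num \<noteq> \<zero>"
proof
  assume 0: "num = \<zero>"
  have "(\<Oplus>i\<in>{..<m}. ((\<zeta> [^] i) [^] j) \<otimes> \<one>) = \<zero>" for j :: nat
  proof -
    have "(\<Oplus>i\<in>{..<m}. ((\<zeta> [^] i) [^] j) \<otimes> \<one>) = (\<Oplus>i\<in>{..<m}. (\<zeta> [^] j) [^] i)"
      by (rule finsum_cong') (auto simp: nat_pow_pow mult.commute)
    also have "\<dots> = \<zero>"
    proof (cases "\<zeta> [^] j = \<one>")
      case True
      then show ?thesis using 0 by (simp add: num_def)
    next
      case False
      moreover have "(\<zeta> [^] j) [^] m = (\<zeta> [^] m) [^] j"
        by (simp only: nat_pow_pow root(1) mult.commute)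
      ultimately show ?thesis by (intro geometric_sum_zero) auto
    qed
    finally show ?thesis .
  qed
  then have "\<forall>i\<in>{..<m}. \<one> = \<zero>"
    using power_sums_zero[OF field_axioms assoc_algebra_self[OF is_cring], of "{..<m}" "\<lambda>i. \<zeta> [^] i" "\<lambda>_. \<one>"]
      root_pow_inj by (auto simp: finsum_self_algebra inj_on_def)
  then show False using m by auto
qed

lemma root_of_unity_div:
  assumes "k dvd m" "0 < k"
  shows "root_of_unity F k (\<zeta> [^] (m div k))"
proof (unfold_locales, unfold primitive_root_of_unity_def, intro conjI allI impI)
  show "(\<zeta> [^] (m div k)) [^] k = \<one>" using assms by (simp add: nat_pow_pow)
  fix i assume "0 < i \<and> i < k"
  moreover have "m dvd m div k * i \<longleftrightarrow> k dvd i"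
    using assms m by (metis dvd_div_mult_self dvd_mult_cancel_left dvd_mult_div_cancel mult.commute nat_mult_dvd_cancel_disj neq0_conv div_eq_0_iff dvd_imp_le not_le)
  ultimately show "(\<zeta> [^] (m div k)) [^] i \<noteq> \<one>"
    by (simp add: nat_pow_pow root_pow_eq_one nat_dvd_not_less)
qed (use assms in auto)

lemma root_of_unity_inv: "root_of_unity F m (inv \<zeta>)"
proof (unfold_locales, unfold primitive_root_of_unity_def, intro conjI allI impI)
  have "inv \<zeta> [^] k = \<one> \<longleftrightarrow> \<zeta> [^] k = \<one>" for k :: nat
    using inv_pow_mult[of \<zeta> k] by (metis l_one r_one nat_pow_closed inv_nonzero root(1) root_nz)
  then show "inv \<zeta> [^] m = \<one>" "\<And>k. 0 < k \<and> k < m ==> inv \<zeta> [^] k \<noteq> \<one>"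
    using prim by (auto simp: primitive_root_of_unity_def)
qed (use m in auto)

end

locale root_idempotents = root_of_unity F m \<zeta> + A: assoc_algebra F A
  for F :: "('f, 'z) ring_scheme" (structure) and m \<zeta> and A :: "('f, 'a, 'k) module_scheme" +
  fixes g :: 'a
  assumes g [simp]: "g \<in> carrier A" and g_pow: "g [^]\<^bsub>A\<^esub> m = \<one>\<^bsub>A\<^esub>"
begin

text \<open>The discrete Fourier transform of the powers of \<open>g\<close>: the projection onto
  the eigenspace on which \<open>g\<close> acts as \<open>\<zeta>^j\<close>. It makes sense for
  every natural number \<open>j\<close> and is periodic in it.\<close>

definition idem :: "nat => 'a" where
  "idem j = inv num \<odot>\<^bsub>A\<^esub> (\<Oplus>\<^bsub>A\<^esub>k\<in>{..<m}. (inv \<zeta> [^] (j * k)) \<odot>\<^bsub>A\<^esub> g [^]\<^bsub>A\<^esub> k)"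

lemma idem_closed [simp]: "idem j \<in> carrier A"
  by (simp add: idem_def Pi_iff)

lemma inv_pow_shift: "\<zeta> [^] i \<otimes> inv \<zeta> [^] (i + k) = inv \<zeta> [^] (k::nat)"
proof -
  have "inv \<zeta> [^] (i + k) = inv \<zeta> [^] i \<otimes> inv \<zeta> [^] k" by (simp add: nat_pow_mult)
  then show ?thesis by (simp add: m_assoc[symmetric])
qed

text \<open>Multiplication by \<open>g\<close> shifts the defining sum by one place, which is
  harmless because \<open>g^m = 1\<close>; matching the coefficients after the shift costs the
  factor \<open>\<zeta>^j\<close>.\<close>

lemma g_idem: "g \<otimes>\<^bsub>A\<^esub> idem j = (\<zeta> [^] j) \<odot>\<^bsub>A\<^esub> idem j"
proof -
  have *: "(inv \<zeta> [^] (j * k)) \<odot>\<^bsub>A\<^esub> (g \<otimes>\<^bsub>A\<^esub> g [^]\<^bsub>A\<^esub> k) = (\<zeta> [^] j) \<odot>\<^bsub>A\<^esub> ((inv \<zeta> [^] (j * Suc k)) \<odot>\<^bsub>A\<^esub> g [^]\<^bsub>A\<^esub> Suc k)" for k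
  proof -
    have "(\<zeta> [^] j) \<odot>\<^bsub>A\<^esub> ((inv \<zeta> [^] (j * Suc k)) \<odot>\<^bsub>A\<^esub> g [^]\<^bsub>A\<^esub> Suc k) = (\<zeta> [^] j \<otimes> inv \<zeta> [^] (j + j * k)) \<odot>\<^bsub>A\<^esub> g [^]\<^bsub>A\<^esub> Suc k"
      by (subst A.smult_assoc1) (auto simp del: A.nat_pow_Suc)
    then show ?thesis by (simp only: inv_pow_shift A.nat_pow_Suc2 g)
  qed
  have "inv \<zeta> [^] (j * m) = (inv \<zeta> [^] m) [^] j" by (simp add: nat_pow_pow mult.commute)
  also have "inv \<zeta> [^] m = \<one>" using inv_pow_mult(1)[of \<zeta> m] by simp
  finally have per: "inv \<zeta> [^] (j * m) = \<one>" by simp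
  have "g \<otimes>\<^bsub>A\<^esub> (\<Oplus>\<^bsub>A\<^esub>k\<in>{..<m}. (inv \<zeta> [^] (j * k)) \<odot>\<^bsub>A\<^esub> g [^]\<^bsub>A\<^esub> k) =
      (\<Oplus>\<^bsub>A\<^esub>k\<in>{..<m}. (\<zeta> [^] j) \<odot>\<^bsub>A\<^esub> ((inv \<zeta> [^] (j * Suc k)) \<odot>\<^bsub>A\<^esub> g [^]\<^bsub>A\<^esub> Suc k))"
    by (subst A.mult_finsum)
      (auto simp: A.smult_mult_right * simp del: A.nat_pow_Suc intro!: A.M.finsum_cong')
  also have "\<dots> = (\<zeta> [^] j) \<odot>\<^bsub>A\<^esub> (\<Oplus>\<^bsub>A\<^esub>k\<in>{..<m}. (inv \<zeta> [^] (j * Suc k)) \<odot>\<^bsub>A\<^esub> g [^]\<^bsub>A\<^esub> Suc k)"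
    by (subst A.smult_finsum) (auto simp del: A.nat_pow_Suc)
  also have "(\<Oplus>\<^bsub>A\<^esub>k\<in>{..<m}. (inv \<zeta> [^] (j * Suc k)) \<odot>\<^bsub>A\<^esub> g [^]\<^bsub>A\<^esub> Suc k) =
      (\<Oplus>\<^bsub>A\<^esub>k\<in>{..<m}. (inv \<zeta> [^] (j * k)) \<odot>\<^bsub>A\<^esub> g [^]\<^bsub>A\<^esub> k)"
    by (rule A.M.finsum_cyclic_shift[where f = "\<lambda>k. (inv \<zeta> [^] (j * k)) \<odot>\<^bsub>A\<^esub> g [^]\<^bsub>A\<^esub> k"])
      (auto simp: per g_pow)
  finally show ?thesis
    by (simp add: idem_def A.smult_mult_right A.smult_assoc1[symmetric] m_comm Pi_iff)
qed

lemma g_pow_idem: "g [^]\<^bsub>A\<^esub> k \<otimes>\<^bsub>A\<^esub> idem j = (\<zeta> [^] (j * k)) \<odot>\<^bsub>A\<^esub> idem j"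
proof (induction k)
  case (Suc k)
  have "g [^]\<^bsub>A\<^esub> Suc k \<otimes>\<^bsub>A\<^esub> idem j = g [^]\<^bsub>A\<^esub> k \<otimes>\<^bsub>A\<^esub> ((\<zeta> [^] j) \<odot>\<^bsub>A\<^esub> idem j)"
    by (simp add: A.m_assoc g_idem)
  also have "\<dots> = (\<zeta> [^] j \<otimes> \<zeta> [^] (j * k)) \<odot>\<^bsub>A\<^esub> idem j"
    by (simp add: A.smult_mult_right Suc A.smult_assoc1)
  finally show ?case by (simp add: nat_pow_mult)
qed simp

text \<open>By \<open>g_pow_idem\<close> the powers of \<open>g\<close> inside \<open>idem i\<close>
  act on \<open>idem j\<close> as scalars, leaving the geometric sum of
  \<open>\<zeta>^(j-i)\<close>, which is \<open>num\<close> or zero.\<close>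

lemma idem_mult:
  assumes "i < m" "j < m"
  shows "idem i \<otimes>\<^bsub>A\<^esub> idem j = (if i = j then idem j else \<zero>\<^bsub>A\<^esub>)"
proof -
  let ?z = "inv \<zeta> [^] i \<otimes> \<zeta> [^] j"
  have z: "inv \<zeta> [^] (i * k) \<otimes> \<zeta> [^] (j * k) = ?z [^] k" for k
    by (simp add: pow_mult_distrib m_comm nat_pow_pow)
  have "idem i \<otimes>\<^bsub>A\<^esub> idem j = inv num \<odot>\<^bsub>A\<^esub> (\<Oplus>\<^bsub>A\<^esub>k\<in>{..<m}. (inv \<zeta> [^] (i * k)) \<odot>\<^bsub>A\<^esub> (g [^]\<^bsub>A\<^esub> k \<otimes>\<^bsub>A\<^esub> idem j))"
    unfolding idem_def[of i] by (simp add: A.smult_mult_left A.finsum_mult Pi_iff)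
  also have "(\<Oplus>\<^bsub>A\<^esub>k\<in>{..<m}. (inv \<zeta> [^] (i * k)) \<odot>\<^bsub>A\<^esub> (g [^]\<^bsub>A\<^esub> k \<otimes>\<^bsub>A\<^esub> idem j)) = (\<Oplus>\<^bsub>A\<^esub>k\<in>{..<m}. (?z [^] k) \<odot>\<^bsub>A\<^esub> idem j)"
    by (rule A.M.finsum_cong') (auto simp: g_pow_idem A.smult_assoc1[symmetric] z)
  also have "\<dots> = (\<Oplus>k\<in>{..<m}. ?z [^] k) \<odot>\<^bsub>A\<^esub> idem j"
    by (subst A.finsum_smult) auto
  finally have *: "idem i \<otimes>\<^bsub>A\<^esub> idem j = inv num \<odot>\<^bsub>A\<^esub> ((\<Oplus>k\<in>{..<m}. ?z [^] k) \<odot>\<^bsub>A\<^esub> idem j)" .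
  show ?thesis
  proof (cases "i = j")
    case True
    then have "(\<Oplus>k\<in>{..<m}. ?z [^] k) = num" by (simp add: num_def)
    then show ?thesis using * True by (simp add: A.smult_assoc1[symmetric])
  next
    case False
    have "?z \<noteq> \<one>"
    proof
      assume "?z = \<one>"
      then have "\<zeta> [^] i \<otimes> inv \<zeta> [^] i \<otimes> \<zeta> [^] j = \<zeta> [^] i" by (simp add: m_assoc del: inv_pow_mult)
      then show False using root_pow_inj[of i j] assms False by simp
    qed
    moreover have "?z [^] m = \<one>"
    proof -
      have "inv \<zeta> [^] m = \<one>" using inv_pow_mult(1)[of \<zeta> m] by simp
      then have "inv \<zeta> [^] (i * m) = \<one>" "\<zeta> [^] (j * m) = \<one>"
        by (metis mult.commute nat_pow_one nat_pow_pow root root_nz inv_nonzero)+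
      then show ?thesis using z[of m] by simp
    qed
    ultimately show ?thesis using * False geometric_sum_zero[of ?z] by simp
  qed
qed

text \<open>Summing over \<open>j\<close> first, the coefficient of \<open>g^k\<close> is a
  geometric sum that vanishes for all \<open>k\<close> except 0, where it is
  \<open>num\<close>.\<close>

lemma idem_sum: "(\<Oplus>\<^bsub>A\<^esub>j\<in>{..<m}. idem j) = \<one>\<^bsub>A\<^esub>"
proof -
  let ?c = "\<lambda>j k. inv \<zeta> [^] (j * k)"
  have "(\<Oplus>\<^bsub>A\<^esub>j\<in>{..<m}. idem j) = inv num \<odot>\<^bsub>A\<^esub> (\<Oplus>\<^bsub>A\<^esub>j\<in>{..<m}. \<Oplus>\<^bsub>A\<^esub>k\<in>{..<m}. ?c j k \<odot>\<^bsub>A\<^esub> g [^]\<^bsub>A\<^esub> k)"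
    unfolding idem_def by (subst A.smult_finsum) (auto simp: Pi_iff)
  also have "(\<Oplus>\<^bsub>A\<^esub>j\<in>{..<m}. \<Oplus>\<^bsub>A\<^esub>k\<in>{..<m}. ?c j k \<odot>\<^bsub>A\<^esub> g [^]\<^bsub>A\<^esub> k) = (\<Oplus>\<^bsub>A\<^esub>k\<in>{..<m}. \<Oplus>\<^bsub>A\<^esub>j\<in>{..<m}. ?c j k \<odot>\<^bsub>A\<^esub> g [^]\<^bsub>A\<^esub> k)"
    by (rule A.M.finsum_swap) auto
  also have "\<dots> = (\<Oplus>\<^bsub>A\<^esub>k\<in>{..<m}. if k = 0 then num \<odot>\<^bsub>A\<^esub> \<one>\<^bsub>A\<^esub> else \<zero>\<^bsub>A\<^esub>)"
  proof (rule A.M.finsum_cong'[OF refl])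
    fix k assume k: "k \<in> {..<m}"
    interpret inv: root_of_unity F m "inv \<zeta>" by (rule root_of_unity_inv)
    have "(\<Oplus>\<^bsub>A\<^esub>j\<in>{..<m}. ?c j k \<odot>\<^bsub>A\<^esub> g [^]\<^bsub>A\<^esub> k) = (\<Oplus>j\<in>{..<m}. ?c j k) \<odot>\<^bsub>A\<^esub> g [^]\<^bsub>A\<^esub> k"
      by (subst A.finsum_smult) auto
    also have "(\<Oplus>j\<in>{..<m}. ?c j k) = (\<Oplus>j\<in>{..<m}. (inv \<zeta> [^] k) [^] j)"
      by (rule finsum_cong') (auto simp: nat_pow_pow mult.commute)
    also have "\<dots> = (if k = 0 then num else \<zero>)"
    proof (cases "k = 0")
      case False
      then have "inv \<zeta> [^] k \<noteq> \<one>" using inv.root_pow_eq_one[of k] k by (auto dest: dvd_imp_le)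
      moreover have "(inv \<zeta> [^] k) [^] m = \<one>"
        using inv.root by (metis mult.commute nat_pow_one nat_pow_pow)
      ultimately show ?thesis using False geometric_sum_zero by simp
    qed (simp add: num_def)
    finally show "(\<Oplus>\<^bsub>A\<^esub>j\<in>{..<m}. ?c j k \<odot>\<^bsub>A\<^esub> g [^]\<^bsub>A\<^esub> k) = (if k = 0 then num \<odot>\<^bsub>A\<^esub> \<one>\<^bsub>A\<^esub> else \<zero>\<^bsub>A\<^esub>)"
      by auto
  qed auto
  also have "\<dots> = num \<odot>\<^bsub>A\<^esub> \<one>\<^bsub>A\<^esub>" using m by (subst A.finsum_delta) auto
  finally show ?thesis by (simp add: A.smult_assoc1[symmetric])
qed

lemma idem_period: "idem (j + m) = idem j"
proof -
  have "inv \<zeta> [^] m = \<one>" using inv_pow_mult(1)[of \<zeta> m] by simp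
  then have "inv \<zeta> [^] (m * k) = \<one>" for k
    by (metis nat_pow_one nat_pow_pow root root_nz inv_nonzero)
  then have "inv \<zeta> [^] ((j + m) * k) = inv \<zeta> [^] (j * k)" for k
    by (simp add: add_mult_distrib nat_pow_mult[symmetric])
  then show ?thesis by (simp add: idem_def)
qed

text \<open>Moving \<open>t\<close> across \<open>g^k\<close> produces \<open>\<zeta>^k\<close>, and
  this is the quotient of the k-th coefficients of two consecutive idempotents.\<close>

lemma idem_twist:
  assumes t: "t \<in> carrier A" "t \<otimes>\<^bsub>A\<^esub> g = \<zeta> \<odot>\<^bsub>A\<^esub> (g \<otimes>\<^bsub>A\<^esub> t)"
  shows "t \<otimes>\<^bsub>A\<^esub> idem (Suc j) = idem j \<otimes>\<^bsub>A\<^esub> t"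
proof -
  have tk: "t \<otimes>\<^bsub>A\<^esub> g [^]\<^bsub>A\<^esub> k = (\<zeta> [^] k) \<odot>\<^bsub>A\<^esub> (g [^]\<^bsub>A\<^esub> k \<otimes>\<^bsub>A\<^esub> t)" for k :: nat
  proof (induction k)
    case (Suc k)
    have "t \<otimes>\<^bsub>A\<^esub> g [^]\<^bsub>A\<^esub> Suc k = (t \<otimes>\<^bsub>A\<^esub> g [^]\<^bsub>A\<^esub> k) \<otimes>\<^bsub>A\<^esub> g" using t by (simp add: A.m_assoc)
    also have "\<dots> = (\<zeta> [^] k) \<odot>\<^bsub>A\<^esub> (g [^]\<^bsub>A\<^esub> k \<otimes>\<^bsub>A\<^esub> (t \<otimes>\<^bsub>A\<^esub> g))"
      using t(1) by (simp add: Suc A.smult_mult_left A.m_assoc)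
    also have "\<dots> = (\<zeta> [^] k \<otimes> \<zeta>) \<odot>\<^bsub>A\<^esub> (g [^]\<^bsub>A\<^esub> k \<otimes>\<^bsub>A\<^esub> g \<otimes>\<^bsub>A\<^esub> t)"
      using t by (simp add: A.smult_mult_right A.smult_assoc1 A.m_assoc)
    finally show ?case by simp
  qed (use t in simp)
  have c: "inv \<zeta> [^] (k + j * k) \<otimes> \<zeta> [^] k = inv \<zeta> [^] (j * k)" for k
    using inv_pow_shift[of k "j * k"] by (simp add: m_comm)
  have "t \<otimes>\<^bsub>A\<^esub> idem (Suc j) = inv num \<odot>\<^bsub>A\<^esub> (\<Oplus>\<^bsub>A\<^esub>k\<in>{..<m}. (inv \<zeta> [^] (k + j * k)) \<odot>\<^bsub>A\<^esub> (t \<otimes>\<^bsub>A\<^esub> g [^]\<^bsub>A\<^esub> k))"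
    using t(1) by (simp add: idem_def A.smult_mult_right A.mult_finsum Pi_iff)
  also have "\<dots> = inv num \<odot>\<^bsub>A\<^esub> (\<Oplus>\<^bsub>A\<^esub>k\<in>{..<m}. (inv \<zeta> [^] (j * k)) \<odot>\<^bsub>A\<^esub> (g [^]\<^bsub>A\<^esub> k \<otimes>\<^bsub>A\<^esub> t))"
    using t(1) by (simp add: tk A.smult_assoc1[symmetric] c)
  also have "\<dots> = idem j \<otimes>\<^bsub>A\<^esub> t"
    using t(1) by (simp add: idem_def A.smult_mult_left A.finsum_mult Pi_iff)
  finally show ?thesis .
qed

end

text \<open>The idempotents of \<open>y\<close> replace the count of roots of
  \<open>X^m - 1\<close>: the element \<open>y - \<zeta>^j\<close> annihilates
  \<open>idem j\<close>. If it were nonzero for every \<open>j\<close>, all idempotents would vanish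
  in the domain, yet they sum to 1.\<close>

lemma (in root_of_unity) roots_of_unity_domain:
  assumes "assoc_algebra F K" "domain K" "y \<in> carrier K" "y [^]\<^bsub>K\<^esub> m = \<one>\<^bsub>K\<^esub>"
  shows "\<exists>j<m. y = (\<zeta> [^] j) \<odot>\<^bsub>K\<^esub> \<one>\<^bsub>K\<^esub>"
proof (rule ccontr)
  assume neg: "\<not> ?thesis"
  interpret K: domain K by fact
  interpret root_idempotents F m \<zeta> K y
    using assms by (simp add: root_idempotents_def root_idempotents_axioms_def root_of_unity_axioms)
  have "idem j = \<zero>\<^bsub>K\<^esub>" if "j < m" for j
  proof -
    have "(y \<ominus>\<^bsub>K\<^esub> (\<zeta> [^] j) \<odot>\<^bsub>K\<^esub> \<one>\<^bsub>K\<^esub>) \<otimes>\<^bsub>K\<^esub> idem j = \<zero>\<^bsub>K\<^esub>"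
      using assms(3) by (simp add: a_minus_def K.l_distr K.l_minus g_idem A.one_smult_mult K.r_neg)
    moreover have "y \<ominus>\<^bsub>K\<^esub> (\<zeta> [^] j) \<odot>\<^bsub>K\<^esub> \<one>\<^bsub>K\<^esub> \<noteq> \<zero>\<^bsub>K\<^esub>"
      using neg that assms(3) by auto
    ultimately show ?thesis using K.integral assms(3) by force
  qed
  then have "(\<Oplus>\<^bsub>K\<^esub>j\<in>{..<m}. idem j) = \<zero>\<^bsub>K\<^esub>"
    using K.finsum_cong'[of "{..<m}" "{..<m}" "\<lambda>_. \<zero>\<^bsub>K\<^esub>" idem] by simp
  then show False using idem_sum by simp
qed

section \<open>Matrix units\<close>

lemma mat_algebra_simps:
  "carrier (mat_algebra m B) = ({..<m} \<times> {..<m} \<rightarrow>\<^sub>E carrier B)"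
  "M \<otimes>\<^bsub>mat_algebra m B\<^esub> N = (\<lambda>(i, j)\<in>{..<m} \<times> {..<m}. \<Oplus>\<^bsub>B\<^esub>k\<in>{..<m}. M (i, k) \<otimes>\<^bsub>B\<^esub> N (k, j))"
  "\<one>\<^bsub>mat_algebra m B\<^esub> = (\<lambda>(i, j)\<in>{..<m} \<times> {..<m}. if i = j then \<one>\<^bsub>B\<^esub> else \<zero>\<^bsub>B\<^esub>)"
  "M \<oplus>\<^bsub>mat_algebra m B\<^esub> N = (\<lambda>(i, j)\<in>{..<m} \<times> {..<m}. M (i, j) \<oplus>\<^bsub>B\<^esub> N (i, j))"
  "c \<odot>\<^bsub>mat_algebra m B\<^esub> M = (\<lambda>(i, j)\<in>{..<m} \<times> {..<m}. c \<odot>\<^bsub>B\<^esub> M (i, j))"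
  by (simp_all add: mat_algebra_def)

text \<open>Of \<open>A\<close> only closure under the operations is asked, so that a matrix algebra
  may be inserted although its ring axioms have not been established.\<close>

lemma alg_iso_inverse:
  assumes h: "h \<in> alg_iso F A B"
    and cl: "\<And>x y. x \<in> carrier A ==> y \<in> carrier A ==> x \<otimes>\<^bsub>A\<^esub> y \<in> carrier A"
      "\<And>x y. x \<in> carrier A ==> y \<in> carrier A ==> x \<oplus>\<^bsub>A\<^esub> y \<in> carrier A"
      "\<And>c x. c \<in> carrier F ==> x \<in> carrier A ==> c \<odot>\<^bsub>A\<^esub> x \<in> carrier A" "\<one>\<^bsub>A\<^esub> \<in> carrier A"
  shows "inv_into (carrier A) h \<in> alg_iso F B A"
proof -
  let ?g = "inv_into (carrier A) h"
  note hom = alg_homD[OF alg_isoD(1)[OF h]]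
  note bij = alg_isoD(2)[OF h]
  have g: "?g y \<in> carrier A" "h (?g y) = y" if "y \<in> carrier B" for y
    using bij that by (auto simp: bij_betw_def inv_into_into f_inv_into_f)
  have gh: "?g (h x) = x" if "x \<in> carrier A" for x
    using bij that by (auto simp: bij_betw_def)
  have "?g \<in> alg_hom F B A"
  proof (rule alg_homI)
    fix x y assume xy: "x \<in> carrier B" "y \<in> carrier B"
    show "?g (x \<otimes>\<^bsub>B\<^esub> y) = ?g x \<otimes>\<^bsub>A\<^esub> ?g y"
      using gh[of "?g x \<otimes>\<^bsub>A\<^esub> ?g y"] xy by (simp add: g hom cl)
    show "?g (x \<oplus>\<^bsub>B\<^esub> y) = ?g x \<oplus>\<^bsub>A\<^esub> ?g y"
      using gh[of "?g x \<oplus>\<^bsub>A\<^esub> ?g y"] xy by (simp add: g hom cl)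
  next
    fix c x assume cx: "c \<in> carrier F" "x \<in> carrier B"
    show "?g (c \<odot>\<^bsub>B\<^esub> x) = c \<odot>\<^bsub>A\<^esub> ?g x"
      using gh[of "c \<odot>\<^bsub>A\<^esub> ?g x"] cx by (simp add: g hom cl)
  qed (use g gh[of "\<one>\<^bsub>A\<^esub>"] hom cl in auto)
  then show ?thesis using bij by (simp add: alg_iso_def bij_betw_inv_into)
qed

text \<open>The units commute with the image of \<open>B\<close>, which makes \<open>of_mat\<close>
  a homomorphism; it is injective because \<open>\<phi>\<close> is. Surjectivity is left open on
  purpose: with \<open>B\<close> the ground field the image is a proper subalgebra in general, and
  it appears below as a centralizer.\<close>

locale matrix_units = phi: alg_homomorphism F B A \<phi>
  for F :: "('f, 'z) ring_scheme" and B :: "('f, 'b, 'm) module_scheme"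
    and A :: "('f, 'a, 'k) module_scheme" (structure) and \<phi> +
  fixes m :: nat and E :: "nat => nat => 'a"
  assumes E_closed [simp]: "\<And>i j. E i j \<in> carrier A"
    and E_mult: "\<And>i j k l. \<lbrakk>i < m; j < m; k < m; l < m\<rbrakk> \<Longrightarrow>
      E i j \<otimes> E k l = (if j = k then E i l else \<zero>)"
    and E_sum: "(\<Oplus>i\<in>{..<m}. E i i) = \<one>"
    and E_comm: "\<And>b i j. \<lbrakk>b \<in> carrier B; i < m; j < m\<rbrakk> \<Longrightarrow> \<phi> b \<otimes> E i j = E i j \<otimes> \<phi> b"
    and inj: "inj_on \<phi> (carrier B)"
begin

definition of_mat :: "(nat \<times> nat => 'b) => 'a" where
  "of_mat M = (\<Oplus>i\<in>{..<m}. \<Oplus>j\<in>{..<m}. \<phi> (M (i, j)) \<otimes> E i j)"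

lemma entry_closed [simp]:
  "M \<in> carrier (mat_algebra m B) ==> i < m ==> j < m ==> M (i, j) \<in> carrier B"
  by (auto simp: mat_algebra_simps)

lemma mat_closed:
  "M \<in> carrier (mat_algebra m B) ==> N \<in> carrier (mat_algebra m B) ==> M \<otimes>\<^bsub>mat_algebra m B\<^esub> N \<in> carrier (mat_algebra m B)"
  "M \<in> carrier (mat_algebra m B) ==> N \<in> carrier (mat_algebra m B) ==> M \<oplus>\<^bsub>mat_algebra m B\<^esub> N \<in> carrier (mat_algebra m B)"
  "c \<in> carrier F ==> M \<in> carrier (mat_algebra m B) ==> c \<odot>\<^bsub>mat_algebra m B\<^esub> M \<in> carrier (mat_algebra m B)"
  "\<one>\<^bsub>mat_algebra m B\<^esub> \<in> carrier (mat_algebra m B)"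
proof -
  show "M \<otimes>\<^bsub>mat_algebra m B\<^esub> N \<in> carrier (mat_algebra m B)"
    if "M \<in> carrier (mat_algebra m B)" "N \<in> carrier (mat_algebra m B)"
    using entry_closed[OF that(1)] entry_closed[OF that(2)]
    unfolding mat_algebra_simps by (auto intro!: phi.A.M.finsum_closed)
  show "M \<oplus>\<^bsub>mat_algebra m B\<^esub> N \<in> carrier (mat_algebra m B)"
    if "M \<in> carrier (mat_algebra m B)" "N \<in> carrier (mat_algebra m B)"
    using entry_closed[OF that(1)] entry_closed[OF that(2)]
    unfolding mat_algebra_simps by auto
  show "c \<odot>\<^bsub>mat_algebra m B\<^esub> M \<in> carrier (mat_algebra m B)"
    if "c \<in> carrier F" "M \<in> carrier (mat_algebra m B)"
    using entry_closed[OF that(2)] that(1) unfolding mat_algebra_simps by auto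
  show "\<one>\<^bsub>mat_algebra m B\<^esub> \<in> carrier (mat_algebra m B)"
    unfolding mat_algebra_simps by auto
qed

lemma of_mat_closed [simp]: "M \<in> carrier (mat_algebra m B) ==> of_mat M \<in> carrier A"
  unfolding of_mat_def by (intro phi.B.M.finsum_closed Pi_I) auto

lemma E_left:
  assumes M: "M \<in> carrier (mat_algebra m B)" and i: "i < m"
  shows "E i i \<otimes> of_mat M = (\<Oplus>j\<in>{..<m}. \<phi> (M (i, j)) \<otimes> E i j)"
proof -
  have t: "E i i \<otimes> (\<phi> (M (k, j)) \<otimes> E k j) = (if k = i then \<phi> (M (i, j)) \<otimes> E i j else \<zero>)"
    if "k < m" "j < m" for k j
  proof -
    have "E i i \<otimes> (\<phi> (M (k, j)) \<otimes> E k j) = (E i i \<otimes> \<phi> (M (k, j))) \<otimes> E k j"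
      using M i that by (simp add: phi.B.m_assoc)
    also have "\<dots> = \<phi> (M (k, j)) \<otimes> (E i i \<otimes> E k j)"
      using M i that by (simp add: phi.B.m_assoc flip: E_comm)
    finally have "E i i \<otimes> (\<phi> (M (k, j)) \<otimes> E k j) = \<phi> (M (k, j)) \<otimes> (E i i \<otimes> E k j)" .
    then show ?thesis using M i that by (auto simp: E_mult)
  qed
  have "E i i \<otimes> of_mat M = (\<Oplus>k\<in>{..<m}. \<Oplus>j\<in>{..<m}. E i i \<otimes> (\<phi> (M (k, j)) \<otimes> E k j))"
    unfolding of_mat_def using M
    by (subst phi.B.mult_finsum) (auto simp: phi.B.mult_finsum Pi_iff intro!: phi.B.M.finsum_cong')
  also have "\<dots> = (\<Oplus>k\<in>{..<m}. if k = i then (\<Oplus>j\<in>{..<m}. \<phi> (M (i, j)) \<otimes> E i j) else \<zero>)"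
  proof (rule phi.B.M.finsum_cong'[OF refl])
    fix k assume k: "k \<in> {..<m}"
    have "(\<Oplus>j\<in>{..<m}. E i i \<otimes> (\<phi> (M (k, j)) \<otimes> E k j)) =
        (\<Oplus>j\<in>{..<m}. if k = i then \<phi> (M (i, j)) \<otimes> E i j else \<zero>)"
      using k M i by (intro phi.B.M.finsum_cong') (auto simp: t)
    then show "(\<Oplus>j\<in>{..<m}. E i i \<otimes> (\<phi> (M (k, j)) \<otimes> E k j)) =
        (if k = i then (\<Oplus>j\<in>{..<m}. \<phi> (M (i, j)) \<otimes> E i j) else \<zero>)" by simp
  qed (use M i in \<open>auto intro!: phi.B.M.finsum_closed\<close>)
  also have "\<dots> = (\<Oplus>j\<in>{..<m}. \<phi> (M (i, j)) \<otimes> E i j)"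
    using M i by (subst phi.B.finsum_delta) (auto intro!: phi.B.M.finsum_closed)
  finally show ?thesis .
qed

lemma E_right:
  assumes M: "M \<in> carrier (mat_algebra m B)" and j: "j < m"
  shows "of_mat M \<otimes> E j j = (\<Oplus>i\<in>{..<m}. \<phi> (M (i, j)) \<otimes> E i j)"
proof -
  have t: "(\<phi> (M (i, k)) \<otimes> E i k) \<otimes> E j j = (if k = j then \<phi> (M (i, j)) \<otimes> E i j else \<zero>)"
    if "k < m" "i < m" for k i
    using M j that by (simp add: phi.B.m_assoc E_mult)
  have "of_mat M \<otimes> E j j = (\<Oplus>i\<in>{..<m}. \<Oplus>k\<in>{..<m}. (\<phi> (M (i, k)) \<otimes> E i k) \<otimes> E j j)"
    unfolding of_mat_def using M
    by (subst phi.B.finsum_mult) (auto simp: phi.B.finsum_mult Pi_iff intro!: phi.B.M.finsum_cong')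
  also have "\<dots> = (\<Oplus>i\<in>{..<m}. \<phi> (M (i, j)) \<otimes> E i j)"
  proof (rule phi.B.M.finsum_cong'[OF refl])
    fix i assume i: "i \<in> {..<m}"
    have "(\<Oplus>k\<in>{..<m}. (\<phi> (M (i, k)) \<otimes> E i k) \<otimes> E j j) =
        (\<Oplus>k\<in>{..<m}. if k = j then \<phi> (M (i, j)) \<otimes> E i j else \<zero>)"
      using i M j by (intro phi.B.M.finsum_cong') (auto simp: t)
    then show "(\<Oplus>k\<in>{..<m}. (\<phi> (M (i, k)) \<otimes> E i k) \<otimes> E j j) = \<phi> (M (i, j)) \<otimes> E i j"
      using i M j by (simp add: phi.B.finsum_delta)
  qed (use M j in auto)
  finally show ?thesis .
qed

lemma E_both:
  assumes M: "M \<in> carrier (mat_algebra m B)" and i: "i < m" and j: "j < m"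
  shows "E i i \<otimes> of_mat M \<otimes> E j j = \<phi> (M (i, j)) \<otimes> E i j"
proof -
  have "E i i \<otimes> of_mat M \<otimes> E j j = (\<Oplus>k\<in>{..<m}. (\<phi> (M (i, k)) \<otimes> E i k) \<otimes> E j j)"
    unfolding E_left[OF M i] using M i j by (subst phi.B.finsum_mult) auto
  also have "\<dots> = (\<Oplus>k\<in>{..<m}. if k = j then \<phi> (M (i, j)) \<otimes> E i j else \<zero>)"
    using M i j by (intro phi.B.M.finsum_cong') (auto simp: phi.B.m_assoc E_mult)
  finally show ?thesis using M i j by (simp add: phi.B.finsum_delta)
qed

text \<open>The Peirce decomposition. By way of \<open>E_eqI\<close>, equations in \<open>A\<close>
  are checked one corner at a time, where \<open>E_both\<close> shows a single matrix entry.\<close>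

lemma E_decomp:
  assumes z: "z \<in> carrier A"
  shows "z = (\<Oplus>i\<in>{..<m}. \<Oplus>j\<in>{..<m}. E i i \<otimes> z \<otimes> E j j)"
proof -
  have "z = (\<Oplus>i\<in>{..<m}. E i i) \<otimes> z \<otimes> (\<Oplus>j\<in>{..<m}. E j j)" using z by (simp add: E_sum)
  also have "\<dots> = (\<Oplus>i\<in>{..<m}. E i i \<otimes> z) \<otimes> (\<Oplus>j\<in>{..<m}. E j j)"
    using z by (subst phi.B.finsum_mult) auto
  also have "\<dots> = (\<Oplus>i\<in>{..<m}. E i i \<otimes> z \<otimes> (\<Oplus>j\<in>{..<m}. E j j))"
    using z by (subst phi.B.finsum_mult) (auto intro!: phi.B.M.finsum_closed)
  also have "\<dots> = (\<Oplus>i\<in>{..<m}. \<Oplus>j\<in>{..<m}. E i i \<otimes> z \<otimes> E j j)"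
    using z by (intro phi.B.M.finsum_cong') (auto simp: phi.B.mult_finsum Pi_iff)
  finally show ?thesis .
qed

lemma E_eqI:
  assumes "z \<in> carrier A" "w \<in> carrier A"
    and "\<And>i j. i < m ==> j < m ==> E i i \<otimes> z \<otimes> E j j = E i i \<otimes> w \<otimes> E j j"
  shows "z = w"
proof -
  have "(\<Oplus>i\<in>{..<m}. \<Oplus>j\<in>{..<m}. E i i \<otimes> z \<otimes> E j j) = (\<Oplus>i\<in>{..<m}. \<Oplus>j\<in>{..<m}. E i i \<otimes> w \<otimes> E j j)"
    using assms by (intro phi.B.M.finsum_cong') (auto intro!: phi.B.M.finsum_closed)
  then show ?thesis using E_decomp assms by simp
qed

text \<open>One corner suffices to rebuild \<open>\<phi> b\<close>: multiplying it by
  \<open>E k i\<close> on the left and \<open>E j k\<close> on the right moves it to the k-th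
  diagonal place, and the sum over \<open>k\<close> is \<open>\<phi> b\<close>.\<close>

lemma E_cancel:
  assumes b: "b \<in> carrier B" "b' \<in> carrier B" and ij: "i < m" "j < m"
    and eq: "\<phi> b \<otimes> E i j = \<phi> b' \<otimes> E i j"
  shows "b = b'"
proof -
  have *: "\<phi> b = (\<Oplus>k\<in>{..<m}. E k i \<otimes> (\<phi> b \<otimes> E i j) \<otimes> E j k)" if b: "b \<in> carrier B" for b
  proof -
    have "\<phi> b = \<phi> b \<otimes> (\<Oplus>k\<in>{..<m}. E k k)" using b by (simp add: E_sum)
    also have "\<dots> = (\<Oplus>k\<in>{..<m}. \<phi> b \<otimes> E k k)" using b by (subst phi.B.mult_finsum) auto
    also have "\<dots> = (\<Oplus>k\<in>{..<m}. E k i \<otimes> (\<phi> b \<otimes> E i j) \<otimes> E j k)"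
    proof (rule phi.B.M.finsum_cong'[OF refl])
      fix k assume k: "k \<in> {..<m}"
      have "E k i \<otimes> (\<phi> b \<otimes> E i j) \<otimes> E j k = (E k i \<otimes> \<phi> b) \<otimes> E i j \<otimes> E j k"
        using b k ij by (simp add: phi.B.m_assoc)
      also have "\<dots> = \<phi> b \<otimes> (E k i \<otimes> E i j \<otimes> E j k)"
        using b k ij by (simp add: phi.B.m_assoc flip: E_comm)
      finally have "E k i \<otimes> (\<phi> b \<otimes> E i j) \<otimes> E j k = \<phi> b \<otimes> (E k i \<otimes> E i j \<otimes> E j k)" .
      then show "\<phi> b \<otimes> E k k = E k i \<otimes> (\<phi> b \<otimes> E i j) \<otimes> E j k"
        using k ij by (simp add: E_mult)
    qed (use b in auto)
    finally show ?thesis .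
  qed
  have "\<phi> b = \<phi> b'" using *[OF b(1)] *[OF b(2)] eq by simp
  then show ?thesis using inj b by (auto dest: inj_onD)
qed

lemma of_mat_hom: "of_mat \<in> alg_hom F (mat_algebra m B) A"
proof (rule alg_homI)
  fix M N assume M: "M \<in> carrier (mat_algebra m B)" and N: "N \<in> carrier (mat_algebra m B)"
  show "of_mat (M \<otimes>\<^bsub>mat_algebra m B\<^esub> N) = of_mat M \<otimes> of_mat N"
  proof (rule E_eqI)
    fix i j assume ij: "i < m" "j < m"
    have t: "(\<phi> (M (i, k)) \<otimes> E i k) \<otimes> (\<phi> (N (l, j)) \<otimes> E l j) =
        (if l = k then \<phi> (M (i, k) \<otimes>\<^bsub>B\<^esub> N (k, j)) \<otimes> E i j else \<zero>)" if kl: "k < m" "l < m" for k l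
    proof -
      have "(\<phi> (M (i, k)) \<otimes> E i k) \<otimes> (\<phi> (N (l, j)) \<otimes> E l j) =
          \<phi> (M (i, k)) \<otimes> (E i k \<otimes> \<phi> (N (l, j))) \<otimes> E l j"
        using M N ij kl by (simp add: phi.B.m_assoc)
      also have "\<dots> = \<phi> (M (i, k)) \<otimes> \<phi> (N (l, j)) \<otimes> (E i k \<otimes> E l j)"
        using M N ij kl by (simp add: phi.B.m_assoc flip: E_comm)
      finally show ?thesis using M N ij kl by (auto simp: E_mult)
    qed
    have "E i i \<otimes> (of_mat M \<otimes> of_mat N) \<otimes> E j j = (E i i \<otimes> of_mat M) \<otimes> (of_mat N \<otimes> E j j)"
      using M N by (simp add: phi.B.m_assoc)
    also have "\<dots> = (\<Oplus>k\<in>{..<m}. (\<phi> (M (i, k)) \<otimes> E i k) \<otimes> (\<Oplus>l\<in>{..<m}. \<phi> (N (l, j)) \<otimes> E l j))"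
      unfolding E_left[OF M ij(1)] E_right[OF N ij(2)] using M N ij
      by (subst phi.B.finsum_mult) (auto intro!: phi.B.M.finsum_closed)
    also have "\<dots> = (\<Oplus>k\<in>{..<m}. \<phi> (M (i, k) \<otimes>\<^bsub>B\<^esub> N (k, j)) \<otimes> E i j)"
    proof (rule phi.B.M.finsum_cong'[OF refl])
      fix k assume k: "k \<in> {..<m}"
      have "(\<phi> (M (i, k)) \<otimes> E i k) \<otimes> (\<Oplus>l\<in>{..<m}. \<phi> (N (l, j)) \<otimes> E l j) =
          (\<Oplus>l\<in>{..<m}. (\<phi> (M (i, k)) \<otimes> E i k) \<otimes> (\<phi> (N (l, j)) \<otimes> E l j))"
        using M N ij k by (subst phi.B.mult_finsum) auto
      also have "\<dots> = (\<Oplus>l\<in>{..<m}. if l = k then \<phi> (M (i, k) \<otimes>\<^bsub>B\<^esub> N (k, j)) \<otimes> E i j else \<zero>)"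
        using M N ij k by (intro phi.B.M.finsum_cong') (auto simp: t simp del: phi.hom_simps(2))
      finally show "(\<phi> (M (i, k)) \<otimes> E i k) \<otimes> (\<Oplus>l\<in>{..<m}. \<phi> (N (l, j)) \<otimes> E l j) =
          \<phi> (M (i, k) \<otimes>\<^bsub>B\<^esub> N (k, j)) \<otimes> E i j"
        using M N ij k by (simp add: phi.B.finsum_delta)
    qed (use M N ij in auto)
    also have "\<dots> = \<phi> ((M \<otimes>\<^bsub>mat_algebra m B\<^esub> N) (i, j)) \<otimes> E i j"
      using M N ij by (simp add: mat_algebra_simps(2) phi.B.finsum_mult Pi_iff)
    also have "\<dots> = E i i \<otimes> of_mat (M \<otimes>\<^bsub>mat_algebra m B\<^esub> N) \<otimes> E j j"
      using E_both[OF mat_closed(1)[OF M N] ij] by simp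
    finally show "E i i \<otimes> of_mat (M \<otimes>\<^bsub>mat_algebra m B\<^esub> N) \<otimes> E j j = E i i \<otimes> (of_mat M \<otimes> of_mat N) \<otimes> E j j"
      by simp
  qed (use M N mat_closed in auto)
  show "of_mat (M \<oplus>\<^bsub>mat_algebra m B\<^esub> N) = of_mat M \<oplus> of_mat N"
  proof (rule E_eqI)
    fix i j assume ij: "i < m" "j < m"
    have "E i i \<otimes> (of_mat M \<oplus> of_mat N) \<otimes> E j j =
        E i i \<otimes> of_mat M \<otimes> E j j \<oplus> E i i \<otimes> of_mat N \<otimes> E j j"
      using M N by (simp add: phi.B.l_distr phi.B.r_distr)
    then show "E i i \<otimes> of_mat (M \<oplus>\<^bsub>mat_algebra m B\<^esub> N) \<otimes> E j j = E i i \<otimes> (of_mat M \<oplus> of_mat N) \<otimes> E j j"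
      using E_both[OF M ij] E_both[OF N ij] E_both[OF mat_closed(2)[OF M N] ij] M N ij
      by (simp add: mat_algebra_simps(4) phi.B.l_distr)
  qed (use M N mat_closed in auto)
next
  fix c M assume c: "c \<in> carrier F" and M: "M \<in> carrier (mat_algebra m B)"
  show "of_mat (c \<odot>\<^bsub>mat_algebra m B\<^esub> M) = c \<odot> of_mat M"
  proof (rule E_eqI)
    fix i j assume ij: "i < m" "j < m"
    have "E i i \<otimes> (c \<odot> of_mat M) \<otimes> E j j = c \<odot> (E i i \<otimes> of_mat M \<otimes> E j j)"
      using c M by (simp add: phi.B.smult_mult_left phi.B.smult_mult_right)
    then show "E i i \<otimes> of_mat (c \<odot>\<^bsub>mat_algebra m B\<^esub> M) \<otimes> E j j = E i i \<otimes> (c \<odot> of_mat M) \<otimes> E j j"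
      using E_both[OF M ij] E_both[OF mat_closed(3)[OF c M] ij] c M ij
      by (simp add: mat_algebra_simps(5) phi.B.smult_mult_left)
  qed (use c M mat_closed in auto)
next
  show "of_mat \<one>\<^bsub>mat_algebra m B\<^esub> = \<one>"
  proof (rule E_eqI)
    fix i j assume ij: "i < m" "j < m"
    then show "E i i \<otimes> of_mat \<one>\<^bsub>mat_algebra m B\<^esub> \<otimes> E j j = E i i \<otimes> \<one> \<otimes> E j j"
      using E_both[OF mat_closed(4) ij] by (auto simp: mat_algebra_simps(3) E_mult)
  qed (use mat_closed in auto)
qed simp

lemma of_mat_inj: "inj_on of_mat (carrier (mat_algebra m B))"
proof (rule inj_onI)
  fix M N assume M: "M \<in> carrier (mat_algebra m B)" and N: "N \<in> carrier (mat_algebra m B)"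
    and eq: "of_mat M = of_mat N"
  have "M (i, j) = N (i, j)" if "i < m" "j < m" for i j
    using E_cancel[of "M (i, j)" "N (i, j)" i j] E_both[OF M that] E_both[OF N that] eq M N that by simp
  then show "M = N"
    using M N unfolding mat_algebra_simps by (intro PiE_ext[of M "{..<m} \<times> {..<m}" "\<lambda>_. carrier B" N]) auto
qed

text \<open>The entries of the matrix are chosen corner by corner, and the corners determine the
  element.\<close>

lemma in_image:
  assumes z: "z \<in> carrier A"
    and b: "\<And>i j. i < m ==> j < m ==> \<exists>b\<in>carrier B. E i i \<otimes> z \<otimes> E j j = \<phi> b \<otimes> E i j"
  shows "z \<in> of_mat ` carrier (mat_algebra m B)"
proof -
  define M where "M = (\<lambda>(i, j)\<in>{..<m} \<times> {..<m}. SOME b. b \<in> carrier B \<and> E i i \<otimes> z \<otimes> E j j = \<phi> b \<otimes> E i j)"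
  have M: "M (i, j) \<in> carrier B \<and> E i i \<otimes> z \<otimes> E j j = \<phi> (M (i, j)) \<otimes> E i j" if "i < m" "j < m" for i j
    using someI_ex[of "\<lambda>b. b \<in> carrier B \<and> E i i \<otimes> z \<otimes> E j j = \<phi> b \<otimes> E i j"] b[OF that] that
    unfolding M_def by auto
  have c: "M \<in> carrier (mat_algebra m B)"
    using M unfolding mat_algebra_simps by (auto simp: M_def)
  have "z = of_mat M"
  proof (rule E_eqI[OF z])
    show "E i i \<otimes> z \<otimes> E j j = E i i \<otimes> of_mat M \<otimes> E j j" if "i < m" "j < m" for i j
      using M[OF that] E_both[OF c that] by simp
  qed (use c in simp)
  then show ?thesis using c by blast
qed

lemma mat_isomorphic:
  assumes "S = of_mat ` carrier (mat_algebra m B)"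
  shows "alg_isomorphic F (A\<lparr>carrier := S\<rparr>) (mat_algebra m B)"
proof -
  have "of_mat \<in> alg_iso F (mat_algebra m B) (A\<lparr>carrier := S\<rparr>)"
  proof (rule alg_isoI)
    show "of_mat \<in> alg_hom F (mat_algebra m B) (A\<lparr>carrier := S\<rparr>)"
      by (rule alg_homI) (use alg_homD[OF of_mat_hom] assms in auto)
  qed (use of_mat_inj assms in auto)
  from alg_iso_inverse[OF this] show ?thesis
    using mat_closed unfolding alg_isomorphic_def by blast
qed

end

text \<open>A unit permuting orthogonal idempotents cyclically yields matrix units.\<close>

locale cyclic_idempotents = A: assoc_algebra F A
  for F :: "('f, 'z) ring_scheme" and A :: "('f, 'a, 'k) module_scheme" (structure) +
  fixes m :: nat and f :: "nat => 'a" and t s :: 'a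
  assumes m: "0 < m" and f_closed [simp]: "\<And>j. f j \<in> carrier A"
    and f_mult: "\<And>i j. i < m ==> j < m ==> f i \<otimes> f j = (if i = j then f j else \<zero>)"
    and f_sum: "(\<Oplus>j\<in>{..<m}. f j) = \<one>"
    and t [simp]: "t \<in> carrier A" and s [simp]: "s \<in> carrier A"
    and ts: "t \<otimes> s = \<one>" and st: "s \<otimes> t = \<one>"
    and twist: "\<And>j. Suc j < m ==> t \<otimes> f (Suc j) = f j \<otimes> t"
begin

definition unit :: "nat => nat => 'a" where
  "unit i j = s [^] i \<otimes> f 0 \<otimes> t [^] j"

lemma pow_ts: "t [^] k \<otimes> s [^] k = \<one>" and pow_st: "s [^] k \<otimes> t [^] k = \<one>" for k :: nat
proof (induction k)
  case (Suc k)
  have "t [^] Suc k \<otimes> s [^] Suc k = t [^] k \<otimes> (t \<otimes> s) \<otimes> s [^] k"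
    "s [^] Suc k \<otimes> t [^] Suc k = s [^] k \<otimes> (s \<otimes> t) \<otimes> t [^] k"
    by (simp_all only: A.nat_pow_Suc2[OF s] A.nat_pow_Suc2[OF t], simp_all only: A.nat_pow_Suc2[symmetric] t s A.m_assoc A.nat_pow_closed A.m_closed)
      (simp_all add: A.m_assoc A.nat_pow_Suc2[symmetric] del: A.nat_pow_Suc)
  then show "t [^] Suc k \<otimes> s [^] Suc k = \<one>" "s [^] Suc k \<otimes> t [^] Suc k = \<one>"
    using Suc ts st by simp_all
qed simp_all

lemma t_pow_f: "j < m ==> t [^] j \<otimes> f j = f 0 \<otimes> t [^] j"
proof (induction j)
  case (Suc j)
  have "t [^] Suc j \<otimes> f (Suc j) = t [^] j \<otimes> (t \<otimes> f (Suc j))" by (simp add: A.m_assoc)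
  also have "\<dots> = (t [^] j \<otimes> f j) \<otimes> t" using Suc.prems by (simp add: twist A.m_assoc)
  finally show ?case using Suc by (simp add: A.m_assoc)
qed simp

lemma f_s_pow: "j < m ==> f j \<otimes> s [^] j = s [^] j \<otimes> f 0"
proof -
  assume j: "j < m"
  have "f j \<otimes> s [^] j = (s [^] j \<otimes> t [^] j) \<otimes> f j \<otimes> s [^] j" by (simp add: pow_st)
  also have "\<dots> = s [^] j \<otimes> (t [^] j \<otimes> f j) \<otimes> s [^] j" by (simp add: A.m_assoc)
  also have "\<dots> = s [^] j \<otimes> f 0 \<otimes> (t [^] j \<otimes> s [^] j)" using j by (simp add: t_pow_f A.m_assoc)
  finally show ?thesis by (simp add: pow_ts)
qed

lemma unit_closed [simp]: "unit i j \<in> carrier A" by (simp add: unit_def)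

lemma unit_diag: "i < m ==> unit i i = f i"
  by (simp add: unit_def f_s_pow[symmetric] A.m_assoc pow_st)

text \<open>In the middle of the product, \<open>f 0 t^j s^k f 0\<close> equals
  \<open>t^j f_j f_k s^k\<close>, and orthogonality of \<open>f_j\<close> and \<open>f_k\<close>
  decides.\<close>

lemma unit_mult:
  assumes "i < m" "j < m" "k < m" "l < m"
  shows "unit i j \<otimes> unit k l = (if j = k then unit i l else \<zero>)"
proof -
  have "unit i j \<otimes> unit k l = s [^] i \<otimes> (f 0 \<otimes> t [^] j) \<otimes> (s [^] k \<otimes> f 0) \<otimes> t [^] l"
    by (simp add: unit_def A.m_assoc)
  also have "\<dots> = s [^] i \<otimes> t [^] j \<otimes> (f j \<otimes> f k) \<otimes> s [^] k \<otimes> t [^] l"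
    using assms by (simp add: t_pow_f[symmetric] f_s_pow[symmetric] A.m_assoc)
  also have "\<dots> = (if j = k then s [^] i \<otimes> (t [^] j \<otimes> f j) \<otimes> s [^] j \<otimes> t [^] l else \<zero>)"
    using assms by (simp add: f_mult A.m_assoc)
  also have "s [^] i \<otimes> (t [^] j \<otimes> f j) \<otimes> s [^] j \<otimes> t [^] l =
      s [^] i \<otimes> f 0 \<otimes> (t [^] j \<otimes> s [^] j) \<otimes> t [^] l"
    using assms by (simp add: t_pow_f A.m_assoc)
  finally show ?thesis by (simp add: pow_ts unit_def)
qed

lemma matrix_units:
  assumes "alg_homomorphism F B A \<phi>" "inj_on \<phi> (carrier B)"
    and "\<And>b i j. b \<in> carrier B ==> i < m ==> j < m ==> \<phi> b \<otimes> unit i j = unit i j \<otimes> \<phi> b"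
  shows "matrix_units F B A \<phi> m unit"
proof (intro matrix_units.intro matrix_units_axioms.intro assms)
  have "(\<Oplus>i\<in>{..<m}. unit i i) = (\<Oplus>i\<in>{..<m}. f i)"
    by (rule A.M.finsum_cong') (auto simp: unit_diag)
  then show "(\<Oplus>i\<in>{..<m}. unit i i) = \<one>" by (simp add: f_sum)
qed (auto simp: unit_mult)

 
end

section \<open>Determinants over a commutative ring\<close>

lemma permutes_permutation: "p permutes {..<d::nat} ==> permutation p"
  by (auto simp: permutation_permutes)

context cring begin

lemma finprod_zero_factor:
  assumes "finite I" "i \<in> I" "f \<in> I \<rightarrow> carrier R" "f i = \<zero>"
  shows "(\<Otimes>i\<in>I. f i) = \<zero>"
proof -
  have "(\<Otimes>i\<in>insert i (I - {i}). f i) = f i \<otimes> (\<Otimes>i\<in>I - {i}. f i)"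
    by (rule finprod_insert) (use assms in auto)
  moreover have "(\<Otimes>i\<in>I - {i}. f i) \<in> carrier R" by (rule finprod_closed) (use assms in auto)
  ultimately show ?thesis using assms by (simp add: insert_absorb)
qed

lemma finsum_cartesian:
  assumes "finite I" "finite J" "\<And>i j. i \<in> I ==> j \<in> J ==> f (i, j) \<in> carrier R"
  shows "(\<Oplus>p\<in>I \<times> J. f p) = (\<Oplus>i\<in>I. \<Oplus>j\<in>J. f (i, j))"
  using assms(1,3)
proof (induction I)
  case (insert i I)
  have split: "insert i I \<times> J = Pair i ` J \<union> I \<times> J" by auto
  have "(\<Oplus>p\<in>insert i I \<times> J. f p) = (\<Oplus>p\<in>Pair i ` J. f p) \<oplus> (\<Oplus>p\<in>I \<times> J. f p)"
    unfolding split by (rule finsum_Un_disjoint) (use insert assms in auto)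
  also have "(\<Oplus>p\<in>Pair i ` J. f p) = (\<Oplus>j\<in>J. f (i, j))"
    by (rule finsum_reindex) (use insert in \<open>auto simp: inj_on_def\<close>)
  also have "(\<Oplus>p\<in>I \<times> J. f p) = (\<Oplus>i\<in>I. \<Oplus>j\<in>J. f (i, j))" using insert by auto
  finally show ?case using insert by (simp add: Pi_iff)
qed simp

text \<open>A choice function on \<open>insert i I\<close> is a value at \<open>i\<close> together
  with a choice function on \<open>I\<close>; this turns the sum over functions into the double sum
  given by distributivity.\<close>

lemma finprod_finsum:
  assumes "finite I" "finite K" "\<And>i k. i \<in> I ==> k \<in> K ==> f i k \<in> carrier R"
  shows "(\<Otimes>i\<in>I. \<Oplus>k\<in>K. f i k) = (\<Oplus>g\<in>I \<rightarrow>\<^sub>E K. \<Otimes>i\<in>I. f i (g i))"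
  using assms(1,3)
proof (induction I)
  case empty then show ?case by simp
next
  case (insert i I)
  let ?G = "I \<rightarrow>\<^sub>E K"
  let ?u = "\<lambda>(k, g). g(i := k)"
  have fin: "finite ?G" using insert assms by (simp add: finite_PiE)
  have img: "insert i I \<rightarrow>\<^sub>E K = ?u ` (K \<times> ?G)" by (rule PiE_insert_eq)
  have inj: "inj_on ?u (K \<times> ?G)"
  proof (rule inj_onI, clarsimp)
    fix k g k' g' assume g: "g \<in> ?G" "g' \<in> ?G" and eq: "g(i := k) = g'(i := k')"
    have "k = k'" using fun_cong[OF eq, of i] by simp
    moreover have "g x = g' x" for x
      using fun_cong[OF eq, of x] PiE_arb[OF g(1) insert.hyps(2)] PiE_arb[OF g(2) insert.hyps(2)]
      by (cases "x = i") simp_all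
    ultimately show "k = k' \<and> g = g'" by auto
  qed
  have cl: "(\<Otimes>j\<in>I. f j (g j)) \<in> carrier R" if "g \<in> ?G" for g
    using that insert.prems by (intro finprod_closed) auto
  have cl': "(\<Otimes>j\<in>insert i I. f j (g j)) \<in> carrier R" if "g \<in> insert i I \<rightarrow>\<^sub>E K" for g
    using that insert.prems by (intro finprod_closed) (auto simp: PiE_iff)
  have "(\<Oplus>g\<in>insert i I \<rightarrow>\<^sub>E K. \<Otimes>j\<in>insert i I. f j (g j)) = (\<Oplus>p\<in>K \<times> ?G. \<Otimes>j\<in>insert i I. f j (?u p j))"
    unfolding img by (rule finsum_reindex[OF _ inj]) (rule Pi_I, rule cl', simp only: img)
  also have "\<dots> = (\<Oplus>p\<in>K \<times> ?G. f i (fst p) \<otimes> (\<Otimes>j\<in>I. f j (snd p j)))"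
  proof (rule finsum_cong'[OF refl])
    fix p assume p: "p \<in> K \<times> ?G"
    have "(\<Otimes>j\<in>insert i I. f j (?u p j)) = f i (?u p i) \<otimes> (\<Otimes>j\<in>I. f j (?u p j))"
      by (rule finprod_insert) (use p insert in \<open>auto simp: PiE_iff\<close>)
    also have "(\<Otimes>j\<in>I. f j (?u p j)) = (\<Otimes>j\<in>I. f j (snd p j))"
      by (rule finprod_cong') (use p insert in \<open>auto simp: PiE_iff\<close>)
    finally show "(\<Otimes>j\<in>insert i I. f j (?u p j)) = f i (fst p) \<otimes> (\<Otimes>j\<in>I. f j (snd p j))"
      by (simp add: case_prod_beta)
  qed (use insert.prems cl in auto)
  also have "\<dots> = (\<Oplus>k\<in>K. \<Oplus>g\<in>?G. f i k \<otimes> (\<Otimes>j\<in>I. f j (g j)))"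
    using finsum_cartesian[of K ?G "\<lambda>p. f i (fst p) \<otimes> (\<Otimes>j\<in>I. f j (snd p j))"] insert.prems cl assms fin by simp
  also have "\<dots> = (\<Oplus>k\<in>K. f i k \<otimes> (\<Oplus>g\<in>?G. \<Otimes>j\<in>I. f j (g j)))"
    using insert.prems cl fin by (intro finsum_cong') (auto simp: finsum_rdistr)
  also have "\<dots> = (\<Oplus>k\<in>K. f i k) \<otimes> (\<Oplus>g\<in>?G. \<Otimes>j\<in>I. f j (g j))"
    using insert.prems cl fin assms by (subst finsum_ldistr) auto
  also have "(\<Oplus>g\<in>?G. \<Otimes>j\<in>I. f j (g j)) = (\<Otimes>j\<in>I. \<Oplus>k\<in>K. f j k)" using insert by auto
  also have "(\<Oplus>k\<in>K. f i k) \<otimes> \<dots> = (\<Otimes>j\<in>insert i I. \<Oplus>k\<in>K. f j k)"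
    using insert by (subst finprod_insert) auto
  finally show ?case by simp
qed

definition sg :: "(nat => nat) => 'a" where "sg p = (if evenperm p then \<one> else \<ominus> \<one>)"

lemma sg_closed [simp]: "sg p \<in> carrier R" by (simp add: sg_def)

lemma sg_comp: "p permutes {..<d::nat} ==> q permutes {..<d} ==> sg (p \<circ> q) = sg p \<otimes> sg q"
  by (auto simp: sg_def evenperm_comp permutes_permutation l_minus)

lemma ring_det_sg: "ring_det R d M = (\<Oplus>p\<in>{p. p permutes {..<d}}. sg p \<otimes> (\<Otimes>i\<in>{..<d}. M i (p i)))"
  by (simp add: ring_det_def sg_def)

lemma det_term_closed:
  "(\<And>i j. i < d ==> j < d ==> M i j \<in> carrier R) ==> p permutes {..<d} ==> (\<Otimes>i\<in>{..<d}. M i (p i)) \<in> carrier R"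
  by (intro finprod_closed) (auto dest: permutes_in_image[where x = x for x])

lemma ring_det_closed:
  "(\<And>i j. i < d ==> j < d ==> M i j \<in> carrier R) ==> ring_det R d M \<in> carrier R"
  unfolding ring_det_sg by (intro finsum_closed Pi_I m_closed sg_closed) (auto intro!: det_term_closed)

lemma ring_det_cong:
  assumes "\<And>i j. i < d ==> j < d ==> M i j \<in> carrier R" "\<And>i j. i < d ==> j < d ==> M i j = N i j"
  shows "ring_det R d M = ring_det R d N"
  unfolding ring_det_sg
proof (rule finsum_cong'[OF refl])
  fix p assume "p \<in> {p. p permutes {..<d}}"
  then have p: "p i < d" if "i < d" for i using that permutes_in_image[of p "{..<d}" i] by simp
  have "(\<Otimes>i\<in>{..<d}. M i (p i)) = (\<Otimes>i\<in>{..<d}. N i (p i))"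
    by (rule finprod_cong') (use assms p in auto)
  then show "sg p \<otimes> (\<Otimes>i\<in>{..<d}. M i (p i)) = sg p \<otimes> (\<Otimes>i\<in>{..<d}. N i (p i))" by simp
next
  have "N i j \<in> carrier R" if "i < d" "j < d" for i j using assms that by metis
  then show "(\<lambda>p. sg p \<otimes> (\<Otimes>i\<in>{..<d}. N i (p i))) \<in> {p. p permutes {..<d}} \<rightarrow> carrier R"
    by (auto intro!: m_closed det_term_closed)
qed

lemma ring_det_diagonal:
  assumes "\<And>i. i < d ==> c i \<in> carrier R"
  shows "ring_det R d (\<lambda>i j. if i = j then c i else \<zero>) = (\<Otimes>i\<in>{..<d}. c i)"
proof -
  let ?D = "\<lambda>i j. if i = j then c i else \<zero>"
  have z: "(\<Otimes>i\<in>{..<d}. ?D i (p i)) = \<zero>" if p: "p permutes {..<d}" "p \<noteq> id" for p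
  proof -
    obtain i where i: "p i \<noteq> i" using p(2) by (auto simp: fun_eq_iff)
    then have "i < d" using p(1) by (metis lessThan_iff permutes_not_in)
    then show ?thesis using i assms by (intro finprod_zero_factor[where i = i]) auto
  qed
  have "ring_det R d ?D = (\<Oplus>p\<in>{p. p permutes {..<d}}. if p = id then (\<Otimes>i\<in>{..<d}. c i) else \<zero>)"
    unfolding ring_det_sg
  proof (rule finsum_cong'[OF refl])
    fix p assume p: "p \<in> {p. p permutes {..<d}}"
    show "sg p \<otimes> (\<Otimes>i\<in>{..<d}. ?D i (p i)) = (if p = id then (\<Otimes>i\<in>{..<d}. c i) else \<zero>)"
    proof (cases "p = id")
      case True
      have "(\<Otimes>i\<in>{..<d}. ?D i (p i)) = (\<Otimes>i\<in>{..<d}. c i)"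
        by (rule finprod_cong') (use True assms in auto)
      moreover have "(\<Otimes>i\<in>{..<d}. c i) \<in> carrier R" by (rule finprod_closed) (use assms in auto)
      ultimately show ?thesis using True by (simp add: sg_def)
    next
      case False then show ?thesis using z p by simp
    qed
  next
    have "(\<Otimes>i\<in>{..<d}. c i) \<in> carrier R" by (rule finprod_closed) (use assms in auto)
    then show "(\<lambda>p. if p = id then (\<Otimes>i\<in>{..<d}. c i) else \<zero>) \<in> {p. p permutes {..<d}} \<rightarrow> carrier R" by auto
  qed
  also have "\<dots> = (\<Otimes>i\<in>{..<d}. c i)"
    using finsum_singleton[of id "{p. p permutes {..<d}}" "\<lambda>_. \<Otimes>i\<in>{..<d}. c i"] assms
    by (simp add: finite_permutations eq_commute[of _ id] permutes_id Pi_iff)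
  finally show ?thesis .
qed

text \<open>The Leibniz sum is reindexed by composition with \<open>g\<close>; the product over rows
  is then reindexed by \<open>g\<close> itself, and the sign of the composite splits.\<close>

lemma ring_det_permute_rows:
  assumes M: "\<And>i j. i < d ==> j < d ==> M i j \<in> carrier R" and g: "g permutes {..<d}"
  shows "ring_det R d (\<lambda>i j. M (g i) j) = sg g \<otimes> ring_det R d M"
proof -
  let ?P = "{p. p permutes {..<d}}"
  have gd: "g i < d \<longleftrightarrow> i < d" for i using permutes_in_image[OF g, of i] by simp
  have img: "?P = (\<lambda>p. p \<circ> g) ` ?P"
  proof (intro equalityI subsetI)
    fix p assume "p \<in> ?P"
    then have "p \<circ> inv_into UNIV g \<in> ?P" using g by (simp add: permutes_compose permutes_inv)
    moreover have "p = (p \<circ> inv_into UNIV g) \<circ> g" using g by (simp add: comp_assoc permutes_inv_o)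
    ultimately show "p \<in> (\<lambda>p. p \<circ> g) ` ?P" by blast
  qed (use g in \<open>auto simp: permutes_compose\<close>)
  have inj: "inj_on (\<lambda>p. p \<circ> g) ?P"
  proof (rule inj_onI)
    fix p q assume "p \<circ> g = q \<circ> g"
    then have "p \<circ> g \<circ> inv_into UNIV g = q \<circ> g \<circ> inv_into UNIV g" by simp
    then show "p = q" using g by (simp add: comp_assoc permutes_inv_o)
  qed
  have prod: "(\<Otimes>i\<in>{..<d}. M (g i) (p (g i))) = (\<Otimes>i\<in>{..<d}. M i (p i))" if p: "p \<in> ?P" for p
  proof -
    have "(\<Otimes>i\<in>g ` {..<d}. M i (p i)) = (\<Otimes>i\<in>{..<d}. M (g i) (p (g i)))"
      by (rule finprod_reindex)
        (use p M g permutes_in_image[of p "{..<d}"] in \<open>auto simp: permutes_image permutes_inj_on\<close>)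
    then show ?thesis using g by (simp add: permutes_image)
  qed
  have cl: "(\<Otimes>i\<in>{..<d}. M i (p i)) \<in> carrier R" if "p \<in> ?P" for p
    using that M by (auto intro: det_term_closed)
  have cl': "(\<Otimes>i\<in>{..<d}. M (g i) (p i)) \<in> carrier R" if "p \<in> ?P" for p
    using that M gd by (intro det_term_closed[where M = "\<lambda>i. M (g i)"]) auto
  have "ring_det R d (\<lambda>i j. M (g i) j) = (\<Oplus>p\<in>(\<lambda>p. p \<circ> g) ` ?P. sg p \<otimes> (\<Otimes>i\<in>{..<d}. M (g i) (p i)))"
    unfolding ring_det_sg using img by simp
  also have "\<dots> = (\<Oplus>p\<in>?P. sg (p \<circ> g) \<otimes> (\<Otimes>i\<in>{..<d}. M (g i) ((p \<circ> g) i)))"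
    by (rule finsum_reindex[OF _ inj]) (use cl' img in auto)
  also have "\<dots> = (\<Oplus>p\<in>?P. sg g \<otimes> (sg p \<otimes> (\<Otimes>i\<in>{..<d}. M i (p i))))"
    by (rule finsum_cong') (use cl prod g in \<open>auto simp: sg_comp m_ac\<close>)
  also have "\<dots> = sg g \<otimes> ring_det R d M"
    unfolding ring_det_sg using cl by (subst finsum_rdistr) (auto simp: finite_permutations)
  finally show ?thesis .
qed

text \<open>Splitting the sum by parity keeps the argument valid in characteristic two.\<close>

lemma ring_det_equal_rows:
  assumes M: "\<And>i j. i < d ==> j < d ==> M i j \<in> carrier R"
    and ab: "a < d" "b < d" "a \<noteq> b" "\<And>j. M a j = M b j"
  shows "ring_det R d M = \<zero>"
proof -
  let ?P = "{p. p permutes {..<d}}"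
  let ?Ev = "{p \<in> ?P. evenperm p}" and ?Od = "{p \<in> ?P. \<not> evenperm p}"
  let ?t = "Transposition.transpose a b"
  have t: "?t permutes {..<d}" using ab by (simp add: permutes_swap_id)
  have tt: "?t \<circ> ?t = id" by simp
  have ev: "evenperm (p \<circ> ?t) \<longleftrightarrow> \<not> evenperm p" if "p \<in> ?P" for p
    using evenperm_comp[OF permutes_permutation permutes_permutation[OF t], of p] that ab
    by (simp add: evenperm_swap)
  have img: "?Od = (\<lambda>p. p \<circ> ?t) ` ?Ev"
  proof (intro equalityI subsetI)
    fix p assume p: "p \<in> ?Od"
    then have "p \<circ> ?t \<in> ?Ev" using t ev by (auto simp: permutes_compose)
    moreover have "p = (p \<circ> ?t) \<circ> ?t" by (simp add: comp_assoc)
    ultimately show "p \<in> (\<lambda>p. p \<circ> ?t) ` ?Ev" by blast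
  qed (use t ev in \<open>auto simp: permutes_compose\<close>)
  have inj: "inj_on (\<lambda>p. p \<circ> ?t) ?Ev"
  proof (rule inj_onI)
    fix p q assume "p \<circ> ?t = q \<circ> ?t"
    then have "p \<circ> ?t \<circ> ?t = q \<circ> ?t \<circ> ?t" by (rule arg_cong)
    then show "p = q" by (simp only: comp_assoc tt comp_id)
  qed
  let ?T = "\<lambda>p. \<Otimes>i\<in>{..<d}. M i (p i)"
  have cl: "?T p \<in> carrier R" if "p \<in> ?P" for p using that M by (auto intro: det_term_closed)
  have inv: "?T (p \<circ> ?t) = ?T p" if p: "p \<in> ?P" for p
  proof -
    have pd: "p i < d" if "i < d" for i using p that permutes_in_image[of p "{..<d}" i] by simp
    have td: "?t i < d" if "i < d" for i using t that permutes_in_image[of ?t "{..<d}" i] by simp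
    have row: "M i j = M (?t i) j" for i j using ab(4) by (simp add: Transposition.transpose_def)
    have "?T (p \<circ> ?t) = (\<Otimes>i\<in>{..<d}. M (?t i) (p (?t i)))"
    proof (rule finprod_cong'[OF refl])
      show "M i ((p \<circ> ?t) i) = M (?t i) (p (?t i))" for i unfolding o_apply by (rule row)
    qed (use M pd td in simp)
    also have "\<dots> = (\<Otimes>i\<in>?t ` {..<d}. M i (p i))"
    proof (rule finprod_reindex[symmetric])
      show "inj_on ?t {..<d}" using t by (rule permutes_inj_on)
    qed (unfold permutes_image[OF t], use M pd in auto)
    finally show ?thesis unfolding permutes_image[OF t] .
  qed
  have "ring_det R d M = (\<Oplus>p\<in>?Ev \<union> ?Od. sg p \<otimes> ?T p)"
    unfolding ring_det_sg by (rule finsum_cong') (use cl in auto)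
  also have "\<dots> = (\<Oplus>p\<in>?Ev. sg p \<otimes> ?T p) \<oplus> (\<Oplus>p\<in>?Od. sg p \<otimes> ?T p)"
    by (rule finsum_Un_disjoint) (use cl in \<open>auto simp: finite_permutations\<close>)
  also have "(\<Oplus>p\<in>?Ev. sg p \<otimes> ?T p) = (\<Oplus>p\<in>?Ev. ?T p)"
    by (rule finsum_cong') (use cl in \<open>auto simp: sg_def\<close>)
  also have "(\<Oplus>p\<in>?Od. sg p \<otimes> ?T p) = (\<Oplus>p\<in>?Od. \<ominus> ?T p)"
    by (rule finsum_cong') (use cl in \<open>auto simp: sg_def l_minus\<close>)
  also have "\<dots> = (\<Oplus>p\<in>?Ev. \<ominus> ?T (p \<circ> ?t))"
    unfolding img by (rule finsum_reindex[OF _ inj]) (rule Pi_I, unfold img[symmetric], use cl in simp)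
  also have "\<dots> = (\<Oplus>p\<in>?Ev. \<ominus> ?T p)"
  proof (rule finsum_cong'[OF refl])
    show "\<ominus> ?T (p \<circ> ?t) = \<ominus> ?T p" if "p \<in> ?Ev" for p using inv[of p] that by simp
  qed (use cl in simp)
  also have "(\<Oplus>p\<in>?Ev. ?T p) \<oplus> (\<Oplus>p\<in>?Ev. \<ominus> ?T p) = (\<Oplus>p\<in>?Ev. ?T p \<oplus> \<ominus> ?T p)"
    by (rule finsum_addf[symmetric]) (use cl in auto)
  also have "\<dots> = (\<Oplus>p\<in>?Ev. \<zero>)"
    by (rule finsum_cong') (use cl in \<open>auto simp: r_neg\<close>)
  finally show ?thesis by simp
qed

text \<open>Distributivity expands the determinant of the product into a sum over all functions
  \<open>g\<close>, with weight the product of the \<open>A i (g i)\<close>, of the determinant of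
  the matrix with rows \<open>B (g i)\<close>. A function that is not injective repeats a row and
  contributes zero; the others are permutations, and reordering the rows yields their sign.\<close>

lemma ring_det_mult:
  assumes A: "\<And>i j. i < d ==> j < d ==> A i j \<in> carrier R"
    and B: "\<And>i j. i < d ==> j < d ==> B i j \<in> carrier R"
  shows "ring_det R d (\<lambda>i j. \<Oplus>k\<in>{..<d}. A i k \<otimes> B k j) = ring_det R d A \<otimes> ring_det R d B"
proof -
  let ?P = "{p. p permutes {..<d}}" and ?G = "{..<d} \<rightarrow>\<^sub>E {..<d}"
  let ?a = "\<lambda>g. \<Otimes>i\<in>{..<d}. A i (g i)"
  have finG: "finite ?G" by (simp add: finite_PiE)
  have finP: "finite ?P" by (simp add: finite_permutations)
  have gd: "g i < d" if "g \<in> ?G" "i < d" for g i using that by auto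
  have pd: "p i < d" if "p \<in> ?P" "i < d" for p i using that permutes_in_image[of p "{..<d}" i] by simp
  have acl: "?a g \<in> carrier R" if "\<And>i. i < d ==> g i < d" for g using that A by (auto intro: finprod_closed)
  have bcl: "(\<Otimes>i\<in>{..<d}. B (g i) (p i)) \<in> carrier R" if "\<And>i. i < d ==> g i < d" "p \<in> ?P" for g p
    using that B pd by (auto intro: finprod_closed)
  have acl': "?a g \<in> carrier R" if "g \<in> ?G" for g using acl gd that by blast
  have bcl': "(\<Otimes>i\<in>{..<d}. B (g i) (p i)) \<in> carrier R" if "g \<in> ?G" "p \<in> ?P" for g p
    using bcl gd that by blast
  have dcl: "ring_det R d (\<lambda>i j. B (g i) j) \<in> carrier R" if "\<And>i. i < d ==> g i < d" for g
    using that B by (auto intro: ring_det_closed)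
  have "ring_det R d (\<lambda>i j. \<Oplus>k\<in>{..<d}. A i k \<otimes> B k j) =
      (\<Oplus>p\<in>?P. sg p \<otimes> (\<Oplus>g\<in>?G. \<Otimes>i\<in>{..<d}. A i (g i) \<otimes> B (g i) (p i)))"
    unfolding ring_det_sg
  proof (rule finsum_cong'[OF refl])
    fix p assume p: "p \<in> ?P"
    then show "sg p \<otimes> (\<Otimes>i\<in>{..<d}. \<Oplus>k\<in>{..<d}. A i k \<otimes> B k (p i)) = sg p \<otimes> (\<Oplus>g\<in>?G. \<Otimes>i\<in>{..<d}. A i (g i) \<otimes> B (g i) (p i))"
      using A B pd by (subst finprod_finsum) auto
  qed (use A B gd pd in \<open>auto intro!: m_closed finsum_closed finprod_closed\<close>)
  also have "\<dots> = (\<Oplus>p\<in>?P. \<Oplus>g\<in>?G. ?a g \<otimes> (sg p \<otimes> (\<Otimes>i\<in>{..<d}. B (g i) (p i))))"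
  proof (rule finsum_cong'[OF refl])
    fix p assume p: "p \<in> ?P"
    have "(\<Oplus>g\<in>?G. \<Otimes>i\<in>{..<d}. A i (g i) \<otimes> B (g i) (p i)) = (\<Oplus>g\<in>?G. ?a g \<otimes> (\<Otimes>i\<in>{..<d}. B (g i) (p i)))"
      using A B gd pd p by (intro finsum_cong') (auto simp: Pi_iff acl bcl intro!: finprod_multf)
    then show "sg p \<otimes> (\<Oplus>g\<in>?G. \<Otimes>i\<in>{..<d}. A i (g i) \<otimes> B (g i) (p i)) = (\<Oplus>g\<in>?G. ?a g \<otimes> (sg p \<otimes> (\<Otimes>i\<in>{..<d}. B (g i) (p i))))"
      using acl' bcl'[OF _ p] finG
      by (simp add: finsum_rdistr Pi_iff del: PiE_iff, intro finsum_cong') (auto simp: m_lcomm)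
  qed (use acl bcl gd in \<open>auto intro!: finsum_closed m_closed\<close>)
  also have "\<dots> = (\<Oplus>g\<in>?G. \<Oplus>p\<in>?P. ?a g \<otimes> (sg p \<otimes> (\<Otimes>i\<in>{..<d}. B (g i) (p i))))"
    using finG finP acl bcl gd by (intro finsum_swap) (auto intro!: m_closed)
  also have "\<dots> = (\<Oplus>g\<in>?G. ?a g \<otimes> ring_det R d (\<lambda>i j. B (g i) j))"
    unfolding ring_det_sg using finG finP acl bcl gd
    by (intro finsum_cong') (auto simp: finsum_rdistr intro!: m_closed finsum_closed)
  \<comment> \<open>The functions \<open>g\<close> are undefined outside \<open>{..<d}\<close>
    whereas permutations are the identity there; restriction matches the injective ones with the
    permutations.\<close>
  also have "\<dots> = (\<Oplus>g\<in>(\<lambda>p. restrict p {..<d}) ` ?P. ?a g \<otimes> ring_det R d (\<lambda>i j. B (g i) j))"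
  proof (rule add.finprod_mono_neutral_cong_right)
    show "(\<lambda>p. restrict p {..<d}) ` ?P \<subseteq> ?G"
      by (rule image_subsetI) (use pd in \<open>auto simp only: PiE_iff extensional_restrict restrict_apply lessThan_iff split: if_splits\<close>)
    show "?a g \<otimes> ring_det R d (\<lambda>i j. B (g i) j) = \<zero>" if g: "g \<in> ?G - (\<lambda>p. restrict p {..<d}) ` ?P" for g
    proof -
      have "\<not> inj_on g {..<d}"
      proof
        assume inj: "inj_on g {..<d}"
        let ?p = "\<lambda>i. if i < d then g i else i"
        have "g ` {..<d} = {..<d}" using inj g by (intro endo_inj_surj) auto
        then have "bij_betw ?p {..<d} {..<d}" using inj by (auto simp: bij_betw_def inj_on_def)
        then have "?p permutes {..<d}" by (rule bij_imp_permutes) auto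
        moreover have "restrict ?p {..<d} = g" using g by (auto simp: fun_eq_iff PiE_def extensional_def)
        ultimately have "g \<in> (\<lambda>p. restrict p {..<d}) ` ?P"
          using imageI[of ?p ?P "\<lambda>p. restrict p {..<d}"] by simp
        then show False using g by simp
      qed
      then obtain a b where "a < d" "b < d" "a \<noteq> b" "g a = g b" by (auto simp: inj_on_def)
      then have "ring_det R d (\<lambda>i j. B (g i) j) = \<zero>"
        using B gd g by (intro ring_det_equal_rows[where a = a and b = b]) auto
      then show ?thesis using acl gd g by simp
    qed
  qed (use finG acl dcl gd in auto)
  also have "\<dots> = (\<Oplus>p\<in>?P. ?a (restrict p {..<d}) \<otimes> ring_det R d (\<lambda>i j. B (restrict p {..<d} i) j))"
  proof (rule finsum_reindex)
    show "inj_on (\<lambda>p. restrict p {..<d}) ?P"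
    proof (rule inj_onI, rule ext)
      fix p q i assume "p \<in> ?P" "q \<in> ?P" and eq: "restrict p {..<d} = restrict q {..<d}"
      have "restrict p {..<d} i = restrict q {..<d} i" using eq by simp
      then show "p i = q i"
        using permutes_not_in[of p "{..<d}" i] permutes_not_in[of q "{..<d}" i] \<open>p \<in> ?P\<close> \<open>q \<in> ?P\<close>
        by (cases "i < d") simp_all
    qed
  qed (use pd acl dcl in \<open>auto intro!: m_closed\<close>)
  also have "\<dots> = (\<Oplus>p\<in>?P. (sg p \<otimes> ?a p) \<otimes> ring_det R d B)"
  proof (rule finsum_cong'[OF refl])
    fix p assume p: "p \<in> ?P"
    have "?a (restrict p {..<d}) = ?a p" using A pd p by (intro finprod_cong') auto
    moreover have "ring_det R d (\<lambda>i j. B (restrict p {..<d} i) j) = ring_det R d (\<lambda>i j. B (p i) j)"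
      using B pd p by (intro ring_det_cong) auto
    moreover have "\<dots> = sg p \<otimes> ring_det R d B" using p B by (intro ring_det_permute_rows) auto
    ultimately show "?a (restrict p {..<d}) \<otimes> ring_det R d (\<lambda>i j. B (restrict p {..<d} i) j) = (sg p \<otimes> ?a p) \<otimes> ring_det R d B"
      using acl[of p] pd p ring_det_closed[of d B] B by (simp add: m_ac)
  qed (use acl pd ring_det_closed[of d B] B in auto)
  also have "\<dots> = ring_det R d A \<otimes> ring_det R d B"
    unfolding ring_det_sg[of d A] using acl pd ring_det_closed[of d B] B finP
    by (subst finsum_ldistr) auto
  finally show ?thesis .
qed

end

section \<open>Bases over the ground field\<close>

lemma scalar_hom:
  assumes "assoc_algebra F A"
  shows "alg_homomorphism F (self_algebra F) A (\<lambda>c. c \<odot>\<^bsub>A\<^esub> \<one>\<^bsub>A\<^esub>)"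
proof -
  interpret A: assoc_algebra F A by fact
  interpret S: assoc_algebra F "self_algebra F" by (rule assoc_algebra_self[OF A.R.is_cring])
  have "(\<lambda>c. c \<odot>\<^bsub>A\<^esub> \<one>\<^bsub>A\<^esub>) \<in> alg_hom F (self_algebra F) A"
    by (rule alg_homI) (auto simp: A.one_smult_mult A.smult_assoc1 A.smult_l_distr)
  then show ?thesis by unfold_locales
qed

lemma domain_self_algebra:
  assumes "domain F"
  shows "domain (self_algebra F)"
proof -
  interpret domain F by fact
  interpret S: assoc_algebra F "self_algebra F" by (rule assoc_algebra_self[OF is_cring])
  show ?thesis
    by (intro domain.intro cring.intro S.ring_axioms comm_monoid.intro S.monoid_axioms
        comm_monoid_axioms.intro domain_axioms.intro) (auto simp: m_comm integral_iff)
qed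

lemma (in root_of_unity) roots_of_unity:
  assumes z: "z \<in> carrier F" "z [^] m = \<one>"
  shows "\<exists>l::nat. z = \<zeta> [^] l"
proof -
  have pow: "x [^]\<^bsub>self_algebra F\<^esub> n = x [^] n" for x and n :: nat
    by (induction n) (simp_all add: nat_pow_def)
  have "z \<in> carrier (self_algebra F)" "z [^]\<^bsub>self_algebra F\<^esub> m = \<one>\<^bsub>self_algebra F\<^esub>"
    using z by (simp_all add: pow)
  from roots_of_unity_domain[OF assoc_algebra_self[OF is_cring] domain_self_algebra[OF domain_axioms] this]
  obtain l :: nat where "z = (\<zeta> [^] l) \<odot>\<^bsub>self_algebra F\<^esub> \<one>\<^bsub>self_algebra F\<^esub>" by blast
  then show ?thesis by auto
qed

locale field_algebra = F: field F + A: assoc_algebra F A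
  for F :: "('f, 'z) ring_scheme" and A :: "('f, 'a, 'k) module_scheme" +
  assumes nontrivial: "\<one>\<^bsub>A\<^esub> \<noteq> \<zero>\<^bsub>A\<^esub>"
begin

sublocale sc: alg_homomorphism F "self_algebra F" A "\<lambda>c. c \<odot>\<^bsub>A\<^esub> \<one>\<^bsub>A\<^esub>"
  by (rule scalar_hom[OF A.assoc_algebra_axioms])

lemma smult_cancel:
  assumes "c \<in> carrier F" "z \<in> carrier A" "c \<odot>\<^bsub>A\<^esub> z = \<zero>\<^bsub>A\<^esub>" "c \<noteq> \<zero>\<^bsub>F\<^esub>"
  shows "z = \<zero>\<^bsub>A\<^esub>"
proof -
  have "z = inv\<^bsub>F\<^esub> c \<odot>\<^bsub>A\<^esub> (c \<odot>\<^bsub>A\<^esub> z)" using assms(1,2,4) by (simp add: A.smult_assoc1[symmetric])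
  then show ?thesis using assms by simp
qed

lemma scalar_zero: "c \<in> carrier F ==> c \<odot>\<^bsub>A\<^esub> \<one>\<^bsub>A\<^esub> = \<zero>\<^bsub>A\<^esub> ==> c = \<zero>\<^bsub>F\<^esub>"
  using smult_cancel[of c "\<one>\<^bsub>A\<^esub>"] nontrivial by auto

lemma scalar_inj: "c \<in> carrier F ==> c' \<in> carrier F ==> c \<odot>\<^bsub>A\<^esub> \<one>\<^bsub>A\<^esub> = c' \<odot>\<^bsub>A\<^esub> \<one>\<^bsub>A\<^esub> ==> c = c'"
proof -
  assume c: "c \<in> carrier F" "c' \<in> carrier F" "c \<odot>\<^bsub>A\<^esub> \<one>\<^bsub>A\<^esub> = c' \<odot>\<^bsub>A\<^esub> \<one>\<^bsub>A\<^esub>"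
  then have "(c \<ominus>\<^bsub>F\<^esub> c') \<odot>\<^bsub>A\<^esub> \<one>\<^bsub>A\<^esub> = \<zero>\<^bsub>A\<^esub>"
    by (simp add: a_minus_def A.smult_l_distr A.smult_l_minus A.M.r_neg)
  then have "c \<ominus>\<^bsub>F\<^esub> c' = \<zero>\<^bsub>F\<^esub>" using scalar_zero c by simp
  then show ?thesis using c by simp
qed

lemma scalars_closed: "scalars F A \<subseteq> carrier A" by (auto simp: scalars_def)

lemma scalars_subfield: "subfield (scalars F A) A"
proof (rule A.subfield_iff(1)[OF _ scalars_closed])
  let ?S = "A\<lparr>carrier := scalars F A\<rparr>"
  have S: "scalars F A = (\<lambda>c. c \<odot>\<^bsub>A\<^esub> \<one>\<^bsub>A\<^esub>) ` carrier (self_algebra F)" by (simp add: scalars_def)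
  interpret S: assoc_algebra F ?S unfolding S by (rule sc.image_algebra)
  have "cring ?S"
  proof (intro cring.intro S.ring_axioms comm_monoid.intro S.monoid_axioms comm_monoid_axioms.intro)
    fix x y assume "x \<in> carrier ?S" "y \<in> carrier ?S"
    then show "x \<otimes>\<^bsub>?S\<^esub> y = y \<otimes>\<^bsub>?S\<^esub> x"
      by (auto simp: scalars_def A.one_smult_mult A.smult_assoc1[symmetric] F.m_comm)
  qed
  then show "field ?S"
  proof (rule cring.cring_fieldI2)
    show "\<zero>\<^bsub>?S\<^esub> \<noteq> \<one>\<^bsub>?S\<^esub>" using nontrivial by simp
    fix x assume x: "x \<in> carrier ?S" "x \<noteq> \<zero>\<^bsub>?S\<^esub>"
    then obtain c where c: "c \<in> carrier F" "x = c \<odot>\<^bsub>A\<^esub> \<one>\<^bsub>A\<^esub>" by (auto simp: scalars_def)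
    then have "c \<noteq> \<zero>\<^bsub>F\<^esub>" using x by auto
    then show "\<exists>y\<in>carrier ?S. x \<otimes>\<^bsub>?S\<^esub> y = \<one>\<^bsub>?S\<^esub>"
      using c by (intro bexI[of _ "inv\<^bsub>F\<^esub> c \<odot>\<^bsub>A\<^esub> \<one>\<^bsub>A\<^esub>"])
        (auto simp: scalars_def A.one_smult_mult A.smult_assoc1[symmetric])
  qed
qed

text \<open>\<open>combine\<close> takes a list of coefficients from the subfield
  \<open>scalars F A\<close> of \<open>A\<close>. Here it is translated into families of elements of
  F and sums over indices, the form used for bases from now on.\<close>

lemma combine_finsum:
  assumes "set us \<subseteq> carrier A" "c \<in> {..<length us} \<rightarrow> carrier F"
  shows "A.combine (map (\<lambda>i. c i \<odot>\<^bsub>A\<^esub> \<one>\<^bsub>A\<^esub>) [0..<length us]) us = (\<Oplus>\<^bsub>A\<^esub>i\<in>{..<length us}. c i \<odot>\<^bsub>A\<^esub> us ! i)"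
  using assms
proof (induction us arbitrary: c)
  case (Cons u us)
  have c: "c i \<in> carrier F" if "i \<le> length us" for i using Cons.prems that by (simp add: Pi_iff)
  have us: "us ! i \<in> carrier A" if "i < length us" for i using Cons.prems that by auto
  have "map (\<lambda>i. c i \<odot>\<^bsub>A\<^esub> \<one>\<^bsub>A\<^esub>) [0..<length (u # us)] =
      c 0 \<odot>\<^bsub>A\<^esub> \<one>\<^bsub>A\<^esub> # map (\<lambda>i. c (Suc i) \<odot>\<^bsub>A\<^esub> \<one>\<^bsub>A\<^esub>) [0..<length us]"
    by (simp only: length_Cons map_upt_Suc)
  then have "A.combine (map (\<lambda>i. c i \<odot>\<^bsub>A\<^esub> \<one>\<^bsub>A\<^esub>) [0..<length (u # us)]) (u # us) =
      (c 0 \<odot>\<^bsub>A\<^esub> \<one>\<^bsub>A\<^esub>) \<otimes>\<^bsub>A\<^esub> u \<oplus>\<^bsub>A\<^esub> A.combine (map (\<lambda>i. c (Suc i) \<odot>\<^bsub>A\<^esub> \<one>\<^bsub>A\<^esub>) [0..<length us]) us"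
    by simp
  also have "\<dots> = c 0 \<odot>\<^bsub>A\<^esub> u \<oplus>\<^bsub>A\<^esub> (\<Oplus>\<^bsub>A\<^esub>i\<in>{..<length us}. c (Suc i) \<odot>\<^bsub>A\<^esub> us ! i)"
    using Cons.prems c by (subst Cons.IH) (auto simp: A.one_smult_mult)
  also have "\<dots> = (\<Oplus>\<^bsub>A\<^esub>i\<in>{..<Suc (length us)}. c i \<odot>\<^bsub>A\<^esub> (u # us) ! i)"
    using Cons.prems c us
    by (subst A.M.finsum_lessThan_shift) (auto simp: nth_Cons split: nat.split)
  finally show ?case by simp
qed simp

lemma scalar_list:
  assumes "set Ks \<subseteq> scalars F A"
  obtains c where "c \<in> {..<length Ks} \<rightarrow> carrier F" "Ks = map (\<lambda>i. c i \<odot>\<^bsub>A\<^esub> \<one>\<^bsub>A\<^esub>) [0..<length Ks]"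
proof -
  have "\<forall>i\<in>{..<length Ks}. \<exists>c. c \<in> carrier F \<and> Ks ! i = c \<odot>\<^bsub>A\<^esub> \<one>\<^bsub>A\<^esub>"
    using assms nth_mem unfolding scalars_def by blast
  from bchoice[OF this] obtain c where
    c: "\<forall>i\<in>{..<length Ks}. c i \<in> carrier F \<and> Ks ! i = c i \<odot>\<^bsub>A\<^esub> \<one>\<^bsub>A\<^esub>" by blast
  show ?thesis by (rule that[of c]) (use c in \<open>auto intro!: nth_equalityI\<close>)
qed

lemma Span_iff:
  assumes us: "set us \<subseteq> carrier A"
  shows "z \<in> A.Span (scalars F A) us \<longleftrightarrow>
    (\<exists>c\<in>{..<length us} \<rightarrow> carrier F. z = (\<Oplus>\<^bsub>A\<^esub>i\<in>{..<length us}. c i \<odot>\<^bsub>A\<^esub> us ! i))"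
proof -
  have "z \<in> A.Span (scalars F A) us \<longleftrightarrow> (\<exists>Ks. set Ks \<subseteq> scalars F A \<and> length Ks = length us \<and> z = A.combine Ks us)"
    by (rule A.Span_mem_iff_length_version[OF scalars_subfield us])
  also have "\<dots> \<longleftrightarrow> (\<exists>c\<in>{..<length us} \<rightarrow> carrier F. z = (\<Oplus>\<^bsub>A\<^esub>i\<in>{..<length us}. c i \<odot>\<^bsub>A\<^esub> us ! i))"
  proof safe
    fix Ks assume Ks: "set Ks \<subseteq> scalars F A" "length Ks = length us"
    from scalar_list[OF Ks(1)] obtain c where
      "c \<in> {..<length Ks} \<rightarrow> carrier F" "Ks = map (\<lambda>i. c i \<odot>\<^bsub>A\<^esub> \<one>\<^bsub>A\<^esub>) [0..<length Ks]" by blast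
    then show "\<exists>c\<in>{..<length us} \<rightarrow> carrier F. A.combine Ks us = (\<Oplus>\<^bsub>A\<^esub>i\<in>{..<length us}. c i \<odot>\<^bsub>A\<^esub> us ! i)"
      using Ks(2) combine_finsum[OF us, of c] by (intro bexI[of _ c]) auto
  next
    fix c assume "c \<in> {..<length us} \<rightarrow> carrier F"
    then show "\<exists>Ks. set Ks \<subseteq> scalars F A \<and> length Ks = length us \<and>
        (\<Oplus>\<^bsub>A\<^esub>i\<in>{..<length us}. c i \<odot>\<^bsub>A\<^esub> us ! i) = A.combine Ks us"
      using combine_finsum[OF us, of c]
      by (intro exI[of _ "map (\<lambda>i. c i \<odot>\<^bsub>A\<^esub> \<one>\<^bsub>A\<^esub>) [0..<length us]"]) (auto simp: scalars_def)
  qed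
  finally show ?thesis .
qed

lemma independent_iff:
  assumes us: "set us \<subseteq> carrier A"
  shows "A.independent (scalars F A) us \<longleftrightarrow>
    (\<forall>c\<in>{..<length us} \<rightarrow> carrier F. (\<Oplus>\<^bsub>A\<^esub>i\<in>{..<length us}. c i \<odot>\<^bsub>A\<^esub> us ! i) = \<zero>\<^bsub>A\<^esub> \<longrightarrow> (\<forall>i<length us. c i = \<zero>\<^bsub>F\<^esub>))"
proof
  assume ind: "A.independent (scalars F A) us"
  show "\<forall>c\<in>{..<length us} \<rightarrow> carrier F. (\<Oplus>\<^bsub>A\<^esub>i\<in>{..<length us}. c i \<odot>\<^bsub>A\<^esub> us ! i) = \<zero>\<^bsub>A\<^esub> \<longrightarrow> (\<forall>i<length us. c i = \<zero>\<^bsub>F\<^esub>)"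
  proof (intro ballI impI allI)
    fix c i assume c: "c \<in> {..<length us} \<rightarrow> carrier F" "(\<Oplus>\<^bsub>A\<^esub>i\<in>{..<length us}. c i \<odot>\<^bsub>A\<^esub> us ! i) = \<zero>\<^bsub>A\<^esub>" and i: "i < length us"
    let ?Ks = "map (\<lambda>i. c i \<odot>\<^bsub>A\<^esub> \<one>\<^bsub>A\<^esub>) [0..<length us]"
    have "set (take (length us) ?Ks) \<subseteq> {\<zero>\<^bsub>A\<^esub>}"
      by (rule A.independent_imp_trivial_combine[OF scalars_subfield ind])
        (use c combine_finsum[OF us c(1)] in \<open>auto simp: scalars_def\<close>)
    then have "c i \<odot>\<^bsub>A\<^esub> \<one>\<^bsub>A\<^esub> = \<zero>\<^bsub>A\<^esub>" using i by (auto simp: image_subset_iff)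
    then show "c i = \<zero>\<^bsub>F\<^esub>" using scalar_zero c i by auto
  qed
next
  assume ind: "\<forall>c\<in>{..<length us} \<rightarrow> carrier F. (\<Oplus>\<^bsub>A\<^esub>i\<in>{..<length us}. c i \<odot>\<^bsub>A\<^esub> us ! i) = \<zero>\<^bsub>A\<^esub> \<longrightarrow> (\<forall>i<length us. c i = \<zero>\<^bsub>F\<^esub>)"
  show "A.independent (scalars F A) us"
  proof (rule A.trivial_combine_imp_independent[OF scalars_subfield us])
    fix Ks assume Ks: "set Ks \<subseteq> scalars F A" "A.combine Ks us = \<zero>\<^bsub>A\<^esub>"
    \<comment> \<open>The list of coefficients may be longer or shorter than \<open>us\<close>;
      truncating or padding with zeros gives it the right length without changing the
      combination.\<close>
    define Ks' where "Ks' = take (length us) Ks @ replicate (length us - length Ks) \<zero>\<^bsub>A\<^esub>"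
    have z: "\<zero>\<^bsub>A\<^esub> \<in> scalars F A"
      unfolding scalars_def by (rule image_eqI[of _ _ "\<zero>\<^bsub>F\<^esub>"]) auto
    have K': "set Ks' \<subseteq> scalars F A" "length Ks' = length us"
      using Ks(1) z set_take_subset[of "length us" Ks] by (auto simp: Ks'_def)
    have "A.combine Ks' us = A.combine (take (length us) Ks) us"
      unfolding Ks'_def by (rule A.combine_append_replicate[OF us])
    then have "A.combine Ks' us = \<zero>\<^bsub>A\<^esub>" using Ks by (simp add: A.combine_take)
    moreover from scalar_list[OF K'(1)] K'(2) obtain c where
      c: "c \<in> {..<length us} \<rightarrow> carrier F" "Ks' = map (\<lambda>i. c i \<odot>\<^bsub>A\<^esub> \<one>\<^bsub>A\<^esub>) [0..<length us]" by metis
    ultimately have "(\<Oplus>\<^bsub>A\<^esub>i\<in>{..<length us}. c i \<odot>\<^bsub>A\<^esub> us ! i) = \<zero>\<^bsub>A\<^esub>"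
      using combine_finsum[OF us c(1)] by simp
    then have "\<forall>i<length us. c i = \<zero>\<^bsub>F\<^esub>" using ind c(1) by blast
    then have "set Ks' \<subseteq> {\<zero>\<^bsub>A\<^esub>}" unfolding c(2) by auto
    then show "set (take (length us) Ks) \<subseteq> {\<zero>\<^bsub>A\<^esub>}" by (auto simp: Ks'_def)
  qed
qed

lemma finsum_map_nth:
  assumes "v \<in> {..<n} \<rightarrow> carrier A" "c \<in> {..<n} \<rightarrow> carrier F"
  shows "(\<Oplus>\<^bsub>A\<^esub>i\<in>{..<n}. c i \<odot>\<^bsub>A\<^esub> map v [0..<n] ! i) = (\<Oplus>\<^bsub>A\<^esub>i\<in>{..<n}. c i \<odot>\<^bsub>A\<^esub> v i)"
  by (rule A.M.finsum_cong') (use assms in \<open>auto simp: Pi_iff\<close>)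

lemma basis_family:
  assumes v: "v \<in> {..<n} \<rightarrow> carrier A"
    and V: "V = {\<Oplus>\<^bsub>A\<^esub>i\<in>{..<n}. c i \<odot>\<^bsub>A\<^esub> v i | c. c \<in> {..<n} \<rightarrow> carrier F}"
    and ind: "\<And>c. c \<in> {..<n} \<rightarrow> carrier F ==> (\<Oplus>\<^bsub>A\<^esub>i\<in>{..<n}. c i \<odot>\<^bsub>A\<^esub> v i) = \<zero>\<^bsub>A\<^esub> ==> \<forall>i<n. c i = \<zero>\<^bsub>F\<^esub>"
  shows "A.independent (scalars F A) (map v [0..<n])" "A.Span (scalars F A) (map v [0..<n]) = V"
    "A.dimension n (scalars F A) V"
proof -
  have us: "set (map v [0..<n]) \<subseteq> carrier A" using v by auto
  show 1: "A.independent (scalars F A) (map v [0..<n])"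
    unfolding independent_iff[OF us] using ind by (auto simp: finsum_map_nth[OF v])
  show 2: "A.Span (scalars F A) (map v [0..<n]) = V"
    unfolding V using Span_iff[OF us] by (auto simp: finsum_map_nth[OF v])
  show "A.dimension n (scalars F A) V"
    using A.dimensionI[OF scalars_subfield 1 2] by simp
qed

end

section \<open>Kummer extensions\<close>

text \<open>The exponent and the constant stay free because the locale serves twice: for E with
  \<open>n\<close> and \<open>s\<close>, and for the corner \<open>E e_0\<close> with
  \<open>d\<close> and \<open>r\<close>.\<close>

locale kummer = F: field F +
  skew_pres F "self_algebra F" K "\<lambda>c. c \<odot>\<^bsub>K\<^esub> \<one>\<^bsub>K\<^esub>" h "\<lambda>x. x" d c
  for F :: "('f, 'z) ring_scheme" and K :: "('f, 'a, 'k) module_scheme" (structure) and h d c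
begin

lemma c [simp]: "c \<in> carrier F" using a by simp

lemma expand_smult: "u \<in> {..<d} \<rightarrow> carrier F ==> expand u = (\<Oplus>k\<in>{..<d}. u k \<odot> h [^] k)"
  unfolding expand_def by (rule A.M.finsum_cong') (auto simp: Pi_iff A.one_smult_mult)

lemma nontrivial: "\<one> \<noteq> \<zero>"
proof
  assume "\<one> = \<zero>"
  then have "\<one>\<^bsub>F\<^esub> \<odot> \<one> = \<zero>\<^bsub>F\<^esub> \<odot> \<one>" by simp
  then have "\<one>\<^bsub>F\<^esub> = \<zero>\<^bsub>F\<^esub>" by (rule inj_onD[OF f_inj]) simp_all
  then show False by simp
qed

sublocale field_algebra F K
  by (intro field_algebra.intro field_algebra_axioms.intro F.field_axioms A.assoc_algebra_axioms nontrivial)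

lemma pow_d: "h [^] d = c \<odot> \<one>" by (rule pow)

lemma comm_h: "z \<in> carrier K ==> z \<otimes> h = h \<otimes> z"
proof (induction z rule: induct)
  case (mono v k)
  then show ?case by (simp add: A.one_smult_mult A.smult_mult_left A.smult_mult_right A.nat_pow_Suc2[symmetric])
qed (auto simp: A.l_distr A.r_distr)

lemma comm: "z \<in> carrier K ==> w \<in> carrier K ==> z \<otimes> w = w \<otimes> z"
proof (induction z rule: induct)
  case (mono v k)
  have "h [^] k \<otimes> w = w \<otimes> h [^] k"
    using A.group_commutes_pow[of h w k] comm_h mono by simp
  then show ?case using mono by (simp add: A.one_smult_mult A.smult_mult_left A.smult_mult_right)
qed (auto simp: A.l_distr A.r_distr)

lemma cring: "cring K"
  by (intro cring.intro A.ring_axioms comm_monoid.intro A.monoid_axioms comm_monoid_axioms.intro comm)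

lemma basis:
  "A.independent (scalars F K) (map (\<lambda>k. h [^] k) [0..<d])"
  "A.Span (scalars F K) (map (\<lambda>k. h [^] k) [0..<d]) = carrier K"
  "A.dimension d (scalars F K) (carrier K)"
proof -
  have v: "(\<lambda>k. h [^] k) \<in> {..<d} \<rightarrow> carrier K" by simp
  have V: "carrier K = {\<Oplus>i\<in>{..<d}. u i \<odot> h [^] i | u. u \<in> {..<d} \<rightarrow> carrier F}"
  proof (intro equalityI subsetI)
    fix z assume "z \<in> carrier K"
    then show "z \<in> {\<Oplus>i\<in>{..<d}. u i \<odot> h [^] i | u. u \<in> {..<d} \<rightarrow> carrier F}"
      using span[of z] expand_smult by fastforce
  qed (auto simp: Pi_iff intro!: A.M.finsum_closed)
  have ind: "\<forall>i<d. u i = \<zero>\<^bsub>F\<^esub>" if "u \<in> {..<d} \<rightarrow> carrier F" "(\<Oplus>i\<in>{..<d}. u i \<odot> h [^] i) = \<zero>" for u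
    using indep[of u] that by (simp add: expand_smult)
  note b = basis_family[where v = "\<lambda>k. h [^] k" and n = d and V = "carrier K", OF v V ind]
  show "A.independent (scalars F K) (map (\<lambda>k. h [^] k) [0..<d])"
    "A.Span (scalars F K) (map (\<lambda>k. h [^] k) [0..<d]) = carrier K"
    "A.dimension d (scalars F K) (carrier K)" using b by auto
qed

end

lemma (in field_algebra) mult_matrix_exists:
  assumes us: "set us \<subseteq> carrier A" and b: "\<And>j. j < length us ==> b \<otimes>\<^bsub>A\<^esub> us ! j \<in> A.Span (scalars F A) us"
  shows "\<exists>N. \<forall>j<length us. (\<forall>i<length us. N i j \<in> carrier F) \<and>
    b \<otimes>\<^bsub>A\<^esub> us ! j = (\<Oplus>\<^bsub>A\<^esub>i\<in>{..<length us}. N i j \<odot>\<^bsub>A\<^esub> us ! i)"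
proof -
  have "\<forall>j. \<exists>c. j < length us \<longrightarrow> c \<in> {..<length us} \<rightarrow> carrier F \<and>
      b \<otimes>\<^bsub>A\<^esub> us ! j = (\<Oplus>\<^bsub>A\<^esub>i\<in>{..<length us}. c i \<odot>\<^bsub>A\<^esub> us ! i)"
    using b Span_iff[OF us] by blast
  from choice[OF this] obtain C where C: "\<forall>j. j < length us \<longrightarrow> C j \<in> {..<length us} \<rightarrow> carrier F \<and>
      b \<otimes>\<^bsub>A\<^esub> us ! j = (\<Oplus>\<^bsub>A\<^esub>i\<in>{..<length us}. C j i \<odot>\<^bsub>A\<^esub> us ! i)" ..
  show ?thesis by (rule exI[of _ "\<lambda>i j. C j i"]) (use C in \<open>auto simp: Pi_iff\<close>)
qed

text \<open>If multiplication by \<open>h\<close> preserves a \<open>k\<close>-dimensional subspace then its determinant there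
  is a \<open>d\<close>-th root of \<open>c\<^sup>k\<close>.\<close>

lemma (in kummer) invariant_subspace_det:
  assumes us: "set us \<subseteq> carrier K" "A.independent (scalars F K) us"
    and inv: "\<And>j. j < length us ==> h \<otimes> us ! j \<in> A.Span (scalars F K) us"
  shows "\<exists>\<delta>\<in>carrier F. \<delta> [^]\<^bsub>F\<^esub> d = c [^]\<^bsub>F\<^esub> length us"
proof -
  let ?k = "length us"
  have usj [simp]: "us ! j \<in> carrier K" if "j < ?k" for j using us(1) that by auto
  from mult_matrix_exists[OF us(1) inv] obtain N where
    N: "\<And>i j. i < ?k ==> j < ?k ==> N i j \<in> carrier F"
    and hN: "\<And>j. j < ?k ==> h \<otimes> us ! j = (\<Oplus>i\<in>{..<?k}. N i j \<odot> us ! i)" by blast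
  have det: "ring_det F ?k N \<in> carrier F" using N by (rule F.ring_det_closed)
  have "\<exists>M. (\<forall>i<?k. \<forall>j<?k. M i j \<in> carrier F) \<and>
      (\<forall>j<?k. h [^] e \<otimes> us ! j = (\<Oplus>i\<in>{..<?k}. M i j \<odot> us ! i)) \<and>
      ring_det F ?k M = ring_det F ?k N [^]\<^bsub>F\<^esub> e" for e :: nat
  proof (induction e)
    case 0
    let ?M = "\<lambda>i j. if i = j then \<one>\<^bsub>F\<^esub> else \<zero>\<^bsub>F\<^esub>"
    have "(\<Oplus>i\<in>{..<?k}. ?M i j \<odot> us ! i) = us ! j" if j: "j < ?k" for j
    proof -
      have "(\<Oplus>i\<in>{..<?k}. ?M i j \<odot> us ! i) = (\<Oplus>i\<in>{..<?k}. if i = j then us ! j else \<zero>)"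
        by (rule A.M.finsum_cong') (use j in auto)
      then show ?thesis using j by (simp add: A.finsum_delta)
    qed
    moreover have "ring_det F ?k ?M = \<one>\<^bsub>F\<^esub>"
      using F.ring_det_diagonal[of ?k "\<lambda>_. \<one>\<^bsub>F\<^esub>"] by simp
    ultimately show ?case by (intro exI[of _ ?M]) auto
  next
    case (Suc e)
    then obtain M where M: "\<And>i j. i < ?k ==> j < ?k ==> M i j \<in> carrier F"
      and hM: "\<And>j. j < ?k ==> h [^] e \<otimes> us ! j = (\<Oplus>i\<in>{..<?k}. M i j \<odot> us ! i)"
      and dM: "ring_det F ?k M = ring_det F ?k N [^]\<^bsub>F\<^esub> e" by blast
    let ?M = "\<lambda>i j. \<Oplus>\<^bsub>F\<^esub>l\<in>{..<?k}. N i l \<otimes>\<^bsub>F\<^esub> M l j"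
    have "h [^] Suc e \<otimes> us ! j = (\<Oplus>i\<in>{..<?k}. ?M i j \<odot> us ! i)" if j: "j < ?k" for j
    proof -
      have "h [^] Suc e \<otimes> us ! j = h \<otimes> (h [^] e \<otimes> us ! j)"
        using j by (simp only: A.nat_pow_Suc2 y A.m_assoc A.nat_pow_closed usj)
      also have "\<dots> = (\<Oplus>l\<in>{..<?k}. h \<otimes> (M l j \<odot> us ! l))"
        unfolding hM[OF j] using M j by (subst A.mult_finsum) auto
      also have "\<dots> = (\<Oplus>l\<in>{..<?k}. \<Oplus>i\<in>{..<?k}. (N i l \<otimes>\<^bsub>F\<^esub> M l j) \<odot> us ! i)"
      proof (rule A.M.finsum_cong'[OF refl])
        fix l assume l: "l \<in> {..<?k}"
        have "h \<otimes> (M l j \<odot> us ! l) = M l j \<odot> (\<Oplus>i\<in>{..<?k}. N i l \<odot> us ! i)"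
          using M j l by (simp add: A.smult_mult_right hN)
        also have "\<dots> = (\<Oplus>i\<in>{..<?k}. (N i l \<otimes>\<^bsub>F\<^esub> M l j) \<odot> us ! i)"
          using M N j l by (subst A.smult_finsum)
            (auto simp: A.smult_assoc1[symmetric] F.m_comm intro!: A.M.finsum_cong')
        finally show "h \<otimes> (M l j \<odot> us ! l) = (\<Oplus>i\<in>{..<?k}. (N i l \<otimes>\<^bsub>F\<^esub> M l j) \<odot> us ! i)" .
      qed (use M N j in \<open>auto intro!: A.M.finsum_closed\<close>)
      also have "\<dots> = (\<Oplus>i\<in>{..<?k}. \<Oplus>l\<in>{..<?k}. (N i l \<otimes>\<^bsub>F\<^esub> M l j) \<odot> us ! i)"
        using M N j by (intro A.M.finsum_swap) auto
      also have "\<dots> = (\<Oplus>i\<in>{..<?k}. ?M i j \<odot> us ! i)"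
        using M N j by (intro A.M.finsum_cong') (auto simp: A.finsum_smult intro!: F.finsum_closed)
      finally show ?thesis .
    qed
    moreover have "ring_det F ?k ?M = ring_det F ?k N [^]\<^bsub>F\<^esub> Suc e"
      using F.ring_det_mult[of ?k N M] M N det by (simp add: dM F.m_comm)
    ultimately show ?case
      using M N by (intro exI[of _ ?M]) (auto intro!: F.finsum_closed)
  qed
  from this[of d] obtain M where M: "\<And>i j. i < ?k ==> j < ?k ==> M i j \<in> carrier F"
    and hM: "\<And>j. j < ?k ==> h [^] d \<otimes> us ! j = (\<Oplus>i\<in>{..<?k}. M i j \<odot> us ! i)"
    and dM: "ring_det F ?k M = ring_det F ?k N [^]\<^bsub>F\<^esub> d" by blast
  \<comment> \<open>\<open>h^d\<close> acts as the scalar \<open>c\<close>, and independence of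
    \<open>us\<close> forces its matrix to be \<open>c\<close> times the identity, whose determinant
    is \<open>c^k\<close>.\<close>
  have "M i j = (if i = j then c else \<zero>\<^bsub>F\<^esub>)" if i: "i < ?k" and j: "j < ?k" for i j
  proof -
    let ?e = "\<lambda>i. if i = j then c else \<zero>\<^bsub>F\<^esub>"
    have "(\<Oplus>i\<in>{..<?k}. ?e i \<odot> us ! i) = (\<Oplus>i\<in>{..<?k}. if i = j then c \<odot> us ! j else \<zero>)"
      by (rule A.M.finsum_cong') (use j in auto)
    also have "\<dots> = (\<Oplus>i\<in>{..<?k}. M i j \<odot> us ! i)"
      unfolding hM[OF j, symmetric] using j by (simp add: A.finsum_delta pow_d A.one_smult_mult)
    finally have eq: "(\<Oplus>i\<in>{..<?k}. M i j \<odot> us ! i) = (\<Oplus>i\<in>{..<?k}. ?e i \<odot> us ! i)" ..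
    have "(\<Oplus>i\<in>{..<?k}. (M i j \<ominus>\<^bsub>F\<^esub> ?e i) \<odot> us ! i) =
        (\<Oplus>i\<in>{..<?k}. M i j \<odot> us ! i \<oplus> (\<ominus>\<^bsub>F\<^esub> \<one>\<^bsub>F\<^esub>) \<odot> (?e i \<odot> us ! i))"
      using M j by (intro A.M.finsum_cong')
        (auto simp: a_minus_def A.smult_l_distr A.smult_minus_one A.smult_l_minus)
    also have "\<dots> = (\<Oplus>i\<in>{..<?k}. M i j \<odot> us ! i) \<oplus> (\<Oplus>i\<in>{..<?k}. (\<ominus>\<^bsub>F\<^esub> \<one>\<^bsub>F\<^esub>) \<odot> (?e i \<odot> us ! i))"
      using M j by (intro A.M.finsum_addf) auto
    also have "(\<Oplus>i\<in>{..<?k}. (\<ominus>\<^bsub>F\<^esub> \<one>\<^bsub>F\<^esub>) \<odot> (?e i \<odot> us ! i)) = (\<ominus>\<^bsub>F\<^esub> \<one>\<^bsub>F\<^esub>) \<odot> (\<Oplus>i\<in>{..<?k}. ?e i \<odot> us ! i)"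
      by (rule A.smult_finsum[symmetric]) auto
    also have "(\<Oplus>i\<in>{..<?k}. M i j \<odot> us ! i) \<oplus> \<dots> = \<zero>"
    proof -
      have "(\<Oplus>i\<in>{..<?k}. ?e i \<odot> us ! i) \<in> carrier K" by (rule A.M.finsum_closed) auto
      then show ?thesis unfolding eq by (simp add: A.smult_minus_one A.M.r_neg del: A.smult_closed)
    qed
    finally have zero: "(\<Oplus>i\<in>{..<?k}. (M i j \<ominus>\<^bsub>F\<^esub> ?e i) \<odot> us ! i) = \<zero>" .
    have "(\<lambda>i. M i j \<ominus>\<^bsub>F\<^esub> ?e i) \<in> {..<?k} \<rightarrow> carrier F" using M j by auto
    from mp[OF bspec[OF us(2)[unfolded independent_iff[OF us(1)]] this]] zero
    have "\<forall>i<?k. M i j \<ominus>\<^bsub>F\<^esub> ?e i = \<zero>\<^bsub>F\<^esub>" by blast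
    then have "M i j \<ominus>\<^bsub>F\<^esub> ?e i = \<zero>\<^bsub>F\<^esub>" using i by blast
    then show ?thesis using M[OF i j] by (auto simp: F.r_right_minus_eq)
  qed
  then have "ring_det F ?k M = ring_det F ?k (\<lambda>i j. if i = j then c else \<zero>\<^bsub>F\<^esub>)"
    using M by (intro F.ring_det_cong) auto
  also have "\<dots> = (\<Otimes>\<^bsub>F\<^esub>i\<in>{..<?k}. c)" by (rule F.ring_det_diagonal) simp
  also have "\<dots> = c [^]\<^bsub>F\<^esub> ?k" by (simp add: F.finprod_const)
  finally show ?thesis using dM det by metis
qed

text \<open>Every nonzero element \<open>x\<close> is invertible because the ideal
  \<open>K x\<close> has full dimension. If its dimension k were smaller than d,
  \<open>invariant_subspace_det\<close> would provide \<open>\<delta>\<close> with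
  \<open>\<delta>^d = c^k\<close>; this leads to an e-th root of \<open>c\<close> in F, where
  \<open>e = d / gcd k d\<close> exceeds 1 and divides d.\<close>

lemma (in kummer) field_if_no_roots:
  assumes c0: "c \<noteq> \<zero>\<^bsub>F\<^esub>" and omega: "root_of_unity F d \<omega>"
    and no_root: "\<And>k u. 1 < k ==> k dvd d ==> u \<in> carrier F ==> u [^]\<^bsub>F\<^esub> k \<noteq> c"
  shows "field K"
proof (rule cring.cring_fieldI2[OF cring])
  show "\<zero> \<noteq> \<one>" using nontrivial by simp
  fix x assume x: "x \<in> carrier K" "x \<noteq> \<zero>"
  interpret om: root_of_unity F d \<omega> by fact
  interpret K: cring K by (rule cring)
  note sf = scalars_subfield
  let ?M = "(\<lambda>y. y \<otimes> x) ` carrier K"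
  have sub: "subalgebra (scalars F K) ?M K"
    by (rule A.ideal_is_subalgebra[OF scalars_closed])
      (use K.cgenideal_ideal[OF x(1)] in \<open>simp add: cgenideal_def image_def Bex_def conj_commute\<close>)
  have MK: "?M \<subseteq> carrier K" using x by auto
  obtain k where k: "A.dimension k (scalars F K) ?M"
    using A.subalbegra_incl_imp_finite_dimension[OF sf A.finite_dimensionI[OF basis(3)] sub MK]
    by (auto simp: A.finite_dimension_def)
  obtain us where us: "set us \<subseteq> carrier K" "A.independent (scalars F K) us" "length us = k"
    "A.Span (scalars F K) us = ?M"
    using A.exists_base[OF sf k] by blast
  have usM: "set us \<subseteq> ?M" using A.Span_base_incl[OF sf us(1)] us(4) by simp
  have "\<one> \<otimes> x \<in> ?M" by blast
  then have xM: "x \<in> ?M" using x by simp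
  have k0: "k \<noteq> 0"
  proof
    assume "k = 0"
    then have "?M = {\<zero>}" using k by (intro A.dimension_zero[OF sf]) simp
    then show False using xM x by simp
  qed
  have kd: "k \<le> d" using A.independent_length_le_dimension[OF sf basis(3) us(2)] us by simp
  have "k = d"
  proof (rule ccontr)
    assume "k \<noteq> d"
    have "h \<otimes> us ! j \<in> A.Span (scalars F K) us" if j: "j < length us" for j
    proof -
      obtain w where w: "w \<in> carrier K" "us ! j = w \<otimes> x" using usM j nth_mem by blast
      then have "h \<otimes> us ! j = (h \<otimes> w) \<otimes> x" using x by (simp add: A.m_assoc)
      then show ?thesis unfolding us(4) by (rule image_eqI) (use w in simp)
    qed
    from invariant_subspace_det[OF us(1,2) this, unfolded us(3)] obtain \<delta> where
      \<delta>: "\<delta> \<in> carrier F" "\<delta> [^]\<^bsub>F\<^esub> d = c [^]\<^bsub>F\<^esub> k" ..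
    define g where "g = gcd k d"
    have "g \<le> k" unfolding g_def using k0 by (rule gcd_le1_nat)
    then have "g < d" using kd \<open>k \<noteq> d\<close> by linarith
    then have g: "0 < g" "g dvd d" "g < d" using k0 by (simp_all add: g_def)
    \<comment> \<open>Bezout coefficients in the natural numbers: \<open>k i - d j\<close> is the
      greatest common divisor of k and d.\<close>
    obtain i j where ij: "k * i = d * j + g" using bezout_nat[OF k0, of d] unfolding g_def by blast
    define e where "e = d div g"
    have e: "d = e * g" using g(2) by (simp add: e_def)
    then have "e \<noteq> 0" "e \<noteq> 1" using g by auto
    then have e: "d = e * g" "1 < e" "e dvd d" using e by auto
    \<comment> \<open>With \<open>w = \<delta>^i c^(-j)\<close> the d-th power is
      \<open>c^(k i - d j) = c^g\<close>.\<close>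
    define w where "w = \<delta> [^]\<^bsub>F\<^esub> i \<otimes>\<^bsub>F\<^esub> inv\<^bsub>F\<^esub> c [^]\<^bsub>F\<^esub> j"
    have w: "w \<in> carrier F" using \<delta> c0 by (simp add: w_def)
    have "w [^]\<^bsub>F\<^esub> d = \<delta> [^]\<^bsub>F\<^esub> (i * d) \<otimes>\<^bsub>F\<^esub> inv\<^bsub>F\<^esub> c [^]\<^bsub>F\<^esub> (j * d)"
      using \<delta> c0 by (simp add: w_def F.pow_mult_distrib F.m_comm F.nat_pow_pow)
    also have "\<delta> [^]\<^bsub>F\<^esub> (i * d) = (\<delta> [^]\<^bsub>F\<^esub> d) [^]\<^bsub>F\<^esub> i"
      by (simp only: F.nat_pow_pow[OF \<delta>(1)] mult.commute)
    also have "\<dots> = c [^]\<^bsub>F\<^esub> g \<otimes>\<^bsub>F\<^esub> c [^]\<^bsub>F\<^esub> (d * j)"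
      unfolding \<delta>(2) by (simp add: F.nat_pow_pow ij F.nat_pow_mult add.commute)
    also have "c [^]\<^bsub>F\<^esub> g \<otimes>\<^bsub>F\<^esub> c [^]\<^bsub>F\<^esub> (d * j) \<otimes>\<^bsub>F\<^esub> inv\<^bsub>F\<^esub> c [^]\<^bsub>F\<^esub> (j * d) = c [^]\<^bsub>F\<^esub> g"
      using c0 by (simp add: F.m_assoc mult.commute)
    finally have wg: "(w [^]\<^bsub>F\<^esub> e) [^]\<^bsub>F\<^esub> g = c [^]\<^bsub>F\<^esub> g" using w e(1) by (simp add: F.nat_pow_pow)
    have w0: "w \<noteq> \<zero>\<^bsub>F\<^esub>"
    proof
      assume "w = \<zero>\<^bsub>F\<^esub>"
      then have "(\<zero>\<^bsub>F\<^esub> [^]\<^bsub>F\<^esub> e) [^]\<^bsub>F\<^esub> g = \<zero>\<^bsub>F\<^esub>" using g e by (simp add: F.nat_pow_zero)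
      then have "c [^]\<^bsub>F\<^esub> g = \<zero>\<^bsub>F\<^esub>" unfolding wg[symmetric] \<open>w = \<zero>\<^bsub>F\<^esub>\<close> .
      then show False using F.pow_neq_zero[OF c c0] by blast
    qed
    \<comment> \<open>\<open>c\<close> and \<open>w^e\<close> have the same g-th power, so
      \<open>z\<close> is a g-th root of unity. The primitive g-th root at hand is
      \<open>\<omega>^e\<close>, hence \<open>z\<close> is itself an e-th power, and with it
      \<open>c\<close>.\<close>
    define z where "z = c \<otimes>\<^bsub>F\<^esub> inv\<^bsub>F\<^esub> (w [^]\<^bsub>F\<^esub> e)"
    have z: "z \<in> carrier F" using w w0 by (simp add: z_def)
    have "z [^]\<^bsub>F\<^esub> g = c [^]\<^bsub>F\<^esub> g \<otimes>\<^bsub>F\<^esub> inv\<^bsub>F\<^esub> (w [^]\<^bsub>F\<^esub> e) [^]\<^bsub>F\<^esub> g"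
      using w w0 by (simp add: z_def F.pow_mult_distrib F.m_comm)
    also have "\<dots> = \<one>\<^bsub>F\<^esub>" unfolding wg[symmetric] using w w0 by simp
    finally have zg: "z [^]\<^bsub>F\<^esub> g = \<one>\<^bsub>F\<^esub>" .
    interpret og: root_of_unity F g "\<omega> [^]\<^bsub>F\<^esub> e"
      using om.root_of_unity_div[OF g(2,1)] by (simp add: e_def)
    from og.roots_of_unity[OF z zg] obtain l where "z = (\<omega> [^]\<^bsub>F\<^esub> e) [^]\<^bsub>F\<^esub> (l::nat)" ..
    then have zl: "z = (\<omega> [^]\<^bsub>F\<^esub> l) [^]\<^bsub>F\<^esub> e" by (simp add: F.nat_pow_pow mult.commute)
    have "c = z \<otimes>\<^bsub>F\<^esub> w [^]\<^bsub>F\<^esub> e" using w w0 by (simp add: z_def F.m_assoc)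
    also have "\<dots> = (\<omega> [^]\<^bsub>F\<^esub> l \<otimes>\<^bsub>F\<^esub> w) [^]\<^bsub>F\<^esub> e" using w by (simp add: zl F.pow_mult_distrib F.m_comm)
    finally show False using no_root[OF e(2,3), of "\<omega> [^]\<^bsub>F\<^esub> l \<otimes>\<^bsub>F\<^esub> w"] w by simp
  qed
  then have "A.Span (scalars F K) us = carrier K"
    using A.independent_length_eq_dimension[OF sf basis(3) us(2,1)] us(3) by simp
  then obtain y where "y \<in> carrier K" "\<one> = y \<otimes> x" using us(4) by (metis A.one_closed imageE)
  then show "\<exists>b\<in>carrier K. x \<otimes> b = \<one>" using comm x by force
qed

section \<open>Cyclic Kummer extensions: Galois group and norm\<close>

lemma (in assoc_algebra) smult_mult_smult:
  "c \<in> carrier R ==> b \<in> carrier R ==> x \<in> carrier M ==> y \<in> carrier M ==>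
    (c \<odot>\<^bsub>M\<^esub> x) \<otimes>\<^bsub>M\<^esub> (b \<odot>\<^bsub>M\<^esub> y) = (c \<otimes>\<^bsub>R\<^esub> b) \<odot>\<^bsub>M\<^esub> (x \<otimes>\<^bsub>M\<^esub> y)"
  by (subst smult_mult_left) (auto simp: smult_mult_right smult_assoc1)

lemma skew_pres_transport:
  assumes "skew_pres F D A f y \<sigma> d a" "\<psi> \<in> alg_iso F A B" "assoc_algebra F B"
  shows "skew_pres F D B (\<lambda>u. \<psi> (f u)) (\<psi> y) \<sigma> d a"
proof -
  interpret skew_pres F D A f y \<sigma> d a by fact
  interpret psi: alg_homomorphism F A B \<psi>
    using assms(2,3) A.assoc_algebra_axioms
    by (intro alg_homomorphism.intro alg_homomorphism_axioms.intro alg_isoD(1))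
  have bij: "inj_on \<psi> (carrier A)" "\<psi> ` carrier A = carrier B"
    using alg_isoD(2)[OF assms(2)] by (auto simp: bij_betw_def)
  have "skew_rel F D B (\<lambda>u. \<psi> (f u)) (\<psi> y) \<sigma> d a"
  proof (intro skew_rel.intro skew_rel_axioms.intro D.assoc_algebra_axioms assms(3) sigma a d)
    show "(\<lambda>u. \<psi> (f u)) \<in> alg_hom F D B" using alg_hom_comp[OF f psi.hom] .
    show "\<psi> y \<in> carrier B" by simp
    show "\<psi> y \<otimes>\<^bsub>B\<^esub> \<psi> (f u) = \<psi> (f (\<sigma> u)) \<otimes>\<^bsub>B\<^esub> \<psi> y" if "u \<in> carrier D" for u
      using that arg_cong[OF rel[OF that], of \<psi>] by simp
    show "\<psi> y [^]\<^bsub>B\<^esub> d = \<psi> (f a)" using arg_cong[OF pow, of \<psi>] by simp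
  qed
  then interpret B: skew_rel F D B "\<lambda>u. \<psi> (f u)" "\<psi> y" \<sigma> d a .
  have exp: "B.expand u = \<psi> (expand u)" if "u \<in> {..<d} \<rightarrow> carrier D" for u
    unfolding B.expand_def expand_def using that
    by (subst psi.finsum) (auto simp: Pi_iff intro!: psi.B.M.finsum_cong')
  show ?thesis
  proof (intro skew_pres.intro skew_pres_axioms.intro B.skew_rel_axioms)
    fix z assume "z \<in> carrier B"
    then obtain w where w: "w \<in> carrier A" "z = \<psi> w" using bij by blast
    then obtain u where "u \<in> {..<d} \<rightarrow> carrier D" "w = expand u" using span by blast
    then show "\<exists>u\<in>{..<d} \<rightarrow> carrier D. z = B.expand u" using w exp by auto
  next
    fix u k assume u: "u \<in> {..<d} \<rightarrow> carrier D" "B.expand u = \<zero>\<^bsub>B\<^esub>" and k: "k < d"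
    then have "\<psi> (expand u) = \<psi> \<zero>\<^bsub>A\<^esub>" by (simp add: exp)
    then have "expand u = \<zero>\<^bsub>A\<^esub>" by (rule inj_onD[OF bij(1)]) (use u in simp_all)
    then show "u k = \<zero>\<^bsub>D\<^esub>" using indep u k by blast
  qed
qed

lemma kummer_transport:
  assumes "kummer F K h d c" "\<psi> \<in> alg_iso F K B" "assoc_algebra F B"
  shows "kummer F B (\<psi> h) d c"
proof -
  interpret kummer F K h d c by fact
  have "skew_pres F (self_algebra F) B (\<lambda>u. u \<odot>\<^bsub>B\<^esub> \<one>\<^bsub>B\<^esub>) (\<psi> h) (\<lambda>x. x) d c"
    by (rule skew_pres_cong[OF skew_pres_transport[OF skew_pres_axioms assms(2,3)]])
      (simp add: alg_homD[OF alg_isoD(1)[OF assms(2)]])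
  then show ?thesis by (intro kummer.intro F.field_axioms)
qed

text \<open>Meant both for E, which is a product of fields, and for \<open>E e_0\<close>; the latter
  is treated further in \<open>kummer_cyclic\<close>.\<close>

locale kummer_aut = kummer F K h d c + om: root_of_unity F d \<omega>
  for F :: "('f, 'z) ring_scheme" and K :: "('f, 'a, 'k) module_scheme" (structure) and h d c \<omega> +
  fixes \<sigma> :: "'a => 'a"
  assumes aut: "\<sigma> \<in> alg_hom F K K" and aut_h: "\<sigma> h = \<omega> \<odot>\<^bsub>K\<^esub> h"
begin

lemma aut_pow: "alg_homomorphism F K K (\<sigma> ^^ k)"
  by unfold_locales (rule alg_hom_funpow[OF aut])

lemma aut_pow_hom: "\<sigma> ^^ k \<in> alg_hom F K K" by (rule alg_hom_funpow[OF aut])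

lemma aut_closed [simp]: "z \<in> carrier K ==> (\<sigma> ^^ k) z \<in> carrier K"
  using alg_homD(1)[OF aut_pow_hom] .

lemma aut_pow_h: "(\<sigma> ^^ k) h = (\<omega> [^]\<^bsub>F\<^esub> k) \<odot> h"
proof (induction k)
  case (Suc k)
  then show ?case
    using alg_homD(5)[OF aut, of "\<omega> [^]\<^bsub>F\<^esub> k" h] by (simp add: aut_h A.smult_assoc1)
qed simp

lemma aut_pow_h_pow: "(\<sigma> ^^ k) (h [^] l) = (\<omega> [^]\<^bsub>F\<^esub> (k * l)) \<odot> h [^] l"
  using alg_homomorphism.pow[OF aut_pow, of h k l]
  by (simp add: aut_pow_h A.smult_pow F.nat_pow_pow)

lemma aut_expand:
  assumes u: "u \<in> {..<d} \<rightarrow> carrier F"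
  shows "(\<sigma> ^^ k) (expand u) = expand (\<lambda>i. \<omega> [^]\<^bsub>F\<^esub> (k * i) \<otimes>\<^bsub>F\<^esub> u i)"
proof -
  have "(\<sigma> ^^ k) (expand u) = (\<Oplus>i\<in>{..<d}. (\<sigma> ^^ k) (u i \<odot> h [^] i))"
    unfolding expand_smult[OF u] using u by (subst alg_homomorphism.finsum[OF aut_pow]) auto
  also have "\<dots> = (\<Oplus>i\<in>{..<d}. (\<omega> [^]\<^bsub>F\<^esub> (k * i) \<otimes>\<^bsub>F\<^esub> u i) \<odot> h [^] i)"
    using u by (intro A.M.finsum_cong')
      (auto simp: Pi_iff alg_homD(5)[OF aut_pow_hom] aut_pow_h_pow A.smult_assoc1[symmetric] F.m_comm)
  also have "\<dots> = expand (\<lambda>i. \<omega> [^]\<^bsub>F\<^esub> (k * i) \<otimes>\<^bsub>F\<^esub> u i)"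
    using u by (subst expand_smult) (auto simp: Pi_iff)
  finally show ?thesis .
qed

lemma aut_order: "z \<in> carrier K ==> (\<sigma> ^^ d) z = z"
proof -
  assume "z \<in> carrier K"
  then obtain u where u: "u \<in> {..<d} \<rightarrow> carrier F" "z = expand u" using span by auto
  have "\<omega> [^]\<^bsub>F\<^esub> (d * i) = \<one>\<^bsub>F\<^esub>" for i by (simp add: om.root_pow_eq_one)
  then show ?thesis unfolding u(2) using aut_expand[OF u(1), of d] u(1)
    by (auto simp: Pi_iff intro: expand_cong)
qed

text \<open>\<open>\<sigma>\<close> multiplies the coefficient of \<open>h^i\<close> by
  \<open>\<omega>^i\<close>, and this differs from 1 for 0 < i < d.\<close>

lemma fixed_scalar:
  assumes z: "z \<in> carrier K" "\<sigma> z = z"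
  shows "z \<in> scalars F K"
proof -
  obtain u where u: "u \<in> {..<d} \<rightarrow> carrier F" "z = expand u" using span z by auto
  have "u i = \<zero>\<^bsub>F\<^esub>" if i: "i < d" "i \<noteq> 0" for i
  proof -
    have "expand (\<lambda>i. \<omega> [^]\<^bsub>F\<^esub> (1 * i) \<otimes>\<^bsub>F\<^esub> u i) = expand u"
      using aut_expand[OF u(1), of 1] z u by simp
    then have "\<omega> [^]\<^bsub>F\<^esub> (1 * i) \<otimes>\<^bsub>F\<^esub> u i = u i"
      using u i by (intro expand_inj) (auto simp: Pi_iff)
    then have "(\<omega> [^]\<^bsub>F\<^esub> i \<ominus>\<^bsub>F\<^esub> \<one>\<^bsub>F\<^esub>) \<otimes>\<^bsub>F\<^esub> u i = \<zero>\<^bsub>F\<^esub>"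
      using u i by (simp add: Pi_iff a_minus_def F.l_distr F.l_minus F.r_neg)
    moreover have "\<omega> [^]\<^bsub>F\<^esub> i \<ominus>\<^bsub>F\<^esub> \<one>\<^bsub>F\<^esub> \<noteq> \<zero>\<^bsub>F\<^esub>"
      using om.root_pow_eq_one[of i] i by (auto dest: dvd_imp_le)
    ultimately show ?thesis using u i F.integral[of "\<omega> [^]\<^bsub>F\<^esub> i \<ominus>\<^bsub>F\<^esub> \<one>\<^bsub>F\<^esub>" "u i"] by (auto simp: Pi_iff)
  qed
  then have "expand u = expand (\<lambda>i. if i = 0 then u 0 else \<zero>\<^bsub>F\<^esub>)"
    using u d by (intro expand_cong) auto
  also have "\<dots> = u 0 \<odot> \<one>"
    using expand_single[of "u 0" 0, unfolded self_algebra_simps] u d by (simp add: Pi_iff)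
  finally show ?thesis using u d by (auto simp: scalars_def Pi_iff)
qed

lemma hom_ext:
  assumes "f \<in> alg_hom F K K" "g \<in> alg_hom F K K" "f h = g h" "z \<in> carrier K"
  shows "f z = g z"
  using assms(4)
proof (induction z rule: induct)
  case (mono v k)
  interpret f: alg_homomorphism F K K f by unfold_locales fact
  interpret g: alg_homomorphism F K K g by unfold_locales fact
  show ?case using mono assms(3) by (simp add: A.one_smult_mult)
next
  case zero
  show ?case
    using alg_homomorphism.zero[of F K K f] alg_homomorphism.zero[of F K K g] assms(1,2)
    by (simp add: alg_homomorphism_def alg_homomorphism_axioms_def A.assoc_algebra_axioms)
next
  case (add z w)
  then show ?case using assms(1,2) by (simp add: alg_homD)
qed

lemma aut_bij: "bij_betw (\<sigma> ^^ k) (carrier K) (carrier K)"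
proof -
  have 1: "bij_betw \<sigma> (carrier K) (carrier K)"
  proof (rule bij_betw_byWitness[where f' = "\<sigma> ^^ (d - 1)"])
    have "\<sigma> ^^ d = \<sigma> ^^ (d - 1) \<circ> \<sigma>" "\<sigma> ^^ d = \<sigma> \<circ> \<sigma> ^^ (d - 1)"
      using d funpow_Suc_right[of "d - 1" \<sigma>] funpow.simps(2)[of "d - 1" \<sigma>] by simp_all
    note e = this
    have *: "(\<sigma> ^^ d) z = (\<sigma> ^^ (d - 1)) (\<sigma> z)" "(\<sigma> ^^ d) z = \<sigma> ((\<sigma> ^^ (d - 1)) z)" for z
      using fun_cong[OF e(1), of z] fun_cong[OF e(2), of z] by (simp_all only: comp_apply)
    show "\<forall>z\<in>carrier K. (\<sigma> ^^ (d - 1)) (\<sigma> z) = z" using aut_order *(1) by metis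
    show "\<forall>z\<in>carrier K. \<sigma> ((\<sigma> ^^ (d - 1)) z) = z" using aut_order *(2) by metis
    show "\<sigma> ` carrier K \<subseteq> carrier K" using alg_homD(1)[OF aut] by blast
    show "(\<sigma> ^^ (d - 1)) ` carrier K \<subseteq> carrier K" using aut_closed by blast
  qed
  show ?thesis
  proof (induction k)
    case 0 show ?case by (simp add: bij_betw_def inj_on_def)
  next
    case (Suc k)
    show ?case unfolding funpow.simps(2) by (rule bij_betw_trans[OF Suc 1])
  qed
qed

end

locale kummer_cyclic = kummer_aut F K h d c \<omega> \<sigma>
  for F :: "('f, 'z) ring_scheme" and K :: "('f, 'a, 'k) module_scheme" (structure) and h d c \<omega> \<sigma> +
  assumes field_K: "field K" and c0: "c \<noteq> \<zero>\<^bsub>F\<^esub>"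
begin

sublocale K: field K by (rule field_K)

text \<open>The restriction makes the map extensional, as membership in \<open>Bij\<close>
  demands.\<close>

definition gal :: "nat => 'a => 'a" where "gal k = restrict (\<sigma> ^^ k) (carrier K)"

lemma alg_hom_restrict: "f \<in> alg_hom F K K ==> restrict f (carrier K) \<in> alg_hom F K K"
  by (rule alg_homI) (simp_all add: alg_homD)

lemma gal_closed: "gal k \<in> carrier (galois_group F K)"
proof -
  have "gal k \<in> alg_hom F K K" unfolding gal_def by (rule alg_hom_restrict[OF aut_pow_hom])
  moreover have "gal k \<in> Bij (carrier K)"
    using aut_bij[of k] by (auto simp: gal_def Bij_def bij_betw_def inj_on_def)
  ultimately show ?thesis by (simp add: galois_group_def)
qed

text \<open>An automorphism fixes \<open>h^d = c\<close>, so the quotient of \<open>\<tau> h\<close>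
  by \<open>h\<close> is a d-th root of unity in the field K, that is, some
  \<open>\<omega>^j\<close>. Then \<open>\<tau>\<close> and the j-th power of
  \<open>\<sigma>\<close> agree on the generator.\<close>

lemma gal_surj:
  assumes "\<tau> \<in> carrier (galois_group F K)"
  shows "\<exists>k. \<tau> = gal k"
proof -
  have t: "\<tau> \<in> alg_hom F K K" "\<tau> \<in> extensional (carrier K)"
    using assms by (auto simp: galois_group_def Bij_def)
  interpret t: alg_homomorphism F K K \<tau> by unfold_locales fact
  have hd: "h [^] d \<noteq> \<zero>" using scalar_zero[OF c] c0 by (auto simp: pow_d)
  have h0: "h \<noteq> \<zero>" using hd d by (auto simp: A.nat_pow_zero)
  let ?y = "\<tau> h \<otimes> inv h"
  have th: "\<tau> h [^] d = h [^] d" using t.pow[of h d] by (simp add: pow_d)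
  have "?y [^] d = \<tau> h [^] d \<otimes> inv h [^] d"
    using h0 by (intro A.pow_mult_distrib K.m_comm) auto
  also have "\<dots> = \<one>" unfolding th using h0 by (simp del: pow)
  finally obtain j where j: "?y = (\<omega> [^]\<^bsub>F\<^esub> (j::nat)) \<odot> \<one>"
    using om.roots_of_unity_domain[OF A.assoc_algebra_axioms K.domain_axioms, of ?y] h0 by auto
  have "\<tau> h = ?y \<otimes> h" using h0 by (simp add: A.m_assoc)
  also have "\<dots> = (\<sigma> ^^ j) h" unfolding j by (simp add: A.one_smult_mult aut_pow_h)
  finally have "\<tau> z = (\<sigma> ^^ j) z" if "z \<in> carrier K" for z
    using hom_ext[OF t(1) aut_pow_hom _ that] by blast
  then have "\<tau> = gal j" using t(2) by (auto simp: gal_def extensional_def)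
  then show ?thesis ..
qed

lemma galois_group: "group (galois_group F K)"
proof -
  interpret B: group "BijGroup (carrier K)" by (rule group_BijGroup)
  have "subgroup (alg_hom F K K \<inter> Bij (carrier K)) (BijGroup (carrier K))"
  proof (rule B.subgroupI)
    show "alg_hom F K K \<inter> Bij (carrier K) \<noteq> {}" using gal_closed[of 0] by (auto simp: galois_group_def)
    fix f assume f: "f \<in> alg_hom F K K \<inter> Bij (carrier K)"
    then have iso: "f \<in> alg_iso F K K" by (auto simp: alg_iso_def Bij_def)
    have "inv\<^bsub>BijGroup (carrier K)\<^esub> f = restrict (inv_into (carrier K) f) (carrier K)"
      using f by (simp add: inv_BijGroup)
    then show "inv\<^bsub>BijGroup (carrier K)\<^esub> f \<in> alg_hom F K K \<inter> Bij (carrier K)"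
      using f alg_hom_restrict[OF alg_isoD(1)[OF alg_iso_inv[OF A.assoc_algebra_axioms iso]]]
      by (simp add: restrict_inv_into_Bij)
    fix g assume g: "g \<in> alg_hom F K K \<inter> Bij (carrier K)"
    have "compose (carrier K) f g \<in> alg_hom F K K"
      using alg_hom_restrict[OF alg_hom_comp[of g F K K f K]] f g by (simp add: compose_def)
    then show "f \<otimes>\<^bsub>BijGroup (carrier K)\<^esub> g \<in> alg_hom F K K \<inter> Bij (carrier K)"
      using f g by (simp add: BijGroup_def compose_Bij)
  qed (auto simp: BijGroup_def)
  then show ?thesis unfolding galois_group_def by (rule B.subgroup_imp_group)
qed

lemma cyclic_galois_group: "cyclic_group (galois_group F K)"
proof -
  interpret G: group "galois_group F K" by (rule galois_group)
  have pow: "gal 1 [^]\<^bsub>galois_group F K\<^esub> k = gal k" for k :: nat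
  proof (induction k)
    case 0 show ?case by (auto simp: gal_def galois_group_def BijGroup_def)
  next
    case (Suc k)
    have "gal k \<in> Bij (carrier K)" "gal 1 \<in> Bij (carrier K)"
      using gal_closed by (auto simp: galois_group_def)
    then have "gal 1 [^]\<^bsub>galois_group F K\<^esub> Suc k = compose (carrier K) (gal k) (gal 1)"
      using Suc by (simp add: galois_group_def BijGroup_def)
    also have "\<dots> = gal (Suc k)"
      using aut_closed[of _ 1] by (auto simp: gal_def compose_def funpow_swap1)
    finally show ?case .
  qed
  have "carrier (galois_group F K) = range (\<lambda>n::int. gal 1 [^]\<^bsub>galois_group F K\<^esub> n)"
  proof (intro equalityI subsetI)
    fix \<tau> assume "\<tau> \<in> carrier (galois_group F K)"
    then obtain k where "\<tau> = gal k" using gal_surj by blast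
    then have "\<tau> = gal 1 [^]\<^bsub>galois_group F K\<^esub> int k" by (simp only: int_pow_int pow)
    then show "\<tau> \<in> range (\<lambda>n::int. gal 1 [^]\<^bsub>galois_group F K\<^esub> n)" by blast
  qed (use gal_closed in auto)
  then show ?thesis using G.cyclic_group gal_closed by blast
qed

lemma galois_extension: "galois_extension F K"
  unfolding galois_extension_def
proof (intro conjI A.assoc_algebra_axioms field_K)
  show "A.finite_dimension (scalars F K) (carrier K)"
    using A.finite_dimensionI[OF basis(3)] .
  show "{x \<in> carrier K. \<forall>\<tau>\<in>carrier (galois_group F K). \<tau> x = x} = scalars F K"
  proof (intro equalityI subsetI)
    fix z assume "z \<in> {x \<in> carrier K. \<forall>\<tau>\<in>carrier (galois_group F K). \<tau> x = x}"
    then have "z \<in> carrier K" "gal 1 z = z" using gal_closed by auto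
    then show "z \<in> scalars F K" by (intro fixed_scalar) (auto simp: gal_def)
  next
    fix z assume "z \<in> scalars F K"
    then show "z \<in> {x \<in> carrier K. \<forall>\<tau>\<in>carrier (galois_group F K). \<tau> x = x}"
      by (auto simp: scalars_def galois_group_def alg_homD)
  qed
qed

lemma h_nonzero: "h \<noteq> \<zero>"
proof
  assume "h = \<zero>"
  then have "h [^] d = \<zero>" using d by (simp add: A.nat_pow_zero)
  then show False using scalar_zero[OF c] c0 by (simp add: pow_d)
qed

lemma orthogonality:
  assumes "i < d" "j < d"
  shows "(\<Oplus>\<^bsub>F\<^esub>l\<in>{..<d}. \<omega> [^]\<^bsub>F\<^esub> (i * l) \<otimes>\<^bsub>F\<^esub> inv\<^bsub>F\<^esub> \<omega> [^]\<^bsub>F\<^esub> (j * l)) = (if i = j then om.num else \<zero>\<^bsub>F\<^esub>)"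
proof -
  let ?z = "\<omega> [^]\<^bsub>F\<^esub> i \<otimes>\<^bsub>F\<^esub> inv\<^bsub>F\<^esub> \<omega> [^]\<^bsub>F\<^esub> j"
  have "(\<Oplus>\<^bsub>F\<^esub>l\<in>{..<d}. \<omega> [^]\<^bsub>F\<^esub> (i * l) \<otimes>\<^bsub>F\<^esub> inv\<^bsub>F\<^esub> \<omega> [^]\<^bsub>F\<^esub> (j * l)) = (\<Oplus>\<^bsub>F\<^esub>l\<in>{..<d}. ?z [^]\<^bsub>F\<^esub> l)"
    by (rule F.finsum_cong') (auto simp: F.pow_mult_distrib F.m_comm F.nat_pow_pow)
  also have "\<dots> = (if i = j then om.num else \<zero>\<^bsub>F\<^esub>)"
  proof (cases "i = j")
    case False
    have "?z [^]\<^bsub>F\<^esub> d = (\<omega> [^]\<^bsub>F\<^esub> d) [^]\<^bsub>F\<^esub> i \<otimes>\<^bsub>F\<^esub> (inv\<^bsub>F\<^esub> \<omega> [^]\<^bsub>F\<^esub> d) [^]\<^bsub>F\<^esub> j"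
      by (simp add: F.pow_mult_distrib F.m_comm F.nat_pow_pow mult.commute del: om.root(2))
    also have "inv\<^bsub>F\<^esub> \<omega> [^]\<^bsub>F\<^esub> d = \<one>\<^bsub>F\<^esub>" using F.inv_pow_mult(1)[of \<omega> d] by simp
    finally have "?z [^]\<^bsub>F\<^esub> d = \<one>\<^bsub>F\<^esub>" by simp
    moreover have "?z \<noteq> \<one>\<^bsub>F\<^esub>"
    proof
      assume "?z = \<one>\<^bsub>F\<^esub>"
      then have "\<omega> [^]\<^bsub>F\<^esub> i \<otimes>\<^bsub>F\<^esub> inv\<^bsub>F\<^esub> \<omega> [^]\<^bsub>F\<^esub> j \<otimes>\<^bsub>F\<^esub> \<omega> [^]\<^bsub>F\<^esub> j = \<omega> [^]\<^bsub>F\<^esub> j" by simp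
      then have "\<omega> [^]\<^bsub>F\<^esub> i = \<omega> [^]\<^bsub>F\<^esub> j" by (simp add: F.m_assoc)
      then show False using om.root_pow_inj assms False by blast
    qed
    ultimately show ?thesis using False om.geometric_sum_zero by simp
  qed (simp add: om.num_def)
  finally show ?thesis .
qed

text \<open>The matrix of conjugates of a basis is invertible; its inverse is obtained from the
  basis \<open>h\<^sup>l\<close>, for which it is a Vandermonde matrix of roots of unity.\<close>

lemma conjugate_matrix_invertible:
  assumes us: "set us \<subseteq> carrier K" "A.Span (scalars F K) us = carrier K" and len: "length us = d"
  shows "\<exists>Q. (\<forall>k<d. \<forall>j<d. Q k j \<in> carrier K) \<and>
    (\<forall>i<d. \<forall>j<d. (\<Oplus>k\<in>{..<d}. (\<sigma> ^^ i) (us ! k) \<otimes> Q k j) = (if i = j then \<one> else \<zero>))"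
proof -
  have usk [simp]: "us ! k \<in> carrier K" if "k < d" for k using us(1) len that by auto
  have "\<forall>l::nat. \<exists>e. e \<in> {..<d} \<rightarrow> carrier F \<and> h [^] l = (\<Oplus>k\<in>{..<d}. e k \<odot> us ! k)"
  proof
    fix l :: nat
    have "h [^] l \<in> A.Span (scalars F K) us" unfolding us(2) by simp
    then show "\<exists>e. e \<in> {..<d} \<rightarrow> carrier F \<and> h [^] l = (\<Oplus>k\<in>{..<d}. e k \<odot> us ! k)"
      using Span_iff[OF us(1)] len by blast
  qed
  from choice[OF this] obtain C where
    C: "\<forall>l::nat. C l \<in> {..<d} \<rightarrow> carrier F \<and> h [^] l = (\<Oplus>k\<in>{..<d}. C l k \<odot> us ! k)" ..
  have Cc [simp]: "C l k \<in> carrier F" if "k < d" for l k using C that by auto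
  \<comment> \<open>For the basis of powers of \<open>h\<close> the conjugate matrix has entries
    \<open>\<omega>^(il) h^l\<close>; these are the entries of its inverse, by
    \<open>orthogonality\<close>. \<open>Q\<close> composes them with the change of basis
    \<open>C\<close>.\<close>
  define w where "w j l = (inv\<^bsub>F\<^esub> om.num \<otimes>\<^bsub>F\<^esub> inv\<^bsub>F\<^esub> \<omega> [^]\<^bsub>F\<^esub> (j * l)) \<odot> inv h [^] l" for j l :: nat
  have w [simp]: "w j l \<in> carrier K" for j l using h_nonzero by (simp add: w_def)
  define Q where "Q k j = (\<Oplus>l\<in>{..<d}. C l k \<odot> w j l)" for k j
  have Q: "Q k j \<in> carrier K" if "k < d" for k j using that unfolding Q_def by (intro A.M.finsum_closed) auto
  have "(\<Oplus>k\<in>{..<d}. (\<sigma> ^^ i) (us ! k) \<otimes> Q k j) = (if i = j then \<one> else \<zero>)" if i: "i < d" and j: "j < d" for i j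
  proof -
    have conj: "(\<Oplus>k\<in>{..<d}. C l k \<odot> (\<sigma> ^^ i) (us ! k)) = (\<omega> [^]\<^bsub>F\<^esub> (i * l)) \<odot> h [^] l" for l
    proof -
      have "(\<sigma> ^^ i) (h [^] l) = (\<sigma> ^^ i) (\<Oplus>k\<in>{..<d}. C l k \<odot> us ! k)" using C by simp
      also have "\<dots> = (\<Oplus>k\<in>{..<d}. (\<sigma> ^^ i) (C l k \<odot> us ! k))"
        by (rule alg_homomorphism.finsum[OF aut_pow]) auto
      also have "\<dots> = (\<Oplus>k\<in>{..<d}. C l k \<odot> (\<sigma> ^^ i) (us ! k))"
        by (rule A.M.finsum_cong') (auto simp: alg_homD(5)[OF aut_pow_hom])
      finally show ?thesis by (simp add: aut_pow_h_pow)
    qed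
    have "(\<Oplus>k\<in>{..<d}. (\<sigma> ^^ i) (us ! k) \<otimes> Q k j) =
        (\<Oplus>k\<in>{..<d}. \<Oplus>l\<in>{..<d}. (C l k \<odot> (\<sigma> ^^ i) (us ! k)) \<otimes> w j l)"
      unfolding Q_def
      by (intro A.M.finsum_cong') (auto simp: A.mult_finsum Pi_iff A.smult_mult_left A.smult_mult_right)
    also have "\<dots> = (\<Oplus>l\<in>{..<d}. \<Oplus>k\<in>{..<d}. (C l k \<odot> (\<sigma> ^^ i) (us ! k)) \<otimes> w j l)"
      by (rule A.M.finsum_swap) auto
    also have "\<dots> = (\<Oplus>l\<in>{..<d}. (\<Oplus>k\<in>{..<d}. C l k \<odot> (\<sigma> ^^ i) (us ! k)) \<otimes> w j l)"
      by (intro A.M.finsum_cong') (auto simp: A.finsum_mult Pi_iff)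
    also have "\<dots> = (\<Oplus>l\<in>{..<d}. (inv\<^bsub>F\<^esub> om.num \<otimes>\<^bsub>F\<^esub> (\<omega> [^]\<^bsub>F\<^esub> (i * l) \<otimes>\<^bsub>F\<^esub> inv\<^bsub>F\<^esub> \<omega> [^]\<^bsub>F\<^esub> (j * l))) \<odot> \<one>)"
    proof (rule A.M.finsum_cong'[OF refl])
      fix l
      have "((\<omega> [^]\<^bsub>F\<^esub> (i * l)) \<odot> h [^] l) \<otimes> w j l =
          (\<omega> [^]\<^bsub>F\<^esub> (i * l) \<otimes>\<^bsub>F\<^esub> (inv\<^bsub>F\<^esub> om.num \<otimes>\<^bsub>F\<^esub> inv\<^bsub>F\<^esub> \<omega> [^]\<^bsub>F\<^esub> (j * l))) \<odot> (h [^] l \<otimes> inv h [^] l)"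
        unfolding w_def using h_nonzero by (intro A.smult_mult_smult) auto
      also have "h [^] l \<otimes> inv h [^] l = \<one>" using h_nonzero by simp
      also have "\<omega> [^]\<^bsub>F\<^esub> (i * l) \<otimes>\<^bsub>F\<^esub> (inv\<^bsub>F\<^esub> om.num \<otimes>\<^bsub>F\<^esub> inv\<^bsub>F\<^esub> \<omega> [^]\<^bsub>F\<^esub> (j * l)) =
          inv\<^bsub>F\<^esub> om.num \<otimes>\<^bsub>F\<^esub> (\<omega> [^]\<^bsub>F\<^esub> (i * l) \<otimes>\<^bsub>F\<^esub> inv\<^bsub>F\<^esub> \<omega> [^]\<^bsub>F\<^esub> (j * l))"
        by (rule F.m_lcomm) auto
      finally show "(\<Oplus>k\<in>{..<d}. C l k \<odot> (\<sigma> ^^ i) (us ! k)) \<otimes> w j l =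
          (inv\<^bsub>F\<^esub> om.num \<otimes>\<^bsub>F\<^esub> (\<omega> [^]\<^bsub>F\<^esub> (i * l) \<otimes>\<^bsub>F\<^esub> inv\<^bsub>F\<^esub> \<omega> [^]\<^bsub>F\<^esub> (j * l))) \<odot> \<one>"
        unfolding conj .
    qed auto
    also have "\<dots> = (inv\<^bsub>F\<^esub> om.num \<otimes>\<^bsub>F\<^esub> (\<Oplus>\<^bsub>F\<^esub>l\<in>{..<d}. \<omega> [^]\<^bsub>F\<^esub> (i * l) \<otimes>\<^bsub>F\<^esub> inv\<^bsub>F\<^esub> \<omega> [^]\<^bsub>F\<^esub> (j * l))) \<odot> \<one>"
      by (subst A.finsum_smult[symmetric]) (auto simp: F.finsum_rdistr Pi_iff)
    finally show ?thesis unfolding orthogonality[OF i j] by simp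
  qed
  then show ?thesis using Q by (intro exI[of _ Q]) blast
qed

text \<open>The norm is a determinant over F, while the comparison with conjugates takes place over
  K; this carries the former into K.\<close>

lemma ring_det_scalars:
  assumes "\<And>i j. i < k ==> j < k ==> M i j \<in> carrier F"
  shows "ring_det K k (\<lambda>i j. M i j \<odot> \<one>) = ring_det F k M \<odot> \<one>"
proof -
  interpret h: ring_hom_cring F K "\<lambda>c. c \<odot> \<one>"
    by (intro ring_hom_cring.intro ring_hom_cring_axioms.intro F.is_cring K.is_cring ring_hom_memI)
      (auto simp: A.smult_l_distr A.one_smult_mult A.smult_assoc1)
  have sg: "K.sg p = F.sg p \<odot> \<one>" for p by (simp add: K.sg_def F.sg_def A.smult_minus_one)
  have pd: "p i < k" if "p permutes {..<k}" "i < k" for p i using that permutes_in_image[of p "{..<k}" i] by simp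
  have pr: "(\<Otimes>i\<in>{..<k}. M i (p i) \<odot> \<one>) = (\<Otimes>\<^bsub>F\<^esub>i\<in>{..<k}. M i (p i)) \<odot> \<one>"
    if "p permutes {..<k}" for p
    using assms pd[OF that] by (subst h.hom_finprod) (auto simp: comp_def)
  have cl: "(\<Otimes>\<^bsub>F\<^esub>i\<in>{..<k}. M i (p i)) \<in> carrier F" if "p permutes {..<k}" for p
    using assms pd[OF that] by (intro F.finprod_closed) auto
  show ?thesis
    unfolding K.ring_det_sg F.ring_det_sg using cl
    by (subst A.finsum_smult)
      (auto simp: pr sg A.one_smult_mult A.smult_assoc1 intro!: A.M.finsum_cong')
qed

text \<open>Let P be the matrix of conjugates of the chosen basis, M the matrix of multiplication by
  \<open>b\<close>, and D the diagonal matrix of conjugates of \<open>b\<close>. Then P M = D P, and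
  cancelling the nonzero determinant of P leaves det M = det D.\<close>

lemma field_norm:
  assumes b: "b \<in> carrier K"
  shows "field_norm F K b \<in> carrier F"
    and "field_norm F K b \<odot> \<one> = (\<Otimes>i\<in>{..<d}. (\<sigma> ^^ i) b)"
proof -
  define us where "us = (SOME us. is_basis F K us)"
  \<comment> \<open>Since the powers of \<open>h\<close> form a basis, the one selected by
    \<open>SOME\<close> is a basis too, and all bases have length \<open>d\<close>.\<close>
  have "is_basis F K (map (\<lambda>k. h [^] k) [0..<d])"
    unfolding is_basis_def by (intro conjI basis(1,2)) (simp add: image_subset_iff)
  then have us: "is_basis F K us" unfolding us_def by (rule someI)
  then have us1: "set us \<subseteq> carrier K" and us2: "A.independent (scalars F K) us"
    and us3: "A.Span (scalars F K) us = carrier K" by (auto simp: is_basis_def)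
  have len: "length us = d"
    using A.dimension_is_inj[OF scalars_subfield] A.dimensionI[OF scalars_subfield us2 us3] basis(3) by blast
  have usk [simp]: "us ! k \<in> carrier K" if "k < d" for k using us1 len that by auto
  define M where "M = mult_matrix F K us b"
  have "\<exists>N. \<forall>j<length us. (\<forall>i<length us. N i j \<in> carrier F) \<and>
      b \<otimes> us ! j = (\<Oplus>i\<in>{..<length us}. N i j \<odot> us ! i)"
    by (rule mult_matrix_exists[OF us1], unfold us3, use b len in simp)
  then have "\<forall>j<length us. (\<forall>i<length us. M i j \<in> carrier F) \<and>
      b \<otimes> us ! j = (\<Oplus>i\<in>{..<length us}. M i j \<odot> us ! i)"
    unfolding M_def mult_matrix_def by (rule someI_ex)
  then have M [simp]: "\<And>i j. i < d ==> j < d ==> M i j \<in> carrier F"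
    and bM: "\<And>j. j < d ==> b \<otimes> us ! j = (\<Oplus>i\<in>{..<d}. M i j \<odot> us ! i)" unfolding len by blast+
  have norm: "field_norm F K b = ring_det F d M"
    by (simp add: field_norm_def us_def[symmetric] M_def[symmetric] Let_def len)
  show "field_norm F K b \<in> carrier F" unfolding norm by (rule F.ring_det_closed) simp
  let ?P = "\<lambda>i j. (\<sigma> ^^ i) (us ! j)" and ?M = "\<lambda>i j. M i j \<odot> \<one>"
    and ?D = "\<lambda>i j. if i = j then (\<sigma> ^^ i) b else \<zero>"
  have detP: "ring_det K d ?P \<in> carrier K" by (rule K.ring_det_closed) simp
  have detM: "ring_det K d ?M \<in> carrier K" by (rule K.ring_det_closed) simp
  \<comment> \<open>The (i, j) entry of either product is the i-th conjugate of \<open>b\<close>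
    times the j-th basis element.\<close>
  have "(\<Oplus>k\<in>{..<d}. ?P i k \<otimes> ?M k j) = (\<Oplus>k\<in>{..<d}. ?D i k \<otimes> ?P k j)" if i: "i < d" and j: "j < d" for i j
  proof -
    have "(\<Oplus>k\<in>{..<d}. ?P i k \<otimes> ?M k j) = (\<Oplus>k\<in>{..<d}. (\<sigma> ^^ i) (M k j \<odot> us ! k))"
      using j by (intro A.M.finsum_cong') (auto simp: A.mult_one_smult alg_homD(5)[OF aut_pow_hom])
    also have "\<dots> = (\<sigma> ^^ i) (\<Oplus>k\<in>{..<d}. M k j \<odot> us ! k)"
      using j by (intro alg_homomorphism.finsum[OF aut_pow, symmetric]) auto
    also have "\<dots> = (\<sigma> ^^ i) (b \<otimes> us ! j)" using bM[OF j] by simp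
    also have "\<dots> = (\<sigma> ^^ i) b \<otimes> ?P i j" using b j by (intro alg_homD(2)[OF aut_pow_hom]) auto
    also have "\<dots> = (\<Oplus>k\<in>{..<d}. if k = i then (\<sigma> ^^ i) b \<otimes> ?P i j else \<zero>)"
      using b i j by (simp add: A.finsum_delta)
    also have "\<dots> = (\<Oplus>k\<in>{..<d}. ?D i k \<otimes> ?P k j)"
      using b j by (intro A.M.finsum_cong') auto
    finally show ?thesis .
  qed
  then have e1: "ring_det K d (\<lambda>i j. \<Oplus>k\<in>{..<d}. ?P i k \<otimes> ?M k j) = ring_det K d (\<lambda>i j. \<Oplus>k\<in>{..<d}. ?D i k \<otimes> ?P k j)"
    using b by (intro K.ring_det_cong) (auto intro!: A.M.finsum_closed)
  have e2: "ring_det K d (\<lambda>i j. \<Oplus>k\<in>{..<d}. ?P i k \<otimes> ?M k j) = ring_det K d ?P \<otimes> ring_det K d ?M"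
    by (rule K.ring_det_mult) auto
  have e3: "ring_det K d (\<lambda>i j. \<Oplus>k\<in>{..<d}. ?D i k \<otimes> ?P k j) = ring_det K d ?D \<otimes> ring_det K d ?P"
    using b by (intro K.ring_det_mult) auto
  have e4: "ring_det K d ?D = (\<Otimes>i\<in>{..<d}. (\<sigma> ^^ i) b)"
    using b by (intro K.ring_det_diagonal) auto
  have prod: "(\<Otimes>i\<in>{..<d}. (\<sigma> ^^ i) b) \<in> carrier K"
    using b by (intro K.finprod_closed) auto
  have eq: "ring_det K d ?P \<otimes> ring_det K d ?M = ring_det K d ?P \<otimes> (\<Otimes>i\<in>{..<d}. (\<sigma> ^^ i) b)"
    unfolding e2[symmetric] unfolding e1 unfolding e3 unfolding e4 by (rule K.m_comm[OF prod detP])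
  from conjugate_matrix_invertible[OF us1 us3 len] obtain Q where
    Q0: "(\<forall>k<d. \<forall>j<d. Q k j \<in> carrier K) \<and>
      (\<forall>i<d. \<forall>j<d. (\<Oplus>k\<in>{..<d}. ?P i k \<otimes> Q k j) = (if i = j then \<one> else \<zero>))" ..
  have Q: "Q k j \<in> carrier K" if "k < d" "j < d" for k j
    by (rule conjunct1[OF Q0, rule_format, OF that])
  have PQ: "(\<Oplus>k\<in>{..<d}. ?P i k \<otimes> Q k j) = (if i = j then \<one> else \<zero>)" if "i < d" "j < d" for i j
    by (rule conjunct2[OF Q0, rule_format, OF that])
  have "ring_det K d ?P \<otimes> ring_det K d Q = ring_det K d (\<lambda>i j. \<Oplus>k\<in>{..<d}. ?P i k \<otimes> Q k j)"
    using Q by (intro K.ring_det_mult[symmetric]) auto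
  also have "\<dots> = ring_det K d (\<lambda>i j. if i = j then \<one> else \<zero>)"
    using Q PQ by (intro K.ring_det_cong) (auto intro!: A.M.finsum_closed)
  also have "\<dots> = \<one>" using K.ring_det_diagonal[of d "\<lambda>_. \<one>"] by simp
  finally have one: "ring_det K d ?P \<otimes> ring_det K d Q = \<one>" .
  have detQ: "ring_det K d Q \<in> carrier K" using Q by (rule K.ring_det_closed)
  have "ring_det K d ?P \<noteq> \<zero>"
  proof
    assume "ring_det K d ?P = \<zero>"
    then show False using one detQ by (simp del: K.zero_not_one) (use K.zero_not_one in blast)
  qed
  from K.m_lcancel[OF this detP detM prod] eq
  have "ring_det K d ?M = (\<Otimes>i\<in>{..<d}. (\<sigma> ^^ i) b)" by blast
  then show "field_norm F K b \<odot> \<one> = (\<Otimes>i\<in>{..<d}. (\<sigma> ^^ i) b)"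
    unfolding norm using ring_det_scalars[of d M] by simp
qed

end

text \<open>The automorphism sending \<open>h\<close> to \<open>\<omega> h\<close> is constructed
  here as a lift of K into itself. The result can therefore be applied to the copy of K inside the
  cyclic algebra, for which no automorphism has been named.\<close>

lemma kummer_galois:
  assumes "kummer F K h d c" "root_of_unity F d \<omega>" "field K" "c \<noteq> \<zero>\<^bsub>F\<^esub>"
  shows "galois_extension F K" "cyclic_group (galois_group F K)"
proof -
  interpret kummer F K h d c by fact
  interpret om: root_of_unity F d \<omega> by fact
  have "skew_rel F (self_algebra F) K (\<lambda>c. c \<odot>\<^bsub>K\<^esub> \<one>\<^bsub>K\<^esub>) (\<omega> \<odot>\<^bsub>K\<^esub> h) (\<lambda>x. x) d c"
  proof (intro skew_rel.intro skew_rel_axioms.intro D.assoc_algebra_axioms A.assoc_algebra_axioms sigma f a d)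
    show "(\<omega> \<odot>\<^bsub>K\<^esub> h) \<otimes>\<^bsub>K\<^esub> (u \<odot>\<^bsub>K\<^esub> \<one>\<^bsub>K\<^esub>) = (u \<odot>\<^bsub>K\<^esub> \<one>\<^bsub>K\<^esub>) \<otimes>\<^bsub>K\<^esub> (\<omega> \<odot>\<^bsub>K\<^esub> h)" if "u \<in> carrier (self_algebra F)" for u
      using that by (simp add: A.one_smult_mult A.mult_one_smult)
    show "(\<omega> \<odot>\<^bsub>K\<^esub> h) [^]\<^bsub>K\<^esub> d = c \<odot>\<^bsub>K\<^esub> \<one>\<^bsub>K\<^esub>"
      by (simp add: A.smult_pow pow_d)
  qed simp
  then interpret L: skew_lift F "self_algebra F" K "\<lambda>c. c \<odot>\<^bsub>K\<^esub> \<one>\<^bsub>K\<^esub>" h "\<lambda>x. x" d c K "\<lambda>c. c \<odot>\<^bsub>K\<^esub> \<one>\<^bsub>K\<^esub>" "\<omega> \<odot>\<^bsub>K\<^esub> h"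
    by (intro skew_lift.intro skew_pres_axioms)
  interpret kummer_cyclic F K h d c \<omega> L.lift
    by (intro kummer_cyclic.intro kummer_aut.intro kummer_aut_axioms.intro kummer_cyclic_axioms.intro kummer_axioms assms L.lift_hom L.lift_gen)
  show "galois_extension F K" "cyclic_group (galois_group F K)"
    by (rule galois_extension cyclic_galois_group)+
qed

section \<open>Cyclic algebras over Kummer extensions\<close>

text \<open>Division with remainder on the index. It serves to number the basis
  \<open>h^l x^k\<close> of a cyclic algebra and to sort the powers of \<open>x\<close> by their
  remainder modulo m.\<close>

lemma (in abelian_monoid) finsum_mult_index:
  fixes d e :: nat
  assumes "\<And>i. f i \<in> carrier G"
  shows "(\<Oplus>i\<in>{..<e * d}. f i) = (\<Oplus>k\<in>{..<e}. \<Oplus>l\<in>{..<d}. f (k * d + l))"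
proof (induction e)
  case (Suc e)
  have split: "{..<Suc e * d} = {..<e * d} \<union> (\<lambda>l. e * d + l) ` {..<d}"
  proof (intro equalityI subsetI)
    fix i assume i: "i \<in> {..<Suc e * d}"
    show "i \<in> {..<e * d} \<union> (\<lambda>l. e * d + l) ` {..<d}"
    proof (cases "i < e * d")
      case False
      then have "i = e * d + (i - e * d)" "i - e * d < d" using i by auto
      then show ?thesis by blast
    qed simp
  qed auto
  have "(\<Oplus>i\<in>{..<Suc e * d}. f i) = (\<Oplus>i\<in>{..<e * d}. f i) \<oplus> (\<Oplus>i\<in>(\<lambda>l. e * d + l) ` {..<d}. f i)"
    unfolding split by (rule finsum_Un_disjoint) (use assms in auto)
  also have "(\<Oplus>i\<in>(\<lambda>l. e * d + l) ` {..<d}. f i) = (\<Oplus>l\<in>{..<d}. f (e * d + l))"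
    by (rule finsum_reindex) (use assms in \<open>auto simp: inj_on_def\<close>)
  finally show ?case
    using assms Suc by (subst finsum_lessThan_Suc) (auto intro!: finsum_closed)
qed simp

lemma (in field_algebra) root_of_scalar_unit:
  assumes "y \<in> carrier A" "y [^]\<^bsub>A\<^esub> d = c \<odot>\<^bsub>A\<^esub> \<one>\<^bsub>A\<^esub>" "0 < (d::nat)" "c \<in> carrier F" "c \<noteq> \<zero>\<^bsub>F\<^esub>"
  defines "y' \<equiv> inv\<^bsub>F\<^esub> c \<odot>\<^bsub>A\<^esub> y [^]\<^bsub>A\<^esub> (d - 1)"
  shows "y' \<in> carrier A" "y \<otimes>\<^bsub>A\<^esub> y' = \<one>\<^bsub>A\<^esub>" "y' \<otimes>\<^bsub>A\<^esub> y = \<one>\<^bsub>A\<^esub>" "y \<in> Units A"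
proof -
  have d: "d = Suc (d - 1)" using assms(3) by simp
  show 1: "y' \<in> carrier A" using assms by simp
  have c: "inv\<^bsub>F\<^esub> c \<odot>\<^bsub>A\<^esub> (c \<odot>\<^bsub>A\<^esub> \<one>\<^bsub>A\<^esub>) = \<one>\<^bsub>A\<^esub>" using assms(4,5) by (simp add: A.smult_assoc1[symmetric])
  have "y \<otimes>\<^bsub>A\<^esub> y [^]\<^bsub>A\<^esub> (d - 1) = y [^]\<^bsub>A\<^esub> d" "y [^]\<^bsub>A\<^esub> (d - 1) \<otimes>\<^bsub>A\<^esub> y = y [^]\<^bsub>A\<^esub> d"
    using A.nat_pow_Suc2[OF assms(1), of "d - 1"] A.nat_pow_Suc[of y "d - 1"] by (simp_all only: d[symmetric])
  then show 2: "y \<otimes>\<^bsub>A\<^esub> y' = \<one>\<^bsub>A\<^esub>" "y' \<otimes>\<^bsub>A\<^esub> y = \<one>\<^bsub>A\<^esub>"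
    using assms(1,4,5) c by (simp_all add: y'_def A.smult_mult_left A.smult_mult_right assms(2))
  show "y \<in> Units A" unfolding Units_def using 1 2 assms(1) by blast
qed

text \<open>As a matrix, \<open>t\<close> has the identity just above the diagonal and
  \<open>t^m\<close> in the lower left corner. The lemma is applied to \<open>h\<close>, where
  \<open>h^d = c\<close>, when EE' is split over F, and to \<open>x\<close> when EE is written as
  matrices over EE'.\<close>

lemma (in cyclic_idempotents) t_corner:
  assumes wrap: "t \<otimes>\<^bsub>A\<^esub> f 0 = f (m - 1) \<otimes>\<^bsub>A\<^esub> t" and ij: "i < m" "j < m"
  shows "f i \<otimes>\<^bsub>A\<^esub> t \<otimes>\<^bsub>A\<^esub> f j =
    (if j = Suc i mod m then (if Suc i < m then \<one>\<^bsub>A\<^esub> else t [^]\<^bsub>A\<^esub> m) \<otimes>\<^bsub>A\<^esub> unit i j else \<zero>\<^bsub>A\<^esub>)"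
proof -
  have *: "f i \<otimes>\<^bsub>A\<^esub> t = t \<otimes>\<^bsub>A\<^esub> f (Suc i mod m)"
  proof (cases "Suc i < m")
    case True then show ?thesis using twist by simp
  next
    case False
    then have "Suc i = m" using ij by simp
    then show ?thesis using wrap by auto
  qed
  have sm: "Suc i mod m < m" using m by simp
  have "f i \<otimes>\<^bsub>A\<^esub> t \<otimes>\<^bsub>A\<^esub> f j = t \<otimes>\<^bsub>A\<^esub> (f (Suc i mod m) \<otimes>\<^bsub>A\<^esub> f j)"
    unfolding * by (simp add: A.m_assoc)
  also have "\<dots> = (if j = Suc i mod m then t \<otimes>\<^bsub>A\<^esub> f j else \<zero>\<^bsub>A\<^esub>)"
    using f_mult[OF sm ij(2)] by auto
  also have "\<dots> = (if j = Suc i mod m then (if Suc i < m then \<one>\<^bsub>A\<^esub> else t [^]\<^bsub>A\<^esub> m) \<otimes>\<^bsub>A\<^esub> unit i j else \<zero>\<^bsub>A\<^esub>)"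
  proof (cases "Suc i < m")
    case True
    have "unit i (Suc i) = unit i i \<otimes>\<^bsub>A\<^esub> t" by (simp add: unit_def A.m_assoc)
    then have "unit i (Suc i) = t \<otimes>\<^bsub>A\<^esub> f (Suc i)" using unit_diag[OF ij(1)] twist[OF True] by simp
    then show ?thesis using True by simp
  next
    case False
    then have i: "m = Suc i" using ij by simp
    have "t [^]\<^bsub>A\<^esub> m \<otimes>\<^bsub>A\<^esub> s [^]\<^bsub>A\<^esub> i = t \<otimes>\<^bsub>A\<^esub> (t [^]\<^bsub>A\<^esub> i \<otimes>\<^bsub>A\<^esub> s [^]\<^bsub>A\<^esub> i)"
      unfolding i A.nat_pow_Suc2[OF t] by (simp add: A.m_assoc)
    then have ts': "t [^]\<^bsub>A\<^esub> m \<otimes>\<^bsub>A\<^esub> s [^]\<^bsub>A\<^esub> i = t" by (simp add: pow_ts)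
    have "t [^]\<^bsub>A\<^esub> m \<otimes>\<^bsub>A\<^esub> unit i 0 = (t [^]\<^bsub>A\<^esub> m \<otimes>\<^bsub>A\<^esub> s [^]\<^bsub>A\<^esub> i) \<otimes>\<^bsub>A\<^esub> f 0"
      by (simp add: unit_def A.m_assoc)
    then have "t [^]\<^bsub>A\<^esub> m \<otimes>\<^bsub>A\<^esub> unit i 0 = t \<otimes>\<^bsub>A\<^esub> f 0" unfolding ts' .
    then show ?thesis using i by simp
  qed
  finally show ?thesis .
qed

locale cyclic_alg = kummer_cyclic F K h d c \<omega> \<sigma> + C: skew_pres F K C \<iota> x \<sigma> d "\<alpha> \<odot>\<^bsub>K\<^esub> \<one>\<^bsub>K\<^esub>"
  for F :: "('f, 'z) ring_scheme" and K :: "('f, 'a, 'k) module_scheme" and h d c \<omega> \<sigma>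
    and C :: "('f, 'b, 'm) module_scheme" (structure) and \<iota> x \<alpha> +
  assumes alpha [simp]: "\<alpha> \<in> carrier F" and alpha0: "\<alpha> \<noteq> \<zero>\<^bsub>F\<^esub>"
begin

lemma iota_zero: "u \<in> carrier K ==> \<iota> u = \<zero> ==> u = \<zero>\<^bsub>K\<^esub>"
  using inj_onD[OF C.f_inj, of u "\<zero>\<^bsub>K\<^esub>"] by simp

lemma C_nontrivial: "\<one> \<noteq> \<zero>"
  using iota_zero[of "\<one>\<^bsub>K\<^esub>"] nontrivial C.f.hom_simps(4) by auto

sublocale CF: field_algebra F C
  by (intro field_algebra.intro field_algebra_axioms.intro F.field_axioms C.A.assoc_algebra_axioms C_nontrivial)

lemma iota_inv: "u \<in> carrier K ==> u \<noteq> \<zero>\<^bsub>K\<^esub> ==> \<iota> (inv\<^bsub>K\<^esub> u) \<otimes> \<iota> u = \<one>"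
  "u \<in> carrier K ==> u \<noteq> \<zero>\<^bsub>K\<^esub> ==> \<iota> u \<otimes> \<iota> (inv\<^bsub>K\<^esub> u) = \<one>"
  using C.f.hom_simps(2)[of "inv\<^bsub>K\<^esub> u" u] C.f.hom_simps(2)[of u "inv\<^bsub>K\<^esub> u"] by simp_all

lemma iota_cancel:
  assumes "u \<in> carrier K" "w \<in> carrier C" "\<iota> u \<otimes> w = \<zero>" "w \<noteq> \<zero>"
  shows "u = \<zero>\<^bsub>K\<^esub>"
proof (rule ccontr)
  assume u: "u \<noteq> \<zero>\<^bsub>K\<^esub>"
  have "w = \<iota> (inv\<^bsub>K\<^esub> u) \<otimes> \<iota> u \<otimes> w" using iota_inv(1)[OF assms(1) u] assms(2) by simp
  also have "\<dots> = \<iota> (inv\<^bsub>K\<^esub> u) \<otimes> (\<iota> u \<otimes> w)"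
    using assms(1,2) u by (intro C.A.m_assoc) auto
  finally show False using assms u by simp
qed

lemma x_pow_d: "x [^] d = \<alpha> \<odot> \<one>"
  using C.pow by simp

lemmas x_unit = CF.root_of_scalar_unit[OF C.y x_pow_d d alpha alpha0]

lemma x_cancel:
  assumes "z \<in> carrier C" "w \<in> carrier C" "z \<otimes> x = w \<otimes> x"
  shows "z = w"
proof -
  let ?x' = "inv\<^bsub>F\<^esub> \<alpha> \<odot> x [^] (d - 1)"
  have "z \<otimes> x \<otimes> ?x' = w \<otimes> x \<otimes> ?x'" using assms(3) by simp
  then show ?thesis using assms(1,2) x_unit(1,2) by (simp only: C.A.m_assoc C.y C.A.r_one)
qed

lemma x_pow_unit: "\<exists>w\<in>carrier C. x [^] (k::nat) \<otimes> w = \<one>"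
proof -
  have "x [^] k \<in> Units C" using x_unit(4) by (rule C.A.Units_pow_closed)
  then show ?thesis by (meson C.A.Units_r_inv_ex)
qed

lemma right_mult:
  assumes u: "u \<in> {..<d} \<rightarrow> carrier K" and v: "v \<in> carrier K"
  shows "C.expand u \<otimes> \<iota> v = C.expand (\<lambda>k. u k \<otimes>\<^bsub>K\<^esub> (\<sigma> ^^ k) v)"
proof -
  have uk: "u k \<in> carrier K" if "k < d" for k using u that by auto
  have "C.expand u \<otimes> \<iota> v = (\<Oplus>k\<in>{..<d}. (\<iota> (u k) \<otimes> x [^] k) \<otimes> \<iota> v)"
    unfolding C.expand_def using uk v by (intro C.A.finsum_mult) auto
  also have "\<dots> = (\<Oplus>k\<in>{..<d}. \<iota> (u k \<otimes>\<^bsub>K\<^esub> (\<sigma> ^^ k) v) \<otimes> x [^] k)"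
  proof (rule C.A.M.finsum_cong'[OF refl])
    fix k assume "k \<in> {..<d}"
    then have uk: "u k \<in> carrier K" using uk by simp
    have "(\<iota> (u k) \<otimes> x [^] k) \<otimes> \<iota> v = \<iota> (u k) \<otimes> (x [^] k \<otimes> \<iota> v)"
      using uk v by (intro C.A.m_assoc) auto
    also have "\<dots> = \<iota> (u k) \<otimes> (\<iota> ((\<sigma> ^^ k) v) \<otimes> x [^] k)" by (simp only: C.pow_rel[OF v])
    also have "\<dots> = \<iota> (u k \<otimes>\<^bsub>K\<^esub> (\<sigma> ^^ k) v) \<otimes> x [^] k" using uk v by (simp add: C.A.m_assoc)
    finally show "(\<iota> (u k) \<otimes> x [^] k) \<otimes> \<iota> v = \<iota> (u k \<otimes>\<^bsub>K\<^esub> (\<sigma> ^^ k) v) \<otimes> x [^] k" .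
  qed (use uk v in auto)
  finally show ?thesis by (simp only: C.expand_def)
qed

text \<open>Commuting with \<open>h\<close> means \<open>(\<omega>^k - 1) h u_k = 0\<close> for each
  coefficient, which leaves \<open>u_0\<close> alone. Commuting with \<open>x\<close> then makes
  \<open>u_0\<close> invariant under \<open>\<sigma>\<close>, hence a scalar.\<close>

lemma center: "centralizer C (carrier C) = scalars F C"
proof (intro equalityI subsetI)
  fix z assume "z \<in> scalars F C"
  then show "z \<in> centralizer C (carrier C)"
    by (auto simp: scalars_def centralizer_def C.A.one_smult_mult C.A.mult_one_smult)
next
  fix z assume "z \<in> centralizer C (carrier C)"
  then have z: "z \<in> carrier C" and comm: "\<And>w. w \<in> carrier C ==> z \<otimes> w = w \<otimes> z"
    by (auto simp: centralizer_def)
  obtain u where u: "u \<in> {..<d} \<rightarrow> carrier K" and zu: "z = C.expand u" using C.span[OF z] by blast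
  have uk: "u k \<in> carrier K" if "k < d" for k using u that by auto
  have "C.expand (\<lambda>k. u k \<otimes>\<^bsub>K\<^esub> (\<sigma> ^^ k) h) = C.expand (\<lambda>k. h \<otimes>\<^bsub>K\<^esub> u k)"
    using right_mult[OF u y] C.expand_left_mult[OF u y] comm[of "\<iota> h"] zu by simp
  then have "u k \<otimes>\<^bsub>K\<^esub> (\<sigma> ^^ k) h = h \<otimes>\<^bsub>K\<^esub> u k" if "k < d" for k
    using that uk by (intro C.expand_inj) auto
  then have eq: "u k \<otimes>\<^bsub>K\<^esub> ((\<omega> [^]\<^bsub>F\<^esub> k) \<odot>\<^bsub>K\<^esub> h) = h \<otimes>\<^bsub>K\<^esub> u k" if "k < d" for k
    using that aut_pow_h by metis
  have "u k = \<zero>\<^bsub>K\<^esub>" if k: "k < d" "k \<noteq> 0" for k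
  proof (rule ccontr)
    assume nz: "u k \<noteq> \<zero>\<^bsub>K\<^esub>"
    have "(\<omega> [^]\<^bsub>F\<^esub> k) \<odot>\<^bsub>K\<^esub> (h \<otimes>\<^bsub>K\<^esub> u k) = \<one>\<^bsub>F\<^esub> \<odot>\<^bsub>K\<^esub> (h \<otimes>\<^bsub>K\<^esub> u k)"
      using eq[OF k(1)] uk[OF k(1)] comm_h[of "u k"] by (simp add: A.smult_mult_right)
    then have "(\<omega> [^]\<^bsub>F\<^esub> k \<ominus>\<^bsub>F\<^esub> \<one>\<^bsub>F\<^esub>) \<odot>\<^bsub>K\<^esub> (h \<otimes>\<^bsub>K\<^esub> u k) = \<zero>\<^bsub>K\<^esub>"
      using uk[OF k(1)] by (simp add: a_minus_def A.smult_l_distr A.smult_l_minus A.M.r_neg)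
    moreover have "\<omega> [^]\<^bsub>F\<^esub> k \<noteq> \<one>\<^bsub>F\<^esub>"
      using om.root_pow_eq_one[of k] k nat_dvd_not_less[of k d] by simp
    then have "\<omega> [^]\<^bsub>F\<^esub> k \<ominus>\<^bsub>F\<^esub> \<one>\<^bsub>F\<^esub> \<noteq> \<zero>\<^bsub>F\<^esub>"
      using F.r_right_minus_eq[of "\<omega> [^]\<^bsub>F\<^esub> k" "\<one>\<^bsub>F\<^esub>"] by (simp del: F.r_right_minus_eq)
    ultimately have "h \<otimes>\<^bsub>K\<^esub> u k = \<zero>\<^bsub>K\<^esub>"
      using smult_cancel[of "\<omega> [^]\<^bsub>F\<^esub> k \<ominus>\<^bsub>F\<^esub> \<one>\<^bsub>F\<^esub>" "h \<otimes>\<^bsub>K\<^esub> u k"] uk[OF k(1)] by simp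
    then show False using K.integral[OF _ y uk[OF k(1)]] h_nonzero nz by blast
  qed
  then have "z = C.expand (\<lambda>k. if k = 0 then u 0 else \<zero>\<^bsub>K\<^esub>)"
    unfolding zu using u d by (intro C.expand_cong) auto
  also have "\<dots> = \<iota> (u 0) \<otimes> x [^] (0::nat)" using uk[OF d] d by (rule C.expand_single)
  finally have z0: "z = \<iota> (u 0)" using uk[OF d] by simp
  have "\<iota> (\<sigma> (u 0)) \<otimes> x = \<iota> (u 0) \<otimes> x"
    unfolding C.rel[OF uk[OF d], symmetric] using comm[OF C.y] unfolding z0 by (rule sym)
  then have "\<iota> (\<sigma> (u 0)) = \<iota> (u 0)"
    by (rule x_cancel[rotated 2]) (simp_all add: uk[OF d] C.sigma.hom_simps(1))
  then have "\<sigma> (u 0) = u 0"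
    by (rule inj_onD[OF C.f_inj]) (simp_all add: uk[OF d] C.sigma.hom_simps(1))
  then have "u 0 \<in> scalars F K" using fixed_scalar uk[OF d] by blast
  then show "z \<in> scalars F C" unfolding z0 by (auto simp: scalars_def)
qed

text \<open>The conjugate of the element by \<open>h^j\<close> lies in \<open>I\<close> again and
  has its k-th component multiplied by \<open>\<omega>^(kj)\<close>. Modulo \<open>I\<close> these
  are vanishing power sums with the distinct scalars \<open>\<omega>^k\<close>, so each component
  vanishes there.\<close>

lemma ideal_mono:
  assumes I: "ideal I C" and u: "u \<in> {..<d} \<rightarrow> carrier K" and z: "C.expand u \<in> I" and k: "k < d"
  shows "\<iota> (u k) \<otimes> x [^] k \<in> I"
proof -
  interpret I: ideal I C by fact
  let ?Q = "quot_algebra C I" and ?p = "\<lambda>z. I +> z"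
  note quot = quot_algebra[OF C.A.assoc_algebra_axioms I]
  interpret p: alg_homomorphism F C ?Q ?p
    by (intro alg_homomorphism.intro alg_homomorphism_axioms.intro C.A.assoc_algebra_axioms quot(1,2))
  have uk: "u k \<in> carrier K" if "k < d" for k using u that by auto
  have "(\<Oplus>\<^bsub>?Q\<^esub>k\<in>{..<d}. ((\<omega> [^]\<^bsub>F\<^esub> k) [^]\<^bsub>F\<^esub> j) \<odot>\<^bsub>?Q\<^esub> ?p (\<iota> (u k) \<otimes> x [^] k)) = \<zero>\<^bsub>?Q\<^esub>" for j :: nat
  proof -
    let ?w = "\<lambda>k. (\<omega> [^]\<^bsub>F\<^esub> (k * j)) \<odot>\<^bsub>K\<^esub> u k"
    have w: "?w \<in> {..<d} \<rightarrow> carrier K" using u by auto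
    have hj: "h [^]\<^bsub>K\<^esub> j \<in> carrier K" "h [^]\<^bsub>K\<^esub> j \<noteq> \<zero>\<^bsub>K\<^esub>" using K.pow_neq_zero[OF y h_nonzero] by auto
    have "C.expand u \<otimes> \<iota> (h [^]\<^bsub>K\<^esub> j) = C.expand (\<lambda>k. h [^]\<^bsub>K\<^esub> j \<otimes>\<^bsub>K\<^esub> ?w k)"
      unfolding right_mult[OF u hj(1)] using uk
      by (intro C.expand_cong) (auto simp: aut_pow_h_pow A.smult_mult_right K.m_comm)
    also have "\<dots> = \<iota> (h [^]\<^bsub>K\<^esub> j) \<otimes> C.expand ?w" by (rule C.expand_left_mult[OF w hj(1)])
    finally have "\<iota> (inv\<^bsub>K\<^esub> (h [^]\<^bsub>K\<^esub> j)) \<otimes> (C.expand u \<otimes> \<iota> (h [^]\<^bsub>K\<^esub> j)) =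
        \<iota> (inv\<^bsub>K\<^esub> (h [^]\<^bsub>K\<^esub> j)) \<otimes> (\<iota> (h [^]\<^bsub>K\<^esub> j) \<otimes> C.expand ?w)" by simp
    also have "\<dots> = \<iota> (inv\<^bsub>K\<^esub> (h [^]\<^bsub>K\<^esub> j)) \<otimes> \<iota> (h [^]\<^bsub>K\<^esub> j) \<otimes> C.expand ?w"
      using hj C.expand_closed[OF w] by (intro C.A.m_assoc[symmetric] C.f.hom_simps(1) K.inv_nonzero)
    finally have "\<iota> (inv\<^bsub>K\<^esub> (h [^]\<^bsub>K\<^esub> j)) \<otimes> (C.expand u \<otimes> \<iota> (h [^]\<^bsub>K\<^esub> j)) =
        \<iota> (inv\<^bsub>K\<^esub> (h [^]\<^bsub>K\<^esub> j)) \<otimes> \<iota> (h [^]\<^bsub>K\<^esub> j) \<otimes> C.expand ?w" .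
    then have "C.expand ?w = \<iota> (inv\<^bsub>K\<^esub> (h [^]\<^bsub>K\<^esub> j)) \<otimes> (C.expand u \<otimes> \<iota> (h [^]\<^bsub>K\<^esub> j))"
      unfolding iota_inv(1)[OF hj] using C.expand_closed[OF w] by simp
    then have "C.expand ?w \<in> I"
      using I.I_l_closed[OF I.I_r_closed[OF z C.f.hom_simps(1)[OF hj(1)]] C.f.hom_simps(1)[OF K.inv_nonzero(1)[OF hj]]]
      by simp
    moreover have "C.expand ?w = (\<Oplus>k\<in>{..<d}. ((\<omega> [^]\<^bsub>F\<^esub> k) [^]\<^bsub>F\<^esub> j) \<odot> (\<iota> (u k) \<otimes> x [^] k))"
      unfolding C.expand_def using uk
      by (intro C.A.M.finsum_cong') (auto simp: C.A.smult_mult_left F.nat_pow_pow)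
    ultimately have "?p (\<Oplus>k\<in>{..<d}. ((\<omega> [^]\<^bsub>F\<^esub> k) [^]\<^bsub>F\<^esub> j) \<odot> (\<iota> (u k) \<otimes> x [^] k)) = \<zero>\<^bsub>?Q\<^esub>"
      using quot(4) w C.expand_closed by metis
    moreover have "?p (\<Oplus>k\<in>{..<d}. ((\<omega> [^]\<^bsub>F\<^esub> k) [^]\<^bsub>F\<^esub> j) \<odot> (\<iota> (u k) \<otimes> x [^] k)) =
        (\<Oplus>\<^bsub>?Q\<^esub>k\<in>{..<d}. ?p (((\<omega> [^]\<^bsub>F\<^esub> k) [^]\<^bsub>F\<^esub> j) \<odot> (\<iota> (u k) \<otimes> x [^] k)))"
      using uk by (intro p.finsum) auto
    moreover have "\<dots> = (\<Oplus>\<^bsub>?Q\<^esub>k\<in>{..<d}. ((\<omega> [^]\<^bsub>F\<^esub> k) [^]\<^bsub>F\<^esub> j) \<odot>\<^bsub>?Q\<^esub> ?p (\<iota> (u k) \<otimes> x [^] k))"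
      using uk by (intro p.B.M.finsum_cong') (auto simp del: p.hom_simps(2) intro!: p.hom_simps)
    ultimately show ?thesis by simp
  qed
  then have "\<forall>k\<in>{..<d}. ?p (\<iota> (u k) \<otimes> x [^] k) = \<zero>\<^bsub>?Q\<^esub>"
    using uk om.root_pow_inj
    by (intro power_sums_zero[OF F.field_axioms quot(1), where l = "\<lambda>k. \<omega> [^]\<^bsub>F\<^esub> k"])
      (auto simp: inj_on_def simp del: p.hom_simps(2) intro!: p.hom_simps(1))
  then have *: "?p (\<iota> (u k) \<otimes> x [^] k) = \<zero>\<^bsub>?Q\<^esub>" using k by blast
  have "\<iota> (u k) \<otimes> x [^] k \<in> carrier C" using uk[OF k] by simp
  from iffD1[OF quot(4)[OF this] *] show ?thesis .
qed

text \<open>A nonzero component of an element of the ideal is a unit: its coefficient is invertible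
  in the field K and the power of \<open>x\<close> is invertible because \<open>\<alpha>\<close> is
  nonzero.\<close>

lemma simple: "simple_ring C"
  unfolding simple_ring_def
proof (intro conjI allI impI)
  show "ring C" by (rule C.A.ring_axioms)
  show "carrier C \<noteq> {\<zero>}" using C_nontrivial C.A.one_closed by (metis singletonD)
  fix I assume I: "ideal I C"
  interpret I: ideal I C by fact
  show "I = {\<zero>} \<or> I = carrier C"
  proof (cases "I = {\<zero>}")
    case False
    have "\<zero> \<in> I" by (rule I.zero_closed)
    then obtain z where z: "z \<in> I" "z \<noteq> \<zero>" using False by auto
    then have zc: "z \<in> carrier C" using I.a_subset by blast
    obtain u where u: "u \<in> {..<d} \<rightarrow> carrier K" and zu: "z = C.expand u" using C.span[OF zc] by blast
    have "\<exists>k<d. u k \<noteq> \<zero>\<^bsub>K\<^esub>"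
    proof (rule ccontr)
      assume "\<not> ?thesis"
      then have "C.expand u = C.expand (\<lambda>k. \<zero>\<^bsub>K\<^esub>)" using u by (intro C.expand_cong) auto
      also have "\<dots> = \<zero>" by (simp add: C.expand_def)
      finally show False using z zu by simp
    qed
    then obtain k where k: "k < d" "u k \<noteq> \<zero>\<^bsub>K\<^esub>" by blast
    have uk: "u k \<in> carrier K" using u k by auto
    obtain w where w: "w \<in> carrier C" "x [^] k \<otimes> w = \<one>" using x_pow_unit by blast
    have iu: "\<iota> (inv\<^bsub>K\<^esub> (u k)) \<in> carrier C" using uk k(2) by (intro C.f.hom_simps(1) K.inv_nonzero)
    have "\<iota> (u k) \<otimes> x [^] k \<in> I" by (rule ideal_mono[OF I u _ k(1)]) (use z zu in simp)
    from I.I_r_closed[OF I.I_l_closed[OF this iu] w(1)]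
    have "\<iota> (inv\<^bsub>K\<^esub> (u k)) \<otimes> (\<iota> (u k) \<otimes> x [^] k) \<otimes> w \<in> I" .
    also have "\<iota> (inv\<^bsub>K\<^esub> (u k)) \<otimes> (\<iota> (u k) \<otimes> x [^] k) \<otimes> w =
        (\<iota> (inv\<^bsub>K\<^esub> (u k)) \<otimes> \<iota> (u k)) \<otimes> (x [^] k \<otimes> w)"
      using w(1) C.f.hom_simps(1)[OF uk] iu by (simp only: C.A.m_assoc C.A.m_closed C.A.nat_pow_closed C.y)
    also have "\<dots> = \<one>" using iota_inv(1)[OF uk k(2)] w by simp
    finally show ?thesis using I.one_imp_carrier by blast
  qed simp
qed

text \<open>The products \<open>h^l x^k\<close> form a basis over F; they are numbered by
  \<open>i = k d + l\<close>.\<close>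

lemma dimension: "C.A.dimension (d * d) (scalars F C) (carrier C)"
proof -
  define v where "v i = \<iota> (h [^]\<^bsub>K\<^esub> (i mod d)) \<otimes> x [^] (i div d)" for i :: nat
  have v: "v i \<in> carrier C" for i by (simp add: v_def)
  have sum: "(\<Oplus>i\<in>{..<d * d}. e i \<odot> v i) = C.expand (\<lambda>k. expand (\<lambda>l. e (k * d + l)))"
    if e: "e \<in> {..<d * d} \<rightarrow> carrier F" for e
  proof -
    have ei: "e i \<in> carrier F" if "i < d * d" for i using e that by auto
    \<comment> \<open>Extended by zero, because the index splitting asks for a family with values in
      the carrier at every index.\<close>
    define e' where "e' i = (if i < d * d then e i else \<zero>\<^bsub>F\<^esub>)" for i
    have e' [simp]: "e' i \<in> carrier F" for i using ei by (simp add: e'_def)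
    have lt: "k * d + l < d * d" if "k < d" "l < d" for k l
    proof -
      have "k * d + l < Suc k * d" using that by simp
      also have "\<dots> \<le> d * d" using that by (intro mult_le_mono1) simp
      finally show ?thesis .
    qed
    have "(\<Oplus>i\<in>{..<d * d}. e i \<odot> v i) = (\<Oplus>i\<in>{..<d * d}. e' i \<odot> v i)"
      by (rule C.A.M.finsum_cong') (use v ei in \<open>auto simp: e'_def\<close>)
    also have "\<dots> = (\<Oplus>k\<in>{..<d}. \<Oplus>l\<in>{..<d}. e' (k * d + l) \<odot> v (k * d + l))"
      by (rule C.A.M.finsum_mult_index) (use v in simp)
    also have "\<dots> = (\<Oplus>k\<in>{..<d}. \<iota> (expand (\<lambda>l. e' (k * d + l))) \<otimes> x [^] k)"
    proof (rule C.A.M.finsum_cong'[OF refl])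
      fix k assume k: "k \<in> {..<d}"
      have "(\<Oplus>l\<in>{..<d}. e' (k * d + l) \<odot> v (k * d + l)) =
          (\<Oplus>l\<in>{..<d}. \<iota> (e' (k * d + l) \<odot>\<^bsub>K\<^esub> h [^]\<^bsub>K\<^esub> l) \<otimes> x [^] k)"
        by (rule C.A.M.finsum_cong') (auto simp: v_def C.A.smult_mult_left)
      also have "\<dots> = (\<Oplus>l\<in>{..<d}. \<iota> (e' (k * d + l) \<odot>\<^bsub>K\<^esub> h [^]\<^bsub>K\<^esub> l)) \<otimes> x [^] k"
        by (subst C.A.finsum_mult) auto
      also have "(\<Oplus>l\<in>{..<d}. \<iota> (e' (k * d + l) \<odot>\<^bsub>K\<^esub> h [^]\<^bsub>K\<^esub> l)) = \<iota> (\<Oplus>\<^bsub>K\<^esub>l\<in>{..<d}. e' (k * d + l) \<odot>\<^bsub>K\<^esub> h [^]\<^bsub>K\<^esub> l)"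
        by (rule C.f.finsum[symmetric]) auto
      also have "(\<Oplus>\<^bsub>K\<^esub>l\<in>{..<d}. e' (k * d + l) \<odot>\<^bsub>K\<^esub> h [^]\<^bsub>K\<^esub> l) = expand (\<lambda>l. e' (k * d + l))"
        by (rule expand_smult[symmetric]) auto
      finally show "(\<Oplus>l\<in>{..<d}. e' (k * d + l) \<odot> v (k * d + l)) = \<iota> (expand (\<lambda>l. e' (k * d + l))) \<otimes> x [^] k" .
    qed auto
    also have "\<dots> = C.expand (\<lambda>k. expand (\<lambda>l. e' (k * d + l)))" by (simp only: C.expand_def)
    also have "\<dots> = C.expand (\<lambda>k. expand (\<lambda>l. e (k * d + l)))"
    proof (rule C.expand_cong)
      show "expand (\<lambda>l. e' (k * d + l)) = expand (\<lambda>l. e (k * d + l))" if "k < d" for k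
      proof (rule expand_cong)
        show "e' (k * d + l) = e (k * d + l)" if "l < d" for l
          using lt[OF \<open>k < d\<close> that] by (simp add: e'_def)
      qed simp
      show "(\<lambda>k. expand (\<lambda>l. e' (k * d + l))) \<in> {..<d} \<rightarrow> carrier K" by (intro Pi_I expand_closed) simp
    qed
    finally show ?thesis .
  qed
  have ec: "expand (\<lambda>l. e (k * d + l)) \<in> carrier K" if "e \<in> {..<d * d} \<rightarrow> carrier F" "k < d" for e k
  proof (rule expand_closed)
    have "k * d + l < d * d" if "l < d" for l
    proof -
      have "k * d + l < Suc k * d" using that by simp
      also have "\<dots> \<le> d * d" using \<open>k < d\<close> by (intro mult_le_mono1) simp
      finally show ?thesis .
    qed
    then show "(\<lambda>l. e (k * d + l)) \<in> {..<d} \<rightarrow> carrier (self_algebra F)" using that by auto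
  qed
  have V: "carrier C = {\<Oplus>i\<in>{..<d * d}. e i \<odot> v i | e. e \<in> {..<d * d} \<rightarrow> carrier F}"
  proof (intro equalityI subsetI)
    fix z assume "z \<in> carrier C"
    then obtain u where u: "u \<in> {..<d} \<rightarrow> carrier K" and zu: "z = C.expand u" using C.span by blast
    define e where "e i = coef (u (i div d)) (i mod d)" for i
    have e: "e \<in> {..<d * d} \<rightarrow> carrier F"
    proof
      fix i assume "i \<in> {..<d * d}"
      then have "i div d < d" "i mod d < d" using d by (auto simp: less_mult_imp_div_less)
      then show "e i \<in> carrier F" using coef(1)[of "u (i div d)"] u by (auto simp: e_def Pi_iff)
    qed
    have "C.expand u = C.expand (\<lambda>k. expand (\<lambda>l. e (k * d + l)))"
    proof (rule C.expand_cong[OF _ u])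
      fix k assume k: "k < d"
      then have uk: "u k \<in> carrier K" using u by auto
      have "expand (coef (u k)) = expand (\<lambda>l. e (k * d + l))"
        by (rule expand_cong[OF _ coef(1)[OF uk]]) (use d in \<open>auto simp: e_def\<close>)
      then show "u k = expand (\<lambda>l. e (k * d + l))" using coef(2)[OF uk] by simp
    qed
    then have "z = (\<Oplus>i\<in>{..<d * d}. e i \<odot> v i)" using zu sum[OF e] by (simp only:)
    then show "z \<in> {\<Oplus>i\<in>{..<d * d}. e i \<odot> v i | e. e \<in> {..<d * d} \<rightarrow> carrier F}" using e by blast
  next
    fix z assume "z \<in> {\<Oplus>i\<in>{..<d * d}. e i \<odot> v i | e. e \<in> {..<d * d} \<rightarrow> carrier F}"
    then obtain e where e: "e \<in> {..<d * d} \<rightarrow> carrier F" and z: "z = (\<Oplus>i\<in>{..<d * d}. e i \<odot> v i)" by blast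
    show "z \<in> carrier C" unfolding z using e v by (intro C.A.M.finsum_closed) (auto simp: Pi_iff)
  qed
  have ind: "\<forall>i<d * d. e i = \<zero>\<^bsub>F\<^esub>" if e: "e \<in> {..<d * d} \<rightarrow> carrier F" and 0: "(\<Oplus>i\<in>{..<d * d}. e i \<odot> v i) = \<zero>" for e
  proof (intro allI impI)
    fix i assume i: "i < d * d"
    then have id: "i div d < d" "i mod d < d" using d by (auto simp: less_mult_imp_div_less)
    have "C.expand (\<lambda>k. expand (\<lambda>l. e (k * d + l))) = \<zero>" using 0 sum[OF e] by simp
    then have *: "expand (\<lambda>l. e (i div d * d + l)) = \<zero>\<^bsub>K\<^esub>"
      using ec[OF e] id(1) C.indep[of "\<lambda>k. expand (\<lambda>l. e (k * d + l))" "i div d"] by (simp add: Pi_iff)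
    have "e (i div d * d + i mod d) = \<zero>\<^bsub>self_algebra F\<^esub>"
    proof (rule indep[of "\<lambda>l. e (i div d * d + l)", OF _ * id(2)])
      have "i div d * d + l < d * d" if "l < d" for l
      proof -
        have "i div d * d + l < Suc (i div d) * d" using that by simp
        also have "\<dots> \<le> d * d" using id by (intro mult_le_mono1) simp
        finally show ?thesis .
      qed
      then show "(\<lambda>l. e (i div d * d + l)) \<in> {..<d} \<rightarrow> carrier (self_algebra F)" using e by auto
    qed
    then show "e i = \<zero>\<^bsub>F\<^esub>" by simp
  qed
  show ?thesis
    by (rule CF.basis_family(3)[where v = v, OF _ V ind]) (use v in auto)
qed

lemma has_degree: "has_degree F C d" and central_simple: "central_simple F C"
proof -
  show cs: "central_simple F C"
    unfolding central_simple_def using C.A.finite_dimensionI[OF dimension]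
    by (intro conjI C.A.assoc_algebra_axioms simple center)
  show "has_degree F C d"
    unfolding has_degree_def power2_eq_square by (intro conjI cs dimension)
qed

lemma iota_iso: "\<iota> \<in> alg_iso F K (C\<lparr>carrier := \<iota> ` carrier K\<rparr>)"
  by (rule alg_isoI) (auto intro!: alg_homI simp: C.f_inj)

lemma iota_kummer: "kummer F (C\<lparr>carrier := \<iota> ` carrier K\<rparr>) (\<iota> h) d c"
  by (rule kummer_transport[OF kummer_axioms iota_iso C.f.image_algebra])

lemma iota_field: "field (C\<lparr>carrier := \<iota> ` carrier K\<rparr>)"
proof (rule cring.cring_fieldI2[OF kummer.cring[OF iota_kummer]])
  show "\<zero>\<^bsub>C\<lparr>carrier := \<iota> ` carrier K\<rparr>\<^esub> \<noteq> \<one>\<^bsub>C\<lparr>carrier := \<iota> ` carrier K\<rparr>\<^esub>" using C_nontrivial by simp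
  fix z assume "z \<in> carrier (C\<lparr>carrier := \<iota> ` carrier K\<rparr>)" "z \<noteq> \<zero>\<^bsub>C\<lparr>carrier := \<iota> ` carrier K\<rparr>\<^esub>"
  then obtain u where u0: "u \<in> carrier K" "z = \<iota> u" "z \<noteq> \<zero>" by auto
  have u: "u \<in> carrier K" "z = \<iota> u" "u \<noteq> \<zero>\<^bsub>K\<^esub>" using u0 C.f.zero by blast+
  then show "\<exists>w\<in>carrier (C\<lparr>carrier := \<iota> ` carrier K\<rparr>). z \<otimes>\<^bsub>C\<lparr>carrier := \<iota> ` carrier K\<rparr>\<^esub> w = \<one>\<^bsub>C\<lparr>carrier := \<iota> ` carrier K\<rparr>\<^esub>"
    using iota_inv(2)[OF u(1,3)] by (intro bexI[of _ "\<iota> (inv\<^bsub>K\<^esub> u)"]) auto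
qed

lemma strictly_maximal: "strictly_maximal_subfield F C (\<iota> ` carrier K)"
  unfolding strictly_maximal_subfield_def
proof (intro conjI exI[of _ d] has_degree)
  show "subfield (\<iota> ` carrier K) C"
    by (rule C.A.subfield_iff(1)[OF iota_field]) auto
  show "scalars F C \<subseteq> \<iota> ` carrier K"
  proof
    fix z assume "z \<in> scalars F C"
    then obtain e where e: "e \<in> carrier F" "z = e \<odot> \<one>" by (auto simp: scalars_def)
    then have "z = \<iota> (e \<odot>\<^bsub>K\<^esub> \<one>\<^bsub>K\<^esub>)" by simp
    then show "z \<in> \<iota> ` carrier K" using e by blast
  qed
  have V: "\<iota> ` carrier K = {\<Oplus>i\<in>{..<d}. e i \<odot> \<iota> (h [^]\<^bsub>K\<^esub> i) | e. e \<in> {..<d} \<rightarrow> carrier F}"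
    and sum: "\<And>e. e \<in> {..<d} \<rightarrow> carrier F ==> (\<Oplus>i\<in>{..<d}. e i \<odot> \<iota> (h [^]\<^bsub>K\<^esub> i)) = \<iota> (expand e)"
  proof -
    show sum: "(\<Oplus>i\<in>{..<d}. e i \<odot> \<iota> (h [^]\<^bsub>K\<^esub> i)) = \<iota> (expand e)" if e: "e \<in> {..<d} \<rightarrow> carrier F" for e
      unfolding expand_smult[OF e] using e
      by (subst C.f.finsum) (auto simp: Pi_iff intro!: C.A.M.finsum_cong')
    show "\<iota> ` carrier K = {\<Oplus>i\<in>{..<d}. e i \<odot> \<iota> (h [^]\<^bsub>K\<^esub> i) | e. e \<in> {..<d} \<rightarrow> carrier F}"
    proof (intro equalityI subsetI)
      fix z assume "z \<in> \<iota> ` carrier K"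
      then obtain v where v: "v \<in> carrier K" "z = \<iota> v" by blast
      obtain e where e: "e \<in> {..<d} \<rightarrow> carrier F" "v = expand e" using span[OF v(1)] by auto
      then have "z = (\<Oplus>i\<in>{..<d}. e i \<odot> \<iota> (h [^]\<^bsub>K\<^esub> i))" using sum[OF e(1)] v by simp
      then show "z \<in> {\<Oplus>i\<in>{..<d}. e i \<odot> \<iota> (h [^]\<^bsub>K\<^esub> i) | e. e \<in> {..<d} \<rightarrow> carrier F}" using e(1) by blast
    next
      fix z assume "z \<in> {\<Oplus>i\<in>{..<d}. e i \<odot> \<iota> (h [^]\<^bsub>K\<^esub> i) | e. e \<in> {..<d} \<rightarrow> carrier F}"
      then obtain e where e: "e \<in> {..<d} \<rightarrow> carrier F" "z = (\<Oplus>i\<in>{..<d}. e i \<odot> \<iota> (h [^]\<^bsub>K\<^esub> i))" by blast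
      have "expand e \<in> carrier K" using e(1) by (intro expand_closed) simp
      then show "z \<in> \<iota> ` carrier K" using sum[OF e(1)] e(2) by simp
    qed
  qed
  show "C.A.dimension d (scalars F C) (\<iota> ` carrier K)"
  proof (rule CF.basis_family(3)[where v = "\<lambda>i. \<iota> (h [^]\<^bsub>K\<^esub> i)", OF _ V])
    fix e assume e: "e \<in> {..<d} \<rightarrow> carrier F" and 0: "(\<Oplus>i\<in>{..<d}. e i \<odot> \<iota> (h [^]\<^bsub>K\<^esub> i)) = \<zero>"
    have ec: "expand e \<in> carrier K" using e by (intro expand_closed) simp
    have "expand e = \<zero>\<^bsub>K\<^esub>" by (rule iota_zero[OF ec]) (use 0 sum[OF e] in \<open>simp only:\<close>)
    from indep[unfolded self_algebra_simps, OF e this] show "\<forall>i<d. e i = \<zero>\<^bsub>F\<^esub>" by blast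
  qed simp
qed

lemma cyclic_algebra: "cyclic_algebra F C"
  unfolding cyclic_algebra_def
  using kummer_galois[OF iota_kummer om.root_of_unity_axioms iota_field c0]
  by (intro conjI central_simple exI[of _ "\<iota> ` carrier K"] strictly_maximal)

lemma iota_mono: "\<iota> \<in> alg_mono F K C"
  by (simp add: alg_mono_def C.f C.f_inj)

end

section \<open>Surjectivity onto matrices from generators\<close>

lemma (in matrix_units) image_closed:
  defines "R \<equiv> of_mat ` carrier (mat_algebra m B)"
  shows "\<zero>\<^bsub>A\<^esub> \<in> R" "z \<in> R ==> w \<in> R ==> z \<otimes>\<^bsub>A\<^esub> w \<in> R" "z \<in> R ==> w \<in> R ==> z \<oplus>\<^bsub>A\<^esub> w \<in> R"
    "z \<in> R ==> z [^]\<^bsub>A\<^esub> (k::nat) \<in> R" "c \<in> carrier F ==> c \<odot>\<^bsub>A\<^esub> \<one>\<^bsub>A\<^esub> \<in> R"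
proof -
  note hom = alg_homD[OF of_mat_hom]
  show mult: "z \<otimes>\<^bsub>A\<^esub> w \<in> R" if zw: "z \<in> R" "w \<in> R" for z w
  proof -
    obtain M N where "M \<in> carrier (mat_algebra m B)" "z = of_mat M" "N \<in> carrier (mat_algebra m B)" "w = of_mat N"
      using zw unfolding R_def by blast
    then show ?thesis using hom(2)[of M N] mat_closed(1)[of M N] unfolding R_def by (metis imageI)
  qed
  show "z \<oplus>\<^bsub>A\<^esub> w \<in> R" if zw: "z \<in> R" "w \<in> R"
  proof -
    obtain M N where "M \<in> carrier (mat_algebra m B)" "z = of_mat M" "N \<in> carrier (mat_algebra m B)" "w = of_mat N"
      using zw unfolding R_def by blast
    then show ?thesis using hom(3)[of M N] mat_closed(2)[of M N] unfolding R_def by (metis imageI)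
  qed
  show one: "c \<odot>\<^bsub>A\<^esub> \<one>\<^bsub>A\<^esub> \<in> R" if "c \<in> carrier F" for c
    using hom(4,5) that mat_closed(3)[OF that mat_closed(4)] mat_closed(4) unfolding R_def by (metis imageI)
  have "\<zero>\<^bsub>A\<^esub> = \<zero>\<^bsub>F\<^esub> \<odot>\<^bsub>A\<^esub> \<one>\<^bsub>A\<^esub>" by simp
  then show "\<zero>\<^bsub>A\<^esub> \<in> R" using one[of "\<zero>\<^bsub>F\<^esub>"] by simp
  have "\<one>\<^bsub>A\<^esub> = \<one>\<^bsub>F\<^esub> \<odot>\<^bsub>A\<^esub> \<one>\<^bsub>A\<^esub>" by simp
  then have "\<one>\<^bsub>A\<^esub> \<in> R" using one[of "\<one>\<^bsub>F\<^esub>"] by simp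
  then show "z [^]\<^bsub>A\<^esub> k \<in> R" if "z \<in> R" using that mult by (induction k) auto
qed

text \<open>The image of \<open>of_mat\<close> is closed under the operations, so it is everything
  once it contains the base and the generator of a presentation.\<close>

lemma (in matrix_units) surj_if_generated:
  assumes "skew_pres F D A f y \<sigma> d a" and f: "\<And>u. u \<in> carrier D ==> f u \<in> of_mat ` carrier (mat_algebra m B)"
    and y: "y \<in> of_mat ` carrier (mat_algebra m B)"
  shows "carrier A = of_mat ` carrier (mat_algebra m B)"
proof -
  interpret P: skew_pres F D A f y \<sigma> d a by fact
  have "z \<in> of_mat ` carrier (mat_algebra m B)" if "z \<in> carrier A" for z
    using that
  proof (induction z rule: P.induct)
    case (mono v k) then show ?case using image_closed(2,4) f y by blast
  qed (use image_closed(1,3) in auto)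
  then show ?thesis using alg_homD(1)[OF of_mat_hom] by blast
qed

section \<open>Splitting of the cyclic algebra and norms\<close>

context cyclic_alg begin

lemma x_iota_h: "x \<otimes> \<iota> h = \<omega> \<odot> (\<iota> h \<otimes> x)"
proof -
  have "x \<otimes> \<iota> h = \<iota> (\<sigma> h) \<otimes> x" by (rule C.rel[OF y])
  also have "\<iota> (\<sigma> h) = \<omega> \<odot> \<iota> h" unfolding aut_h by simp
  finally show ?thesis by (simp add: C.A.smult_mult_left)
qed

text \<open>Each factor \<open>x\<close> conjugates the factors \<open>b\<close> to its right, so
  the k-th power collects the first k conjugates; for k = d these multiply to the norm.\<close>

lemma iota_x_pow:
  assumes b: "b \<in> carrier K"
  shows "(\<iota> b \<otimes> x) [^] (k::nat) = \<iota> (\<Otimes>\<^bsub>K\<^esub>i\<in>{..<k}. (\<sigma> ^^ i) b) \<otimes> x [^] k"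
proof (induction k)
  case (Suc k)
  have cl: "(\<Otimes>\<^bsub>K\<^esub>i\<in>{..<k}. (\<sigma> ^^ i) b) \<in> carrier K" using b by (intro K.finprod_closed) auto
  have "(\<iota> b \<otimes> x) [^] Suc k = (\<iota> (\<Otimes>\<^bsub>K\<^esub>i\<in>{..<k}. (\<sigma> ^^ i) b) \<otimes> x [^] k) \<otimes> (\<iota> b \<otimes> x [^] (1::nat))"
    using Suc b by simp
  also have "\<dots> = \<iota> ((\<Otimes>\<^bsub>K\<^esub>i\<in>{..<k}. (\<sigma> ^^ i) b) \<otimes>\<^bsub>K\<^esub> (\<sigma> ^^ k) b) \<otimes> x [^] (k + 1)"
    by (rule C.mono_mult[OF cl b])
  also have "(\<Otimes>\<^bsub>K\<^esub>i\<in>{..<k}. (\<sigma> ^^ i) b) \<otimes>\<^bsub>K\<^esub> (\<sigma> ^^ k) b = (\<Otimes>\<^bsub>K\<^esub>i\<in>{..<Suc k}. (\<sigma> ^^ i) b)"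
    using b cl by (simp add: lessThan_Suc K.m_comm Pi_iff)
  finally show ?case by simp
qed simp

text \<open>Rescaling \<open>x\<close> by \<open>b\<^sup>-\<^sup>1\<close> makes its \<open>d\<close>-th power trivial; the idempotents built from this
  element are permuted cyclically by \<open>h\<close>.\<close>

lemma split_if_norm:
  assumes b: "b \<in> carrier K" and norm: "\<alpha> \<odot>\<^bsub>K\<^esub> \<one>\<^bsub>K\<^esub> = (\<Otimes>\<^bsub>K\<^esub>i\<in>{..<d}. (\<sigma> ^^ i) b)"
  shows "alg_isomorphic F C (mat_algebra d (self_algebra F))"
proof -
  have b0: "b \<noteq> \<zero>\<^bsub>K\<^esub>"
  proof
    assume "b = \<zero>\<^bsub>K\<^esub>"
    then have "(\<Otimes>\<^bsub>K\<^esub>i\<in>{..<d}. (\<sigma> ^^ i) b) = \<zero>\<^bsub>K\<^esub>"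
      using d b by (intro K.finprod_zero_factor[where i = 0]) auto
    then show False using scalar_zero[OF alpha] norm alpha0 by simp
  qed
  let ?b = "inv\<^bsub>K\<^esub> b"
  have bi: "?b \<in> carrier K" using b b0 by simp
  define y where "y = \<iota> ?b \<otimes> x"
  have y: "y \<in> carrier C" using bi by (simp add: y_def)
  have ypow: "y [^] d = \<one>"
  proof -
    have cl: "(\<Otimes>\<^bsub>K\<^esub>i\<in>{..<d}. (\<sigma> ^^ i) ?b) \<in> carrier K" using bi by (intro K.finprod_closed) auto
    have "y [^] d = \<iota> (\<Otimes>\<^bsub>K\<^esub>i\<in>{..<d}. (\<sigma> ^^ i) ?b) \<otimes> \<iota> (\<alpha> \<odot>\<^bsub>K\<^esub> \<one>\<^bsub>K\<^esub>)"
      unfolding y_def iota_x_pow[OF bi] C.pow ..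
    also have "\<dots> = \<iota> ((\<Otimes>\<^bsub>K\<^esub>i\<in>{..<d}. (\<sigma> ^^ i) ?b) \<otimes>\<^bsub>K\<^esub> (\<Otimes>\<^bsub>K\<^esub>i\<in>{..<d}. (\<sigma> ^^ i) b))"
      unfolding norm using cl b bi by (intro C.f.hom_simps(2)[symmetric] K.finprod_closed) auto
    also have "(\<Otimes>\<^bsub>K\<^esub>i\<in>{..<d}. (\<sigma> ^^ i) ?b) \<otimes>\<^bsub>K\<^esub> (\<Otimes>\<^bsub>K\<^esub>i\<in>{..<d}. (\<sigma> ^^ i) b) = (\<Otimes>\<^bsub>K\<^esub>i\<in>{..<d}. (\<sigma> ^^ i) ?b \<otimes>\<^bsub>K\<^esub> (\<sigma> ^^ i) b)"
      using b bi by (intro K.finprod_multf[symmetric]) auto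
    also have "\<dots> = (\<Otimes>\<^bsub>K\<^esub>i\<in>{..<d}. \<one>\<^bsub>K\<^esub>)"
    proof (rule K.finprod_cong'[OF refl])
      fix i :: nat
      have "(\<sigma> ^^ i) (?b \<otimes>\<^bsub>K\<^esub> b) = (\<sigma> ^^ i) \<one>\<^bsub>K\<^esub>" using b b0 by simp
      then show "(\<sigma> ^^ i) ?b \<otimes>\<^bsub>K\<^esub> (\<sigma> ^^ i) b = \<one>\<^bsub>K\<^esub>"
        using alg_homD(2,4)[OF aut_pow_hom] b bi by simp
    qed simp
    finally show ?thesis by simp
  qed
  \<comment> \<open>From \<open>y h = \<omega> h y\<close> one gets
    \<open>h y = \<omega>^(-1) y h\<close>. The latter is the twist relation with \<open>h\<close>
    as the shifting unit and the inverse root, so the idempotents of \<open>y\<close> are formed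
    with \<open>\<omega>^(-1)\<close>.\<close>
  interpret inv: root_of_unity F d "inv\<^bsub>F\<^esub> \<omega>" by (rule om.root_of_unity_inv)
  interpret R: root_idempotents F d "inv\<^bsub>F\<^esub> \<omega>" C y
    by (intro root_idempotents.intro root_idempotents_axioms.intro inv.root_of_unity_axioms
        C.A.assoc_algebra_axioms y ypow)
  have yh: "y \<otimes> \<iota> h = \<omega> \<odot> (\<iota> h \<otimes> y)"
  proof -
    have "y \<otimes> \<iota> h = \<iota> ?b \<otimes> (x \<otimes> \<iota> h)" using bi by (simp add: y_def C.A.m_assoc)
    also have "\<dots> = \<omega> \<odot> (\<iota> (?b \<otimes>\<^bsub>K\<^esub> h) \<otimes> x)"
      unfolding x_iota_h using bi by (simp add: C.A.smult_mult_right C.A.m_assoc)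
    also have "?b \<otimes>\<^bsub>K\<^esub> h = h \<otimes>\<^bsub>K\<^esub> ?b" using bi by (rule comm_h)
    also have "\<iota> (h \<otimes>\<^bsub>K\<^esub> ?b) \<otimes> x = \<iota> h \<otimes> y" using bi by (simp add: y_def C.A.m_assoc)
    finally show ?thesis .
  qed
  have twist: "\<iota> h \<otimes> y = inv\<^bsub>F\<^esub> \<omega> \<odot> (y \<otimes> \<iota> h)"
    unfolding yh using y by (simp add: C.A.smult_assoc1[symmetric])
  have ht: "\<iota> h \<otimes> R.idem (Suc j) = R.idem j \<otimes> \<iota> h" for j
    by (rule R.idem_twist[OF _ twist]) simp
  interpret U: cyclic_idempotents F C d R.idem "\<iota> h" "\<iota> (inv\<^bsub>K\<^esub> h)"
    using iota_inv[of h] h_nonzero d ht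
    by unfold_locales (auto simp: R.idem_mult R.idem_sum)
  have wrap: "\<iota> h \<otimes> R.idem 0 = R.idem (d - 1) \<otimes> \<iota> h"
    using ht[of "d - 1"] R.idem_period[of 0] d by simp
  interpret M: matrix_units F "self_algebra F" C "\<lambda>c. c \<odot> \<one>" d U.unit
  proof (rule U.matrix_units[OF scalar_hom[OF C.A.assoc_algebra_axioms]])
    show "inj_on (\<lambda>c. c \<odot> \<one>) (carrier (self_algebra F))"
      using CF.scalar_inj by (auto intro!: inj_onI)
  qed (simp add: C.A.one_smult_mult C.A.mult_one_smult)
  let ?R = "M.of_mat ` carrier (mat_algebra d (self_algebra F))"
  \<comment> \<open>In these matrix units \<open>y\<close> is diagonal, with the powers of
    \<open>\<omega>^(-1)\<close> on the diagonal.\<close>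
  have Ry: "y \<in> ?R"
  proof (rule M.in_image[OF y])
    fix i j assume ij: "i < d" "j < d"
    have "U.unit i i \<otimes> y \<otimes> U.unit j j = R.idem i \<otimes> (y \<otimes> R.idem j)"
      using ij y by (simp add: U.unit_diag C.A.m_assoc)
    also have "\<dots> = (inv\<^bsub>F\<^esub> \<omega> [^]\<^bsub>F\<^esub> j) \<odot> (R.idem i \<otimes> R.idem j)"
      by (simp add: R.g_idem C.A.smult_mult_right)
    also have "\<dots> = (if i = j then inv\<^bsub>F\<^esub> \<omega> [^]\<^bsub>F\<^esub> j else \<zero>\<^bsub>F\<^esub>) \<odot> U.unit i j"
      using ij by (simp add: R.idem_mult U.unit_diag)
    finally have "U.unit i i \<otimes> y \<otimes> U.unit j j =
        ((if i = j then inv\<^bsub>F\<^esub> \<omega> [^]\<^bsub>F\<^esub> j else \<zero>\<^bsub>F\<^esub>) \<odot> \<one>) \<otimes> U.unit i j"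
      by (subst C.A.one_smult_mult) auto
    then show "\<exists>e\<in>carrier (self_algebra F). U.unit i i \<otimes> y \<otimes> U.unit j j = (e \<odot> \<one>) \<otimes> U.unit i j"
      by (intro bexI[of _ "if i = j then inv\<^bsub>F\<^esub> \<omega> [^]\<^bsub>F\<^esub> j else \<zero>\<^bsub>F\<^esub>"]) auto
  qed
  \<comment> \<open>\<open>h\<close> is the cyclic shift with \<open>h^d = c\<close> in the corner.
    It generates K over F, so with \<open>h\<close> and \<open>y\<close> the image also contains
    \<open>x = b y\<close>.\<close>
  have Rh: "\<iota> h \<in> ?R"
  proof (rule M.in_image)
    fix i j assume ij: "i < d" "j < d"
    let ?e = "if j = Suc i mod d then (if Suc i < d then \<one>\<^bsub>F\<^esub> else c) else \<zero>\<^bsub>F\<^esub>"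
    have hd: "\<iota> h [^] d = c \<odot> \<one>" using C.f.pow[of h d] by (simp add: pow_d)
    have "U.unit i i \<otimes> \<iota> h \<otimes> U.unit j j = (?e \<odot> \<one>) \<otimes> U.unit i j"
      unfolding U.unit_diag[OF ij(1)] U.unit_diag[OF ij(2)] U.t_corner[OF wrap ij] hd by auto
    then show "\<exists>e\<in>carrier (self_algebra F). U.unit i i \<otimes> \<iota> h \<otimes> U.unit j j = (e \<odot> \<one>) \<otimes> U.unit i j"
      by (intro bexI[of _ ?e]) auto
  qed simp
  have Rmult: "z \<otimes> w \<in> ?R" if "z \<in> ?R" "w \<in> ?R" for z w
    using that M.image_closed(2) by blast
  have RK: "\<iota> u \<in> ?R" if "u \<in> carrier K" for u
    using that
  proof (induction u rule: induct)
    case (mono v k)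
    then have "\<iota> ((v \<odot>\<^bsub>K\<^esub> \<one>\<^bsub>K\<^esub>) \<otimes>\<^bsub>K\<^esub> h [^]\<^bsub>K\<^esub> k) = (v \<odot> \<one>) \<otimes> \<iota> h [^] k" by simp
    moreover have "\<iota> h [^] k \<in> ?R" by (rule M.image_closed(4)[OF Rh])
    moreover have "v \<odot> \<one> \<in> ?R" using mono M.image_closed(5) by simp
    ultimately show ?case using Rmult by simp
  next
    case zero then show ?case using M.image_closed(1) by simp
  next
    case (add u v) then show ?case using M.image_closed(3) by simp
  qed
  have "x = \<iota> b \<otimes> y"
    using iota_inv(2)[OF b b0] b bi by (simp add: y_def C.A.m_assoc[symmetric])
  then have "x \<in> ?R" using Rmult[OF RK[OF b] Ry] by simp
  from M.mat_isomorphic[OF M.surj_if_generated[OF C.skew_pres_axioms RK this]]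
  show ?thesis by simp
qed

text \<open>Let \<open>p\<close> correspond to the matrix unit at (0, 0). The left ideal
  \<open>C p\<close> consists of the matrices supported on the first column and has dimension d.
  Since K is a field, \<open>u \<mapsto> u p\<close> is injective on it, and \<open>K p\<close>,
  also of dimension d, is all of \<open>C p\<close>. Hence \<open>x p = b p\<close> for some
  \<open>b\<close> in K; then \<open>x^d p = N(b) p\<close>, and \<open>x^d = \<alpha>\<close> gives
  the claim.\<close>

lemma norm_if_split:
  assumes "alg_isomorphic F C (mat_algebra d (self_algebra F))"
  shows "\<exists>b\<in>carrier K. b \<noteq> \<zero>\<^bsub>K\<^esub> \<and> \<alpha> \<odot>\<^bsub>K\<^esub> \<one>\<^bsub>K\<^esub> = (\<Otimes>\<^bsub>K\<^esub>i\<in>{..<d}. (\<sigma> ^^ i) b)"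
proof -
  let ?M = "mat_algebra d (self_algebra F)"
  obtain \<theta> where \<theta>: "\<theta> \<in> alg_iso F C ?M" using assms unfolding alg_isomorphic_def by blast
  note hom = alg_homD[OF alg_isoD(1)[OF \<theta>]]
  have bij: "inj_on \<theta> (carrier C)" "\<theta> ` carrier C = carrier ?M"
    using alg_isoD(2)[OF \<theta>] by (auto simp: bij_betw_def)
  have zeroM: "\<zero>\<^bsub>?M\<^esub> = (\<lambda>(i, j)\<in>{..<d} \<times> {..<d}. \<zero>\<^bsub>F\<^esub>)" by (simp add: mat_algebra_def)
  have "\<theta> \<zero> = \<zero>\<^bsub>F\<^esub> \<odot>\<^bsub>?M\<^esub> \<theta> \<one>" using hom(5)[of "\<zero>\<^bsub>F\<^esub>" "\<one>"] by simp
  also have "\<dots> = \<zero>\<^bsub>?M\<^esub>" unfolding hom(4) zeroM mat_algebra_simps by (auto simp: fun_eq_iff)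
  finally have \<theta>0: "\<theta> \<zero> = \<zero>\<^bsub>?M\<^esub>" .
  interpret Mt: assoc_algebra F ?M
    by (rule assoc_algebra_image[OF C.A.assoc_algebra_axioms bij(2) hom(3,2,5,4) \<theta>0])
  interpret th: alg_homomorphism F C ?M \<theta>
    by (intro alg_homomorphism.intro alg_homomorphism_axioms.intro C.A.assoc_algebra_axioms
        Mt.assoc_algebra_axioms alg_isoD(1)[OF \<theta>])
  \<comment> \<open>The matrix units of the first column; their preimages \<open>v i\<close> span
    the left ideal generated by \<open>v 0\<close>.\<close>
  define e where "e i = (\<lambda>(k, l)\<in>{..<d} \<times> {..<d}. if k = i \<and> l = 0 then \<one>\<^bsub>F\<^esub> else \<zero>\<^bsub>F\<^esub>)" for i
  have e: "e i \<in> carrier ?M" for i unfolding mat_algebra_simps by (auto simp: e_def)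
  have "\<forall>i. \<exists>w. w \<in> carrier C \<and> \<theta> w = e i" using bij(2) e by (metis imageE)
  from choice[OF this] obtain v where v0: "\<forall>i. v i \<in> carrier C \<and> \<theta> (v i) = e i" ..
  have v [simp]: "v i \<in> carrier C" "\<theta> (v i) = e i" for i using v0 by auto
  have entry: "(\<Oplus>\<^bsub>?M\<^esub>i\<in>I. f i) (k, l) = (\<Oplus>\<^bsub>F\<^esub>i\<in>I. f i (k, l))"
    if kl: "k < d" "l < d" and f: "f \<in> I \<rightarrow> carrier ?M" for I f k l
  proof (rule additive_finsum[where h = "\<lambda>N. N (k, l)", OF Mt.M.abelian_monoid_axioms F.abelian_monoid_axioms _ _ _ f])
    show "(\<lambda>N. N (k, l)) \<in> carrier ?M \<rightarrow> carrier F" using kl by (auto simp: mat_algebra_simps)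
    show "\<zero>\<^bsub>?M\<^esub> (k, l) = \<zero>\<^bsub>F\<^esub>" using kl by (simp add: zeroM)
    show "(N \<oplus>\<^bsub>?M\<^esub> N') (k, l) = N (k, l) \<oplus>\<^bsub>F\<^esub> N' (k, l)" for N N'
      using kl by (simp add: mat_algebra_simps(4))
  qed
  have mat_ext: "N = N'" if "N \<in> carrier ?M" "N' \<in> carrier ?M" "\<And>k l. k < d ==> l < d ==> N (k, l) = N' (k, l)" for N N'
    using that unfolding mat_algebra_simps
    by (intro PiE_ext[of N "{..<d} \<times> {..<d}" "\<lambda>_. carrier F" N']) auto
  have me [simp]: "N (k, l) \<in> carrier F" if "N \<in> carrier ?M" "k < d" "l < d" for N k l
    using that by (auto simp: mat_algebra_simps)
  have lin: "(\<Oplus>\<^bsub>?M\<^esub>i\<in>{..<d}. f i \<odot>\<^bsub>?M\<^esub> e i) (k, l) = (if l = 0 then f k else \<zero>\<^bsub>F\<^esub>)"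
    if f: "f \<in> {..<d} \<rightarrow> carrier F" and kl: "k < d" "l < d" for f k l
  proof -
    have "(\<Oplus>\<^bsub>?M\<^esub>i\<in>{..<d}. f i \<odot>\<^bsub>?M\<^esub> e i) (k, l) = (\<Oplus>\<^bsub>F\<^esub>i\<in>{..<d}. (f i \<odot>\<^bsub>?M\<^esub> e i) (k, l))"
      using f e by (intro entry kl) auto
    also have "\<dots> = (\<Oplus>\<^bsub>F\<^esub>i\<in>{..<d}. if i = k then (if l = 0 then f k else \<zero>\<^bsub>F\<^esub>) else \<zero>\<^bsub>F\<^esub>)"
      using f kl by (intro F.finsum_cong') (auto simp: mat_algebra_simps(5) e_def Pi_iff)
    also have "\<dots> = (if l = 0 then f k else \<zero>\<^bsub>F\<^esub>)"
      using F.finsum_singleton[of k "{..<d}" "\<lambda>_. if l = 0 then f k else \<zero>\<^bsub>F\<^esub>"] f kl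
      by (auto simp: Pi_iff eq_commute[of k])
    finally show ?thesis .
  qed
  let ?p = "v 0"
  have p0: "?p \<noteq> \<zero>"
  proof
    assume "?p = \<zero>"
    then have "e 0 = \<zero>\<^bsub>?M\<^esub>" using v(2)[of 0] \<theta>0 by simp
    from fun_cong[OF this, of "(0, 0)"] show False using d by (simp add: e_def zeroM)
  qed
  have left: "z \<otimes> ?p = (\<Oplus>i\<in>{..<d}. \<theta> z (i, 0) \<odot> v i)" if z: "z \<in> carrier C" for z
  proof (rule inj_onD[OF bij(1)])
    have tz: "\<theta> z \<in> carrier ?M" using hom(1) z by blast
    have cf: "(\<lambda>i. \<theta> z (i, 0)) \<in> {..<d} \<rightarrow> carrier F" using tz d by auto
    have "\<theta> z \<otimes>\<^bsub>?M\<^esub> e 0 = (\<Oplus>\<^bsub>?M\<^esub>i\<in>{..<d}. \<theta> z (i, 0) \<odot>\<^bsub>?M\<^esub> e i)"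
    proof (rule mat_ext)
      fix k l assume kl: "k < d" "l < d"
      have "(\<theta> z \<otimes>\<^bsub>?M\<^esub> e 0) (k, l) = (\<Oplus>\<^bsub>F\<^esub>i\<in>{..<d}. \<theta> z (k, i) \<otimes>\<^bsub>F\<^esub> e 0 (i, l))"
        using kl by (simp add: mat_algebra_simps(2) finsum_self_algebra)
      also have "\<dots> = (\<Oplus>\<^bsub>F\<^esub>i\<in>{..<d}. if i = 0 then (if l = 0 then \<theta> z (k, 0) else \<zero>\<^bsub>F\<^esub>) else \<zero>\<^bsub>F\<^esub>)"
        using kl tz by (intro F.finsum_cong') (auto simp: e_def)
      also have "\<dots> = (if l = 0 then \<theta> z (k, 0) else \<zero>\<^bsub>F\<^esub>)"
        using F.finsum_singleton[of 0 "{..<d}" "\<lambda>_. if l = 0 then \<theta> z (k, 0) else \<zero>\<^bsub>F\<^esub>"] tz kl d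
        by (auto simp: eq_commute[of 0])
      finally show "(\<theta> z \<otimes>\<^bsub>?M\<^esub> e 0) (k, l) = (\<Oplus>\<^bsub>?M\<^esub>i\<in>{..<d}. \<theta> z (i, 0) \<odot>\<^bsub>?M\<^esub> e i) (k, l)"
        unfolding lin[OF cf kl] .
    next
      show "(\<Oplus>\<^bsub>?M\<^esub>i\<in>{..<d}. \<theta> z (i, 0) \<odot>\<^bsub>?M\<^esub> e i) \<in> carrier ?M"
        using cf e by (intro Mt.M.finsum_closed) auto
    qed (rule Mt.m_closed[OF tz e])
    moreover have "\<theta> (\<Oplus>i\<in>{..<d}. \<theta> z (i, 0) \<odot> v i) = (\<Oplus>\<^bsub>?M\<^esub>i\<in>{..<d}. \<theta> (\<theta> z (i, 0) \<odot> v i))"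
      using cf by (intro th.finsum) auto
    moreover have "\<dots> = (\<Oplus>\<^bsub>?M\<^esub>i\<in>{..<d}. \<theta> z (i, 0) \<odot>\<^bsub>?M\<^esub> e i)"
    proof (rule Mt.M.finsum_cong'[OF refl])
      show "\<theta> (\<theta> z (i, 0) \<odot> v i) = \<theta> z (i, 0) \<odot>\<^bsub>?M\<^esub> e i" if "i \<in> {..<d}" for i
        using cf that hom(5)[of "\<theta> z (i, 0)" "v i"] by (simp add: Pi_iff)
    qed (use cf e in auto)
    moreover have "\<theta> (z \<otimes> ?p) = \<theta> z \<otimes>\<^bsub>?M\<^esub> e 0" using hom(2)[of z ?p] z by simp
    ultimately show "\<theta> (z \<otimes> ?p) = \<theta> (\<Oplus>i\<in>{..<d}. \<theta> z (i, 0) \<odot> v i)" by simp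
    show "(\<Oplus>i\<in>{..<d}. \<theta> z (i, 0) \<odot> v i) \<in> carrier C" using cf by (intro C.A.M.finsum_closed) auto
  qed (use z in simp)
  let ?V = "{\<Oplus>i\<in>{..<d}. f i \<odot> v i | f. f \<in> {..<d} \<rightarrow> carrier F}"
  have indv: "\<forall>i<d. f i = \<zero>\<^bsub>F\<^esub>" if f: "f \<in> {..<d} \<rightarrow> carrier F" and 0: "(\<Oplus>i\<in>{..<d}. f i \<odot> v i) = \<zero>" for f
  proof (intro allI impI)
    fix k assume k: "k < d"
    have "\<zero>\<^bsub>?M\<^esub> = \<theta> (\<Oplus>i\<in>{..<d}. f i \<odot> v i)" unfolding 0 \<theta>0 ..
    also have "\<dots> = (\<Oplus>\<^bsub>?M\<^esub>i\<in>{..<d}. \<theta> (f i \<odot> v i))" using f by (intro th.finsum) auto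
    also have "\<dots> = (\<Oplus>\<^bsub>?M\<^esub>i\<in>{..<d}. f i \<odot>\<^bsub>?M\<^esub> e i)"
    proof (rule Mt.M.finsum_cong'[OF refl])
      show "\<theta> (f i \<odot> v i) = f i \<odot>\<^bsub>?M\<^esub> e i" if "i \<in> {..<d}" for i
        using f that hom(5)[of "f i" "v i"] by (simp add: Pi_iff)
    qed (use f e in auto)
    finally have "\<zero>\<^bsub>?M\<^esub> (k, 0) = (\<Oplus>\<^bsub>?M\<^esub>i\<in>{..<d}. f i \<odot>\<^bsub>?M\<^esub> e i) (k, 0)" by (rule fun_cong)
    then show "f k = \<zero>\<^bsub>F\<^esub>" using lin[OF f k d] k d by (simp add: zeroM)
  qed
  have dimV: "C.A.dimension d (scalars F C) ?V"
    by (rule CF.basis_family(3)[where v = v, OF _ refl indv]) auto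
  have inV: "z \<otimes> ?p \<in> ?V" if z: "z \<in> carrier C" for z
  proof -
    have "\<theta> z \<in> carrier ?M" using hom(1) z by blast
    then have "(\<lambda>i. \<theta> z (i, 0)) \<in> {..<d} \<rightarrow> carrier F" using d by auto
    then show ?thesis unfolding left[OF z] by (intro CollectI exI[of _ "\<lambda>i. \<theta> z (i, 0)"] conjI refl)
  qed
  define w where "w i = \<iota> (h [^]\<^bsub>K\<^esub> i) \<otimes> ?p" for i :: nat
  have w: "w i \<in> carrier C" for i by (simp add: w_def)
  have sumw: "(\<Oplus>i\<in>{..<d}. f i \<odot> w i) = \<iota> (expand f) \<otimes> ?p" if f: "f \<in> {..<d} \<rightarrow> carrier F" for f
  proof -
    have fi: "f i \<in> carrier F" if "i < d" for i using f that by auto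
    have "\<iota> (expand f) = (\<Oplus>i\<in>{..<d}. \<iota> (f i \<odot>\<^bsub>K\<^esub> h [^]\<^bsub>K\<^esub> i))"
      unfolding expand_smult[OF f] using fi by (intro C.f.finsum) auto
    then have "\<iota> (expand f) \<otimes> ?p = (\<Oplus>i\<in>{..<d}. \<iota> (f i \<odot>\<^bsub>K\<^esub> h [^]\<^bsub>K\<^esub> i) \<otimes> ?p)"
      using fi by (simp only:, intro C.A.finsum_mult) auto
    also have "\<dots> = (\<Oplus>i\<in>{..<d}. f i \<odot> w i)"
      using fi by (intro C.A.M.finsum_cong') (auto simp: w_def C.A.smult_mult_left)
    finally show ?thesis ..
  qed
  let ?us = "map w [0..<d]"
  have us: "set ?us \<subseteq> ?V" using inV unfolding w_def by auto
  have indw: "C.A.independent (scalars F C) ?us"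
  proof (rule CF.basis_family(1)[where v = w, OF _ refl])
    fix f assume f: "f \<in> {..<d} \<rightarrow> carrier F" and 0: "(\<Oplus>i\<in>{..<d}. f i \<odot> w i) = \<zero>"
    have ec: "expand f \<in> carrier K" using f by (intro expand_closed) simp
    have "expand f = \<zero>\<^bsub>K\<^esub>" using 0 unfolding sumw[OF f] by (intro iota_cancel[OF ec v(1)[of 0] _ p0])
    from indep[unfolded self_algebra_simps, OF f this] show "\<forall>i<d. f i = \<zero>\<^bsub>F\<^esub>" by blast
  qed (use w in auto)
  \<comment> \<open>The d elements \<open>h^i p\<close> are independent in a space of dimension d,
    hence they span it: \<open>K p = C p\<close>.\<close>
  have "C.A.Span (scalars F C) ?us = ?V"
    using C.A.independent_length_eq_dimension[OF CF.scalars_subfield dimV indw us] by simp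
  moreover have "set ?us \<subseteq> carrier C" using w by auto
  ultimately have "\<exists>f\<in>{..<length ?us} \<rightarrow> carrier F. x \<otimes> ?p = (\<Oplus>i\<in>{..<length ?us}. f i \<odot> ?us ! i)"
    using CF.Span_iff[of ?us "x \<otimes> ?p"] inV[OF C.y] by blast
  then obtain f where f: "f \<in> {..<d} \<rightarrow> carrier F" "x \<otimes> ?p = (\<Oplus>i\<in>{..<d}. f i \<odot> ?us ! i)" by auto
  define b where "b = expand f"
  have b: "b \<in> carrier K" unfolding b_def using f by (intro expand_closed) simp
  have xp: "x \<otimes> ?p = \<iota> b \<otimes> ?p"
    using f(2) CF.finsum_map_nth[of w d f] w f(1) sumw[OF f(1)] by (simp add: b_def)
  \<comment> \<open>Moving \<open>x^k\<close> across \<open>b\<close> replaces \<open>b\<close> by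
    its k-th conjugate, which is the new factor of the product.\<close>
  have xk: "x [^] k \<otimes> ?p = \<iota> (\<Otimes>\<^bsub>K\<^esub>i\<in>{..<k}. (\<sigma> ^^ i) b) \<otimes> ?p" for k :: nat
  proof (induction k)
    case (Suc k)
    have cl: "(\<Otimes>\<^bsub>K\<^esub>i\<in>{..<k}. (\<sigma> ^^ i) b) \<in> carrier K" using b by (intro K.finprod_closed) auto
    have "x [^] Suc k \<otimes> ?p = x [^] k \<otimes> (\<iota> b \<otimes> ?p)"
      by (simp add: C.A.m_assoc xp)
    also have "\<dots> = (x [^] k \<otimes> \<iota> b) \<otimes> ?p" using b by (simp add: C.A.m_assoc)
    also have "\<dots> = \<iota> ((\<sigma> ^^ k) b) \<otimes> (x [^] k \<otimes> ?p)"
      using b by (simp add: C.pow_rel C.A.m_assoc)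
    also have "\<dots> = \<iota> ((\<sigma> ^^ k) b \<otimes>\<^bsub>K\<^esub> (\<Otimes>\<^bsub>K\<^esub>i\<in>{..<k}. (\<sigma> ^^ i) b)) \<otimes> ?p"
      unfolding Suc using b cl by (simp add: C.A.m_assoc)
    also have "(\<sigma> ^^ k) b \<otimes>\<^bsub>K\<^esub> (\<Otimes>\<^bsub>K\<^esub>i\<in>{..<k}. (\<sigma> ^^ i) b) = (\<Otimes>\<^bsub>K\<^esub>i\<in>{..<Suc k}. (\<sigma> ^^ i) b)"
      using b by (simp add: lessThan_Suc Pi_iff)
    finally show ?case .
  qed simp
  let ?N = "\<Otimes>\<^bsub>K\<^esub>i\<in>{..<d}. (\<sigma> ^^ i) b"
  have N: "?N \<in> carrier K" using b by (intro K.finprod_closed) auto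
  have "\<iota> ?N \<otimes> ?p = \<iota> (\<alpha> \<odot>\<^bsub>K\<^esub> \<one>\<^bsub>K\<^esub>) \<otimes> ?p" using xk[of d] unfolding C.pow ..
  then have "\<iota> (?N \<ominus>\<^bsub>K\<^esub> \<alpha> \<odot>\<^bsub>K\<^esub> \<one>\<^bsub>K\<^esub>) \<otimes> ?p = \<zero>"
    using N by (simp add: a_minus_def C.A.l_distr C.A.l_minus C.A.M.r_neg)
  then have "?N \<ominus>\<^bsub>K\<^esub> \<alpha> \<odot>\<^bsub>K\<^esub> \<one>\<^bsub>K\<^esub> = \<zero>\<^bsub>K\<^esub>" using N p0 by (intro iota_cancel[of _ ?p]) auto
  then have eq: "\<alpha> \<odot>\<^bsub>K\<^esub> \<one>\<^bsub>K\<^esub> = ?N" using N by simp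
  have "b \<noteq> \<zero>\<^bsub>K\<^esub>"
  proof
    assume "b = \<zero>\<^bsub>K\<^esub>"
    then have "?N = \<zero>\<^bsub>K\<^esub>" using d b by (intro K.finprod_zero_factor[where i = 0]) auto
    then show False using scalar_zero[OF alpha] eq alpha0 by simp
  qed
  then show ?thesis using b eq by blast
qed

theorem split_iff_norm:
  "alg_isomorphic F C (mat_algebra d (self_algebra F)) \<longleftrightarrow> (\<exists>b\<in>Units K. \<alpha> = field_norm F K b)"
proof
  assume "alg_isomorphic F C (mat_algebra d (self_algebra F))"
  from norm_if_split[OF this] obtain b where b: "b \<in> carrier K" "b \<noteq> \<zero>\<^bsub>K\<^esub>"
    and eq: "\<alpha> \<odot>\<^bsub>K\<^esub> \<one>\<^bsub>K\<^esub> = (\<Otimes>\<^bsub>K\<^esub>i\<in>{..<d}. (\<sigma> ^^ i) b)" by blast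
  have "\<alpha> = field_norm F K b"
    using field_norm[OF b(1)] eq by (intro scalar_inj) auto
  then show "\<exists>b\<in>Units K. \<alpha> = field_norm F K b" using b by (auto simp: K.field_Units)
next
  assume "\<exists>b\<in>Units K. \<alpha> = field_norm F K b"
  then obtain b where b: "b \<in> carrier K" "\<alpha> = field_norm F K b" by (auto simp: K.field_Units)
  show "alg_isomorphic F C (mat_algebra d (self_algebra F))"
    by (rule split_if_norm[OF b(1)]) (use field_norm(2)[OF b(1)] b(2) in simp)
qed

end

section \<open>Direct sums, change of base and corners\<close>

lemma (in assoc_algebra) additive_subgroupI:
  assumes "S \<subseteq> carrier M" "\<zero>\<^bsub>M\<^esub> \<in> S" "\<And>x y. x \<in> S ==> y \<in> S ==> x \<oplus>\<^bsub>M\<^esub> y \<in> S"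
    and "\<And>c x. c \<in> carrier R ==> x \<in> S ==> c \<odot>\<^bsub>M\<^esub> x \<in> S"
  shows "additive_subgroup S M"
proof (rule additive_subgroup.intro, rule M.add.subgroupI)
  show "S \<noteq> {}" using assms(2) by blast
  fix x assume x: "x \<in> S"
  then have "\<ominus>\<^bsub>M\<^esub> x = (\<ominus> \<one>) \<odot>\<^bsub>M\<^esub> x" using assms(1) by (simp add: smult_minus_one subset_eq)
  then show "\<ominus>\<^bsub>M\<^esub> x \<in> S" using assms(4)[of "\<ominus> \<one>" x] x by simp
qed (use assms in auto)

lemma (in abelian_group) direct_sumI:
  assumes S: "\<And>i. i \<in> I ==> additive_subgroup (S i) G"
    and T: "T = {\<Oplus>i\<in>I. u i | u. u \<in> Pi I S}"
    and indep: "\<And>u i. u \<in> Pi I S ==> (\<Oplus>i\<in>I. u i) = \<zero> ==> i \<in> I ==> u i = \<zero>"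
  shows "internal_direct_sum G I S T"
  unfolding internal_direct_sum_def
proof (intro conjI ballI impI)
  fix u v i assume u: "u \<in> Pi I S" and v: "v \<in> Pi I S" and eq: "(\<Oplus>i\<in>I. u i) = (\<Oplus>i\<in>I. v i)" and i: "i \<in> I"
  have cl: "u j \<in> S j" "v j \<in> S j" "u j \<in> carrier G" "v j \<in> carrier G" if "j \<in> I" for j
    using additive_subgroup.a_subset[OF S[OF that]] u v that by auto
  let ?w = "\<lambda>i. u i \<ominus> v i"
  have w: "?w \<in> Pi I S"
    using additive_subgroup.a_closed[OF S] additive_subgroup.a_inv_closed[OF S] cl by (auto simp: a_minus_def)
  have "(\<Oplus>i\<in>I. ?w i) \<oplus> (\<Oplus>i\<in>I. v i) = (\<Oplus>i\<in>I. ?w i \<oplus> v i)"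
    using cl by (intro finsum_addf[symmetric]) auto
  also have "\<dots> = (\<Oplus>i\<in>I. u i)"
    using cl by (intro finsum_cong') (auto simp: a_minus_def a_assoc l_neg)
  finally have "(\<Oplus>i\<in>I. ?w i) \<oplus> (\<Oplus>i\<in>I. v i) = (\<Oplus>i\<in>I. v i)" using eq by simp
  moreover have "(\<Oplus>i\<in>I. ?w i) \<in> carrier G" "(\<Oplus>i\<in>I. v i) \<in> carrier G"
    using cl by (auto intro!: finsum_closed)
  ultimately have "(\<Oplus>i\<in>I. ?w i) = \<zero>" by simp
  from indep[OF w this i] have "u i \<ominus> v i = \<zero>" .
  moreover have "(u i \<ominus> v i) \<oplus> v i = u i" using cl[OF i] by (simp add: a_minus_def a_assoc l_neg)
  ultimately show "u i = v i" using cl[OF i] by simp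
qed (use S T in auto)

text \<open>Stated for bare relations with independence as a hypothesis, because it is also applied
  inside EE, where the powers of \<open>x^m\<close> over E'' span only the image of EE'.\<close>

lemma (in skew_rel) direct_sum:
  assumes indep: "\<And>u k. u \<in> {..<d} \<rightarrow> carrier D ==> expand u = \<zero>\<^bsub>A\<^esub> ==> k < d ==> u k = \<zero>\<^bsub>D\<^esub>"
  shows "internal_direct_sum A {..<d} (\<lambda>k. {f u \<otimes>\<^bsub>A\<^esub> y [^]\<^bsub>A\<^esub> k | u. u \<in> carrier D})
    {expand u | u. u \<in> {..<d} \<rightarrow> carrier D}"
proof (rule A.M.direct_sumI)
  let ?S = "\<lambda>k. {f u \<otimes>\<^bsub>A\<^esub> y [^]\<^bsub>A\<^esub> (k::nat) | u. u \<in> carrier D}"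
  have choose: "\<exists>u\<in>{..<d} \<rightarrow> carrier D. (\<Oplus>\<^bsub>A\<^esub>k\<in>{..<d}. w k) = expand u \<and> (\<forall>k<d. w k = f (u k) \<otimes>\<^bsub>A\<^esub> y [^]\<^bsub>A\<^esub> k)"
    if w: "w \<in> Pi {..<d} ?S" for w
  proof -
    have "\<exists>u. k < d \<longrightarrow> u \<in> carrier D \<and> w k = f u \<otimes>\<^bsub>A\<^esub> y [^]\<^bsub>A\<^esub> k" for k
    proof (cases "k < d")
      case True
      then have "w k \<in> ?S k" by (intro Pi_mem[OF w]) simp
      then show ?thesis by blast
    qed simp
    then have "\<forall>k. \<exists>u. k < d \<longrightarrow> u \<in> carrier D \<and> w k = f u \<otimes>\<^bsub>A\<^esub> y [^]\<^bsub>A\<^esub> k" by blast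
    from choice[OF this] obtain u where u: "\<forall>k. k < d \<longrightarrow> u k \<in> carrier D \<and> w k = f (u k) \<otimes>\<^bsub>A\<^esub> y [^]\<^bsub>A\<^esub> k" ..
    have "(\<Oplus>\<^bsub>A\<^esub>k\<in>{..<d}. w k) = expand u"
      unfolding expand_def by (rule A.M.finsum_cong') (use u in simp_all)
    then show ?thesis using u by (intro bexI[of _ u] conjI allI impI Pi_I) simp_all
  qed
  show "additive_subgroup (?S k) A" for k
  proof (rule A.additive_subgroupI)
    show "\<zero>\<^bsub>A\<^esub> \<in> ?S k" by (intro CollectI exI[of _ "\<zero>\<^bsub>D\<^esub>"]) simp
  next
    fix z w assume "z \<in> ?S k" "w \<in> ?S k"
    then obtain u v where "u \<in> carrier D" "v \<in> carrier D" "z = f u \<otimes>\<^bsub>A\<^esub> y [^]\<^bsub>A\<^esub> k" "w = f v \<otimes>\<^bsub>A\<^esub> y [^]\<^bsub>A\<^esub> k" by blast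
    then show "z \<oplus>\<^bsub>A\<^esub> w \<in> ?S k"
      by (intro CollectI exI[of _ "u \<oplus>\<^bsub>D\<^esub> v"]) (simp add: A.l_distr)
  next
    fix c z assume "c \<in> carrier F" "z \<in> ?S k"
    then obtain u where "c \<in> carrier F" "u \<in> carrier D" "z = f u \<otimes>\<^bsub>A\<^esub> y [^]\<^bsub>A\<^esub> k" by blast
    then show "c \<odot>\<^bsub>A\<^esub> z \<in> ?S k"
      by (intro CollectI exI[of _ "c \<odot>\<^bsub>D\<^esub> u"]) (simp add: A.smult_mult_left)
  qed auto
  show "{expand u | u. u \<in> {..<d} \<rightarrow> carrier D} = {\<Oplus>\<^bsub>A\<^esub>k\<in>{..<d}. w k | w. w \<in> Pi {..<d} ?S}"
  proof (intro equalityI subsetI)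
    fix z assume "z \<in> {expand u | u. u \<in> {..<d} \<rightarrow> carrier D}"
    then obtain u where u: "u \<in> {..<d} \<rightarrow> carrier D" "z = expand u" by blast
    then show "z \<in> {\<Oplus>\<^bsub>A\<^esub>k\<in>{..<d}. w k | w. w \<in> Pi {..<d} ?S}"
      by (intro CollectI exI[of _ "\<lambda>k. f (u k) \<otimes>\<^bsub>A\<^esub> y [^]\<^bsub>A\<^esub> k"] conjI Pi_I) (simp add: expand_def, blast)
  next
    fix z assume "z \<in> {\<Oplus>\<^bsub>A\<^esub>k\<in>{..<d}. w k | w. w \<in> Pi {..<d} ?S}"
    then obtain w where w: "w \<in> Pi {..<d} ?S" "z = (\<Oplus>\<^bsub>A\<^esub>k\<in>{..<d}. w k)" by blast
    from choose[OF w(1)] obtain u where "u \<in> {..<d} \<rightarrow> carrier D" "z = expand u" using w(2) by metis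
    then show "z \<in> {expand u | u. u \<in> {..<d} \<rightarrow> carrier D}" by blast
  qed
  fix w k assume w: "w \<in> Pi {..<d} ?S" and 0: "(\<Oplus>\<^bsub>A\<^esub>k\<in>{..<d}. w k) = \<zero>\<^bsub>A\<^esub>" and k: "k \<in> {..<d}"
  obtain u where u: "u \<in> {..<d} \<rightarrow> carrier D" "expand u = \<zero>\<^bsub>A\<^esub>" "w k = f (u k) \<otimes>\<^bsub>A\<^esub> y [^]\<^bsub>A\<^esub> k"
    using choose[OF w] 0 k by (metis lessThan_iff)
  then show "w k = \<zero>\<^bsub>A\<^esub>" using indep[OF u(1,2)] k by simp
qed

lemma (in skew_pres) direct_sum_carrier:
  "internal_direct_sum A {..<d} (\<lambda>k. {f u \<otimes>\<^bsub>A\<^esub> y [^]\<^bsub>A\<^esub> k | u. u \<in> carrier D}) (carrier A)"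
proof -
  have "carrier A = {expand u | u. u \<in> {..<d} \<rightarrow> carrier D}" using span by auto
  moreover have "internal_direct_sum A {..<d} (\<lambda>k. {f u \<otimes>\<^bsub>A\<^esub> y [^]\<^bsub>A\<^esub> k | u. u \<in> carrier D})
      {expand u | u. u \<in> {..<d} \<rightarrow> carrier D}"
    by (rule direct_sum) (rule indep)
  ultimately show ?thesis by simp
qed

lemma (in skew_rel) mono_span:
  assumes "u \<in> carrier D"
  shows "\<exists>v\<in>{..<d} \<rightarrow> carrier D. f u \<otimes>\<^bsub>A\<^esub> y [^]\<^bsub>A\<^esub> (k::nat) = expand v"
  using assms
proof (induction k arbitrary: u rule: less_induct)
  case (less k)
  show ?case
  proof (cases "k < d")
    case True
    then show ?thesis using expand_single[OF less.prems True] less.prems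
      by (intro bexI[of _ "\<lambda>i. if i = k then u else \<zero>\<^bsub>D\<^esub>"]) auto
  next
    case False
    then have "k - d < k" "d \<le> k" using d by auto
    then show ?thesis using less.IH[of "k - d" "u \<otimes>\<^bsub>D\<^esub> a"] mono_reduce[OF less.prems, of k] less.prems by auto
  qed
qed

section \<open>Change of the base algebra\<close>

lemma alg_hom_along_iso:
  assumes "assoc_algebra F D" and \<theta>: "\<theta> \<in> alg_iso F D D'" and k: "k' \<in> alg_hom F D B"
    and kt: "\<And>u. u \<in> carrier D ==> k (\<theta> u) = k' u"
  shows "k \<in> alg_hom F D' B"
proof (rule alg_homI)
  interpret D: assoc_algebra F D by fact
  note t = alg_homD[OF alg_isoD(1)[OF \<theta>]]
  have onto: "carrier D' = \<theta> ` carrier D" using alg_isoD(2)[OF \<theta>] by (simp add: bij_betw_def)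
  show "k \<one>\<^bsub>D'\<^esub> = \<one>\<^bsub>B\<^esub>" using alg_homD(4)[OF k] kt[of "\<one>\<^bsub>D\<^esub>"] t(4) by simp
  show "k u \<in> carrier B" if "u \<in> carrier D'" for u
    using that alg_homD(1)[OF k] kt unfolding onto by auto
  show "k (u \<otimes>\<^bsub>D'\<^esub> v) = k u \<otimes>\<^bsub>B\<^esub> k v" if "u \<in> carrier D'" "v \<in> carrier D'" for u v
    using that alg_homD(2)[OF k] kt unfolding onto by (auto simp flip: t(2))
  show "k (u \<oplus>\<^bsub>D'\<^esub> v) = k u \<oplus>\<^bsub>B\<^esub> k v" if "u \<in> carrier D'" "v \<in> carrier D'" for u v
    using that alg_homD(3)[OF k] kt unfolding onto by (auto simp flip: t(3))
  show "k (c \<odot>\<^bsub>D'\<^esub> u) = c \<odot>\<^bsub>B\<^esub> k u" if "c \<in> carrier F" "u \<in> carrier D'" for c u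
    using that alg_homD(5)[OF k] kt unfolding onto by (auto simp flip: t(5))
qed

text \<open>The algebra and its generator stay fixed while the base is renamed along an isomorphism.
  In this way the base \<open>E e_0\<close> of EE' is read as \<open>E e_j\<close> or as
  E''.\<close>

lemma skew_pres_base:
  assumes P: "skew_pres F D A f y \<sigma> d a" and \<theta>: "\<theta> \<in> alg_iso F D D'" and D': "assoc_algebra F D'"
    and \<sigma>': "\<And>u. u \<in> carrier D ==> \<sigma>' (\<theta> u) = \<theta> (\<sigma> u)"
    and g: "\<And>u. u \<in> carrier D ==> g (\<theta> u) = f u" and a': "a' = \<theta> a"
  shows "skew_pres F D' A g y \<sigma>' d a'"
proof -
  interpret P: skew_pres F D A f y \<sigma> d a by fact
  interpret D': assoc_algebra F D' by fact
  note t = alg_homD[OF alg_isoD(1)[OF \<theta>]]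
  have onto: "carrier D' = \<theta> ` carrier D" using alg_isoD(2)[OF \<theta>] by (simp add: bij_betw_def)
  interpret th: alg_homomorphism F D D' \<theta>
    by (intro alg_homomorphism.intro alg_homomorphism_axioms.intro P.D.assoc_algebra_axioms D' alg_isoD(1)[OF \<theta>])
  note hom = alg_hom_along_iso[OF P.D.assoc_algebra_axioms \<theta>]
  interpret R: skew_rel F D' A g y \<sigma>' d a'
  proof (intro skew_rel.intro skew_rel_axioms.intro D' P.A.assoc_algebra_axioms)
    show "\<sigma>' \<in> alg_hom F D' D'"
      by (rule hom[OF alg_hom_comp[OF P.sigma alg_isoD(1)[OF \<theta>]] \<sigma>'])
    show "g \<in> alg_hom F D' A" by (rule hom[OF P.f g])
    show "y \<otimes>\<^bsub>A\<^esub> g u = g (\<sigma>' u) \<otimes>\<^bsub>A\<^esub> y" if "u \<in> carrier D'" for u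
      using that unfolding onto by (auto simp: g \<sigma>' P.rel)
  qed (use P.d P.pow g a' t(1) in auto)
  have ex: "R.expand (\<lambda>k. \<theta> (u k)) = P.expand u" if u: "u \<in> {..<d} \<rightarrow> carrier D" for u
    unfolding R.expand_def P.expand_def by (rule P.A.M.finsum_cong') (use u g in \<open>auto simp: Pi_iff\<close>)
  show ?thesis
  proof (intro skew_pres.intro skew_pres_axioms.intro R.skew_rel_axioms)
    fix z assume "z \<in> carrier A"
    then obtain u where u: "u \<in> {..<d} \<rightarrow> carrier D" "z = P.expand u" using P.span by blast
    then show "\<exists>v\<in>{..<d} \<rightarrow> carrier D'. z = R.expand v"
      using ex[OF u(1)] t(1) by (intro bexI[of _ "\<lambda>k. \<theta> (u k)"]) (auto simp: Pi_iff)
  next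
    fix v k assume v: "v \<in> {..<d} \<rightarrow> carrier D'" and 0: "R.expand v = \<zero>\<^bsub>A\<^esub>" and k: "k < d"
    have "\<exists>u. k < d \<longrightarrow> u \<in> carrier D \<and> v k = \<theta> u" for k
    proof (cases "k < d")
      case True
      then have "v k \<in> \<theta> ` carrier D" using v unfolding onto by (intro Pi_mem[of v "{..<d}"]) simp_all
      then show ?thesis by blast
    qed simp
    then have "\<forall>k. \<exists>u. k < d \<longrightarrow> u \<in> carrier D \<and> v k = \<theta> u" by blast
    from choice[OF this] obtain u where u: "\<forall>k. k < d \<longrightarrow> u k \<in> carrier D \<and> v k = \<theta> (u k)" ..
    then have uD: "u \<in> {..<d} \<rightarrow> carrier D" by simp
    have "R.expand v = R.expand (\<lambda>k. \<theta> (u k))" by (rule R.expand_cong) (use u v in auto)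
    then have "P.expand u = \<zero>\<^bsub>A\<^esub>" using 0 ex[OF uD] by simp
    then have "u k = \<zero>\<^bsub>D\<^esub>" using P.indep[OF uD _ k] by simp
    then show "v k = \<zero>\<^bsub>D'\<^esub>" using u k by simp
  qed
qed

text \<open>The three conditions give \<open>skew_quot\<close> a presentation by
  \<open>skew_quot_pres\<close>; two presentations with the same data are isomorphic, compatibly
  with constants and generator.\<close>

lemma is_skew_quotI:
  assumes P: "skew_pres F D A f y \<sigma> d a" and a: "\<sigma> a = a"
    and "\<And>u. u \<in> carrier D ==> a \<otimes>\<^bsub>D\<^esub> u = u \<otimes>\<^bsub>D\<^esub> a" "\<And>u. u \<in> carrier D ==> (\<sigma> ^^ d) u = u"
  shows "is_skew_quot F A D f y \<sigma> d a"
proof -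
  interpret P: skew_pres F D A f y \<sigma> d a by fact
  have "skew_pres F D (skew_quot D \<sigma> d a) (skew_const D \<sigma> d a) (skew_gen D \<sigma> d a) \<sigma> d a"
    by (rule skew_quot_pres[OF P.D.assoc_algebra_axioms P.sigma P.d P.a a assms(3,4)])
  from skew_pres_iso[OF this P] show ?thesis unfolding is_skew_quot_def .
qed

section \<open>Corners cut out by an idempotent\<close>

lemma corner_simps [simp]:
  "x \<otimes>\<^bsub>corner E e\<^esub> y = x \<otimes>\<^bsub>E\<^esub> y" "x \<oplus>\<^bsub>corner E e\<^esub> y = x \<oplus>\<^bsub>E\<^esub> y" "c \<odot>\<^bsub>corner E e\<^esub> x = c \<odot>\<^bsub>E\<^esub> x"
  "\<one>\<^bsub>corner E e\<^esub> = e" "\<zero>\<^bsub>corner E e\<^esub> = \<zero>\<^bsub>E\<^esub>"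
  by (simp_all add: corner_def)

lemma corner_algebra:
  fixes E :: "('f, 'a) module"
  assumes "assoc_algebra F E" and e: "e \<in> carrier E" "e \<otimes>\<^bsub>E\<^esub> e = e"
    and central: "\<And>y. y \<in> carrier E ==> e \<otimes>\<^bsub>E\<^esub> y = y \<otimes>\<^bsub>E\<^esub> e"
  shows "carrier (corner E e) = {y \<in> carrier E. y \<otimes>\<^bsub>E\<^esub> e = y}"
    and "assoc_algebra F (corner E e)" and "(\<lambda>y. y \<otimes>\<^bsub>E\<^esub> e) \<in> alg_hom F E (corner E e)"
proof -
  interpret A: assoc_algebra F E by fact
  have ee: "y \<otimes>\<^bsub>E\<^esub> e \<otimes>\<^bsub>E\<^esub> e = y \<otimes>\<^bsub>E\<^esub> e" if "y \<in> carrier E" for y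
    using that e by (simp add: A.m_assoc)
  show car: "carrier (corner E e) = {y \<in> carrier E. y \<otimes>\<^bsub>E\<^esub> e = y}"
  proof (intro equalityI subsetI)
    fix y assume "y \<in> carrier (corner E e)"
    then obtain z where "z \<in> carrier E" "y = z \<otimes>\<^bsub>E\<^esub> e" unfolding corner_def by auto
    then show "y \<in> {y \<in> carrier E. y \<otimes>\<^bsub>E\<^esub> e = y}" using ee e by simp
  next
    fix y assume y: "y \<in> {y \<in> carrier E. y \<otimes>\<^bsub>E\<^esub> e = y}"
    then have "y = y \<otimes>\<^bsub>E\<^esub> e" "y \<in> carrier E" by simp_all
    then show "y \<in> carrier (corner E e)" unfolding corner_def by force
  qed
  have mult: "(y \<otimes>\<^bsub>E\<^esub> e) \<otimes>\<^bsub>E\<^esub> (z \<otimes>\<^bsub>E\<^esub> e) = (y \<otimes>\<^bsub>E\<^esub> z) \<otimes>\<^bsub>E\<^esub> e" if yz: "y \<in> carrier E" "z \<in> carrier E" for y z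
  proof -
    have "(y \<otimes>\<^bsub>E\<^esub> e) \<otimes>\<^bsub>E\<^esub> (z \<otimes>\<^bsub>E\<^esub> e) = y \<otimes>\<^bsub>E\<^esub> (e \<otimes>\<^bsub>E\<^esub> z \<otimes>\<^bsub>E\<^esub> e)" using yz e by (simp add: A.m_assoc)
    also have "\<dots> = (y \<otimes>\<^bsub>E\<^esub> z) \<otimes>\<^bsub>E\<^esub> e" unfolding central[OF yz(2)] ee[OF yz(2)] using yz e by (simp add: A.m_assoc)
    finally show ?thesis .
  qed
  have "corner E e = E\<lparr>carrier := {y \<in> carrier E. y \<otimes>\<^bsub>E\<^esub> e = y}, one := e\<rparr>"
    using car by (simp add: corner_def)
  moreover have "assoc_algebra F (E\<lparr>carrier := {y \<in> carrier E. y \<otimes>\<^bsub>E\<^esub> e = y}, one := e\<rparr>)"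
  proof (rule assoc_algebra_sub[OF assms(1)])
    fix y assume y: "y \<in> {y \<in> carrier E. y \<otimes>\<^bsub>E\<^esub> e = y}"
    then show "e \<otimes>\<^bsub>E\<^esub> y = y" using central[of y] by simp
  qed (use e in \<open>auto simp: A.l_distr A.m_assoc A.smult_mult_left\<close>)
  ultimately show "assoc_algebra F (corner E e)" by simp
  show "(\<lambda>y. y \<otimes>\<^bsub>E\<^esub> e) \<in> alg_hom F E (corner E e)"
    using e ee by (intro alg_homI) (auto simp: car mult A.l_distr A.smult_mult_left)
qed

section \<open>The idempotents of a Kummer algebra\<close>

text \<open>The maximality of \<open>m\<close> is kept in the form \<open>no_root\<close>: for a
  divisor k > 1 of d, a k-th root of \<open>r\<close> would be a km-th root of \<open>s\<close>, and
  km divides n.\<close>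

locale split_kummer = kummer_aut F E h n s q \<sigma>
  for F :: "('f, 'z) ring_scheme" and E :: "('f, 'a) module" (structure) and h n s q \<sigma> +
  fixes m d :: nat and r :: 'f
  assumes n: "n = d * m" and s0: "s \<noteq> \<zero>\<^bsub>F\<^esub>"
    and r [simp]: "r \<in> carrier F" and r_pow: "r [^]\<^bsub>F\<^esub> m = s"
    and no_root: "\<And>k u. 1 < k ==> k dvd d ==> u \<in> carrier F ==> u [^]\<^bsub>F\<^esub> k \<noteq> r"
begin

sublocale K: cring E by (rule cring)
sublocale sg: alg_homomorphism F E E \<sigma>
  by (intro alg_homomorphism.intro alg_homomorphism_axioms.intro A.assoc_algebra_axioms aut)

lemma dm: "0 < d" "0 < m" using d n by auto

lemma r0 [simp]: "r \<noteq> \<zero>\<^bsub>F\<^esub>"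
  using r_pow s0 dm by (auto simp: F.nat_pow_zero)

sublocale z: root_of_unity F m "q [^]\<^bsub>F\<^esub> d"
  using om.root_of_unity_div[of m] n dm by simp
sublocale w: root_of_unity F d "q [^]\<^bsub>F\<^esub> m"
  using om.root_of_unity_div[of d] n dm by simp

definition g where "g = inv\<^bsub>F\<^esub> r \<odot> h [^] d"

lemma g_closed [simp]: "g \<in> carrier E" by (simp add: g_def)

lemma h_pow_d: "h [^] d = r \<odot> g"
  by (simp add: g_def A.smult_assoc1[symmetric])

lemma g_pow: "g [^] m = \<one>"
proof -
  have "g [^] m = (inv\<^bsub>F\<^esub> r [^]\<^bsub>F\<^esub> m) \<odot> (s \<odot> \<one>)"
    by (simp add: g_def A.smult_pow A.nat_pow_pow n[symmetric] pow_d)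
  also have "\<dots> = (inv\<^bsub>F\<^esub> r [^]\<^bsub>F\<^esub> m \<otimes>\<^bsub>F\<^esub> r [^]\<^bsub>F\<^esub> m) \<odot> \<one>"
    by (simp add: A.smult_assoc1 r_pow)
  finally show ?thesis by simp
qed

sublocale R: root_idempotents F m "q [^]\<^bsub>F\<^esub> d" E g
  by (intro root_idempotents.intro root_idempotents_axioms.intro z.root_of_unity_axioms
      A.assoc_algebra_axioms g_closed g_pow)

definition e where "e = kummer_idem F E m (q [^]\<^bsub>F\<^esub> d) r (h [^] d)"

text \<open>Identifies the interpolation products of the statement with the Fourier idempotents. On
  \<open>R.idem k\<close> the element \<open>h^d\<close> acts as \<open>\<zeta>^k r\<close>, so the
  factor with index i acts as the quotient of \<open>\<zeta>^k - \<zeta>^i\<close> by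
  \<open>\<zeta>^j - \<zeta>^i\<close>. For k = j every factor acts as 1; for other k the factor
  with i = k acts as zero. Summing over k gives the equality.\<close>

lemma e_idem:
  assumes j: "j < m"
  shows "e j = R.idem j"
proof -
  define t where "t i = (q [^]\<^bsub>F\<^esub> d) [^]\<^bsub>F\<^esub> i \<otimes>\<^bsub>F\<^esub> r" for i :: nat
  define D where "D i = t j \<ominus>\<^bsub>F\<^esub> t i" for i
  define Y where "Y i = h [^] d \<ominus> t i \<odot> \<one>" for i
  define p where "p i = inv\<^bsub>F\<^esub> (D i) \<odot> Y i" for i
  have t [simp]: "t i \<in> carrier F" for i by (simp add: t_def)
  have D [simp]: "D i \<in> carrier F" for i by (simp add: D_def)
  have Y [simp]: "Y i \<in> carrier E" for i by (simp add: Y_def)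
  have nz: "D i \<noteq> \<zero>\<^bsub>F\<^esub>" if "i \<in> {..<m} - {j}" for i
  proof
    assume "D i = \<zero>\<^bsub>F\<^esub>"
    then have "t j = t i" unfolding D_def by (subst (asm) F.r_right_minus_eq) simp_all
    then have "(q [^]\<^bsub>F\<^esub> d) [^]\<^bsub>F\<^esub> j = (q [^]\<^bsub>F\<^esub> d) [^]\<^bsub>F\<^esub> i"
      unfolding t_def by (subst (asm) F.m_rcancel) simp_all
    then show False using z.root_pow_inj[of j i] j that by auto
  qed
  have p: "p i \<in> carrier E" if "i \<in> {..<m} - {j}" for i
    unfolding p_def using nz[OF that] by simp
  have act: "Y i \<otimes> R.idem k = (t k \<ominus>\<^bsub>F\<^esub> t i) \<odot> R.idem k" for i k
  proof -
    have "h [^] d \<otimes> R.idem k = t k \<odot> R.idem k"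
      unfolding h_pow_d t_def by (simp add: A.smult_mult_left R.g_idem A.smult_assoc1[symmetric] F.m_comm)
    then show ?thesis
      by (simp add: Y_def a_minus_def A.l_distr A.l_minus A.smult_l_distr A.smult_l_minus A.one_smult_mult)
  qed
  have pact: "p i \<otimes> R.idem k = inv\<^bsub>F\<^esub> (D i) \<odot> ((t k \<ominus>\<^bsub>F\<^esub> t i) \<odot> R.idem k)"
    if "i \<in> {..<m} - {j}" for i k
    unfolding p_def act[symmetric] by (rule A.smult_mult_left) (use nz[OF that] in simp_all)
  have same: "(\<Otimes>i\<in>J. p i) \<otimes> R.idem j = R.idem j" if "finite J" "J \<subseteq> {..<m} - {j}" for J
    using that
  proof (induction J)
    case (insert i J)
    then have i: "i \<in> {..<m} - {j}" and J: "p \<in> J \<rightarrow> carrier E" using p by (blast, blast)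
    have "p i \<otimes> R.idem j = (inv\<^bsub>F\<^esub> (D i) \<otimes>\<^bsub>F\<^esub> D i) \<odot> R.idem j"
      unfolding pact[OF i] D_def[symmetric] by (rule A.smult_assoc1[symmetric]) (use nz[OF i] in simp_all)
    then have pj: "p i \<otimes> R.idem j = R.idem j" using nz[OF i] by simp
    have cl: "(\<Otimes>i\<in>J. p i) \<in> carrier E" using J by (rule K.finprod_closed)
    have "(\<Otimes>i\<in>insert i J. p i) = p i \<otimes> (\<Otimes>i\<in>J. p i)"
      using insert(1,2) J p[OF i] by (intro K.finprod_insert)
    then have "(\<Otimes>i\<in>insert i J. p i) \<otimes> R.idem j = p i \<otimes> ((\<Otimes>i\<in>J. p i) \<otimes> R.idem j)"
      using A.m_assoc[OF p[OF i] cl] by simp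
    also have "(\<Otimes>i\<in>J. p i) \<otimes> R.idem j = R.idem j" using insert by blast
    finally show ?case unfolding pj .
  qed simp
  have pc: "p \<in> ({..<m} - {j}) \<rightarrow> carrier E" using p by blast
  have ej: "e j = (\<Otimes>i\<in>{..<m} - {j}. p i)"
    unfolding e_def kummer_idem_def p_def D_def Y_def t_def ..
  have ec: "e j \<in> carrier E" unfolding ej using pc by (rule K.finprod_closed)
  have "e j \<otimes> R.idem k = (if k = j then R.idem j else \<zero>)" if k: "k < m" for k
  proof (cases "k = j")
    case True then show ?thesis unfolding ej using same by simp
  next
    case False
    let ?J = "{..<m} - {j} - {k}"
    have kk: "k \<in> {..<m} - {j}" using k False by simp
    have J: "p \<in> ?J \<rightarrow> carrier E" using p by blast
    note cl = K.finprod_closed[OF J]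
    have "(\<Otimes>i\<in>insert k ?J. p i) = p k \<otimes> (\<Otimes>i\<in>?J. p i)"
      using J p[OF kk] by (intro K.finprod_insert) auto
    moreover have "insert k ?J = {..<m} - {j}" using kk by blast
    ultimately have eq: "e j = (\<Otimes>i\<in>?J. p i) \<otimes> p k"
      unfolding ej using K.m_comm[OF p[OF kk] cl] by simp
    have z: "t k \<ominus>\<^bsub>F\<^esub> t k = \<zero>\<^bsub>F\<^esub>" by (simp add: a_minus_def F.r_neg)
    have "p k \<otimes> R.idem k = \<zero>" unfolding pact[OF kk] z using nz[OF kk] by simp
    then show ?thesis unfolding eq using False A.m_assoc[OF cl p[OF kk], of "R.idem k"] cl by simp
  qed
  note comp = this
  have "e j = e j \<otimes> (\<Oplus>k\<in>{..<m}. R.idem k)" using ec by (simp add: R.idem_sum)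
  also have "\<dots> = (\<Oplus>k\<in>{..<m}. e j \<otimes> R.idem k)" using ec by (intro A.mult_finsum) auto
  also have "\<dots> = (\<Oplus>k\<in>{..<m}. if k = j then R.idem j else \<zero>)"
    using comp by (intro A.M.finsum_cong') auto
  also have "\<dots> = R.idem j" using j by (intro A.finsum_delta) auto
  finally show ?thesis .
qed

lemma e_closed [simp]: "j < m ==> e j \<in> carrier E" by (simp add: e_idem)

lemma e_mult: "i < m ==> j < m ==> e i \<otimes> e j = (if i = j then e j else \<zero>)"
  by (simp add: e_idem R.idem_mult)

lemma e_sum: "(\<Oplus>j\<in>{..<m}. e j) = \<one>"
  unfolding R.idem_sum[symmetric] by (rule A.M.finsum_cong') (auto simp: e_idem)

lemma component_ext:
  assumes "u \<in> carrier E" "v \<in> carrier E" "\<And>j. j < m ==> u \<otimes> e j = v \<otimes> e j"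
  shows "u = v"
proof -
  have *: "u = (\<Oplus>j\<in>{..<m}. u \<otimes> e j)" if "u \<in> carrier E" for u
    using A.mult_finsum[of u e "{..<m}"] that e_closed by (auto simp: e_sum)
  have "u = (\<Oplus>j\<in>{..<m}. u \<otimes> e j)" by (rule *[OF assms(1)])
  also have "\<dots> = (\<Oplus>j\<in>{..<m}. v \<otimes> e j)"
    by (rule A.M.finsum_cong'[OF refl]) (use assms e_closed in \<open>simp_all add: Pi_iff\<close>)
  also have "\<dots> = v" by (rule *[OF assms(2), symmetric])
  finally show ?thesis .
qed

text \<open>\<open>\<sigma>\<close> multiplies \<open>g\<close> by \<open>\<zeta>\<close>, and the
  resulting \<open>\<zeta>^k\<close> cancels one unit of the index in the k-th coefficient. The
  formula holds for all \<open>j\<close>; going past 0 is handled by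
  \<open>idem_period\<close>.\<close>

lemma aut_idem: "\<sigma> (R.idem (Suc j)) = R.idem j"
proof -
  have "\<sigma> (h [^] d) = (q [^]\<^bsub>F\<^esub> d) \<odot> h [^] d" using aut_pow_h_pow[of 1 d] by simp
  then have sg_g: "\<sigma> g = (q [^]\<^bsub>F\<^esub> d) \<odot> g"
    by (simp add: g_def A.smult_assoc1[symmetric] F.m_comm)
  let ?z = "q [^]\<^bsub>F\<^esub> d"
  have "\<sigma> (R.idem (Suc j)) = inv\<^bsub>F\<^esub> z.num \<odot> \<sigma> (\<Oplus>k\<in>{..<m}. (inv\<^bsub>F\<^esub> ?z [^]\<^bsub>F\<^esub> (Suc j * k)) \<odot> g [^] k)"
    unfolding R.idem_def by (rule sg.hom_simps) (auto intro!: A.M.finsum_closed)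
  also have "\<sigma> (\<Oplus>k\<in>{..<m}. (inv\<^bsub>F\<^esub> ?z [^]\<^bsub>F\<^esub> (Suc j * k)) \<odot> g [^] k) =
      (\<Oplus>k\<in>{..<m}. \<sigma> ((inv\<^bsub>F\<^esub> ?z [^]\<^bsub>F\<^esub> (Suc j * k)) \<odot> g [^] k))"
    by (rule sg.finsum) auto
  also have "\<dots> = (\<Oplus>k\<in>{..<m}. (inv\<^bsub>F\<^esub> ?z [^]\<^bsub>F\<^esub> (j * k)) \<odot> g [^] k)"
  proof (rule A.M.finsum_cong'[OF refl])
    fix k assume "k \<in> {..<m}"
    have "\<sigma> ((inv\<^bsub>F\<^esub> ?z [^]\<^bsub>F\<^esub> (Suc j * k)) \<odot> g [^] k) =
        (inv\<^bsub>F\<^esub> ?z [^]\<^bsub>F\<^esub> (k + j * k)) \<odot> ((?z [^]\<^bsub>F\<^esub> k) \<odot> g [^] k)"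
      by (simp add: sg_g A.smult_pow)
    also have "\<dots> = (?z [^]\<^bsub>F\<^esub> k \<otimes>\<^bsub>F\<^esub> inv\<^bsub>F\<^esub> ?z [^]\<^bsub>F\<^esub> (k + j * k)) \<odot> g [^] k"
      by (simp add: A.smult_assoc1[symmetric] F.m_comm)
    also have "\<dots> = (inv\<^bsub>F\<^esub> ?z [^]\<^bsub>F\<^esub> (j * k)) \<odot> g [^] k" by (simp only: R.inv_pow_shift)
    finally show "\<sigma> ((inv\<^bsub>F\<^esub> ?z [^]\<^bsub>F\<^esub> (Suc j * k)) \<odot> g [^] k) = (inv\<^bsub>F\<^esub> ?z [^]\<^bsub>F\<^esub> (j * k)) \<odot> g [^] k" .
  qed auto
  finally show ?thesis unfolding R.idem_def .
qed

lemma aut_e: "Suc j < m ==> \<sigma> (e (Suc j)) = e j" by (simp add: e_idem aut_idem)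

lemma aut_e0: "\<sigma> (e 0) = e (m - 1)"
  using aut_idem[of "m - 1"] R.idem_period[of 0] dm by (simp add: e_idem)

text \<open>\<open>(j + m - 1) mod m\<close> is j - 1 modulo m, written without leaving the natural
  numbers.\<close>

lemma aut_e_mod: "j < m ==> \<sigma> (e j) = e ((j + m - 1) mod m)"
proof (cases j)
  case 0 then show ?thesis using aut_e0 dm by simp
next
  case (Suc i)
  assume "j < m"
  then have "(j + m - 1) mod m = i" using Suc by simp
  then show ?thesis using aut_e[of i] Suc \<open>j < m\<close> by simp
qed

lemma aut_pow_e: "i \<le> j ==> j < m ==> (\<sigma> ^^ i) (e j) = e (j - i)"
proof (induction i)
  case (Suc i)
  then have "(\<sigma> ^^ Suc i) (e j) = \<sigma> (e (Suc (j - Suc i)))" by (simp add: Suc_diff_Suc)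
  also have "\<dots> = e (j - Suc i)" using Suc.prems by (intro aut_e) simp
  finally show ?case .
qed simp

text \<open>Periodicity raises the index from \<open>j\<close> to \<open>j + m\<close>; then m
  applications of \<open>\<sigma>\<close> lower it one step at a time, with no wrap-around on the
  way.\<close>

lemma aut_m_e: "j < m ==> (\<sigma> ^^ m) (e j) = e j"
proof -
  assume j: "j < m"
  have *: "(\<sigma> ^^ m) (R.idem (k + m)) = R.idem k" for k
  proof -
    have "(\<sigma> ^^ i) (R.idem (k + i)) = R.idem k" for i
      by (induction i) (simp_all add: aut_idem funpow_swap1 del: funpow.simps(2), simp_all add: funpow_swap1 aut_idem)
    then show ?thesis .
  qed
  show ?thesis using *[of j] j by (simp add: e_idem R.idem_period)
qed

abbreviation "K j \<equiv> corner E (e j)"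

lemma K_algebra:
  assumes "j < m"
  shows "carrier (K j) = {u \<in> carrier E. u \<otimes> e j = u}" "assoc_algebra F (K j)"
    "(\<lambda>u. u \<otimes> e j) \<in> alg_hom F E (K j)"
proof -
  have "e j \<otimes> e j = e j" using e_mult[OF assms assms] by simp
  note corner = corner_algebra[OF A.assoc_algebra_axioms e_closed[OF assms] this comm[OF e_closed[OF assms]]]
  show "carrier (K j) = {u \<in> carrier E. u \<otimes> e j = u}" "assoc_algebra F (K j)"
    "(\<lambda>u. u \<otimes> e j) \<in> alg_hom F E (K j)"
    by (rule corner; assumption)+
qed

lemma K_aut: "j < m ==> \<sigma> ^^ m \<in> alg_hom F (K j) (K j)"
proof (rule alg_homI)
  assume j: "j < m"
  note h = alg_homD[OF aut_pow_hom[of m]]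
  show "(\<sigma> ^^ m) u \<in> carrier (K j)" if "u \<in> carrier (K j)" for u
    using that h(2)[of u "e j"] j by (simp add: K_algebra aut_m_e)
  show "(\<sigma> ^^ m) \<one>\<^bsub>K j\<^esub> = \<one>\<^bsub>K j\<^esub>" using aut_m_e[OF j] by simp
qed (use alg_homD[OF aut_pow_hom[of m]] K_algebra in simp_all)

text \<open>The product is expanded in the basis of powers of \<open>h\<close> in E: since
  \<open>e_0\<close> is the sum of the \<open>r^(-k) h^(dk)\<close> divided by m, the coefficient at
  \<open>k d + i\<close> is \<open>u_i r^(-k) / m\<close>. The first d coefficients alone already
  recover the \<open>u_i\<close>.\<close>

lemma e0_indep:
  assumes u: "u \<in> {..<d} \<rightarrow> carrier F" and 0: "(\<Oplus>i\<in>{..<d}. u i \<odot> h [^] i) \<otimes> e 0 = \<zero>" and i: "i < d"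
  shows "u i = \<zero>\<^bsub>F\<^esub>"
proof -
  define v where "v l = (if l < d then u l else \<zero>\<^bsub>F\<^esub>)" for l
  have v [simp]: "v l \<in> carrier F" for l using u by (auto simp: v_def)
  let ?c = "\<lambda>k. inv\<^bsub>F\<^esub> z.num \<otimes>\<^bsub>F\<^esub> inv\<^bsub>F\<^esub> r [^]\<^bsub>F\<^esub> (k::nat)"
  let ?w = "\<lambda>l. ?c (l div d) \<otimes>\<^bsub>F\<^esub> v (l mod d)"
  have gk: "g [^] k = (inv\<^bsub>F\<^esub> r [^]\<^bsub>F\<^esub> k) \<odot> h [^] (d * k)" for k :: nat
    by (simp add: g_def A.smult_pow A.nat_pow_pow)
  have e0: "e 0 = (\<Oplus>k\<in>{..<m}. ?c k \<odot> h [^] (d * k))"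
  proof -
    have "e 0 = (\<Oplus>k\<in>{..<m}. inv\<^bsub>F\<^esub> z.num \<odot> g [^] k)"
      using dm by (simp add: e_idem R.idem_def A.smult_finsum)
    also have "\<dots> = (\<Oplus>k\<in>{..<m}. ?c k \<odot> h [^] (d * k))"
      by (rule A.M.finsum_cong') (auto simp: gk A.smult_assoc1)
    finally show ?thesis .
  qed
  have vs: "(\<Oplus>i\<in>{..<d}. u i \<odot> h [^] i) = (\<Oplus>i\<in>{..<d}. v i \<odot> h [^] i)"
  proof (rule A.M.finsum_cong'[OF refl])
    show "u i \<odot> h [^] i = v i \<odot> h [^] i" if "i \<in> {..<d}" for i using that by (simp add: v_def)
  qed simp
  have "expand ?w = (\<Oplus>l\<in>{..<m * d}. ?w l \<odot> h [^] l)"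
    by (subst expand_smult) (simp_all add: n mult.commute)
  also have "\<dots> = (\<Oplus>k\<in>{..<m}. \<Oplus>i\<in>{..<d}. ?w (k * d + i) \<odot> h [^] (k * d + i))"
    by (rule A.M.finsum_mult_index) simp
  also have "\<dots> = (\<Oplus>k\<in>{..<m}. (\<Oplus>i\<in>{..<d}. v i \<odot> h [^] i) \<otimes> (?c k \<odot> h [^] (d * k)))"
  proof (rule A.M.finsum_cong'[OF refl])
    fix k assume "k \<in> {..<m}"
    have "(\<Oplus>i\<in>{..<d}. v i \<odot> h [^] i) \<otimes> (?c k \<odot> h [^] (d * k)) =
        (\<Oplus>i\<in>{..<d}. (v i \<odot> h [^] i) \<otimes> (?c k \<odot> h [^] (d * k)))"
      by (rule A.finsum_mult) auto
    also have "\<dots> = (\<Oplus>i\<in>{..<d}. ?w (k * d + i) \<odot> h [^] (k * d + i))"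
    proof (rule A.M.finsum_cong'[OF refl])
      fix i assume "i \<in> {..<d}"
      then have "(k * d + i) div d = k" "(k * d + i) mod d = i" by auto
      then show "(v i \<odot> h [^] i) \<otimes> (?c k \<odot> h [^] (d * k)) = ?w (k * d + i) \<odot> h [^] (k * d + i)"
        using A.smult_mult_smult[of "v i" "?c k" "h [^] i" "h [^] (d * k)"]
        by (simp add: A.nat_pow_mult F.m_comm ac_simps)
    qed auto
    finally show "(\<Oplus>i\<in>{..<d}. ?w (k * d + i) \<odot> h [^] (k * d + i)) =
        (\<Oplus>i\<in>{..<d}. v i \<odot> h [^] i) \<otimes> (?c k \<odot> h [^] (d * k))" ..
  qed (auto intro!: A.M.finsum_closed)
  also have "\<dots> = (\<Oplus>i\<in>{..<d}. v i \<odot> h [^] i) \<otimes> e 0"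
    unfolding e0 by (rule A.mult_finsum[symmetric]) (auto intro!: A.M.finsum_closed)
  also have "\<dots> = \<zero>" using 0 unfolding vs .
  finally have z0: "expand ?w = \<zero>" .
  have "d * 1 \<le> n" unfolding n using dm by (intro mult_le_mono2) simp
  then have "i < n" using i by simp
  then have "?w i = \<zero>\<^bsub>self_algebra F\<^esub>" using z0 by (intro indep[of ?w]) auto
  then have "inv\<^bsub>F\<^esub> z.num \<otimes>\<^bsub>F\<^esub> u i = \<zero>\<^bsub>F\<^esub>" using i u by (simp add: v_def)
  then show ?thesis using F.integral[of "inv\<^bsub>F\<^esub> z.num" "u i"] F.inv_neq_zero[OF z.num_closed z.num_nz] u i by (auto simp: Pi_iff)
qed

text \<open>\<open>e_0\<close> is nonzero because it is the independent family above in degree 0,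
  and the j-th power of \<open>\<sigma>\<close> carries \<open>e_j\<close> to
  \<open>e_0\<close>.\<close>

lemma e_nonzero: "j < m ==> e j \<noteq> \<zero>"
proof -
  have e0: "e 0 \<noteq> \<zero>"
  proof
    assume e0: "e 0 = \<zero>"
    have "\<one>\<^bsub>F\<^esub> = \<zero>\<^bsub>F\<^esub>"
      by (rule e0_indep[of "\<lambda>i. \<one>\<^bsub>F\<^esub>" 0]) (use e0 dm in \<open>auto intro!: A.M.finsum_closed\<close>)
    then show False by simp
  qed
  assume "j < m"
  then show ?thesis using aut_pow_e[of j j] e0 alg_homomorphism.zero[OF aut_pow, of j] by auto
qed

text \<open>\<open>h^d\<close> acts on the corner as \<open>r\<close>, which gives the relation;
  projecting the powers of \<open>h\<close> to the corner gives spanning, and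
  \<open>e0_indep\<close> gives independence. So \<open>E e_0\<close> is
  \<open>F[X]/(X^d - r)\<close>.\<close>

lemma K0_kummer: "kummer F (K 0) (h \<otimes> e 0) d r"
proof -
  note K0 = K_algebra[OF dm(2)]
  note sc = scalar_hom[OF K0(2)]
  interpret K0: assoc_algebra F "K 0" by (rule K0(2))
  interpret c: alg_homomorphism F E "K 0" "\<lambda>u. u \<otimes> e 0"
    by (intro alg_homomorphism.intro alg_homomorphism_axioms.intro A.assoc_algebra_axioms K0)
  have "h [^] d \<otimes> e 0 = r \<odot> e 0"
    unfolding h_pow_d using R.g_idem[of 0] dm by (simp add: A.smult_mult_left e_idem)
  then have pow: "(h \<otimes> e 0) [^]\<^bsub>K 0\<^esub> d = r \<odot> e 0"
    using c.pow[OF y, of d] by simp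
  interpret P: skew_rel F "self_algebra F" "K 0" "\<lambda>c. c \<odot>\<^bsub>K 0\<^esub> \<one>\<^bsub>K 0\<^esub>" "h \<otimes> e 0" "\<lambda>x. x" d r
  proof (intro skew_rel.intro skew_rel_axioms.intro D.assoc_algebra_axioms K0(2) sigma alg_homomorphism.hom[OF sc])
    show "h \<otimes> e 0 \<in> carrier (K 0)" using c.hom_simps(1)[OF y] .
    show "(h \<otimes> e 0) \<otimes>\<^bsub>K 0\<^esub> (u \<odot>\<^bsub>K 0\<^esub> \<one>\<^bsub>K 0\<^esub>) = (u \<odot>\<^bsub>K 0\<^esub> \<one>\<^bsub>K 0\<^esub>) \<otimes>\<^bsub>K 0\<^esub> (h \<otimes> e 0)"
      if "u \<in> carrier (self_algebra F)" for u
      using that dm by (simp add: K.m_comm)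
    show "(h \<otimes> e 0) [^]\<^bsub>K 0\<^esub> d = r \<odot>\<^bsub>K 0\<^esub> \<one>\<^bsub>K 0\<^esub>" using pow by simp
  qed (use dm in simp_all)
  have ex: "P.expand u = (\<Oplus>i\<in>{..<d}. u i \<odot> h [^] i) \<otimes> e 0" if u: "u \<in> {..<d} \<rightarrow> carrier F" for u
  proof -
    have ui: "u i \<in> carrier F" if "i < d" for i using u that by auto
    have "(\<Oplus>i\<in>{..<d}. u i \<odot> h [^] i) \<otimes> e 0 = (\<Oplus>\<^bsub>K 0\<^esub>i\<in>{..<d}. (u i \<odot> h [^] i) \<otimes> e 0)"
      using ui by (intro c.finsum) auto
    also have "\<dots> = P.expand u"
      unfolding P.expand_def
    proof (rule K0.M.finsum_cong'[OF refl])
      fix i assume "i \<in> {..<d}"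
      then have i: "u i \<in> carrier F" using ui by simp
      have "(u i \<odot> h [^] i) \<otimes> e 0 = u i \<odot>\<^bsub>K 0\<^esub> (h \<otimes> e 0) [^]\<^bsub>K 0\<^esub> i"
        using i c.hom_simps(5)[OF i, of "h [^] i"] c.pow[OF y, of i] by simp
      also have "\<dots> = (u i \<odot>\<^bsub>K 0\<^esub> \<one>\<^bsub>K 0\<^esub>) \<otimes>\<^bsub>K 0\<^esub> (h \<otimes> e 0) [^]\<^bsub>K 0\<^esub> i"
        by (rule K0.one_smult_mult[symmetric]) (use i P.y in \<open>auto simp del: corner_simps\<close>)
      finally show "(u i \<odot> h [^] i) \<otimes> e 0 = (u i \<odot>\<^bsub>K 0\<^esub> \<one>\<^bsub>K 0\<^esub>) \<otimes>\<^bsub>K 0\<^esub> (h \<otimes> e 0) [^]\<^bsub>K 0\<^esub> i" .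
    qed (use ui P.mono_closed in \<open>auto simp del: corner_simps\<close>)
    finally show ?thesis ..
  qed
  have span: "\<exists>v\<in>{..<d} \<rightarrow> carrier (self_algebra F). z = P.expand v" if "z \<in> carrier (K 0)" for z
  proof -
    have "\<exists>v\<in>{..<d} \<rightarrow> carrier (self_algebra F). u \<otimes> e 0 = P.expand v" if "u \<in> carrier E" for u
      using that
    proof (induction u rule: induct)
      case (mono v k)
      then have v: "v \<in> carrier F" by simp
      have "((v \<odot> \<one>) \<otimes> h [^] k) \<otimes> e 0 = (v \<odot>\<^bsub>K 0\<^esub> \<one>\<^bsub>K 0\<^esub>) \<otimes>\<^bsub>K 0\<^esub> (h \<otimes> e 0) [^]\<^bsub>K 0\<^esub> k"
        using v c.hom_simps(2)[of "v \<odot> \<one>" "h [^] k"] c.hom_simps(5)[OF v A.one_closed] c.pow[OF y, of k] dm by simp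
      then show ?case using P.mono_span[of v k] v by simp
    next
      case zero
      have "P.expand (\<lambda>k. \<zero>\<^bsub>F\<^esub>) = \<zero> \<otimes> e 0" by (subst ex) (simp_all add: dm)
      then show ?case by (intro bexI[of _ "\<lambda>k. \<zero>\<^bsub>F\<^esub>"]) auto
    next
      case (add u v)
      then obtain u' v' where *: "u' \<in> {..<d} \<rightarrow> carrier (self_algebra F)" "u \<otimes> e 0 = P.expand u'"
        "v' \<in> {..<d} \<rightarrow> carrier (self_algebra F)" "v \<otimes> e 0 = P.expand v'" by blast
      have "(u \<oplus> v) \<otimes> e 0 = P.expand (\<lambda>k. u' k \<oplus>\<^bsub>self_algebra F\<^esub> v' k)"
        using P.expand_add[OF *(1,3)] *(2,4) add(1,2) dm by (simp add: A.l_distr)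
      then show ?case using *(1,3) by (intro bexI[of _ "\<lambda>k. u' k \<oplus>\<^bsub>self_algebra F\<^esub> v' k"]) (auto simp: Pi_iff)
    qed
    from this[of z] show ?thesis using that by (simp add: K0)
  qed
  have "u k = \<zero>\<^bsub>self_algebra F\<^esub>" if "u \<in> {..<d} \<rightarrow> carrier (self_algebra F)" "P.expand u = \<zero>\<^bsub>K 0\<^esub>" "k < d" for u k
    using that ex[of u] e0_indep[of u k] by simp
  then have "skew_pres F (self_algebra F) (K 0) (\<lambda>c. c \<odot>\<^bsub>K 0\<^esub> \<one>\<^bsub>K 0\<^esub>) (h \<otimes> e 0) (\<lambda>x. x) d r"
    using span by (intro skew_pres.intro skew_pres_axioms.intro P.skew_rel_axioms) auto
  then show ?thesis by (intro kummer.intro F.field_axioms)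
qed

lemma K0_field: "field (K 0)"
  by (rule kummer.field_if_no_roots[OF K0_kummer r0 w.root_of_unity_axioms no_root])

lemma K0_cyclic: "kummer_cyclic F (K 0) (h \<otimes> e 0) d r (q [^]\<^bsub>F\<^esub> m) (\<sigma> ^^ m)"
proof (intro kummer_cyclic.intro kummer_aut.intro kummer_aut_axioms.intro kummer_cyclic_axioms.intro
    K0_kummer K0_field w.root_of_unity_axioms r0 K_aut[OF dm(2)])
  show "(\<sigma> ^^ m) (h \<otimes> e 0) = (q [^]\<^bsub>F\<^esub> m) \<odot>\<^bsub>K 0\<^esub> (h \<otimes> e 0)"
    using alg_homD(2)[OF aut_pow_hom[of m], of h "e 0"] dm
    by (simp add: aut_pow_h aut_m_e A.smult_mult_left)
qed

end

section \<open>Splitting a cyclic algebra along its idempotents\<close>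

locale split_cyclic = split_kummer F E h n s q \<sigma> m d r + C: skew_pres F E C \<iota> x \<sigma> n "a \<odot>\<^bsub>E\<^esub> \<one>\<^bsub>E\<^esub>"
  for F :: "('f, 'z) ring_scheme" and E :: "('f, 'a) module" and h n s q \<sigma> m d r
    and C :: "('f, 'b, 'k) module_scheme" (structure) and \<iota> x a +
  assumes a_closed [simp]: "a \<in> carrier F" and a0: "a \<noteq> \<zero>\<^bsub>F\<^esub>"
begin

abbreviation "B \<equiv> skew_quot (K 0) (\<sigma> ^^ m) d (a \<odot>\<^bsub>E\<^esub> e 0)"
abbreviation "\<kappa> \<equiv> skew_const (K 0) (\<sigma> ^^ m) d (a \<odot>\<^bsub>E\<^esub> e 0)"
abbreviation "t \<equiv> skew_gen (K 0) (\<sigma> ^^ m) d (a \<odot>\<^bsub>E\<^esub> e 0)"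

lemma B_cyclic: "cyclic_alg F (K 0) (h \<otimes>\<^bsub>E\<^esub> e 0) d r (q [^]\<^bsub>F\<^esub> m) (\<sigma> ^^ m) B \<kappa> t a"
proof -
  interpret kc: kummer_cyclic F "K 0" "h \<otimes>\<^bsub>E\<^esub> e 0" d r "q [^]\<^bsub>F\<^esub> m" "\<sigma> ^^ m" by (rule K0_cyclic)
  have "skew_pres F (K 0) B \<kappa> t (\<sigma> ^^ m) d (a \<odot>\<^bsub>E\<^esub> e 0)"
  proof (rule skew_quot_pres[OF K_algebra(2)[OF dm(2)] K_aut[OF dm(2)] dm(1)])
    show "a \<odot>\<^bsub>E\<^esub> e 0 \<in> carrier (K 0)"
      using kc.A.smult_closed[OF a_closed kc.A.one_closed] by simp
    then show "(a \<odot>\<^bsub>E\<^esub> e 0) \<otimes>\<^bsub>K 0\<^esub> u = u \<otimes>\<^bsub>K 0\<^esub> (a \<odot>\<^bsub>E\<^esub> e 0)" if "u \<in> carrier (K 0)" for u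
      using that by (rule kc.comm)
    show "(\<sigma> ^^ m) (a \<odot>\<^bsub>E\<^esub> e 0) = a \<odot>\<^bsub>E\<^esub> e 0"
      using alg_homD(5)[OF aut_pow_hom[of m] a_closed e_closed[OF dm(2)]] aut_m_e[OF dm(2)] by simp
  qed (rule kc.aut_order)
  then have "skew_pres F (K 0) B \<kappa> t (\<sigma> ^^ m) d (a \<odot>\<^bsub>K 0\<^esub> \<one>\<^bsub>K 0\<^esub>)" by simp
  then show ?thesis
    by (intro cyclic_alg.intro cyclic_alg_axioms.intro K0_cyclic a_closed a0)
qed

sublocale B: cyclic_alg F "K 0" "h \<otimes>\<^bsub>E\<^esub> e 0" d r "q [^]\<^bsub>F\<^esub> m" "\<sigma> ^^ m" B \<kappa> t a
  by (rule B_cyclic)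

lemma K0D: "u \<in> carrier (K 0) ==> u \<in> carrier E" "u \<in> carrier (K 0) ==> u \<otimes>\<^bsub>E\<^esub> e 0 = u"
  by (simp_all add: K_algebra[OF dm(2)])

lemma aut_pow_n: "u \<in> carrier E ==> (\<sigma> ^^ (i * n)) u = u"
proof (induction i)
  case (Suc i)
  have "(\<sigma> ^^ (Suc i * n)) u = (\<sigma> ^^ n) ((\<sigma> ^^ (i * n)) u)" by (simp add: funpow_add)
  then show ?case using Suc aut_order by simp
qed simp

text \<open>On \<open>E\<close> the automorphism \<open>\<sigma>\<close> has order \<open>n\<close>, so this is its \<open>i\<close>-th inverse power.\<close>

definition \<rho> :: "nat => 'a => 'a" where "\<rho> i = \<sigma> ^^ (i * (n - 1))"

lemma rho_hom: "\<rho> i \<in> alg_hom F E E" unfolding \<rho>_def by (rule aut_pow_hom)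

sublocale rho: alg_homomorphism F E E "\<rho> i" for i
  by (intro alg_homomorphism.intro alg_homomorphism_axioms.intro A.assoc_algebra_axioms rho_hom)

lemma rho_closed [simp]: "u \<in> carrier E ==> \<rho> i u \<in> carrier E"
  by (rule alg_homD(1)[OF rho_hom])

lemma rho_inv: "u \<in> carrier E ==> (\<sigma> ^^ i) (\<rho> i u) = u" "u \<in> carrier E ==> \<rho> i ((\<sigma> ^^ i) u) = u"
proof -
  have i: "i + i * (n - 1) = i * n" using d by (cases n) simp_all
  show "u \<in> carrier E ==> (\<sigma> ^^ i) (\<rho> i u) = u"
    unfolding \<rho>_def using aut_pow_n[of u i] fun_cong[OF funpow_add[of i "i * (n - 1)" \<sigma>], of u] unfolding i by simp
  show "u \<in> carrier E ==> \<rho> i ((\<sigma> ^^ i) u) = u"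
    unfolding \<rho>_def using aut_pow_n[of u i] fun_cong[OF funpow_add[of "i * (n - 1)" i \<sigma>], of u]
    unfolding add.commute[of "i * (n - 1)" i] i by simp
qed

lemma rho_aut: "\<rho> i ((\<sigma> ^^ k) u) = (\<sigma> ^^ k) (\<rho> i u)"
  unfolding \<rho>_def using fun_cong[OF funpow_add[of "i * (n - 1)" k \<sigma>], of u]
    fun_cong[OF funpow_add[of k "i * (n - 1)" \<sigma>], of u] by (simp add: add.commute)

lemma rho_e: "i < m ==> \<rho> i (e 0) = e i"
  using rho_inv(2)[of "e i" i] aut_pow_e[of i i] by simp

definition \<phi>0 :: "'a => 'a" where "\<phi>0 u = (\<Oplus>\<^bsub>E\<^esub>i\<in>{..<m}. \<rho> i u)"

text \<open>\<open>inv_into\<close> inverts \<open>\<sigma>\<close> only on the carrier, and there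
  the inverse is the power with exponent \<open>n - 1\<close>. Powers of \<open>\<sigma>\<close> are
  algebra homomorphisms outright, so the rest of the argument uses \<open>\<rho>\<close>.\<close>

lemma orbit_sum_eq:
  assumes "u \<in> carrier E"
  shows "orbit_sum E \<sigma> m u = \<phi>0 u"
proof -
  have inj: "inj_on \<sigma> (carrier E)" using aut_bij[of 1] by (simp add: bij_betw_def)
  have *: "(inv_into (carrier E) \<sigma> ^^ i) u = \<rho> i u" for i
  proof (induction i)
    case (Suc i)
    have "(\<sigma> ^^ Suc (n - 1)) (\<rho> i u) = \<rho> i u"
      using aut_order[OF rho_closed[OF assms, of i]] d by (simp del: funpow.simps)
    then have "\<sigma> ((\<sigma> ^^ (n - 1)) (\<rho> i u)) = \<rho> i u" by simp
    then have "inv_into (carrier E) \<sigma> (\<rho> i u) = (\<sigma> ^^ (n - 1)) (\<rho> i u)"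
      using assms by (intro inv_into_f_eq[OF inj]) simp_all
    also have "\<dots> = \<rho> (Suc i) u" by (simp add: \<rho>_def funpow_add)
    finally show ?case using Suc by simp
  qed (simp add: \<rho>_def)
  show ?thesis unfolding orbit_sum_def \<phi>0_def * ..
qed

lemma phi0_closed [simp]: "u \<in> carrier E ==> \<phi>0 u \<in> carrier E"
  unfolding \<phi>0_def by (intro A.M.finsum_closed) simp

lemma rho_K0: "u \<in> carrier (K 0) ==> i < m ==> \<rho> i u \<otimes>\<^bsub>E\<^esub> e i = \<rho> i u"
  using alg_homD(2)[OF rho_hom, of u "e 0" i] K0D[of u] dm by (simp add: rho_e)

text \<open>The summand \<open>\<rho> i u\<close> lies in \<open>E e_i\<close>, so multiplication by
  \<open>e_j\<close> leaves exactly one summand.\<close>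

lemma phi0_e:
  assumes u: "u \<in> carrier (K 0)" and j: "j < m"
  shows "\<phi>0 u \<otimes>\<^bsub>E\<^esub> e j = \<rho> j u"
proof -
  note uE = K0D(1)[OF u]
  have "\<phi>0 u \<otimes>\<^bsub>E\<^esub> e j = (\<Oplus>\<^bsub>E\<^esub>i\<in>{..<m}. \<rho> i u \<otimes>\<^bsub>E\<^esub> e j)"
    unfolding \<phi>0_def using uE j by (intro A.finsum_mult) auto
  also have "\<dots> = (\<Oplus>\<^bsub>E\<^esub>i\<in>{..<m}. if i = j then \<rho> j u else \<zero>\<^bsub>E\<^esub>)"
  proof (rule A.M.finsum_cong'[OF refl])
    fix i assume "i \<in> {..<m}"
    then have i: "i < m" by simp
    have "\<rho> i u \<otimes>\<^bsub>E\<^esub> e j = \<rho> i u \<otimes>\<^bsub>E\<^esub> (e i \<otimes>\<^bsub>E\<^esub> e j)"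
      using A.m_assoc[of "\<rho> i u" "e i" "e j"] uE i j rho_K0[OF u i] by simp
    then show "\<rho> i u \<otimes>\<^bsub>E\<^esub> e j = (if i = j then \<rho> j u else \<zero>\<^bsub>E\<^esub>)"
      using e_mult[OF i j] uE rho_K0[OF u j] by (cases "i = j") simp_all
  qed (use uE in simp)
  also have "\<dots> = \<rho> j u" using j uE by (intro A.finsum_delta) auto
  finally show ?thesis .
qed

lemma rho_iso: "j < m ==> \<rho> j \<in> alg_iso F (K 0) (K j)"
proof (rule alg_isoI)
  assume j: "j < m"
  note Kj = K_algebra[OF j]
  show "\<rho> j \<in> alg_hom F (K 0) (K j)"
  proof (rule alg_homI)
    show "\<rho> j u \<in> carrier (K j)" if "u \<in> carrier (K 0)" for u
      using rho_K0[OF that j] K0D(1)[OF that] by (simp add: Kj)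
    show "\<rho> j \<one>\<^bsub>K 0\<^esub> = \<one>\<^bsub>K j\<^esub>" using rho_e[OF j] by simp
  qed (use alg_homD[OF rho_hom[of j]] K0D(1) in simp_all)
  show "inj_on (\<rho> j) (carrier (K 0))"
  proof (rule Fun.inj_onI)
    fix u v assume u: "u \<in> carrier (K 0)" and v: "v \<in> carrier (K 0)" and eq: "\<rho> j u = \<rho> j v"
    have "u = (\<sigma> ^^ j) (\<rho> j u)" by (rule rho_inv(1)[OF K0D(1)[OF u], symmetric])
    also have "\<dots> = v" unfolding eq by (rule rho_inv(1)[OF K0D(1)[OF v]])
    finally show "u = v" .
  qed
  show "carrier (K j) \<subseteq> \<rho> j ` carrier (K 0)"
  proof
    fix v assume "v \<in> carrier (K j)"
    then have v: "v \<in> carrier E" "v \<otimes>\<^bsub>E\<^esub> e j = v" by (simp_all add: Kj)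
    have "(\<sigma> ^^ j) v \<otimes>\<^bsub>E\<^esub> e 0 = (\<sigma> ^^ j) v"
      using alg_homD(2)[OF aut_pow_hom[of j] v(1) e_closed[OF j]] aut_pow_e[OF le_refl j] v(2) by simp
    then have "(\<sigma> ^^ j) v \<in> carrier (K 0)" using v(1) by (simp add: K_algebra[OF dm(2)])
    then show "v \<in> \<rho> j ` carrier (K 0)" using rho_inv(2)[OF v(1), of j] by force
  qed
qed

lemma rho_in_K: "u \<in> carrier (K 0) ==> j < m ==> \<rho> j u \<in> carrier (K j)"
  using alg_homD(1)[OF alg_isoD(1)[OF rho_iso]] .

lemma phi0_hom: "\<phi>0 \<in> alg_hom F (K 0) E"
proof (rule alg_homI)
  show "\<phi>0 u \<in> carrier E" if "u \<in> carrier (K 0)" for u using K0D(1)[OF that] by simp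
  show "\<phi>0 \<one>\<^bsub>K 0\<^esub> = \<one>\<^bsub>E\<^esub>"
    unfolding \<phi>0_def e_sum[symmetric] corner_simps by (rule A.M.finsum_cong') (simp_all add: rho_e)
  show "\<phi>0 (u \<oplus>\<^bsub>K 0\<^esub> v) = \<phi>0 u \<oplus>\<^bsub>E\<^esub> \<phi>0 v" if "u \<in> carrier (K 0)" "v \<in> carrier (K 0)" for u v
    unfolding \<phi>0_def corner_simps using K0D(1)[OF that(1)] K0D(1)[OF that(2)]
    by (subst A.M.finsum_addf[symmetric]) simp_all
  show "\<phi>0 (c \<odot>\<^bsub>K 0\<^esub> u) = c \<odot>\<^bsub>E\<^esub> \<phi>0 u" if "c \<in> carrier F" "u \<in> carrier (K 0)" for c u
    unfolding \<phi>0_def corner_simps using that(1) K0D(1)[OF that(2)] by (simp add: A.smult_finsum)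
  fix u v assume u: "u \<in> carrier (K 0)" and v: "v \<in> carrier (K 0)"
  note uv = K0D(1)[OF u] K0D(1)[OF v]
  have uvK: "u \<otimes>\<^bsub>E\<^esub> v \<in> carrier (K 0)" using B.A.m_closed[OF u v] by simp
  have "\<phi>0 (u \<otimes>\<^bsub>E\<^esub> v) = \<phi>0 u \<otimes>\<^bsub>E\<^esub> \<phi>0 v"
  \<comment> \<open>In each component only one summand of either factor survives, so no double sum
    has to be expanded.\<close>
  proof (rule component_ext)
    fix j assume j: "j < m"
    have "(\<phi>0 u \<otimes>\<^bsub>E\<^esub> \<phi>0 v) \<otimes>\<^bsub>E\<^esub> e j = \<phi>0 u \<otimes>\<^bsub>E\<^esub> \<rho> j v"
      using uv j by (simp add: A.m_assoc phi0_e[OF v j])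
    also have "\<dots> = \<phi>0 u \<otimes>\<^bsub>E\<^esub> (e j \<otimes>\<^bsub>E\<^esub> \<rho> j v)"
      using rho_K0[OF v j] K.m_comm[of "\<rho> j v" "e j"] uv j by simp
    also have "\<dots> = \<phi>0 u \<otimes>\<^bsub>E\<^esub> e j \<otimes>\<^bsub>E\<^esub> \<rho> j v" using uv j by (simp add: A.m_assoc)
    also have "\<dots> = \<phi>0 (u \<otimes>\<^bsub>E\<^esub> v) \<otimes>\<^bsub>E\<^esub> e j"
      using uv by (simp add: phi0_e[OF u j] phi0_e[OF uvK j])
    finally show "\<phi>0 (u \<otimes>\<^bsub>E\<^esub> v) \<otimes>\<^bsub>E\<^esub> e j = (\<phi>0 u \<otimes>\<^bsub>E\<^esub> \<phi>0 v) \<otimes>\<^bsub>E\<^esub> e j" ..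
  qed (use uv in simp_all)
  then show "\<phi>0 (u \<otimes>\<^bsub>K 0\<^esub> v) = \<phi>0 u \<otimes>\<^bsub>E\<^esub> \<phi>0 v" by simp
qed

lemma phi0_aut:
  assumes "u \<in> carrier E"
  shows "(\<sigma> ^^ m) (\<phi>0 u) = \<phi>0 ((\<sigma> ^^ m) u)"
  unfolding \<phi>0_def using assms
  by (subst alg_homomorphism.finsum[OF aut_pow]) (simp_all add: rho_aut)

lemma phi0_inj: "u \<in> carrier (K 0) ==> \<phi>0 u = \<zero>\<^bsub>E\<^esub> ==> u = \<zero>\<^bsub>E\<^esub>"
  using phi0_e[of u 0] K0D[of u] dm by (simp add: \<rho>_def)

text \<open>\<open>T.expand w\<close> is a polynomial in \<open>x^m\<close> with arbitrary
  coefficients in E. These elements make up only a part of C, later called \<open>P\<close>; hence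
  relations without the spanning axiom.\<close>

sublocale T: skew_rel F E C \<iota> "x [^] m" "\<sigma> ^^ m" d "a \<odot>\<^bsub>E\<^esub> \<one>\<^bsub>E\<^esub>"
proof (intro skew_rel.intro skew_rel_axioms.intro A.assoc_algebra_axioms C.A.assoc_algebra_axioms C.f aut_pow_hom dm)
  show "(x [^] m) [^] d = \<iota> (a \<odot>\<^bsub>E\<^esub> \<one>\<^bsub>E\<^esub>)"
    using C.pow by (simp add: C.A.nat_pow_pow n mult.commute)
qed (use C.pow_rel in simp_all)

lemma x_pow_T:
  assumes w: "w \<in> {..<d} \<rightarrow> carrier E"
  shows "x [^] k \<otimes> T.expand w = T.expand (\<lambda>l. (\<sigma> ^^ k) (w l)) \<otimes> x [^] (k::nat)"
proof -
  have wl: "w l \<in> carrier E" if "l < d" for l using w that by auto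
  have "x [^] k \<otimes> T.expand w = (\<Oplus>l\<in>{..<d}. x [^] k \<otimes> (\<iota> (w l) \<otimes> (x [^] m) [^] l))"
    unfolding T.expand_def using wl by (intro C.A.mult_finsum) auto
  also have "\<dots> = (\<Oplus>l\<in>{..<d}. (\<iota> ((\<sigma> ^^ k) (w l)) \<otimes> (x [^] m) [^] l) \<otimes> x [^] k)"
  proof (rule C.A.M.finsum_cong'[OF refl])
    fix l assume "l \<in> {..<d}"
    then have l: "w l \<in> carrier E" using wl by simp
    have "x [^] k \<otimes> (\<iota> (w l) \<otimes> (x [^] m) [^] l) =
        (x [^] k \<otimes> \<iota> (w l)) \<otimes> (x [^] m) [^] l"
      using l by (simp add: C.A.m_assoc)
    also have "\<dots> = \<iota> ((\<sigma> ^^ k) (w l)) \<otimes> (x [^] k \<otimes> (x [^] m) [^] l)"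
      unfolding C.pow_rel[OF l] using l by (intro C.A.m_assoc) simp_all
    also have "x [^] k \<otimes> (x [^] m) [^] l = (x [^] m) [^] l \<otimes> x [^] k"
      by (simp add: C.A.nat_pow_pow C.A.nat_pow_mult add.commute)
    also have "\<iota> ((\<sigma> ^^ k) (w l)) \<otimes> ((x [^] m) [^] l \<otimes> x [^] k) =
        (\<iota> ((\<sigma> ^^ k) (w l)) \<otimes> (x [^] m) [^] l) \<otimes> x [^] k"
      using l by (simp add: C.A.m_assoc)
    finally show "x [^] k \<otimes> (\<iota> (w l) \<otimes> (x [^] m) [^] l) =
        (\<iota> ((\<sigma> ^^ k) (w l)) \<otimes> (x [^] m) [^] l) \<otimes> x [^] k" .
  qed (use wl in simp)
  also have "\<dots> = T.expand (\<lambda>l. (\<sigma> ^^ k) (w l)) \<otimes> x [^] k"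
    unfolding T.expand_def using wl by (intro C.A.finsum_mult[symmetric]) auto
  finally show ?thesis .
qed

text \<open>An element fixed by \<open>\<sigma>^m\<close> commutes with \<open>x^m\<close>, so it
  can be moved next to each coefficient. The idempotents \<open>e_j\<close> are of this
  kind.\<close>

lemma T_iota:
  assumes w: "w \<in> {..<d} \<rightarrow> carrier E" and v: "v \<in> carrier E" "(\<sigma> ^^ m) v = v"
  shows "T.expand w \<otimes> \<iota> v = T.expand (\<lambda>l. w l \<otimes>\<^bsub>E\<^esub> v)"
proof -
  have wl: "w l \<in> carrier E" if "l < d" for l using w that by auto
  have fixed: "((\<sigma> ^^ m) ^^ l) v = v" for l by (induction l) (simp_all add: v(2))
  have "T.expand w \<otimes> \<iota> v = (\<Oplus>l\<in>{..<d}. (\<iota> (w l) \<otimes> (x [^] m) [^] l) \<otimes> \<iota> v)"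
    unfolding T.expand_def using wl v by (intro C.A.finsum_mult) auto
  also have "\<dots> = (\<Oplus>l\<in>{..<d}. \<iota> (w l \<otimes>\<^bsub>E\<^esub> v) \<otimes> (x [^] m) [^] l)"
  proof (rule C.A.M.finsum_cong'[OF refl])
    fix l assume "l \<in> {..<d}"
    then have l: "w l \<in> carrier E" using wl by simp
    have "(\<iota> (w l) \<otimes> (x [^] m) [^] l) \<otimes> \<iota> v = \<iota> (w l) \<otimes> ((x [^] m) [^] l \<otimes> \<iota> v)"
      using l v by (simp add: C.A.m_assoc)
    also have "\<dots> = \<iota> (w l) \<otimes> (\<iota> v \<otimes> (x [^] m) [^] l)"
      unfolding T.pow_rel[OF v(1)] fixed ..
    also have "\<dots> = \<iota> (w l \<otimes>\<^bsub>E\<^esub> v) \<otimes> (x [^] m) [^] l" using l v by (simp add: C.A.m_assoc)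
    finally show "(\<iota> (w l) \<otimes> (x [^] m) [^] l) \<otimes> \<iota> v = \<iota> (w l \<otimes>\<^bsub>E\<^esub> v) \<otimes> (x [^] m) [^] l" .
  qed (use wl v in simp)
  finally show ?thesis by (simp only: T.expand_def)
qed

text \<open>The exponents of \<open>x\<close> are sorted by their remainder \<open>i\<close> modulo
  m; within one class \<open>x^(km)\<close> is a power of \<open>x^m\<close>.\<close>

lemma C_decomp:
  assumes v: "\<And>l. v l \<in> carrier E"
  shows "C.expand v = (\<Oplus>i\<in>{..<m}. T.expand (\<lambda>k. v (k * m + i)) \<otimes> x [^] i)"
proof -
  let ?f = "\<lambda>k i. \<iota> (v (k * m + i)) \<otimes> x [^] (k * m + i)"
  have "C.expand v = (\<Oplus>k\<in>{..<d}. \<Oplus>i\<in>{..<m}. ?f k i)"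
    unfolding C.expand_def unfolding n by (rule C.A.M.finsum_mult_index) (simp add: v)
  also have "\<dots> = (\<Oplus>i\<in>{..<m}. \<Oplus>k\<in>{..<d}. ?f k i)"
    by (rule C.A.M.finsum_swap) (simp_all add: v)
  also have "\<dots> = (\<Oplus>i\<in>{..<m}. T.expand (\<lambda>k. v (k * m + i)) \<otimes> x [^] i)"
  proof (rule C.A.M.finsum_cong'[OF refl])
    fix i assume "i \<in> {..<m}"
    have "T.expand (\<lambda>k. v (k * m + i)) \<otimes> x [^] i =
        (\<Oplus>k\<in>{..<d}. (\<iota> (v (k * m + i)) \<otimes> (x [^] m) [^] k) \<otimes> x [^] i)"
      unfolding T.expand_def using v by (intro C.A.finsum_mult) auto
    also have "\<dots> = (\<Oplus>k\<in>{..<d}. ?f k i)"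
      using v by (intro C.A.M.finsum_cong') (auto simp: C.A.m_assoc C.A.nat_pow_pow C.A.nat_pow_mult mult.commute)
    finally show "(\<Oplus>k\<in>{..<d}. ?f k i) = T.expand (\<lambda>k. v (k * m + i)) \<otimes> x [^] i" ..
  qed (simp add: v T.expand_closed)
  finally show ?thesis .
qed

lemma T_sum_indep:
  assumes w: "\<And>i. i < m ==> w i \<in> {..<d} \<rightarrow> carrier E"
    and 0: "(\<Oplus>i\<in>{..<m}. T.expand (w i) \<otimes> x [^] i) = \<zero>" and i: "i < m" and k: "k < d"
  shows "w i k = \<zero>\<^bsub>E\<^esub>"
proof -
  \<comment> \<open>The m families are merged into a single coefficient family of length n by
    \<open>v (k m + i) = w i k\<close>, to which independence in C applies.\<close>
  define v where "v l = (if l < n then w (l mod m) (l div m) else \<zero>\<^bsub>E\<^esub>)" for l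
  have lt: "k * m + i < n" if "k < d" "i < m" for k i
  proof -
    have "k * m + i < Suc k * m" using that by simp
    also have "\<dots> \<le> d * m" using that by (intro mult_le_mono1) simp
    finally show ?thesis using n by simp
  qed
  have v: "v l \<in> carrier E" for l
  proof (cases "l < n")
    case True
    then have "l div m < d" "l mod m < m" using n dm by (simp_all add: less_mult_imp_div_less)
    then show ?thesis using Pi_mem[OF w[of "l mod m"], of "l div m"] by (simp add: v_def)
  qed (simp add: v_def)
  have vw: "v (k * m + i) = w i k" if "k < d" "i < m" for k i
    using lt[OF that] that by (simp add: v_def)
  have "C.expand v = (\<Oplus>i\<in>{..<m}. T.expand (w i) \<otimes> x [^] i)"
    unfolding C_decomp[OF v]
  proof (rule C.A.M.finsum_cong'[OF refl])
    fix i assume "i \<in> {..<m}"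
    then have "T.expand (\<lambda>k. v (k * m + i)) = T.expand (w i)"
      using vw v by (intro T.expand_cong) auto
    then show "T.expand (\<lambda>k. v (k * m + i)) \<otimes> x [^] i = T.expand (w i) \<otimes> x [^] i" by simp
  qed (use w in simp)
  then have "C.expand v = \<zero>" using 0 by simp
  then have "v (k * m + i) = \<zero>\<^bsub>E\<^esub>" using v lt[OF k i] by (intro C.indep[of v]) auto
  then show ?thesis using vw[OF k i] by simp
qed

lemma T_indep:
  assumes w: "w \<in> {..<d} \<rightarrow> carrier E" and 0: "T.expand w = \<zero>" and k: "k < d"
  shows "w k = \<zero>\<^bsub>E\<^esub>"
proof -
  define w' where "w' i = (if i = 0 then w else (\<lambda>_. \<zero>\<^bsub>E\<^esub>))" for i :: nat
  have w': "w' i \<in> {..<d} \<rightarrow> carrier E" for i using w by (simp add: w'_def)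
  have 0: "T.expand (w' i) = \<zero>" for i using 0 by (simp add: w'_def T.expand_def)
  have "(\<Oplus>i\<in>{..<m}. T.expand (w' i) \<otimes> x [^] i) = \<zero>" unfolding 0 by simp
  from T_sum_indep[OF w' this dm(2) k] show ?thesis by (simp add: w'_def)
qed

text \<open>The embedding of EE' is the lift of \<open>\<phi>0\<close> with \<open>t\<close> going
  to \<open>x^m\<close>. The relations hold because \<open>\<phi>0\<close> commutes with
  \<open>\<sigma>^m\<close> and sends \<open>a e_0\<close> to \<open>a\<close>, which is
  \<open>x^n\<close>.\<close>

sublocale L: skew_lift F "K 0" B \<kappa> t "\<sigma> ^^ m" d "a \<odot>\<^bsub>K 0\<^esub> \<one>\<^bsub>K 0\<^esub>" C "\<lambda>u. \<iota> (\<phi>0 u)" "x [^] m"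
proof (intro skew_lift.intro B.C.skew_pres_axioms skew_rel.intro skew_rel_axioms.intro
    K_algebra(2) K_aut C.A.assoc_algebra_axioms dm)
  show "(\<lambda>u. \<iota> (\<phi>0 u)) \<in> alg_hom F (K 0) C" by (rule alg_hom_comp[OF phi0_hom C.f])
  show "a \<odot>\<^bsub>K 0\<^esub> \<one>\<^bsub>K 0\<^esub> \<in> carrier (K 0)" by (rule B.A.smult_closed[OF a_closed B.A.one_closed])
  show "x [^] m \<otimes> \<iota> (\<phi>0 u) = \<iota> (\<phi>0 ((\<sigma> ^^ m) u)) \<otimes> x [^] m" if "u \<in> carrier (K 0)" for u
    using C.pow_rel[of "\<phi>0 u" m] phi0_aut[of u] K0D(1)[OF that] by simp
  have "\<phi>0 (a \<odot>\<^bsub>K 0\<^esub> \<one>\<^bsub>K 0\<^esub>) = a \<odot>\<^bsub>E\<^esub> \<one>\<^bsub>E\<^esub>"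
    using alg_homD(4,5)[OF phi0_hom] B.A.one_closed a_closed by metis
  then show "(x [^] m) [^] d = \<iota> (\<phi>0 (a \<odot>\<^bsub>K 0\<^esub> \<one>\<^bsub>K 0\<^esub>))" using T.pow by simp
qed simp

abbreviation "\<phi> \<equiv> L.lift"

sublocale phi: alg_homomorphism F B C \<phi>
  by (intro alg_homomorphism.intro alg_homomorphism_axioms.intro B.C.A.assoc_algebra_axioms
      C.A.assoc_algebra_axioms L.lift_hom)

lemma phi_expand: "u \<in> {..<d} \<rightarrow> carrier (K 0) ==> \<phi> (B.C.expand u) = T.expand (\<lambda>k. \<phi>0 (u k))"
  by (simp add: L.lift_expand L.B.expand_def T.expand_def)

lemma phi0_Pi: "u \<in> {..<d} \<rightarrow> carrier (K 0) ==> (\<lambda>k. \<phi>0 (u k)) \<in> {..<d} \<rightarrow> carrier E"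
  using K0D(1) by (auto simp: Pi_iff)

lemma phi_image: "\<phi> ` carrier B = {T.expand (\<lambda>k. \<phi>0 (u k)) | u. u \<in> {..<d} \<rightarrow> carrier (K 0)}"
proof (intro equalityI subsetI)
  fix z assume "z \<in> \<phi> ` carrier B"
  then obtain b where b: "b \<in> carrier B" "z = \<phi> b" by blast
  obtain u where u: "u \<in> {..<d} \<rightarrow> carrier (K 0)" "b = B.C.expand u" using B.C.span[OF b(1)] by blast
  then have "z = T.expand (\<lambda>k. \<phi>0 (u k))" using phi_expand[OF u(1)] b by simp
  then show "z \<in> {T.expand (\<lambda>k. \<phi>0 (u k)) | u. u \<in> {..<d} \<rightarrow> carrier (K 0)}" using u(1) by blast
next
  fix z assume "z \<in> {T.expand (\<lambda>k. \<phi>0 (u k)) | u. u \<in> {..<d} \<rightarrow> carrier (K 0)}"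
  then obtain u where u: "u \<in> {..<d} \<rightarrow> carrier (K 0)" "z = T.expand (\<lambda>k. \<phi>0 (u k))" by blast
  then have "z = \<phi> (B.C.expand u)" using phi_expand[OF u(1)] by simp
  then show "z \<in> \<phi> ` carrier B" using B.C.expand_closed[OF u(1)] by blast
qed

lemma phi_inj: "inj_on \<phi> (carrier B)"
proof (rule phi.inj_onI)
  fix b assume b: "b \<in> carrier B" "\<phi> b = \<zero>"
  obtain u where u: "u \<in> {..<d} \<rightarrow> carrier (K 0)" "b = B.C.expand u" using B.C.span[OF b(1)] by blast
  have "u k = \<zero>\<^bsub>K 0\<^esub>" if k: "k < d" for k
  proof -
    have "\<phi>0 (u k) = \<zero>\<^bsub>E\<^esub>"
      using T_indep[OF phi0_Pi[OF u(1)] _ k] b(2) phi_expand[OF u(1)] u(2) by simp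
    then show ?thesis using phi0_inj[of "u k"] Pi_mem[OF u(1), of k] k by simp
  qed
  then have "b = B.C.expand (\<lambda>k. \<zero>\<^bsub>K 0\<^esub>)" unfolding u(2) using u(1) by (intro B.C.expand_cong) auto
  then show "b = \<zero>\<^bsub>B\<^esub>" by (simp add: B.C.expand_def del: corner_simps)
qed

end

section \<open>The components of EE and their permutation by x\<close>

context split_cyclic begin

text \<open>\<open>S j\<close> is the algebra EE' \<open>e_j\<close> inside EE, and \<open>P\<close>
  is the algebra of all polynomials in \<open>x^m\<close> over E; \<open>direct_product\<close>
  shows that \<open>P\<close> is the product of the \<open>S j\<close>.\<close>

definition S :: "nat => 'b set" where "S j = (\<lambda>y. y \<otimes> \<iota> (e j)) ` (\<phi> ` carrier B)"
definition P :: "'b set" where "P = {T.expand w | w. w \<in> {..<d} \<rightarrow> carrier E}"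

lemma KD: "u \<in> carrier (K j) ==> j < m ==> u \<in> carrier E" "u \<in> carrier (K j) ==> j < m ==> u \<otimes>\<^bsub>E\<^esub> e j = u"
  by (simp_all add: K_algebra)

lemma K_Pi: "w \<in> {..<d} \<rightarrow> carrier (K j) ==> j < m ==> w \<in> {..<d} \<rightarrow> carrier E"
  using KD(1) by (auto simp: Pi_iff)

lemma T_e: "w \<in> {..<d} \<rightarrow> carrier E ==> j < m ==> T.expand w \<otimes> \<iota> (e j) = T.expand (\<lambda>k. w k \<otimes>\<^bsub>E\<^esub> e j)"
  by (rule T_iota) (simp_all add: aut_m_e)

lemma T_e_comm:
  assumes w: "w \<in> {..<d} \<rightarrow> carrier E" and j: "j < m"
  shows "T.expand w \<otimes> \<iota> (e j) = \<iota> (e j) \<otimes> T.expand w"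
proof -
  have "T.expand (\<lambda>k. w k \<otimes>\<^bsub>E\<^esub> e j) = T.expand (\<lambda>k. e j \<otimes>\<^bsub>E\<^esub> w k)"
  proof (rule T.expand_cong)
    show "w k \<otimes>\<^bsub>E\<^esub> e j = e j \<otimes>\<^bsub>E\<^esub> w k" if "k < d" for k
      using Pi_mem[OF w, of k] that j by (intro comm) simp_all
  qed (use w j in \<open>simp add: Pi_iff\<close>)
  then show ?thesis
    unfolding T_e[OF w j] using T.expand_left_mult[OF w e_closed[OF j]] by simp
qed

lemma phi_in_T:
  assumes "b \<in> carrier B"
  obtains u where "u \<in> {..<d} \<rightarrow> carrier (K 0)" "b = B.C.expand u" "\<phi> b = T.expand (\<lambda>k. \<phi>0 (u k))"
  using B.C.span[OF assms] phi_expand by blast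

lemma theta_expand:
  assumes u: "u \<in> {..<d} \<rightarrow> carrier (K 0)" and j: "j < m"
  shows "\<phi> (B.C.expand u) \<otimes> \<iota> (e j) = T.expand (\<lambda>k. \<rho> j (u k))"
  unfolding phi_expand[OF u] T_e[OF phi0_Pi[OF u] j]
proof (rule T.expand_cong)
  show "\<phi>0 (u k) \<otimes>\<^bsub>E\<^esub> e j = \<rho> j (u k)" if "k < d" for k
    using Pi_mem[OF u, of k] that by (intro phi0_e j) simp
  show "(\<lambda>k. \<phi>0 (u k) \<otimes>\<^bsub>E\<^esub> e j) \<in> {..<d} \<rightarrow> carrier E"
    using phi0_Pi[OF u] j by (simp add: Pi_iff)
qed

text \<open>Multiplying by \<open>e_j\<close> replaces each coefficient \<open>\<phi>0 u\<close> by
  \<open>\<rho> j u\<close>, and \<open>\<rho> j\<close> maps \<open>E e_0\<close> onto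
  \<open>E e_j\<close>, so all polynomials in \<open>x^m\<close> over \<open>E e_j\<close>
  occur.\<close>

lemma S_eq:
  assumes j: "j < m"
  shows "S j = {T.expand w | w. w \<in> {..<d} \<rightarrow> carrier (K j)}"
proof (intro equalityI subsetI)
  fix z assume "z \<in> S j"
  then obtain b where b: "b \<in> carrier B" "z = \<phi> b \<otimes> \<iota> (e j)" unfolding S_def by blast
  obtain u where u: "u \<in> {..<d} \<rightarrow> carrier (K 0)" "b = B.C.expand u" using B.C.span[OF b(1)] by blast
  have "z = T.expand (\<lambda>k. \<rho> j (u k))" using theta_expand[OF u(1) j] b u by simp
  moreover have "(\<lambda>k. \<rho> j (u k)) \<in> {..<d} \<rightarrow> carrier (K j)" using rho_in_K[OF _ j] u(1) by (simp add: Pi_iff)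
  ultimately show "z \<in> {T.expand w | w. w \<in> {..<d} \<rightarrow> carrier (K j)}" by blast
next
  fix z assume "z \<in> {T.expand w | w. w \<in> {..<d} \<rightarrow> carrier (K j)}"
  then obtain w where w: "w \<in> {..<d} \<rightarrow> carrier (K j)" "z = T.expand w" by blast
  have "\<exists>u. k < d \<longrightarrow> u \<in> carrier (K 0) \<and> w k = \<rho> j u" for k
  proof (cases "k < d")
    case True
    then have "w k \<in> carrier (K j)" using Pi_mem[OF w(1), of k] by simp
    then have "w k \<in> \<rho> j ` carrier (K 0)" using alg_isoD(2)[OF rho_iso[OF j]] by (simp add: bij_betw_def)
    then show ?thesis by blast
  qed simp
  then have "\<forall>k. \<exists>u. k < d \<longrightarrow> u \<in> carrier (K 0) \<and> w k = \<rho> j u" by blast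
  from choice[OF this] obtain u where u: "\<forall>k. k < d \<longrightarrow> u k \<in> carrier (K 0) \<and> w k = \<rho> j (u k)" ..
  have uK: "u \<in> {..<d} \<rightarrow> carrier (K 0)" using u by (intro Pi_I) simp
  have "z = T.expand (\<lambda>k. \<rho> j (u k))"
    unfolding w(2) by (rule T.expand_cong[OF _ K_Pi[OF w(1) j]]) (use u in blast)
  then have "z = \<phi> (B.C.expand u) \<otimes> \<iota> (e j)" using theta_expand[OF uK j] by simp
  then show "z \<in> S j" unfolding S_def using B.C.expand_closed[OF uK] by blast
qed

lemma phi_e_comm: "b \<in> carrier B ==> j < m ==> \<phi> b \<otimes> \<iota> (e j) = \<iota> (e j) \<otimes> \<phi> b"
  using phi_in_T[of b] T_e_comm[OF phi0_Pi] by metis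

lemma iota_e_mult: "i < m ==> j < m ==> \<iota> (e i) \<otimes> \<iota> (e j) = (if i = j then \<iota> (e j) else \<zero>)"
  using C.f.hom_simps(2)[of "e i" "e j"] e_mult[of i j] C.f.zero by (simp split: if_splits)

lemma theta_mult:
  assumes b: "b \<in> carrier B" "b' \<in> carrier B" and ij: "i < m" "j < m"
  shows "(\<phi> b \<otimes> \<iota> (e i)) \<otimes> (\<phi> b' \<otimes> \<iota> (e j)) = (if i = j then \<phi> (b \<otimes>\<^bsub>B\<^esub> b') \<otimes> \<iota> (e j) else \<zero>)"
proof -
  have "(\<phi> b \<otimes> \<iota> (e i)) \<otimes> (\<phi> b' \<otimes> \<iota> (e j)) = \<phi> b \<otimes> (\<iota> (e i) \<otimes> \<phi> b') \<otimes> \<iota> (e j)"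
    using b ij by (simp add: C.A.m_assoc)
  also have "\<dots> = (\<phi> b \<otimes> \<phi> b') \<otimes> (\<iota> (e i) \<otimes> \<iota> (e j))"
    unfolding phi_e_comm[OF b(2) ij(1), symmetric] using b ij by (simp add: C.A.m_assoc)
  finally show ?thesis using b ij by (simp add: iota_e_mult)
qed

abbreviation "SA j \<equiv> C\<lparr>carrier := S j, one := \<iota> (e j)\<rparr>"

text \<open>The algebra axioms of the component are transported along
  \<open>b \<mapsto> \<phi> b e_j\<close>, which is multiplicative because \<open>e_j\<close> is an
  idempotent commuting with the image of \<open>\<phi>\<close>. For injectivity, the coefficients
  \<open>\<rho> j u\<close> vanish by \<open>T_indep\<close>, and the j-th power of
  \<open>\<sigma>\<close> recovers \<open>u\<close> from them.\<close>

lemma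
  assumes j: "j < m"
  shows S_algebra: "assoc_algebra F (SA j)"
    and theta_iso: "(\<lambda>b. \<phi> b \<otimes> \<iota> (e j)) \<in> alg_iso F B (SA j)"
proof -
  let ?\<theta> = "\<lambda>b. \<phi> b \<otimes> \<iota> (e j)"
  have img: "?\<theta> ` carrier B = carrier (SA j)" by (auto simp: S_def)
  have add: "?\<theta> (b \<oplus>\<^bsub>B\<^esub> b') = ?\<theta> b \<oplus>\<^bsub>SA j\<^esub> ?\<theta> b'" if "b \<in> carrier B" "b' \<in> carrier B" for b b'
    using that j by (simp add: C.A.l_distr)
  have mult: "?\<theta> (b \<otimes>\<^bsub>B\<^esub> b') = ?\<theta> b \<otimes>\<^bsub>SA j\<^esub> ?\<theta> b'" if "b \<in> carrier B" "b' \<in> carrier B" for b b'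
    using theta_mult[OF that j j] by simp
  have smult: "?\<theta> (c \<odot>\<^bsub>B\<^esub> b) = c \<odot>\<^bsub>SA j\<^esub> ?\<theta> b" if "c \<in> carrier F" "b \<in> carrier B" for c b
    using that j by (simp add: C.A.smult_mult_left)
  have one: "?\<theta> \<one>\<^bsub>B\<^esub> = \<one>\<^bsub>SA j\<^esub>" using j by simp
  have zero: "?\<theta> \<zero>\<^bsub>B\<^esub> = \<zero>\<^bsub>SA j\<^esub>" using j by simp
  show alg: "assoc_algebra F (SA j)"
    by (rule assoc_algebra_image[OF B.C.A.assoc_algebra_axioms img add mult smult one zero])
  have hom: "?\<theta> \<in> alg_hom F B (SA j)"
    by (rule alg_homI) (use img add mult smult one in blast)+
  interpret th: alg_homomorphism F B "SA j" ?\<theta>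
    by (intro alg_homomorphism.intro alg_homomorphism_axioms.intro B.C.A.assoc_algebra_axioms alg hom)
  have "inj_on ?\<theta> (carrier B)"
  proof (rule th.inj_onI)
    fix b assume b: "b \<in> carrier B" "?\<theta> b = \<zero>\<^bsub>SA j\<^esub>"
    obtain u where u: "u \<in> {..<d} \<rightarrow> carrier (K 0)" "b = B.C.expand u" using B.C.span[OF b(1)] by blast
    have z: "T.expand (\<lambda>k. \<rho> j (u k)) = \<zero>" using theta_expand[OF u(1) j] b(2) u(2) by simp
    have cl: "(\<lambda>k. \<rho> j (u k)) \<in> {..<d} \<rightarrow> carrier E" using u(1) K0D(1) by (simp add: Pi_iff)
    have "u k = \<zero>\<^bsub>K 0\<^esub>" if k: "k < d" for k
    proof -
      have uk: "u k \<in> carrier E" using Pi_mem[OF u(1), of k] k K0D(1) by simp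
      have "u k = (\<sigma> ^^ j) (\<rho> j (u k))" by (rule rho_inv(1)[OF uk, symmetric])
      also have "\<dots> = \<zero>\<^bsub>E\<^esub>" unfolding T_indep[OF cl z k] by (rule alg_homomorphism.zero[OF aut_pow])
      finally show ?thesis by simp
    qed
    then have "b = B.C.expand (\<lambda>k. \<zero>\<^bsub>K 0\<^esub>)" unfolding u(2) using u(1) by (intro B.C.expand_cong) auto
    then show "b = \<zero>\<^bsub>B\<^esub>" by (simp add: B.C.expand_def del: corner_simps)
  qed
  then show "?\<theta> \<in> alg_iso F B (SA j)" using hom img by (intro alg_isoI) auto
qed

lemma aut_m_d: "u \<in> carrier E ==> ((\<sigma> ^^ m) ^^ d) u = u"
  using aut_order[of u] by (simp add: funpow_mult n mult.commute)

lemma S_isomorphic: "j < m ==> alg_isomorphic F (SA j) B"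
  using alg_isomorphic_sym[OF B.C.A.assoc_algebra_axioms] theta_iso unfolding alg_isomorphic_def by blast

text \<open>The presentation of EE' is carried to the component by \<open>theta_iso\<close>, and
  then its base is renamed from \<open>E e_0\<close> to \<open>E e_j\<close> by
  \<open>\<rho> j\<close>.\<close>

lemma S_skew_quot:
  assumes j: "j < m"
  shows "is_skew_quot F (SA j) (K j) \<iota> (x [^] m \<otimes> \<iota> (e j)) (\<sigma> ^^ m) d (a \<odot>\<^bsub>E\<^esub> e j)"
proof (rule is_skew_quotI)
  have "skew_pres F (K j) (SA j) \<iota> (\<phi> t \<otimes> \<iota> (e j)) (\<sigma> ^^ m) d (a \<odot>\<^bsub>E\<^esub> e j)"
  proof (rule skew_pres_base[OF skew_pres_transport[OF B.C.skew_pres_axioms theta_iso[OF j] S_algebra[OF j]]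
        rho_iso[OF j] K_algebra(2)[OF j]])
    show "(\<sigma> ^^ m) (\<rho> j u) = \<rho> j ((\<sigma> ^^ m) u)" if "u \<in> carrier (K 0)" for u by (rule rho_aut[symmetric])
    show "\<iota> (\<rho> j u) = \<phi> (\<kappa> u) \<otimes> \<iota> (e j)" if "u \<in> carrier (K 0)" for u
      using C.f.hom_simps(2)[of "\<phi>0 u" "e j"] phi0_e[OF that j] K0D(1)[OF that] j L.lift_const[OF that] by simp
    show "a \<odot>\<^bsub>E\<^esub> e j = \<rho> j (a \<odot>\<^bsub>K 0\<^esub> \<one>\<^bsub>K 0\<^esub>)"
      using alg_homD(5)[OF rho_hom a_closed e_closed[OF dm(2)], of j] rho_e[OF j] by simp
  qed
  then show "skew_pres F (K j) (SA j) \<iota> (x [^] m \<otimes> \<iota> (e j)) (\<sigma> ^^ m) d (a \<odot>\<^bsub>E\<^esub> e j)"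
    unfolding L.lift_gen .
  show "(\<sigma> ^^ m) (a \<odot>\<^bsub>E\<^esub> e j) = a \<odot>\<^bsub>E\<^esub> e j"
    using alg_homD(5)[OF aut_pow_hom[of m] a_closed e_closed[OF j]] aut_m_e[OF j] by simp
  show "(a \<odot>\<^bsub>E\<^esub> e j) \<otimes>\<^bsub>K j\<^esub> u = u \<otimes>\<^bsub>K j\<^esub> (a \<odot>\<^bsub>E\<^esub> e j)" if "u \<in> carrier (K j)" for u
    unfolding corner_simps by (rule comm) (use KD(1)[OF that j] j in simp_all)
qed (use KD(1)[OF _ j] aut_m_d in blast)

lemma phi_iso: "\<phi> \<in> alg_iso F B (C\<lparr>carrier := \<phi> ` carrier B\<rparr>)"
  by (rule alg_isoI) (auto intro!: alg_homI simp: phi_inj)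

lemma phi_skew_quot:
  "is_skew_quot F (C\<lparr>carrier := \<phi> ` carrier B\<rparr>) (E\<lparr>carrier := \<phi>0 ` carrier (K 0)\<rparr>) \<iota> (x [^] m) (\<sigma> ^^ m) d (a \<odot>\<^bsub>E\<^esub> \<one>\<^bsub>E\<^esub>)"
proof (rule is_skew_quotI)
  interpret p0: alg_homomorphism F "K 0" E \<phi>0
    by (intro alg_homomorphism.intro alg_homomorphism_axioms.intro K_algebra(2) dm A.assoc_algebra_axioms phi0_hom)
  have inj: "inj_on \<phi>0 (carrier (K 0))" by (rule p0.inj_onI) (simp add: phi0_inj)
  have iso: "\<phi>0 \<in> alg_iso F (K 0) (E\<lparr>carrier := \<phi>0 ` carrier (K 0)\<rparr>)"
    by (rule alg_isoI[OF _ inj]) (use alg_homD[OF phi0_hom] in \<open>auto intro!: alg_homI simp del: corner_simps\<close>)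
  have "skew_pres F (E\<lparr>carrier := \<phi>0 ` carrier (K 0)\<rparr>) (C\<lparr>carrier := \<phi> ` carrier B\<rparr>) \<iota> (\<phi> t) (\<sigma> ^^ m) d (a \<odot>\<^bsub>E\<^esub> \<one>\<^bsub>E\<^esub>)"
  proof (rule skew_pres_base[OF skew_pres_transport[OF B.C.skew_pres_axioms phi_iso phi.image_algebra] iso p0.image_algebra])
    show "(\<sigma> ^^ m) (\<phi>0 u) = \<phi>0 ((\<sigma> ^^ m) u)" if "u \<in> carrier (K 0)" for u by (rule phi0_aut[OF K0D(1)[OF that]])
    show "\<iota> (\<phi>0 u) = \<phi> (\<kappa> u)" if "u \<in> carrier (K 0)" for u using L.lift_const[OF that] by simp
    show "a \<odot>\<^bsub>E\<^esub> \<one>\<^bsub>E\<^esub> = \<phi>0 (a \<odot>\<^bsub>K 0\<^esub> \<one>\<^bsub>K 0\<^esub>)"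
      using alg_homD(4,5)[OF phi0_hom] B.A.one_closed a_closed by metis
  qed
  then show "skew_pres F (E\<lparr>carrier := \<phi>0 ` carrier (K 0)\<rparr>) (C\<lparr>carrier := \<phi> ` carrier B\<rparr>) \<iota> (x [^] m) (\<sigma> ^^ m) d (a \<odot>\<^bsub>E\<^esub> \<one>\<^bsub>E\<^esub>)"
    unfolding L.lift_gen .
  show "(\<sigma> ^^ m) (a \<odot>\<^bsub>E\<^esub> \<one>\<^bsub>E\<^esub>) = a \<odot>\<^bsub>E\<^esub> \<one>\<^bsub>E\<^esub>"
    using alg_homD(4,5)[OF aut_pow_hom[of m]] A.one_closed a_closed by metis
next
  have sub: "u \<in> carrier E" if "u \<in> carrier (E\<lparr>carrier := \<phi>0 ` carrier (K 0)\<rparr>)" for u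
    using that K0D(1) phi0_closed by auto
  show "(a \<odot>\<^bsub>E\<^esub> \<one>\<^bsub>E\<^esub>) \<otimes>\<^bsub>E\<lparr>carrier := \<phi>0 ` carrier (K 0)\<rparr>\<^esub> u = u \<otimes>\<^bsub>E\<lparr>carrier := \<phi>0 ` carrier (K 0)\<rparr>\<^esub> (a \<odot>\<^bsub>E\<^esub> \<one>\<^bsub>E\<^esub>)"
    if "u \<in> carrier (E\<lparr>carrier := \<phi>0 ` carrier (K 0)\<rparr>)" for u
    using comm[of "a \<odot>\<^bsub>E\<^esub> \<one>\<^bsub>E\<^esub>" u] sub[OF that] by simp
  show "((\<sigma> ^^ m) ^^ d) u = u" if "u \<in> carrier (E\<lparr>carrier := \<phi>0 ` carrier (K 0)\<rparr>)" for u
    by (rule aut_m_d[OF sub[OF that]])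
qed

lemma phi_direct_sum:
  "internal_direct_sum C {..<d} (\<lambda>k. {\<iota> u \<otimes> x [^] (k * m) | u. u \<in> \<phi>0 ` carrier (K 0)}) (\<phi> ` carrier B)"
proof -
  have ex: "L.B.expand u = T.expand (\<lambda>k. \<phi>0 (u k))" for u by (simp add: L.B.expand_def T.expand_def)
  have "internal_direct_sum C {..<d} (\<lambda>k. {\<iota> (\<phi>0 u) \<otimes> (x [^] m) [^] k | u. u \<in> carrier (K 0)})
      {L.B.expand u | u. u \<in> {..<d} \<rightarrow> carrier (K 0)}"
  proof (rule L.B.direct_sum)
    fix u k assume u: "u \<in> {..<d} \<rightarrow> carrier (K 0)" and 0: "L.B.expand u = \<zero>" and k: "k < d"
    have "\<phi>0 (u k) = \<zero>\<^bsub>E\<^esub>" by (rule T_indep[OF phi0_Pi[OF u] _ k]) (use 0 ex in simp)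
    then show "u k = \<zero>\<^bsub>K 0\<^esub>" using phi0_inj[of "u k"] Pi_mem[OF u, of k] k by simp
  qed
  moreover have "{\<iota> (\<phi>0 u) \<otimes> (x [^] m) [^] k | u. u \<in> carrier (K 0)} =
      {\<iota> u \<otimes> x [^] (k * m) | u. u \<in> \<phi>0 ` carrier (K 0)}" for k :: nat
    by (simp add: C.A.nat_pow_pow mult.commute) blast
  ultimately show ?thesis unfolding phi_image ex by simp
qed

lemma C_nontrivial: "\<one> \<noteq> \<zero>"
proof
  assume "\<one> = \<zero>"
  then have "\<iota> \<one>\<^bsub>E\<^esub> = \<iota> \<zero>\<^bsub>E\<^esub>" using C.f.hom_simps(4) C.f.zero by simp
  then have "\<one>\<^bsub>E\<^esub> = \<zero>\<^bsub>E\<^esub>" by (rule inj_onD[OF C.f_inj]) simp_all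
  then show False using nontrivial by simp
qed

sublocale CF: field_algebra F C
  by (intro field_algebra.intro field_algebra_axioms.intro F.field_axioms C.A.assoc_algebra_axioms C_nontrivial)

lemma x_pow_n: "x [^] n = a \<odot> \<one>" using C.pow by simp

lemmas x_unit = CF.root_of_scalar_unit[OF C.y x_pow_n d a_closed a0]

text \<open>Conjugation by \<open>x\<close> applies \<open>\<sigma>\<close> to the coefficients of a
  polynomial in \<open>x^m\<close>, and \<open>\<sigma>\<close> carries \<open>E e_j\<close> into
  the preceding corner. Every element there is reached by applying \<open>\<rho> 1\<close>
  first.\<close>

lemma x_conj:
  assumes j: "j < m"
  shows "(\<lambda>u. x \<otimes> u \<otimes> inv x) ` S j = S ((j + m - 1) mod m)"
proof -
  let ?i = "(j + m - 1) mod m"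
  have i: "?i < m" using dm by simp
  have conj: "x \<otimes> T.expand w \<otimes> inv x = T.expand (\<lambda>l. \<sigma> (w l))" if w: "w \<in> {..<d} \<rightarrow> carrier E" for w
  proof -
    have cl: "T.expand (\<lambda>l. \<sigma> (w l)) \<in> carrier C" using w by (intro T.expand_closed) (simp add: Pi_iff)
    have "x \<otimes> T.expand w = T.expand (\<lambda>l. \<sigma> (w l)) \<otimes> x" using x_pow_T[OF w, of 1] by simp
    then show ?thesis using cl C.A.Units_inv_closed[OF x_unit(4)] C.A.Units_r_inv[OF x_unit(4)]
      by (simp add: C.A.m_assoc)
  qed
  show ?thesis
  proof (intro equalityI subsetI)
    fix z assume "z \<in> (\<lambda>u. x \<otimes> u \<otimes> inv x) ` S j"
    then obtain w where w: "w \<in> {..<d} \<rightarrow> carrier (K j)" "z = x \<otimes> T.expand w \<otimes> inv x"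
      unfolding S_eq[OF j] by blast
    have "\<sigma> (w l) \<in> carrier (K ?i)" if "l < d" for l
    proof -
      have wl: "w l \<in> carrier E" "w l \<otimes>\<^bsub>E\<^esub> e j = w l" using Pi_mem[OF w(1), of l] that KD[OF _ j] by simp_all
      have "\<sigma> (w l) \<otimes>\<^bsub>E\<^esub> e ?i = \<sigma> (w l \<otimes>\<^bsub>E\<^esub> e j)"
        using sg.hom_simps(2)[OF wl(1) e_closed[OF j]] aut_e_mod[OF j] by simp
      then show ?thesis unfolding K_algebra(1)[OF i] using wl by simp
    qed
    then show "z \<in> S ?i" unfolding S_eq[OF i] w(2) conj[OF K_Pi[OF w(1) j]]
      by (intro CollectI exI[of _ "\<lambda>l. \<sigma> (w l)"]) simp
  next
    fix z assume "z \<in> S ?i"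
    then obtain w where w: "w \<in> {..<d} \<rightarrow> carrier (K ?i)" "z = T.expand w" unfolding S_eq[OF i] by blast
    have w': "\<rho> 1 (w l) \<in> carrier (K j)" if "l < d" for l
    proof -
      have wl: "w l \<in> carrier E" "w l \<otimes>\<^bsub>E\<^esub> e ?i = w l" using Pi_mem[OF w(1), of l] that KD[OF _ i] by simp_all
      have "\<rho> 1 (e ?i) = e j" using rho_inv(2)[OF e_closed[OF j], of 1] aut_e_mod[OF j] by simp
      then have "\<rho> 1 (w l) \<otimes>\<^bsub>E\<^esub> e j = \<rho> 1 (w l \<otimes>\<^bsub>E\<^esub> e ?i)"
        using alg_homD(2)[OF rho_hom[of 1] wl(1) e_closed[OF i]] by simp
      then show ?thesis using wl by (simp add: K_algebra[OF j])
    qed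
    have w'K: "(\<lambda>l. \<rho> 1 (w l)) \<in> {..<d} \<rightarrow> carrier (K j)" using w' by simp
    have "T.expand (\<lambda>l. \<sigma> (\<rho> 1 (w l))) = T.expand w"
    proof (rule T.expand_cong[symmetric, OF _ K_Pi[OF w(1) i]])
      show "w l = \<sigma> (\<rho> 1 (w l))" if "l < d" for l
        using rho_inv(1)[of "w l" 1] KD(1)[OF _ i, of "w l"] Pi_mem[OF w(1), of l] that by simp
    qed
    then have "z = x \<otimes> T.expand (\<lambda>l. \<rho> 1 (w l)) \<otimes> inv x"
      unfolding w(2) conj[OF K_Pi[OF w'K j]] by simp
    then show "z \<in> (\<lambda>u. x \<otimes> u \<otimes> inv x) ` S j"
      unfolding S_eq[OF j] using w'K by blast
  qed
qed

lemma P_closed: "z \<in> P ==> z \<in> carrier C" unfolding P_def by auto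

lemma P_subgroup:
  shows "\<zero> \<in> P" "z \<in> P ==> z' \<in> P ==> z \<oplus> z' \<in> P" "c \<in> carrier F ==> z \<in> P ==> c \<odot> z \<in> P"
proof -
  have "\<zero> = T.expand (\<lambda>_. \<zero>\<^bsub>E\<^esub>)" by (simp add: T.expand_def)
  then show "\<zero> \<in> P" unfolding P_def by (intro CollectI exI[of _ "\<lambda>_. \<zero>\<^bsub>E\<^esub>"]) simp
next
  assume "z \<in> P" "z' \<in> P"
  then obtain w w' where w: "w \<in> {..<d} \<rightarrow> carrier E" "w' \<in> {..<d} \<rightarrow> carrier E" "z = T.expand w" "z' = T.expand w'"
    unfolding P_def by blast
  then show "z \<oplus> z' \<in> P"
    unfolding P_def using T.expand_add[OF w(1,2)]
    by (intro CollectI exI[of _ "\<lambda>k. w k \<oplus>\<^bsub>E\<^esub> w' k"]) (simp add: Pi_iff)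
next
  assume c: "c \<in> carrier F" and "z \<in> P"
  then obtain w where w: "w \<in> {..<d} \<rightarrow> carrier E" "z = T.expand w" unfolding P_def by blast
  then show "c \<odot> z \<in> P"
    unfolding P_def using T.expand_smult[OF w(1) c] c
    by (intro CollectI exI[of _ "\<lambda>k. c \<odot>\<^bsub>E\<^esub> w k"]) (simp add: Pi_iff)
qed

lemma P_finsum: "finite I ==> f \<in> I \<rightarrow> P ==> (\<Oplus>i\<in>I. f i) \<in> P"
proof (induction I rule: finite_induct)
  case (insert i I)
  then show ?case using P_subgroup(2) P_closed by (simp add: Pi_iff)
qed (use P_subgroup(1) in simp)

lemma S_P: "j < m ==> S j \<subseteq> P"
  unfolding S_eq P_def using K_Pi by blast

lemma S_e: "i < m ==> j < m ==> z \<in> S i ==> z \<otimes> \<iota> (e j) = (if i = j then z else \<zero>)"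
proof -
  assume ij: "i < m" "j < m" and "z \<in> S i"
  then obtain b where b: "b \<in> carrier B" "z = \<phi> b \<otimes> \<iota> (e i)" unfolding S_def by blast
  then show ?thesis using ij by (simp add: C.A.m_assoc iota_e_mult)
qed

text \<open>Multiplication by \<open>e_j\<close> picks the j-th summand out of a sum, which gives
  independence; the sum of the \<open>e_j\<close> being 1 gives spanning, and orthogonality gives
  the zero products.\<close>

lemma direct_product: "internal_direct_product C {..<m} S P"
  unfolding internal_direct_product_def
proof (intro conjI ballI impI)
  fix i j y z assume ij: "i \<in> {..<m}" "j \<in> {..<m}" "i \<noteq> j" and yz: "y \<in> S i" "z \<in> S j"
  then obtain b b' where b: "b \<in> carrier B" "b' \<in> carrier B" "y = \<phi> b \<otimes> \<iota> (e i)" "z = \<phi> b' \<otimes> \<iota> (e j)"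
    unfolding S_def by blast
  then show "y \<otimes> z = \<zero>" using theta_mult[OF b(1,2)] ij by simp
next
  fix i y z assume i: "i \<in> {..<m}" and yz: "y \<in> S i" "z \<in> S i"
  then obtain b b' where b: "b \<in> carrier B" "b' \<in> carrier B" "y = \<phi> b \<otimes> \<iota> (e i)" "z = \<phi> b' \<otimes> \<iota> (e i)"
    unfolding S_def by blast
  then have "y \<otimes> z = \<phi> (b \<otimes>\<^bsub>B\<^esub> b') \<otimes> \<iota> (e i)" using theta_mult[OF b(1,2)] i by simp
  then show "y \<otimes> z \<in> S i" unfolding S_def using b(1,2) by blast
next
  show "internal_direct_sum C {..<m} S P"
  proof (rule C.A.M.direct_sumI)
    fix j assume "j \<in> {..<m}"
    then have j: "j < m" by simp
    interpret SA: assoc_algebra F "SA j" by (rule S_algebra[OF j])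
    show "additive_subgroup (S j) C"
      by (rule C.A.additive_subgroupI)
        (use S_P[OF j] P_closed SA.zero_closed SA.a_closed SA.smult_closed in \<open>auto simp: subset_eq\<close>)
  next
    show "P = {\<Oplus>j\<in>{..<m}. u j | u. u \<in> Pi {..<m} S}"
    proof (intro equalityI subsetI)
      fix z assume "z \<in> P"
      then obtain w where w: "w \<in> {..<d} \<rightarrow> carrier E" "z = T.expand w" unfolding P_def by blast
      have zS: "z \<otimes> \<iota> (e j) \<in> S j" if j: "j < m" for j
      proof -
        have "w k \<otimes>\<^bsub>E\<^esub> e j \<in> carrier (K j)" if "k < d" for k
          using alg_homD(1)[OF K_algebra(3)[OF j]] Pi_mem[OF w(1), of k] that by simp
        then show ?thesis unfolding S_eq[OF j] w(2) T_e[OF w(1) j]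
          by (intro CollectI exI[of _ "\<lambda>k. w k \<otimes>\<^bsub>E\<^esub> e j"]) simp
      qed
      have zc: "z \<in> carrier C" using w by simp
      have "(\<Oplus>j\<in>{..<m}. \<iota> (e j)) = \<iota> (\<Oplus>\<^bsub>E\<^esub>j\<in>{..<m}. e j)" by (rule C.f.finsum[symmetric]) simp
      then have "z = z \<otimes> (\<Oplus>j\<in>{..<m}. \<iota> (e j))" using zc by (simp add: e_sum)
      also have "\<dots> = (\<Oplus>j\<in>{..<m}. z \<otimes> \<iota> (e j))" using zc by (intro C.A.mult_finsum) auto
      finally show "z \<in> {\<Oplus>j\<in>{..<m}. u j | u. u \<in> Pi {..<m} S}"
        using zS by (intro CollectI exI[of _ "\<lambda>j. z \<otimes> \<iota> (e j)"]) simp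
    next
      fix z assume "z \<in> {\<Oplus>j\<in>{..<m}. u j | u. u \<in> Pi {..<m} S}"
      then obtain u where u: "u \<in> Pi {..<m} S" "z = (\<Oplus>j\<in>{..<m}. u j)" by blast
      show "z \<in> P" unfolding u(2) by (rule P_finsum) (use u(1) S_P in \<open>auto simp: Pi_iff\<close>)
    qed
  next
    fix u j assume u: "u \<in> Pi {..<m} S" and 0: "(\<Oplus>i\<in>{..<m}. u i) = \<zero>" and j: "j \<in> {..<m}"
    have ui: "u i \<in> S i" "u i \<in> carrier C" if "i < m" for i
      using Pi_mem[OF u, of i] S_P[OF that] P_closed that by auto
    have "(\<Oplus>i\<in>{..<m}. u i) \<otimes> \<iota> (e j) = (\<Oplus>i\<in>{..<m}. u i \<otimes> \<iota> (e j))"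
      using ui j by (intro C.A.finsum_mult) auto
    also have "\<dots> = (\<Oplus>i\<in>{..<m}. if i = j then u j else \<zero>)"
      using ui j S_e by (intro C.A.M.finsum_cong') auto
    also have "\<dots> = u j" using j ui by (intro C.A.finsum_delta) auto
    finally show "u j = \<zero>" unfolding 0 using j by simp
  qed
qed

lemma direct_sum_P: "internal_direct_sum C {..<m} (\<lambda>i. {y \<otimes> x [^] i | y. y \<in> P}) (carrier C)"
proof (rule C.A.M.direct_sumI)
  let ?Q = "\<lambda>i. {y \<otimes> x [^] (i::nat) | y. y \<in> P}"
  have choose: "\<exists>w. (\<forall>i<m. w i \<in> {..<d} \<rightarrow> carrier E \<and> u i = T.expand (w i) \<otimes> x [^] i)"
    if u: "u \<in> Pi {..<m} ?Q" for u
  proof -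
    have "\<exists>w. i < m \<longrightarrow> w \<in> {..<d} \<rightarrow> carrier E \<and> u i = T.expand w \<otimes> x [^] i" for i
    proof (cases "i < m")
      case True
      then have "u i \<in> ?Q i" using Pi_mem[OF u, of i] by simp
      then show ?thesis unfolding P_def by blast
    qed simp
    then have "\<forall>i. \<exists>w. i < m \<longrightarrow> w \<in> {..<d} \<rightarrow> carrier E \<and> u i = T.expand w \<otimes> x [^] i" by blast
    from choice[OF this] show ?thesis by blast
  qed
  show "additive_subgroup (?Q i) C" for i
  proof (rule C.A.additive_subgroupI)
    show "?Q i \<subseteq> carrier C" using P_closed by auto
    show "\<zero> \<in> ?Q i" using P_subgroup(1) by (intro CollectI exI[of _ "\<zero>"]) simp
  next
    fix z z' assume "z \<in> ?Q i" "z' \<in> ?Q i"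
    then obtain y y' where "y \<in> P" "y' \<in> P" "z = y \<otimes> x [^] i" "z' = y' \<otimes> x [^] i" by blast
    then show "z \<oplus> z' \<in> ?Q i" using P_subgroup(2) P_closed
      by (intro CollectI exI[of _ "y \<oplus> y'"]) (simp add: C.A.l_distr)
  next
    fix c z assume "c \<in> carrier F" "z \<in> ?Q i"
    then obtain y where "c \<in> carrier F" "y \<in> P" "z = y \<otimes> x [^] i" by blast
    then show "c \<odot> z \<in> ?Q i" using P_subgroup(3) P_closed
      by (intro CollectI exI[of _ "c \<odot> y"]) (simp add: C.A.smult_mult_left)
  qed
  show "carrier C = {\<Oplus>i\<in>{..<m}. u i | u. u \<in> Pi {..<m} ?Q}"
  proof (intro equalityI subsetI)
    fix z assume "z \<in> carrier C"
    then obtain v0 where v0: "v0 \<in> {..<n} \<rightarrow> carrier E" "z = C.expand v0" using C.span by blast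
    \<comment> \<open>Extended by zero so that \<open>C_decomp\<close>, which speaks of coefficients
      at all indices, can be used.\<close>
    define v where "v l = (if l < n then v0 l else \<zero>\<^bsub>E\<^esub>)" for l
    have v: "v l \<in> carrier E" for l using Pi_mem[OF v0(1), of l] by (simp add: v_def)
    have "C.expand v0 = C.expand v" by (rule C.expand_cong[OF _ v0(1)]) (simp add: v_def)
    then have "z = (\<Oplus>i\<in>{..<m}. T.expand (\<lambda>k. v (k * m + i)) \<otimes> x [^] i)"
      using v0(2) C_decomp[of v] v by simp
    moreover have "T.expand (\<lambda>k. v (k * m + i)) \<in> P" for i
      unfolding P_def using v by (intro CollectI exI[of _ "\<lambda>k. v (k * m + i)"]) simp
    ultimately show "z \<in> {\<Oplus>i\<in>{..<m}. u i | u. u \<in> Pi {..<m} ?Q}"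
      by (intro CollectI exI[of _ "\<lambda>i. T.expand (\<lambda>k. v (k * m + i)) \<otimes> x [^] i"]) blast
  next
    fix z assume "z \<in> {\<Oplus>i\<in>{..<m}. u i | u. u \<in> Pi {..<m} ?Q}"
    then obtain u where u: "u \<in> Pi {..<m} ?Q" "z = (\<Oplus>i\<in>{..<m}. u i)" by blast
    have "u i \<in> carrier C" if "i < m" for i
      using Pi_mem[OF u(1), of i] that P_closed by auto
    then show "z \<in> carrier C" unfolding u(2) by (intro C.A.M.finsum_closed) simp
  qed
  fix u i assume u: "u \<in> Pi {..<m} ?Q" and 0: "(\<Oplus>i\<in>{..<m}. u i) = \<zero>" and i: "i \<in> {..<m}"
  obtain w where w: "\<forall>i<m. w i \<in> {..<d} \<rightarrow> carrier E \<and> u i = T.expand (w i) \<otimes> x [^] i"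
    using choose[OF u] by blast
  have wi: "w i \<in> {..<d} \<rightarrow> carrier E" if "i < m" for i using w that by blast
  have "(\<Oplus>i\<in>{..<m}. u i) = (\<Oplus>i\<in>{..<m}. T.expand (w i) \<otimes> x [^] i)"
    by (rule C.A.M.finsum_cong') (use w in simp_all)
  then have z: "(\<Oplus>i\<in>{..<m}. T.expand (w i) \<otimes> x [^] i) = \<zero>" using 0 by simp
  have im: "i < m" using i by simp
  have "T.expand (w i) = T.expand (\<lambda>_. \<zero>\<^bsub>E\<^esub>)"
    by (rule T.expand_cong[OF _ wi[OF im]]) (rule T_sum_indep[OF wi z im])
  also have "\<dots> = \<zero>" by (simp add: T.expand_def)
  finally show "u i = \<zero>" using w im by simp
qed

end

section \<open>Matrix units over EE' and the centralizer\<close>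

context split_cyclic begin

definition x_inv where "x_inv = inv\<^bsub>F\<^esub> a \<odot> x [^] (n - 1)"

lemmas x_inv = x_unit(1,2,3)[folded x_inv_def]

text \<open>Stated with \<open>R.idem\<close> rather than \<open>e\<close>, since the idempotents
  have to lie in the carrier at every index and not only below \<open>m\<close>.\<close>

sublocale U: cyclic_idempotents F C m "\<lambda>j. \<iota> (R.idem j)" x x_inv
proof (intro cyclic_idempotents.intro cyclic_idempotents_axioms.intro C.A.assoc_algebra_axioms dm C.y x_inv)
  show "\<iota> (R.idem i) \<otimes> \<iota> (R.idem j) = (if i = j then \<iota> (R.idem j) else \<zero>)" if "i < m" "j < m" for i j
    using iota_e_mult[OF that] that by (simp add: e_idem)
  have "(\<Oplus>j\<in>{..<m}. \<iota> (R.idem j)) = \<iota> (\<Oplus>\<^bsub>E\<^esub>j\<in>{..<m}. R.idem j)" by (rule C.f.finsum[symmetric]) simp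
  then show "(\<Oplus>j\<in>{..<m}. \<iota> (R.idem j)) = \<one>" by (simp add: R.idem_sum)
  show "x \<otimes> \<iota> (R.idem (Suc j)) = \<iota> (R.idem j) \<otimes> x" for j
    using C.rel[of "R.idem (Suc j)"] by (simp add: aut_idem)
qed simp_all

lemma T_x_inv_pow:
  assumes w: "w \<in> {..<d} \<rightarrow> carrier E"
  shows "T.expand w \<otimes> x_inv [^] i = x_inv [^] i \<otimes> T.expand (\<lambda>l. (\<sigma> ^^ i) (w l))"
proof -
  let ?v = "T.expand (\<lambda>l. (\<sigma> ^^ i) (w l))"
  have cl: "?v \<in> carrier C" using w by (intro T.expand_closed) (simp add: Pi_iff)
  have yc: "x_inv [^] i \<in> carrier C" "x [^] i \<in> carrier C" using x_inv(1) by simp_all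
  note wc = T.expand_closed[OF w]
  have "T.expand w \<otimes> x_inv [^] i = (x_inv [^] i \<otimes> x [^] i) \<otimes> T.expand w \<otimes> x_inv [^] i"
    unfolding U.pow_st using wc by simp
  also have "\<dots> = x_inv [^] i \<otimes> (x [^] i \<otimes> T.expand w) \<otimes> x_inv [^] i"
    using wc yc by (simp only: C.A.m_assoc C.A.m_closed)
  also have "\<dots> = x_inv [^] i \<otimes> ?v \<otimes> (x [^] i \<otimes> x_inv [^] i)"
    unfolding x_pow_T[OF w] using cl yc by (simp only: C.A.m_assoc C.A.m_closed)
  also have "\<dots> = x_inv [^] i \<otimes> ?v" unfolding U.pow_ts using cl yc by (simp only: C.A.r_one C.A.m_closed)
  finally show ?thesis .
qed

text \<open>The \<open>e_0\<close> component of the j-th power of \<open>\<sigma>\<close> applied to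
  \<open>\<phi>0 u\<close> is the image of the \<open>e_j\<close> component of
  \<open>\<phi>0 u\<close>, that is, of \<open>\<rho> j u\<close>, and hence equals \<open>u\<close>
  for every \<open>j\<close>.\<close>

lemma T_aut_phi0:
  assumes u: "u \<in> {..<d} \<rightarrow> carrier (K 0)" and j: "j < m"
  shows "T.expand (\<lambda>k. (\<sigma> ^^ j) (\<phi>0 (u k))) \<otimes> \<iota> (e 0) = T.expand u"
    "\<iota> (e 0) \<otimes> T.expand (\<lambda>k. (\<sigma> ^^ j) (\<phi>0 (u k))) = T.expand u"
proof -
  have w: "(\<lambda>k. (\<sigma> ^^ j) (\<phi>0 (u k))) \<in> {..<d} \<rightarrow> carrier E" using phi0_Pi[OF u] by (simp add: Pi_iff)
  have "T.expand u = T.expand (\<lambda>k. (\<sigma> ^^ j) (\<phi>0 (u k)) \<otimes>\<^bsub>E\<^esub> e 0)"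
  proof (rule T.expand_cong[OF _ K_Pi[OF u dm(2)]])
    fix k assume "k < d"
    then have uk: "u k \<in> carrier (K 0)" using Pi_mem[OF u, of k] by simp
    have "(\<sigma> ^^ j) (\<phi>0 (u k)) \<otimes>\<^bsub>E\<^esub> e 0 = (\<sigma> ^^ j) (\<phi>0 (u k) \<otimes>\<^bsub>E\<^esub> e j)"
      using alg_homD(2)[OF aut_pow_hom[of j] phi0_closed[OF K0D(1)[OF uk]] e_closed[OF j]] aut_pow_e[OF le_refl j] by simp
    also have "\<dots> = u k" unfolding phi0_e[OF uk j] by (rule rho_inv(1)[OF K0D(1)[OF uk]])
    finally show "u k = (\<sigma> ^^ j) (\<phi>0 (u k)) \<otimes>\<^bsub>E\<^esub> e 0" ..
  qed
  then show 1: "T.expand (\<lambda>k. (\<sigma> ^^ j) (\<phi>0 (u k))) \<otimes> \<iota> (e 0) = T.expand u"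
    unfolding T_e[OF w dm(2)] by simp
  then show "\<iota> (e 0) \<otimes> T.expand (\<lambda>k. (\<sigma> ^^ j) (\<phi>0 (u k))) = T.expand u"
    unfolding T_e_comm[OF w dm(2)] .
qed

text \<open>Moving \<open>\<phi> b\<close> across \<open>x^(-i)\<close> from the left applies the
  i-th power of \<open>\<sigma>\<close> to its coefficients; moving it across \<open>x^j\<close>
  from the right applies the j-th power. Next to \<open>e_0\<close> both powers have the same effect
  by \<open>T_aut_phi0\<close>.\<close>

lemma phi_unit:
  assumes b: "b \<in> carrier B" and ij: "i < m" "j < m"
  shows "\<phi> b \<otimes> U.unit i j = U.unit i j \<otimes> \<phi> b"
proof -
  obtain u where u: "u \<in> {..<d} \<rightarrow> carrier (K 0)" and bu: "\<phi> b = T.expand (\<lambda>k. \<phi>0 (u k))"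
    using phi_in_T[OF b] by metis
  let ?T = "T.expand (\<lambda>k. \<phi>0 (u k))" and ?Ti = "\<lambda>i. T.expand (\<lambda>k. (\<sigma> ^^ i) (\<phi>0 (u k)))"
  note w = phi0_Pi[OF u]
  have cl: "?T \<in> carrier C" "?Ti k \<in> carrier C" for k
    using w by (auto intro!: T.expand_closed simp: Pi_iff)
  have yc: "x_inv [^] i \<in> carrier C" "x [^] j \<in> carrier C" "\<iota> (e 0) \<in> carrier C"
    using x_inv(1) dm by simp_all
  have uc: "T.expand u \<in> carrier C" by (rule T.expand_closed[OF K_Pi[OF u dm(2)]])
  have f0: "\<iota> (R.idem 0) = \<iota> (e 0)" using dm by (simp add: e_idem)
  have "\<phi> b \<otimes> U.unit i j = (?T \<otimes> x_inv [^] i) \<otimes> \<iota> (e 0) \<otimes> x [^] j"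
    unfolding bu U.unit_def f0 using cl yc by (simp only: C.A.m_assoc C.A.m_closed)
  also have "\<dots> = x_inv [^] i \<otimes> (?Ti i \<otimes> \<iota> (e 0)) \<otimes> x [^] j"
    unfolding T_x_inv_pow[OF w] using cl yc by (simp only: C.A.m_assoc C.A.m_closed)
  also have "\<dots> = x_inv [^] i \<otimes> (\<iota> (e 0) \<otimes> ?Ti j) \<otimes> x [^] j"
    unfolding T_aut_phi0(1)[OF u ij(1)] T_aut_phi0(2)[OF u ij(2)] ..
  also have "\<dots> = x_inv [^] i \<otimes> \<iota> (e 0) \<otimes> (?Ti j \<otimes> x [^] j)"
    using cl yc by (simp only: C.A.m_assoc C.A.m_closed)
  also have "\<dots> = U.unit i j \<otimes> \<phi> b"
    unfolding bu x_pow_T[OF w, symmetric] U.unit_def f0 using cl yc by (simp only: C.A.m_assoc C.A.m_closed)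
  finally show ?thesis .
qed

sublocale MU: matrix_units F B C \<phi> m U.unit
  by (rule U.matrix_units[OF phi.alg_homomorphism_axioms phi_inj phi_unit])

text \<open>The same units over two bases: with EE' as base the matrices fill EE, with F as base
  they fill the centralizer of EE'.\<close>

sublocale MF: matrix_units F "self_algebra F" C "\<lambda>c. c \<odot> \<one>" m U.unit
proof (rule U.matrix_units[OF scalar_hom[OF C.A.assoc_algebra_axioms]])
  show "inj_on (\<lambda>c. c \<odot> \<one>) (carrier (self_algebra F))"
    using CF.scalar_inj by (auto intro!: inj_onI)
qed (simp add: C.A.one_smult_mult C.A.mult_one_smult)

lemma unit_diag: "i < m ==> U.unit i i = \<iota> (e i)" by (simp add: U.unit_diag e_idem)

text \<open>An element \<open>u\<close> of E is a diagonal matrix whose i-th entry is the element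
  \<open>l\<close> of \<open>E e_0\<close> with \<open>\<rho> i l = u e_i\<close>. The generator
  \<open>x\<close> is the cyclic shift with \<open>t\<close> in the corner, because
  \<open>x^m\<close> is the image of \<open>t\<close>.\<close>

lemma MU_surj: "carrier C = MU.of_mat ` carrier (mat_algebra m B)"
proof (rule MU.surj_if_generated[OF C.skew_pres_axioms])
  fix u assume u: "u \<in> carrier E"
  show "\<iota> u \<in> MU.of_mat ` carrier (mat_algebra m B)"
  proof (rule MU.in_image)
    fix i j assume ij: "i < m" "j < m"
    have "U.unit i i \<otimes> \<iota> u \<otimes> U.unit j j = \<iota> (e i \<otimes>\<^bsub>E\<^esub> u \<otimes>\<^bsub>E\<^esub> e j)"
      using u ij by (simp add: unit_diag)
    also have "e i \<otimes>\<^bsub>E\<^esub> u \<otimes>\<^bsub>E\<^esub> e j = u \<otimes>\<^bsub>E\<^esub> (e i \<otimes>\<^bsub>E\<^esub> e j)"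
      unfolding comm[OF e_closed[OF ij(1)] u] using u ij by (simp add: A.m_assoc)
    finally have eq: "U.unit i i \<otimes> \<iota> u \<otimes> U.unit j j = \<iota> (u \<otimes>\<^bsub>E\<^esub> (e i \<otimes>\<^bsub>E\<^esub> e j))" .
    show "\<exists>b\<in>carrier B. U.unit i i \<otimes> \<iota> u \<otimes> U.unit j j = \<phi> b \<otimes> U.unit i j"
    proof (cases "i = j")
      case True
      have "u \<otimes>\<^bsub>E\<^esub> e i \<in> carrier (K i)" by (rule alg_homD(1)[OF K_algebra(3)[OF ij(1)] u])
      then have "u \<otimes>\<^bsub>E\<^esub> e i \<in> \<rho> i ` carrier (K 0)" using alg_isoD(2)[OF rho_iso[OF ij(1)]] by (simp add: bij_betw_def)
      then obtain l where l: "l \<in> carrier (K 0)" "u \<otimes>\<^bsub>E\<^esub> e i = \<rho> i l" by blast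
      have "\<phi> (\<kappa> l) \<otimes> U.unit i i = \<iota> (\<phi>0 l \<otimes>\<^bsub>E\<^esub> e i)"
        using L.lift_const[OF l(1)] K0D(1)[OF l(1)] ij by (simp add: unit_diag)
      also have "\<dots> = \<iota> (u \<otimes>\<^bsub>E\<^esub> (e i \<otimes>\<^bsub>E\<^esub> e i))" unfolding phi0_e[OF l(1) ij(1)] l(2)[symmetric] using ij by (simp add: e_mult)
      finally have "\<phi> (\<kappa> l) \<otimes> U.unit i i = \<iota> (u \<otimes>\<^bsub>E\<^esub> (e i \<otimes>\<^bsub>E\<^esub> e i))" .
      then have "\<phi> (\<kappa> l) \<otimes> U.unit i j = U.unit i i \<otimes> \<iota> u \<otimes> U.unit j j"
        using eq unfolding True by (rule trans[OF _ sym])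
      note kl = this
      show ?thesis
      proof (rule bexI[of _ "\<kappa> l"])
        show "U.unit i i \<otimes> \<iota> u \<otimes> U.unit j j = \<phi> (\<kappa> l) \<otimes> U.unit i j" by (rule kl[symmetric])
      qed (rule B.C.f.hom_simps(1)[OF l(1)])
    next
      case False
      then show ?thesis unfolding eq using ij u by (intro bexI[of _ "\<zero>\<^bsub>B\<^esub>"]) (simp_all add: e_mult)
    qed
  qed (use u in simp)
next
  have wrap: "x \<otimes> \<iota> (R.idem 0) = \<iota> (R.idem (m - 1)) \<otimes> x"
    using C.rel[of "R.idem 0"] aut_e0 dm by (simp add: e_idem)
  show "x \<in> MU.of_mat ` carrier (mat_algebra m B)"
  proof (rule MU.in_image[OF C.y])
    fix i j assume ij: "i < m" "j < m"
    let ?b = "if j = Suc i mod m then (if Suc i < m then \<one>\<^bsub>B\<^esub> else t) else \<zero>\<^bsub>B\<^esub>"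
    have "U.unit i i \<otimes> x \<otimes> U.unit j j = \<phi> ?b \<otimes> U.unit i j"
      unfolding U.unit_diag[OF ij(1)] U.unit_diag[OF ij(2)] U.t_corner[OF wrap ij] using L.lift_gen by simp
    then show "\<exists>b\<in>carrier B. U.unit i i \<otimes> x \<otimes> U.unit j j = \<phi> b \<otimes> U.unit i j"
      by (intro bexI[of _ ?b]) simp_all
  qed
qed

lemma isomorphic_matrix: "alg_isomorphic F C (mat_algebra m B)"
  using MU.mat_isomorphic[OF MU_surj] by simp

text \<open>Elements of EE are matrices over EE', and the image of EE' consists of the constant
  diagonal ones. Commuting with all of these means that each entry is central in EE', and by
  \<open>B.center\<close> the centre is F.\<close>

lemma centralizer_phi: "centralizer C (\<phi> ` carrier B) = MF.of_mat ` carrier (mat_algebra m (self_algebra F))"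
proof (intro equalityI subsetI)
  fix z assume "z \<in> MF.of_mat ` carrier (mat_algebra m (self_algebra F))"
  then obtain N where N: "N \<in> carrier (mat_algebra m (self_algebra F))" "z = MF.of_mat N" by blast
  have z: "z \<in> carrier C" unfolding N(2) by (rule MF.of_mat_closed[OF N(1)])
  have "z \<otimes> \<phi> b = \<phi> b \<otimes> z" if b: "b \<in> carrier B" for b
  proof (rule MU.E_eqI)
    fix i j assume ij: "i < m" "j < m"
    let ?c = "N (i, j) \<odot> \<one>"
    have c: "?c \<in> carrier C" using MF.entry_closed[OF N(1) ij] by simp
    have corner: "U.unit i i \<otimes> z \<otimes> U.unit j j = ?c \<otimes> U.unit i j"
      unfolding N(2) by (rule MF.E_both[OF N(1) ij])
    have pb: "\<phi> b \<in> carrier C" using b by simp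
    have "U.unit i i \<otimes> (z \<otimes> \<phi> b) \<otimes> U.unit j j = U.unit i i \<otimes> z \<otimes> (\<phi> b \<otimes> U.unit j j)"
      using z pb by (simp add: C.A.m_assoc)
    also have "\<dots> = (U.unit i i \<otimes> z \<otimes> U.unit j j) \<otimes> \<phi> b"
      unfolding phi_unit[OF b ij(2) ij(2)] using z pb by (simp add: C.A.m_assoc)
    also have "\<dots> = ?c \<otimes> (U.unit i j \<otimes> \<phi> b)"
      unfolding corner using c pb by (intro C.A.m_assoc) simp_all
    also have "\<dots> = (?c \<otimes> \<phi> b) \<otimes> U.unit i j"
      unfolding phi_unit[OF b ij, symmetric] using c pb by (simp add: C.A.m_assoc)
    also have "?c \<otimes> \<phi> b = \<phi> b \<otimes> ?c"
      using MF.entry_closed[OF N(1) ij] pb by (simp add: C.A.one_smult_mult C.A.mult_one_smult)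
    also have "(\<phi> b \<otimes> ?c) \<otimes> U.unit i j = \<phi> b \<otimes> (U.unit i i \<otimes> z \<otimes> U.unit j j)"
      unfolding corner using c pb by (intro C.A.m_assoc) simp_all
    also have "\<dots> = (\<phi> b \<otimes> U.unit i i) \<otimes> z \<otimes> U.unit j j"
      using z pb by (simp add: C.A.m_assoc)
    also have "\<dots> = U.unit i i \<otimes> (\<phi> b \<otimes> z) \<otimes> U.unit j j"
      unfolding phi_unit[OF b ij(1) ij(1)] using z pb by (simp add: C.A.m_assoc)
    finally show "U.unit i i \<otimes> (z \<otimes> \<phi> b) \<otimes> U.unit j j = U.unit i i \<otimes> (\<phi> b \<otimes> z) \<otimes> U.unit j j" .
  qed (use z b in simp_all)
  then show "z \<in> centralizer C (\<phi> ` carrier B)" using z by (auto simp: centralizer_def)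
next
  fix z assume "z \<in> centralizer C (\<phi> ` carrier B)"
  then have z: "z \<in> carrier C" and zb: "\<And>b. b \<in> carrier B ==> z \<otimes> \<phi> b = \<phi> b \<otimes> z"
    by (auto simp: centralizer_def)
  obtain N where N: "N \<in> carrier (mat_algebra m B)" "z = MU.of_mat N" using z MU_surj by blast
  show "z \<in> MF.of_mat ` carrier (mat_algebra m (self_algebra F))"
  proof (rule MF.in_image[OF z])
    fix i j assume ij: "i < m" "j < m"
    let ?b = "N (i, j)"
    have b: "?b \<in> carrier B" by (rule MU.entry_closed[OF N(1) ij])
    have corner: "U.unit i i \<otimes> z \<otimes> U.unit j j = \<phi> ?b \<otimes> U.unit i j"
      unfolding N(2) by (rule MU.E_both[OF N(1) ij])
    \<comment> \<open>The (i, j) corners of \<open>z\<close> times \<open>\<phi> b'\<close> and of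
      \<open>\<phi> b'\<close> times \<open>z\<close> carry the two products of the entry with
      \<open>b'\<close>; \<open>E_cancel\<close> brings the equality back to EE'.\<close>
    have "?b \<otimes>\<^bsub>B\<^esub> b' = b' \<otimes>\<^bsub>B\<^esub> ?b" if b': "b' \<in> carrier B" for b'
    proof (rule MU.E_cancel[OF _ _ ij])
      have pb: "\<phi> b' \<in> carrier C" "\<phi> ?b \<in> carrier C" using b b' by simp_all
      have "\<phi> (?b \<otimes>\<^bsub>B\<^esub> b') \<otimes> U.unit i j = \<phi> ?b \<otimes> (\<phi> b' \<otimes> U.unit i j)"
        using b b' pb by (simp add: C.A.m_assoc)
      also have "\<dots> = (U.unit i i \<otimes> z \<otimes> U.unit j j) \<otimes> \<phi> b'"
        unfolding phi_unit[OF b' ij] corner using pb by (simp add: C.A.m_assoc)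
      also have "\<dots> = U.unit i i \<otimes> z \<otimes> (\<phi> b' \<otimes> U.unit j j)"
        unfolding phi_unit[OF b' ij(2) ij(2)] using z pb by (simp add: C.A.m_assoc)
      also have "\<dots> = U.unit i i \<otimes> (z \<otimes> \<phi> b') \<otimes> U.unit j j"
        using z pb by (simp add: C.A.m_assoc)
      also have "\<dots> = (U.unit i i \<otimes> \<phi> b') \<otimes> z \<otimes> U.unit j j"
        unfolding zb[OF b'] using z pb by (simp add: C.A.m_assoc)
      also have "\<dots> = \<phi> b' \<otimes> (U.unit i i \<otimes> z \<otimes> U.unit j j)"
        unfolding phi_unit[OF b' ij(1) ij(1), symmetric] using z pb by (simp add: C.A.m_assoc)
      also have "\<dots> = \<phi> (b' \<otimes>\<^bsub>B\<^esub> ?b) \<otimes> U.unit i j"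
        unfolding corner using b b' pb by (simp add: C.A.m_assoc)
      finally show "\<phi> (?b \<otimes>\<^bsub>B\<^esub> b') \<otimes> U.unit i j = \<phi> (b' \<otimes>\<^bsub>B\<^esub> ?b) \<otimes> U.unit i j" .
    qed (use b b' in simp_all)
    then have "?b \<in> scalars F B" using B.center b by (auto simp: centralizer_def)
    then obtain c where c: "c \<in> carrier F" "?b = c \<odot>\<^bsub>B\<^esub> \<one>\<^bsub>B\<^esub>" by (auto simp: scalars_def)
    then have "\<phi> ?b = c \<odot> \<one>" by simp
    then show "\<exists>c\<in>carrier (self_algebra F). U.unit i i \<otimes> z \<otimes> U.unit j j = (c \<odot> \<one>) \<otimes> U.unit i j"
      unfolding corner using c(1) by (intro bexI[of _ c]) simp_all
  qed
qed

lemma centralizer_isomorphic: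
  "alg_isomorphic F (C\<lparr>carrier := centralizer C (\<phi> ` carrier B)\<rparr>) (mat_algebra m (self_algebra F))"
  by (rule MF.mat_isomorphic[OF centralizer_phi])

end

text \<open>The set whose maximum is taken is finite, as its elements divide n, and it contains 1
  because \<open>s\<close> is its own first power; so the maximum is attained and bounds every other
  element.\<close>

lemma root_index_props:
  fixes F :: "('f, 'z) ring_scheme"
  assumes "field F" "0 < n" "s \<in> carrier F"
  defines "m \<equiv> root_index F n s"
  shows "m dvd n" "0 < m" "\<And>k u. k dvd n ==> 0 < k ==> u \<in> carrier F ==> s = u [^]\<^bsub>F\<^esub> k ==> k \<le> m"
proof -
  interpret F: field F by fact
  let ?M = "{m. 1 \<le> m \<and> m dvd n \<and> (\<exists>u\<in>carrier F. s = u [^]\<^bsub>F\<^esub> (m::nat))}"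
  have fin: "finite ?M" using assms(2) by (intro finite_subset[of ?M "{..n}"]) (auto dest: dvd_imp_le)
  have "\<exists>u\<in>carrier F. s = u [^]\<^bsub>F\<^esub> (1::nat)" using assms(3) by (intro bexI[of _ s]) simp_all
  then have "1 \<in> ?M" by simp
  then have "m \<in> ?M" unfolding m_def root_index_def using Max_in[OF fin] by blast
  then show "m dvd n" "0 < m" by auto
  show "k \<le> m" if "k dvd n" "0 < k" "u \<in> carrier F" "s = u [^]\<^bsub>F\<^esub> k" for k u
    unfolding m_def root_index_def by (rule Max_ge[OF fin]) (use that in auto)
qed

theorem theorem2p11:
  fixes F :: "('f, 'z) ring_scheme"
    and n :: nat and q s a r :: 'f
    and \<sigma> :: "(nat \<Rightarrow> 'f) set \<Rightarrow> (nat \<Rightarrow> 'f) set"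
  assumes "field F" and "n \<ge> 2" and "primitive_root_of_unity F n q"
    and "s \<in> carrier F" and "a \<in> carrier F"
    and "s \<noteq> \<zero>\<^bsub>F\<^esub>" and "a \<noteq> \<zero>\<^bsub>F\<^esub>"
    and "E = kummer_algebra F n s"
    and "h = kummer_gen F n s"
    and "\<sigma> \<in> alg_iso F E E" and "\<sigma> h = q \<odot>\<^bsub>E\<^esub> h"
    and "m = root_index F n s"
    and "r \<in> carrier F" and "r [^]\<^bsub>F\<^esub> m = s"
    and "d = n div m"
    and "e = kummer_idem F E m (q [^]\<^bsub>F\<^esub> (n div m)) r (h [^]\<^bsub>E\<^esub> (n div m))"
    and "E' = corner E (e 0)"
    and "\<sigma>' = \<sigma> ^^ m"
    and "\<phi>\<^sub>0 = orbit_sum E \<sigma> m"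
    and "E'' = E\<lparr>carrier := \<phi>\<^sub>0 ` carrier E'\<rparr>"
    and "EE = skew_quot E \<sigma> n (a \<odot>\<^bsub>E\<^esub> \<one>\<^bsub>E\<^esub>)"
    and "\<iota> = skew_const E \<sigma> n (a \<odot>\<^bsub>E\<^esub> \<one>\<^bsub>E\<^esub>)"
    and "x = skew_gen E \<sigma> n (a \<odot>\<^bsub>E\<^esub> \<one>\<^bsub>E\<^esub>)"
    and "EE' = skew_quot E' \<sigma>' d (a \<odot>\<^bsub>E\<^esub> e 0)"
    and "\<iota>' = skew_const E' \<sigma>' d (a \<odot>\<^bsub>E\<^esub> e 0)"
    and "x' = skew_gen E' \<sigma>' d (a \<odot>\<^bsub>E\<^esub> e 0)"
  shows
    "(cyclic_algebra F EE'
     \<and> has_degree F EE' d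
     \<and> internal_direct_sum EE' {..<d}
         (\<lambda>k. {\<iota>' u \<otimes>\<^bsub>EE'\<^esub> x' [^]\<^bsub>EE'\<^esub> k | u. u \<in> carrier E'}) (carrier EE')
     \<and> a \<odot>\<^bsub>E\<^esub> e 0 \<noteq> \<zero>\<^bsub>E\<^esub>
     \<and> a \<odot>\<^bsub>E\<^esub> e 0 \<in> {c \<odot>\<^bsub>E\<^esub> e 0 | c. c \<in> Units F}
     \<and> centralizer EE' (carrier EE') = scalars F EE'
     \<and> field E'
     \<and> \<iota>' \<in> alg_mono F E' EE'
     \<and> strictly_maximal_subfield F EE' (\<iota>' ` carrier E')
     \<and> ring.dimension E' d (scalars F E') (carrier E'))
   \<and>
    (alg_isomorphic F EE' (mat_algebra d (self_algebra F))
     \<longleftrightarrow> (\<exists>b\<in>Units E'. a = field_norm F E' b))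
   \<and>
    (\<exists>\<phi>. \<phi> \<in> alg_mono F EE' EE
       \<and> (\<forall>u\<in>carrier E'. \<phi> (\<iota>' u) = \<iota> (\<phi>\<^sub>0 u))
       \<and> \<phi> x' = x [^]\<^bsub>EE\<^esub> m
       \<and> is_skew_quot F (EE\<lparr>carrier := \<phi> ` carrier EE'\<rparr>) E'' \<iota> (x [^]\<^bsub>EE\<^esub> m)
            \<sigma>' d (a \<odot>\<^bsub>E\<^esub> \<one>\<^bsub>E\<^esub>)
       \<and> internal_direct_sum EE {..<d}
            (\<lambda>k. {\<iota> u \<otimes>\<^bsub>EE\<^esub> x [^]\<^bsub>EE\<^esub> (k * m) | u. u \<in> carrier E''}) (\<phi> ` carrier EE')
       \<and> alg_isomorphic F EE (mat_algebra m EE')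
       \<and> alg_isomorphic F (EE\<lparr>carrier := centralizer EE (\<phi> ` carrier EE')\<rparr>)
            (mat_algebra m (self_algebra F))
       \<and> (let S = (\<lambda>j. (\<lambda>y. y \<otimes>\<^bsub>EE\<^esub> \<iota> (e j)) ` (\<phi> ` carrier EE')) in
            (\<exists>P. internal_direct_product EE {..<m} S P
               \<and> internal_direct_sum EE {..<m}
                   (\<lambda>i. {y \<otimes>\<^bsub>EE\<^esub> x [^]\<^bsub>EE\<^esub> i | y. y \<in> P}) (carrier EE))
          \<and> (\<forall>j<m. is_skew_quot F (EE\<lparr>carrier := S j, one := \<iota> (e j)\<rparr>) (corner E (e j)) \<iota>
                     (x [^]\<^bsub>EE\<^esub> m \<otimes>\<^bsub>EE\<^esub> \<iota> (e j)) \<sigma>' d (a \<odot>\<^bsub>E\<^esub> e j)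
                \<and> alg_isomorphic F (EE\<lparr>carrier := S j, one := \<iota> (e j)\<rparr>) EE')
          \<and> x \<in> Units EE
          \<and> (\<forall>j<m. (\<lambda>u. x \<otimes>\<^bsub>EE\<^esub> u \<otimes>\<^bsub>EE\<^esub> inv\<^bsub>EE\<^esub> x) ` S j = S ((j + m - 1) mod m))))"
proof -
  interpret F: field F by fact
  have n0: "0 < n" using assms(2) by simp
  note m = root_index_props[OF assms(1) n0 assms(4), folded assms(12)]
  have nmd: "n = d * m" using m(1,2) assms(15) by simp
  have kummer: "kummer F E h n s"
    using kummer_pres(2)[OF F.is_cring n0 assms(4)] unfolding assms(8,9)
    by (intro kummer.intro F.field_axioms)
  have root: "root_of_unity F n q"
    by (intro root_of_unity.intro root_of_unity_axioms.intro F.field_axioms assms(3) n0)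
  \<comment> \<open>A k-th root of \<open>r\<close> is a km-th root of \<open>s\<close>; since km
    divides n, maximality of \<open>m\<close> gives km at most m, contradicting k > 1.\<close>
  have no_root: "u [^]\<^bsub>F\<^esub> k \<noteq> r" if "1 < k" "k dvd d" "u \<in> carrier F" for k u
  proof
    assume u: "u [^]\<^bsub>F\<^esub> k = r"
    have "s = u [^]\<^bsub>F\<^esub> (k * m)" using u assms(14) F.nat_pow_pow[OF that(3), of k m] by simp
    then have "k * m \<le> m" using that nmd m(2) by (intro m(3)) simp_all
    then show False using that(1) m(2) by simp
  qed
  have split: "split_kummer F E h n s q \<sigma> m d r"
    by (intro split_kummer.intro kummer_aut.intro kummer_aut_axioms.intro split_kummer_axioms.intro
        kummer root alg_isoD(1) assms nmd no_root)
  have pres: "skew_pres F E EE \<iota> x \<sigma> n (a \<odot>\<^bsub>E\<^esub> \<one>\<^bsub>E\<^esub>)"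
  proof -
    interpret sk: split_kummer F E h n s q \<sigma> m d r by (rule split)
    have scalar: "a \<odot>\<^bsub>E\<^esub> \<one>\<^bsub>E\<^esub> \<in> carrier E" using assms(5) by simp
    have "\<sigma> (a \<odot>\<^bsub>E\<^esub> \<one>\<^bsub>E\<^esub>) = a \<odot>\<^bsub>E\<^esub> \<one>\<^bsub>E\<^esub>" using assms(5) by simp
    from skew_quot_pres[OF sk.A.assoc_algebra_axioms sk.aut n0 scalar this sk.comm[OF scalar] sk.aut_order]
    show ?thesis unfolding assms(21,22,23) .
  qed
  interpret sc: split_cyclic F E h n s q \<sigma> m d r EE \<iota> x a
    by (intro split_cyclic.intro split split_cyclic_axioms.intro pres assms(5,7))
  \<comment> \<open>From here on the objects named in the statement are identified with those built
    in the locale.\<close>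
  have e: "e = sc.e" unfolding assms(16) sc.e_def unfolding assms(15) ..
  have E': "E' = sc.K 0" unfolding assms(17) e ..
  have EE': "EE' = sc.B" unfolding assms(24) E' assms(18) e ..
  have \<iota>': "\<iota>' = sc.\<kappa>" unfolding assms(25) E' assms(18) e ..
  have x': "x' = sc.t" unfolding assms(26) E' assms(18) e ..
  \<comment> \<open>An equality on the carrier only, because outside it the iterated
    \<open>inv_into\<close> need not follow the powers of \<open>\<sigma>\<close>.\<close>
  have \<phi>0: "\<phi>\<^sub>0 u = sc.\<phi>0 u" if "u \<in> carrier E'" for u
    using sc.orbit_sum_eq[OF sc.K0D(1)] that unfolding assms(19) E' by simp
  have E'': "E'' = E\<lparr>carrier := sc.\<phi>0 ` carrier (sc.K 0)\<rparr>"
  proof -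
    have "\<phi>\<^sub>0 ` carrier E' = sc.\<phi>0 ` carrier E'" by (rule image_cong[OF refl \<phi>0])
    then show ?thesis unfolding assms(20) E' by simp
  qed
  have e0: "a \<odot>\<^bsub>E\<^esub> sc.e 0 \<noteq> \<zero>\<^bsub>E\<^esub>"
    using sc.smult_cancel[OF assms(5) sc.e_closed[OF sc.dm(2)] _ assms(7)] sc.e_nonzero[OF sc.dm(2)] by blast
  have dimension: "ring.dimension E' d (scalars F E') (carrier E')"
    using sc.B.basis(3) unfolding E' .
  have part1: "(cyclic_algebra F EE'
     \<and> has_degree F EE' d
     \<and> internal_direct_sum EE' {..<d}
         (\<lambda>k. {\<iota>' u \<otimes>\<^bsub>EE'\<^esub> x' [^]\<^bsub>EE'\<^esub> k | u. u \<in> carrier E'}) (carrier EE')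
     \<and> a \<odot>\<^bsub>E\<^esub> e 0 \<noteq> \<zero>\<^bsub>E\<^esub>
     \<and> a \<odot>\<^bsub>E\<^esub> e 0 \<in> {c \<odot>\<^bsub>E\<^esub> e 0 | c. c \<in> Units F}
     \<and> centralizer EE' (carrier EE') = scalars F EE'
     \<and> field E'
     \<and> \<iota>' \<in> alg_mono F E' EE'
     \<and> strictly_maximal_subfield F EE' (\<iota>' ` carrier E')
     \<and> ring.dimension E' d (scalars F E') (carrier E'))"
    unfolding EE' \<iota>' x' e
    using sc.B.cyclic_algebra sc.B.has_degree sc.B.C.direct_sum_carrier e0 assms(5,7) sc.B.center
      sc.K0_field sc.B.iota_mono sc.B.strictly_maximal dimension
    unfolding E' F.field_Units by blast
  have part2: "(alg_isomorphic F EE' (mat_algebra d (self_algebra F))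
     \<longleftrightarrow> (\<exists>b\<in>Units E'. a = field_norm F E' b))"
    unfolding EE' E' by (rule sc.B.split_iff_norm)
  let ?S = "\<lambda>j. (\<lambda>y. y \<otimes>\<^bsub>EE\<^esub> \<iota> (e j)) ` (sc.\<phi> ` carrier EE')"
  have S: "?S = sc.S" unfolding sc.S_def EE' e ..
  have "sc.\<phi> \<in> alg_mono F EE' EE" unfolding EE' alg_mono_def using sc.L.lift_hom sc.phi_inj by blast
  moreover have "\<forall>u\<in>carrier E'. sc.\<phi> (\<iota>' u) = \<iota> (\<phi>\<^sub>0 u)"
    using sc.L.lift_const \<phi>0 unfolding E' \<iota>' by simp
  moreover have "sc.\<phi> x' = x [^]\<^bsub>EE\<^esub> m" unfolding x' by (rule sc.L.lift_gen)
  moreover have "is_skew_quot F (EE\<lparr>carrier := sc.\<phi> ` carrier EE'\<rparr>) E'' \<iota> (x [^]\<^bsub>EE\<^esub> m) \<sigma>' d (a \<odot>\<^bsub>E\<^esub> \<one>\<^bsub>E\<^esub>)"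
    using sc.phi_skew_quot unfolding EE' E'' assms(18) .
  moreover have "internal_direct_sum EE {..<d}
      (\<lambda>k. {\<iota> u \<otimes>\<^bsub>EE\<^esub> x [^]\<^bsub>EE\<^esub> (k * m) | u. u \<in> carrier E''}) (sc.\<phi> ` carrier EE')"
    using sc.phi_direct_sum unfolding EE' E'' by simp
  moreover have "alg_isomorphic F EE (mat_algebra m EE')" unfolding EE' by (rule sc.isomorphic_matrix)
  moreover have "alg_isomorphic F (EE\<lparr>carrier := centralizer EE (sc.\<phi> ` carrier EE')\<rparr>)
      (mat_algebra m (self_algebra F))"
    unfolding EE' by (rule sc.centralizer_isomorphic)
  moreover have "\<exists>P. internal_direct_product EE {..<m} ?S P
      \<and> internal_direct_sum EE {..<m} (\<lambda>i. {y \<otimes>\<^bsub>EE\<^esub> x [^]\<^bsub>EE\<^esub> i | y. y \<in> P}) (carrier EE)"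
    unfolding S using sc.direct_product sc.direct_sum_P by blast
  moreover have "is_skew_quot F (EE\<lparr>carrier := ?S j, one := \<iota> (e j)\<rparr>) (corner E (e j)) \<iota>
        (x [^]\<^bsub>EE\<^esub> m \<otimes>\<^bsub>EE\<^esub> \<iota> (e j)) \<sigma>' d (a \<odot>\<^bsub>E\<^esub> e j)
      \<and> alg_isomorphic F (EE\<lparr>carrier := ?S j, one := \<iota> (e j)\<rparr>) EE'" if "j < m" for j
    using sc.S_skew_quot[OF that] sc.S_isomorphic[OF that] unfolding sc.S_def EE' e assms(18) by blast
  moreover have "x \<in> Units EE" by (rule sc.x_unit(4))
  moreover have "(\<lambda>u. x \<otimes>\<^bsub>EE\<^esub> u \<otimes>\<^bsub>EE\<^esub> inv\<^bsub>EE\<^esub> x) ` ?S j = ?S ((j + m - 1) mod m)" if "j < m" for j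
    using sc.x_conj[OF that] unfolding sc.S_def EE' e .
  ultimately have part3: "(\<exists>\<phi>. \<phi> \<in> alg_mono F EE' EE
       \<and> (\<forall>u\<in>carrier E'. \<phi> (\<iota>' u) = \<iota> (\<phi>\<^sub>0 u))
       \<and> \<phi> x' = x [^]\<^bsub>EE\<^esub> m
       \<and> is_skew_quot F (EE\<lparr>carrier := \<phi> ` carrier EE'\<rparr>) E'' \<iota> (x [^]\<^bsub>EE\<^esub> m)
            \<sigma>' d (a \<odot>\<^bsub>E\<^esub> \<one>\<^bsub>E\<^esub>)
       \<and> internal_direct_sum EE {..<d}
            (\<lambda>k. {\<iota> u \<otimes>\<^bsub>EE\<^esub> x [^]\<^bsub>EE\<^esub> (k * m) | u. u \<in> carrier E''}) (\<phi> ` carrier EE')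
       \<and> alg_isomorphic F EE (mat_algebra m EE')
       \<and> alg_isomorphic F (EE\<lparr>carrier := centralizer EE (\<phi> ` carrier EE')\<rparr>)
            (mat_algebra m (self_algebra F))
       \<and> (let S = (\<lambda>j. (\<lambda>y. y \<otimes>\<^bsub>EE\<^esub> \<iota> (e j)) ` (\<phi> ` carrier EE')) in
            (\<exists>P. internal_direct_product EE {..<m} S P
               \<and> internal_direct_sum EE {..<m}
                   (\<lambda>i. {y \<otimes>\<^bsub>EE\<^esub> x [^]\<^bsub>EE\<^esub> i | y. y \<in> P}) (carrier EE))
          \<and> (\<forall>j<m. is_skew_quot F (EE\<lparr>carrier := S j, one := \<iota> (e j)\<rparr>) (corner E (e j)) \<iota>
                     (x [^]\<^bsub>EE\<^esub> m \<otimes>\<^bsub>EE\<^esub> \<iota> (e j)) \<sigma>' d (a \<odot>\<^bsub>E\<^esub> e j)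
                \<and> alg_isomorphic F (EE\<lparr>carrier := S j, one := \<iota> (e j)\<rparr>) EE')
          \<and> x \<in> Units EE
          \<and> (\<forall>j<m. (\<lambda>u. x \<otimes>\<^bsub>EE\<^esub> u \<otimes>\<^bsub>EE\<^esub> inv\<^bsub>EE\<^esub> x) ` S j = S ((j + m - 1) mod m))))"
    unfolding Let_def by (intro exI[of _ sc.\<phi>] conjI allI impI) blast+
  show ?thesis by (intro conjI part1 part2 part3)
qed

end
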